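(* Suppose that $\mathscr{A}=(\{\mathcal{A}_{s,t}\}_{0<s<t},\{\Delta_{r,s,t}\}_{0<r<s<t})$ is a unital co-unital $C^*$-subproduct system with unit $\{p_{s,t}\}_{0<s<t}$ and co-unit $\{\varphi_{s,t}\}_{0<s<t}$ satisfying $\varphi_{s,t}(p_{s,t})=1$ for all $0<s<t$. Then there exists a unique idempotent state $\varphi$ of the $C^*$-algebra $C^*_{\{p_{s,t}\}}(\mathscr{A})$ such that $\{\varphi_{s,t}\}_{0<s<t}$ are the marginal states of $\varphi$, i.e. $\varphi_{s,t}=\varphi\circ\Delta^\times_{s,t}$ for all $0<s<t$.
   Context: All tensor products of $C^*$-algebras are injective (minimal) tensor products; $\mathrm{id}$ denotes identity maps; a $*$-monomorphism is an injective $*$-homomorphism. A $C^*$-subproduct system is a pair $\mathscr{A}=(\{\mathcal{A}_{s,t}\}_{0<s<t},\{\Delta_{r,s,t}\}_{0<r<s<t})$ of $C^*$-algebras $\mathcal{A}_{s,t}$ and $*$-monomorphisms $\Delta_{r,s,t}:\mathcal{A}_{r,t}\to\mathcal{A}_{r,s}\otimes\mathcal{A}_{s,t}$ such that $(\mathrm{id}_{\mathcal{A}_{r,s}}\otimes\Delta_{s,t,u})\Delta_{r,s,u}=(\Delta_{r,s,t}\otimes\mathrm{id}_{\mathcal{A}_{t,u}})\Delta_{r,t,u}$ for all $0<r<s<t<u$. A unit of $\mathscr{A}$ is a family of non-zero projections $p_{s,t}\in\mathcal{A}_{s,t}$, $0<s<t$, with $\Delta_{r,s,t}(p_{r,t})=p_{r,s}\otimes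 p_{s,t}$ for all $0<r<s<t$. A co-unit of $\mathscr{A}$ is a family of states $\varphi_{s,t}$ of $\mathcal{A}_{s,t}$, $0<s<t$, with $\varphi_{r,t}=(\varphi_{r,s}\otimes\varphi_{s,t})\circ\Delta_{r,s,t}$ for all $0<r<s<t$. $\mathscr{A}$ is unital (co-unital) if it admits a unit (co-unit). For $0<s<t$, $\mathcal{P}_{s,t}$ is the set of finite partitions $I=\{s=\iota_0<\iota_1<\dots<\iota_m<\iota_{m+1}=t\}$ of $[s,t]$ ($m\ge 0$). Put $\mathcal{A}_I=\mathcal{A}_{\iota_0,\iota_1}\otimes\cdots\otimes\mathcal{A}_{\iota_m,\iota_{m+1}}$ and $p_I=p_{\iota_0,\iota_1}\otimes\cdots\otimes p_{\iota_m,\iota_{m+1}}$. Define $\Delta_{\{s,t\},I}:\mathcal{A}_{s,t}\to\mathcal{A}_I$ as the identity if $m=0$, as $\Delta_{\iota_0,\iota_1,\iota_2}$ if $m=1$, and as $(\Delta_{\{\iota_0,\iota_m\},I\setminus\{\iota_{m+1}\}}\otimes\mathrm{id}_{\mathcal{A}_{\iota_m,\iota_{m+1}}})\Delta_{\iota_0,\iota_m,\iota_{m+1}}$ if $m\ge2$. For $I\subseteq J$ in $\mathcal{P}_{s,t}$, with $I_i=J\cap[\iota_i,\iota_{i+1}]$, put $\Delta_{I,J}=\Delta_{\{\iota_0,\iota_1\},I_0}\otimes\cdots\otimes\Delta_{\{\iota_m,\iota_{m+1}\},I_m}:\mathcal{A}_I\to\mathcal{A}_J=\mathcal{A}_{I_0}\otimes\cdots\otimes\mathcal{A}_{I_m}$.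 $\mathcal{P}=\bigcup_{0<s<t}\mathcal{P}_{s,t}$ is the set of all finite subsets of $(0,\infty)$ with at least two elements, ordered by inclusion. For $I\subseteq J$ in $\mathcal{P}$ with $I\in\mathcal{P}_{s,t}$, write $J=\underline{I}\cup I^\times\cup\overline{I}$, where $\underline{I}=\{j\in J: j\le s\}$, $I^\times=J\cap[s,t]$, $\overline{I}=\{j\in J: j\ge t\}$, so that $\mathcal{A}_J=\mathcal{A}_{\underline{I}}\otimes\mathcal{A}_{I^\times}\otimes\mathcal{A}_{\overline{I}}$, and define $\Delta^\times_{I,J}(x)=p_{\underline{I}}\otimes\Delta_{I,I^\times}(x)\otimes p_{\overline{I}}$ for $x\in\mathcal{A}_I$; tensor factors corresponding to single-point $\underline{I}$ or $\overline{I}$ are omitted (so $\Delta^\times_{I,J}=\Delta_{I,J}$ if $I,J\in\mathcal{P}_{s,t}$). These form an inductive system over $(\mathcal{P},\subseteq)$; $C^*_{\{p_{s,t}\}}(\mathscr{A})$ is its $C^*$-inductive limit, with connecting $*$-monomorphisms $\Delta^\times_I:\mathcal{A}_I\to C^*_{\{p_{s,t}\}}(\mathscr{A})$; write $\Delta^\times_{s,t}=\Delta^\times_{\{s,t\}}$. The one-parameter co-multiplication of $C^*_{\{p_{s,t}\}}(\mathscr{A})$ is the family $\{\Delta_s\}_{s>0}$ of $*$-monomorphisms $\Delta_s:C^*_{\{p_{s,t}\}}(\mathscr{A})\to C^*_{\{p_{s,t}\}}(\mathscr{A})\otimes C^*_{\{p_{s,t}\}}(\mathscr{A})$ determined by $\Delta_s\Delta^\times_{I\cup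 J}=\Delta^\times_I\otimes\Delta^\times_J$ for all $I\in\mathcal{P}_{r,s}$, $J\in\mathcal{P}_{s,t}$, $0<r<s<t$. The projection $p=\Delta^\times_{s,t}(p_{s,t})$ does not depend on $0<s<t$. A state $\varphi$ of $C^*_{\{p_{s,t}\}}(\mathscr{A})$ is an idempotent state if $(\varphi\otimes\varphi)\circ\Delta_s=\varphi$ for all $s>0$ and $p\notin\mathcal{N}_\varphi$, where $\mathcal{N}_\varphi=\{x:\varphi(x^*x)=0\}$ is the left kernel of $\varphi$. *)

theory Defs
  imports "HOL-Analysis.Analysis" "HOL-Library.FuncSet" "HOL-Library.Poly_Mapping"
begin

section \<open>C*-algebras, homomorphisms and states\<close>

text \<open>A family of C*-algebras indexed by pairs of reals needs carriers rather than type
  classes.  One common type \<open>'a\<close> for the elements of all members is no restriction.  The same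
  record also holds the *-algebras with a C*-seminorm that occur before completion.
  Algebras need not have an identity.\<close>

record 'a star_alg =
  carrier :: "'a set"
  add_of :: "'a \<Rightarrow> 'a \<Rightarrow> 'a"
  zero_of :: 'a
  scale_of :: "complex \<Rightarrow> 'a \<Rightarrow> 'a"
  mult_of :: "'a \<Rightarrow> 'a \<Rightarrow> 'a"
  star_of :: "'a \<Rightarrow> 'a"
  norm_of :: "'a \<Rightarrow> real"

definition minus_of :: "'a star_alg \<Rightarrow> 'a \<Rightarrow> 'a \<Rightarrow> 'a" where
  "minus_of A x y = add_of A x (scale_of A (-1) y)"

locale cstar_algebra =
  fixes A :: "'a star_alg"
  assumes add_closed: "x \<in> carrier A \<Longrightarrow> y \<in> carrier A \<Longrightarrow> add_of A x y \<in> carrier A"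
    and zero_closed: "zero_of A \<in> carrier A"
    and scale_closed: "x \<in> carrier A \<Longrightarrow> scale_of A c x \<in> carrier A"
    and mult_closed: "x \<in> carrier A \<Longrightarrow> y \<in> carrier A \<Longrightarrow> mult_of A x y \<in> carrier A"
    and star_closed: "x \<in> carrier A \<Longrightarrow> star_of A x \<in> carrier A"
    and add_assoc: "x \<in> carrier A \<Longrightarrow> y \<in> carrier A \<Longrightarrow> z \<in> carrier A \<Longrightarrow>
      add_of A (add_of A x y) z = add_of A x (add_of A y z)"
    and add_comm: "x \<in> carrier A \<Longrightarrow> y \<in> carrier A \<Longrightarrow> add_of A x y = add_of A y x"
    and add_zero: "x \<in> carrier A \<Longrightarrow> add_of A x (zero_of A) = x"
    and minus_self: "x \<in> carrier A \<Longrightarrow> minus_of A x x = zero_of A"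
    and scale_one: "x \<in> carrier A \<Longrightarrow> scale_of A 1 x = x"
    and scale_scale: "x \<in> carrier A \<Longrightarrow> scale_of A c (scale_of A d x) = scale_of A (c * d) x"
    and scale_add: "x \<in> carrier A \<Longrightarrow> y \<in> carrier A \<Longrightarrow>
      scale_of A c (add_of A x y) = add_of A (scale_of A c x) (scale_of A c y)"
    and add_scale: "x \<in> carrier A \<Longrightarrow>
      scale_of A (c + d) x = add_of A (scale_of A c x) (scale_of A d x)"
    and mult_assoc: "x \<in> carrier A \<Longrightarrow> y \<in> carrier A \<Longrightarrow> z \<in> carrier A \<Longrightarrow>
      mult_of A (mult_of A x y) z = mult_of A x (mult_of A y z)"
    and mult_add: "x \<in> carrier A \<Longrightarrow> y \<in> carrier A \<Longrightarrow> z \<in> carrier A \<Longrightarrow>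
      mult_of A x (add_of A y z) = add_of A (mult_of A x y) (mult_of A x z)"
    and add_mult: "x \<in> carrier A \<Longrightarrow> y \<in> carrier A \<Longrightarrow> z \<in> carrier A \<Longrightarrow>
      mult_of A (add_of A x y) z = add_of A (mult_of A x z) (mult_of A y z)"
    and scale_mult: "x \<in> carrier A \<Longrightarrow> y \<in> carrier A \<Longrightarrow>
      mult_of A (scale_of A c x) y = scale_of A c (mult_of A x y)"
    and mult_scale: "x \<in> carrier A \<Longrightarrow> y \<in> carrier A \<Longrightarrow>
      mult_of A x (scale_of A c y) = scale_of A c (mult_of A x y)"
    and star_star: "x \<in> carrier A \<Longrightarrow> star_of A (star_of A x) = x"
    and star_add: "x \<in> carrier A \<Longrightarrow> y \<in> carrier A \<Longrightarrow>
      star_of A (add_of A x y) = add_of A (star_of A x) (star_of A y)"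
    and star_scale: "x \<in> carrier A \<Longrightarrow> star_of A (scale_of A c x) = scale_of A (cnj c) (star_of A x)"
    and star_mult: "x \<in> carrier A \<Longrightarrow> y \<in> carrier A \<Longrightarrow>
      star_of A (mult_of A x y) = mult_of A (star_of A y) (star_of A x)"
    and norm_nonneg: "x \<in> carrier A \<Longrightarrow> 0 \<le> norm_of A x"
    and norm_eq_zero: "x \<in> carrier A \<Longrightarrow> norm_of A x = 0 \<longleftrightarrow> x = zero_of A"
    and norm_add: "x \<in> carrier A \<Longrightarrow> y \<in> carrier A \<Longrightarrow>
      norm_of A (add_of A x y) \<le> norm_of A x + norm_of A y"
    and norm_scale: "x \<in> carrier A \<Longrightarrow> norm_of A (scale_of A c x) = cmod c * norm_of A x"
    and norm_mult: "x \<in> carrier A \<Longrightarrow> y \<in> carrier A \<Longrightarrow>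
      norm_of A (mult_of A x y) \<le> norm_of A x * norm_of A y"
    and cstar_identity: "x \<in> carrier A \<Longrightarrow> norm_of A (mult_of A (star_of A x) x) = (norm_of A x)\<^sup>2"
    and complete: "\<And>X :: nat \<Rightarrow> 'a. (\<And>n. X n \<in> carrier A) \<Longrightarrow>
      (\<forall>e>0. \<exists>N. \<forall>m\<ge>N. \<forall>n\<ge>N. norm_of A (minus_of A (X m) (X n)) < e) \<Longrightarrow>
      \<exists>x\<in>carrier A. (\<lambda>n. norm_of A (minus_of A (X n) x)) \<longlonglongrightarrow> 0"

definition complex_alg :: "complex star_alg" where
  "complex_alg = \<lparr>carrier = UNIV, add_of = (+), zero_of = 0, scale_of = (*), mult_of = (*),
     star_of = cnj, norm_of = cmod\<rparr>"

definition linear_map :: "'a star_alg \<Rightarrow> 'b star_alg \<Rightarrow> ('a \<Rightarrow> 'b) \<Rightarrow> bool" where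
  "linear_map A B h \<longleftrightarrow>
     (\<forall>x\<in>carrier A. h x \<in> carrier B) \<and>
     (\<forall>x\<in>carrier A. \<forall>y\<in>carrier A. h (add_of A x y) = add_of B (h x) (h y)) \<and>
     (\<forall>c. \<forall>x\<in>carrier A. h (scale_of A c x) = scale_of B c (h x))"

definition bounded_linear_map :: "'a star_alg \<Rightarrow> 'b star_alg \<Rightarrow> ('a \<Rightarrow> 'b) \<Rightarrow> bool" where
  "bounded_linear_map A B h \<longleftrightarrow>
     linear_map A B h \<and> (\<exists>C. \<forall>x\<in>carrier A. norm_of B (h x) \<le> C * norm_of A x)"

definition star_hom :: "'a star_alg \<Rightarrow> 'b star_alg \<Rightarrow> ('a \<Rightarrow> 'b) \<Rightarrow> bool" where
  "star_hom A B h \<longleftrightarrow>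
     linear_map A B h \<and>
     (\<forall>x\<in>carrier A. \<forall>y\<in>carrier A. h (mult_of A x y) = mult_of B (h x) (h y)) \<and>
     (\<forall>x\<in>carrier A. h (star_of A x) = star_of B (h x))"

definition star_mono :: "'a star_alg \<Rightarrow> 'b star_alg \<Rightarrow> ('a \<Rightarrow> 'b) \<Rightarrow> bool" where
  "star_mono A B h \<longleftrightarrow> star_hom A B h \<and> inj_on h (carrier A)"

definition projection :: "'a star_alg \<Rightarrow> 'a \<Rightarrow> bool" where
  "projection A q \<longleftrightarrow> q \<in> carrier A \<and> star_of A q = q \<and> mult_of A q q = q"

definition state :: "'a star_alg \<Rightarrow> ('a \<Rightarrow> complex) \<Rightarrow> bool" where
  "state A \<phi> \<longleftrightarrow>
     linear_map A complex_alg \<phi> \<and>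
     (\<forall>x\<in>carrier A. \<phi> (mult_of A (star_of A x) x) \<in> \<real>\<^sub>\<ge>\<^sub>0) \<and>
     (let S = (\<lambda>x. cmod (\<phi> x)) ` {x \<in> carrier A. norm_of A x \<le> 1} in bdd_above S \<and> Sup S = 1)"

definition left_kernel :: "'a star_alg \<Rightarrow> ('a \<Rightarrow> complex) \<Rightarrow> 'a set" where
  "left_kernel A \<phi> = {x \<in> carrier A. \<phi> (mult_of A (star_of A x) x) = 0}"


section \<open>C*-inductive limits\<close>

text \<open>
  \<open>N i\<close> (\<open>i \<in> I\<close>, \<open>I\<close> directed) is a system of *-algebras with C*-seminorms and contractive
  connecting *-homomorphisms \<open>T i j : N i \<rightarrow> N j\<close> for \<open>i \<le> j\<close>.  Its C*-inductive limit is realised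
  inside the product of the \<open>N i\<close> modulo nets whose norms tend to zero.  The classes of the
  nets \<open>T i j x\<close> (\<open>j \<ge> i\<close>) form the algebraic limit; the coherent nets below are exactly those
  whose class is in its closure.  The limit seminorm is \<open>lim \<parallel>f i\<parallel>\<close>.

  For a constant system over the natural numbers, coherent nets are Cauchy sequences and the limit
  is the separated completion.\<close>

definition net_at_top :: "'i::order set \<Rightarrow> 'i filter" where
  "net_at_top I = (INF i\<in>I. principal {j \<in> I. i \<le> j})"

definition coherent_nets ::
  "'i::order set \<Rightarrow> ('i \<Rightarrow> 'b star_alg) \<Rightarrow> ('i \<Rightarrow> 'i \<Rightarrow> 'b \<Rightarrow> 'b) \<Rightarrow> ('i \<Rightarrow> 'b) set" where
  "coherent_nets I N T = {f \<in> (\<Pi>\<^sub>E i\<in>I. carrier (N i)).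
     \<forall>e>0. \<exists>i\<in>I. \<forall>j\<in>I. i \<le> j \<longrightarrow> norm_of (N j) (minus_of (N j) (f j) (T i j (f i))) < e}"

definition net_class ::
  "'i::order set \<Rightarrow> ('i \<Rightarrow> 'b star_alg) \<Rightarrow> ('i \<Rightarrow> 'i \<Rightarrow> 'b \<Rightarrow> 'b) \<Rightarrow> ('i \<Rightarrow> 'b) \<Rightarrow> ('i \<Rightarrow> 'b) set" where
  "net_class I N T f = {g \<in> coherent_nets I N T.
     ((\<lambda>i. norm_of (N i) (minus_of (N i) (f i) (g i))) \<longlongrightarrow> 0) (net_at_top I)}"

definition rep :: "('i \<Rightarrow> 'b) set \<Rightarrow> 'i \<Rightarrow> 'b" where
  "rep P = (SOME f. f \<in> P)"

definition ind_limit ::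
  "'i::order set \<Rightarrow> ('i \<Rightarrow> 'b star_alg) \<Rightarrow> ('i \<Rightarrow> 'i \<Rightarrow> 'b \<Rightarrow> 'b) \<Rightarrow> ('i \<Rightarrow> 'b) set star_alg" where
  "ind_limit I N T = \<lparr>
     carrier = net_class I N T ` coherent_nets I N T,
     add_of = (\<lambda>P Q. net_class I N T (\<lambda>i\<in>I. add_of (N i) (rep P i) (rep Q i))),
     zero_of = net_class I N T (\<lambda>i\<in>I. zero_of (N i)),
     scale_of = (\<lambda>c P. net_class I N T (\<lambda>i\<in>I. scale_of (N i) c (rep P i))),
     mult_of = (\<lambda>P Q. net_class I N T (\<lambda>i\<in>I. mult_of (N i) (rep P i) (rep Q i))),
     star_of = (\<lambda>P. net_class I N T (\<lambda>i\<in>I. star_of (N i) (rep P i))),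
     norm_of = (\<lambda>P. Lim (net_at_top I) (\<lambda>i. norm_of (N i) (rep P i)))\<rparr>"

definition limit_emb ::
  "'i::order set \<Rightarrow> ('i \<Rightarrow> 'b star_alg) \<Rightarrow> ('i \<Rightarrow> 'i \<Rightarrow> 'b \<Rightarrow> 'b) \<Rightarrow> 'i \<Rightarrow> 'b \<Rightarrow> ('i \<Rightarrow> 'b) set" where
  "limit_emb I N T i x = net_class I N T (\<lambda>j\<in>I. if i \<le> j then T i j x else zero_of (N j))"


section \<open>Minimal tensor products of finite lists of C*-algebras\<close>

text \<open>Formal tensors: a basis element \<open>[a\<^sub>1, \<dots>, a\<^sub>n]\<close> of the free vector space stands for
  \<open>a\<^sub>1 \<otimes> \<dots> \<otimes> a\<^sub>n\<close>.  The multilinear relations need no separate quotient: the minimal seminorm of a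
  formal tensor vanishes iff it is zero in the algebraic tensor product.\<close>

type_synonym 'a formal = "'a list \<Rightarrow>\<^sub>0 complex"
type_synonym 'a tensor = "(nat \<Rightarrow> 'a formal) set"

definition formal_tensors :: "'a star_alg list \<Rightarrow> 'a formal set" where
  "formal_tensors As = {u. Poly_Mapping.keys u \<subseteq> listset (map carrier As)}"

definition formal_scale :: "complex \<Rightarrow> 'a formal \<Rightarrow> 'a formal" where
  "formal_scale c u = Poly_Mapping.map ((*) c) u"

definition formal_mult :: "'a star_alg list \<Rightarrow> 'a formal \<Rightarrow> 'a formal \<Rightarrow> 'a formal" where
  "formal_mult As u v = (\<Sum>as\<in>Poly_Mapping.keys u. \<Sum>bs\<in>Poly_Mapping.keys v.
     Poly_Mapping.single (map2 (\<lambda>A (a, b). mult_of A a b) As (zip as bs))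
       (Poly_Mapping.lookup u as * Poly_Mapping.lookup v bs))"

definition formal_star :: "'a star_alg list \<Rightarrow> 'a formal \<Rightarrow> 'a formal" where
  "formal_star As u = (\<Sum>as\<in>Poly_Mapping.keys u.
     Poly_Mapping.single (map2 star_of As as) (cnj (Poly_Mapping.lookup u as)))"

definition formal_functional :: "('a \<Rightarrow> complex) list \<Rightarrow> 'a formal \<Rightarrow> complex" where
  "formal_functional \<phi>s u = (\<Sum>as\<in>Poly_Mapping.keys u.
     Poly_Mapping.lookup u as * prod_list (map2 (\<lambda>\<phi> a. \<phi> a) \<phi>s as))"

text \<open>The minimal (spatial) norm of \<open>u\<close> is the supremum of \<open>\<parallel>(\<pi>\<^sub>1 \<otimes> \<dots> \<otimes> \<pi>\<^sub>n)(u)\<parallel>\<close> over the GNS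
  representations \<open>\<pi>\<^sub>i\<close> of states \<open>\<phi>\<^sub>i\<close>, that is, the operator norm in the tensor product of
  the universal representations.  The classes of formal tensors \<open>v\<close> are dense in the tensor
  product of the GNS spaces, where \<open>\<parallel>v\<parallel>\<^sup>2 = (\<phi>\<^sub>1 \<otimes> \<dots> \<otimes> \<phi>\<^sub>n)(v\<^sup>* v)\<close>; this gives the quotients below.
  The element 0 only serves to make the set non-empty when some algebra has no state.\<close>

definition min_norm :: "'a star_alg list \<Rightarrow> 'a formal \<Rightarrow> real" where
  "min_norm As u = Sup (insert 0
     {sqrt (Re (formal_functional \<phi>s (formal_mult As (formal_star As (formal_mult As u v))
                                                    (formal_mult As u v)))
            / Re (formal_functional \<phi>s (formal_mult As (formal_star As v) v))) | \<phi>s v.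
        list_all2 state As \<phi>s \<and> v \<in> formal_tensors As \<and>
        formal_functional \<phi>s (formal_mult As (formal_star As v) v) \<noteq> 0})"

definition formal_alg :: "'a star_alg list \<Rightarrow> 'a formal star_alg" where
  "formal_alg As = \<lparr>carrier = formal_tensors As, add_of = (+), zero_of = 0,
     scale_of = formal_scale, mult_of = formal_mult As, star_of = formal_star As,
     norm_of = min_norm As\<rparr>"

definition tensor :: "'a star_alg list \<Rightarrow> 'a tensor star_alg" where
  "tensor As = ind_limit UNIV (\<lambda>_. formal_alg As) (\<lambda>_ _ u. u)"

definition tensor_class :: "'a star_alg list \<Rightarrow> (nat \<Rightarrow> 'a formal) \<Rightarrow> 'a tensor" where
  "tensor_class As = net_class UNIV (\<lambda>_. formal_alg As) (\<lambda>_ _ u. u)"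

definition pure :: "'a star_alg list \<Rightarrow> 'a list \<Rightarrow> 'a tensor" where
  "pure As as = tensor_class As (\<lambda>_. Poly_Mapping.single as 1)"

text \<open>Identification of \<open>A\<close> with the one-fold tensor product.  It is also \<open>id\<^sub>A\<close> when it
  occurs as a factor of a tensor product of maps below.\<close>

definition single_tensor :: "'a star_alg \<Rightarrow> 'a \<Rightarrow> 'a tensor" where
  "single_tensor A a = pure [A] [a]"

text \<open>The element \<open>x \<otimes> y\<close> of \<open>tensor As \<otimes> tensor Bs\<close>, identified with \<open>tensor (As @ Bs)\<close>.\<close>

definition formal_append :: "'a formal \<Rightarrow> 'a formal \<Rightarrow> 'a formal" where
  "formal_append u v = (\<Sum>as\<in>Poly_Mapping.keys u. \<Sum>bs\<in>Poly_Mapping.keys v.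
     Poly_Mapping.single (as @ bs) (Poly_Mapping.lookup u as * Poly_Mapping.lookup v bs))"

definition tensor_append ::
  "'a star_alg list \<Rightarrow> 'a star_alg list \<Rightarrow> 'a tensor \<Rightarrow> 'a tensor \<Rightarrow> 'a tensor" where
  "tensor_append As Bs x y = tensor_class (As @ Bs) (\<lambda>n. formal_append (rep x n) (rep y n))"

text \<open>The empty tensor product is the complex numbers, with identity \<open>pure [] []\<close>.\<close>

fun tensor_concat :: "'a star_alg list list \<Rightarrow> 'a tensor list \<Rightarrow> 'a tensor" where
  "tensor_concat (As # Ass) (x # xs) = tensor_append As (concat Ass) x (tensor_concat Ass xs)"
| "tensor_concat _ _ = pure [] []"

definition tensor_lift ::
  "'a star_alg list \<Rightarrow> 'b star_alg \<Rightarrow> ('a list \<Rightarrow> 'b) \<Rightarrow> 'a tensor \<Rightarrow> 'b" where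
  "tensor_lift As B g = (THE h. h \<in> extensional (carrier (tensor As)) \<and>
     bounded_linear_map (tensor As) B h \<and>
     (\<forall>as\<in>listset (map carrier As). h (pure As as) = g as))"

text \<open>\<open>f\<^sub>1 \<otimes> \<dots> \<otimes> f\<^sub>n\<close> for \<open>f\<^sub>i : A\<^sub>i \<rightarrow> tensor Bs\<^sub>i\<close>, with values in \<open>tensor (Bs\<^sub>1 @ \<dots> @ Bs\<^sub>n)\<close>.\<close>

definition tensor_map ::
  "'a star_alg list \<Rightarrow> 'a star_alg list list \<Rightarrow> ('a \<Rightarrow> 'a tensor) list \<Rightarrow> 'a tensor \<Rightarrow> 'a tensor" where
  "tensor_map As Bss fs = tensor_lift As (tensor (concat Bss))
     (\<lambda>as. tensor_concat Bss (map2 (\<lambda>f a. f a) fs as))"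

definition tensor_functional ::
  "'a star_alg list \<Rightarrow> ('a \<Rightarrow> complex) list \<Rightarrow> 'a tensor \<Rightarrow> complex" where
  "tensor_functional As \<phi>s = tensor_lift As complex_alg
     (\<lambda>as. prod_list (map2 (\<lambda>\<phi> a. \<phi> a) \<phi>s as))"


section \<open>C*-subproduct systems\<close>

definition subproduct_system ::
  "(real \<Rightarrow> real \<Rightarrow> 'a star_alg) \<Rightarrow> (real \<Rightarrow> real \<Rightarrow> real \<Rightarrow> 'a \<Rightarrow> 'a tensor) \<Rightarrow> bool" where
  "subproduct_system A D \<longleftrightarrow>
     (\<forall>s t. 0 < s \<and> s < t \<longrightarrow> cstar_algebra (A s t)) \<and>
     (\<forall>r s t. 0 < r \<and> r < s \<and> s < t \<longrightarrow> star_mono (A r t) (tensor [A r s, A s t]) (D r s t)) \<and>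
     (\<forall>r s t u. 0 < r \<and> r < s \<and> s < t \<and> t < u \<longrightarrow> (\<forall>a\<in>carrier (A r u).
        tensor_map [A r s, A s u] [[A r s], [A s t, A t u]]
          [single_tensor (A r s), D s t u] (D r s u a) =
        tensor_map [A r t, A t u] [[A r s, A s t], [A t u]]
          [D r s t, single_tensor (A t u)] (D r t u a)))"

definition subproduct_unit ::
  "(real \<Rightarrow> real \<Rightarrow> 'a star_alg) \<Rightarrow> (real \<Rightarrow> real \<Rightarrow> real \<Rightarrow> 'a \<Rightarrow> 'a tensor) \<Rightarrow>
   (real \<Rightarrow> real \<Rightarrow> 'a) \<Rightarrow> bool" where
  "subproduct_unit A D p \<longleftrightarrow>
     (\<forall>s t. 0 < s \<and> s < t \<longrightarrow> projection (A s t) (p s t) \<and> p s t \<noteq> zero_of (A s t)) \<and>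
     (\<forall>r s t. 0 < r \<and> r < s \<and> s < t \<longrightarrow> D r s t (p r t) = pure [A r s, A s t] [p r s, p s t])"

definition subproduct_counit ::
  "(real \<Rightarrow> real \<Rightarrow> 'a star_alg) \<Rightarrow> (real \<Rightarrow> real \<Rightarrow> real \<Rightarrow> 'a \<Rightarrow> 'a tensor) \<Rightarrow>
   (real \<Rightarrow> real \<Rightarrow> 'a \<Rightarrow> complex) \<Rightarrow> bool" where
  "subproduct_counit A D \<phi> \<longleftrightarrow>
     (\<forall>s t. 0 < s \<and> s < t \<longrightarrow> state (A s t) (\<phi> s t)) \<and>
     (\<forall>r s t. 0 < r \<and> r < s \<and> s < t \<longrightarrow> (\<forall>a\<in>carrier (A r t).
        \<phi> r t a = tensor_functional [A r s, A s t] [\<phi> r s, \<phi> s t] (D r s t a)))"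


section \<open>The inductive limit along partitions\<close>

definition partitions :: "real \<Rightarrow> real \<Rightarrow> real set set" where
  "partitions s t = {I. finite I \<and> I \<subseteq> {s..t} \<and> s \<in> I \<and> t \<in> I}"

definition all_partitions :: "real set set" where
  "all_partitions = {I. \<exists>s t. 0 < s \<and> s < t \<and> I \<in> partitions s t}"

definition intervals :: "real set \<Rightarrow> (real \<times> real) list" where
  "intervals I = (let xs = sorted_list_of_set I in zip xs (tl xs))"

text \<open>\<open>tensor (factors A I)\<close> is the algebra of the partition \<open>I\<close>.  For a single point \<open>I\<close> the
  list is empty, and \<open>unit_tensor A p I\<close> is the identity of the complex numbers: tensoring with it
  omits the factor.\<close>

definition factors :: "(real \<Rightarrow> real \<Rightarrow> 'a star_alg) \<Rightarrow> real set \<Rightarrow> 'a star_alg list" where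
  "factors A I = map (\<lambda>(s, t). A s t) (intervals I)"

definition unit_tensor ::
  "(real \<Rightarrow> real \<Rightarrow> 'a star_alg) \<Rightarrow> (real \<Rightarrow> real \<Rightarrow> 'a) \<Rightarrow> real set \<Rightarrow> 'a tensor" where
  "unit_tensor A p I = pure (factors A I) (map (\<lambda>(s, t). p s t) (intervals I))"

text \<open>The iterated co-multiplication along a partition, listed in decreasing order.\<close>

fun split_rev ::
  "(real \<Rightarrow> real \<Rightarrow> 'a star_alg) \<Rightarrow> (real \<Rightarrow> real \<Rightarrow> real \<Rightarrow> 'a \<Rightarrow> 'a tensor) \<Rightarrow>
   real list \<Rightarrow> 'a \<Rightarrow> 'a tensor" where
  "split_rev A D [t, s] = single_tensor (A s t)"
| "split_rev A D [t, r, s] = D s r t"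
| "split_rev A D (u # t # r # q # qs) = (let s = last (q # qs); I = set (t # r # q # qs) in
     (\<lambda>a. tensor_map [A s t, A t u] [factors A I, [A t u]]
            [split_rev A D (t # r # q # qs), single_tensor (A t u)] (D s t u a)))"

definition split ::
  "(real \<Rightarrow> real \<Rightarrow> 'a star_alg) \<Rightarrow> (real \<Rightarrow> real \<Rightarrow> real \<Rightarrow> 'a \<Rightarrow> 'a tensor) \<Rightarrow>
   real set \<Rightarrow> 'a \<Rightarrow> 'a tensor" where
  "split A D I = split_rev A D (rev (sorted_list_of_set I))"

text \<open>\<open>refine A D I J\<close> is \<open>\<Delta>\<^bsub>I,J\<^esub>\<close> (\<open>I \<subseteq> J\<close> with the same end points), and \<open>refine_ext A D p I J\<close>
  is its extension \<open>\<Delta>\<^sup>\<times>\<^bsub>I,J\<^esub>\<close> to arbitrary \<open>I \<subseteq> J\<close>.\<close>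

definition refine ::
  "(real \<Rightarrow> real \<Rightarrow> 'a star_alg) \<Rightarrow> (real \<Rightarrow> real \<Rightarrow> real \<Rightarrow> 'a \<Rightarrow> 'a tensor) \<Rightarrow>
   real set \<Rightarrow> real set \<Rightarrow> 'a tensor \<Rightarrow> 'a tensor" where
  "refine A D I J = tensor_map (factors A I)
     (map (\<lambda>(s, t). factors A (J \<inter> {s..t})) (intervals I))
     (map (\<lambda>(s, t). split A D (J \<inter> {s..t})) (intervals I))"

definition refine_ext ::
  "(real \<Rightarrow> real \<Rightarrow> 'a star_alg) \<Rightarrow> (real \<Rightarrow> real \<Rightarrow> real \<Rightarrow> 'a \<Rightarrow> 'a tensor) \<Rightarrow>
   (real \<Rightarrow> real \<Rightarrow> 'a) \<Rightarrow> real set \<Rightarrow> real set \<Rightarrow> 'a tensor \<Rightarrow> 'a tensor" where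
  "refine_ext A D p I J x =
     (let s = Min I; t = Max I;
          lower = {j \<in> J. j \<le> s}; middle = J \<inter> {s..t}; upper = {j \<in> J. t \<le> j}
      in tensor_concat [factors A lower, factors A middle, factors A upper]
           [unit_tensor A p lower, refine A D I middle x, unit_tensor A p upper])"

type_synonym 'a limit = "(real set \<Rightarrow> 'a tensor) set"

definition limit_alg ::
  "(real \<Rightarrow> real \<Rightarrow> 'a star_alg) \<Rightarrow> (real \<Rightarrow> real \<Rightarrow> real \<Rightarrow> 'a \<Rightarrow> 'a tensor) \<Rightarrow>
   (real \<Rightarrow> real \<Rightarrow> 'a) \<Rightarrow> 'a limit star_alg" where
  "limit_alg A D p =
     ind_limit all_partitions (\<lambda>I. tensor (factors A I)) (refine_ext A D p)"

definition partition_emb ::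
  "(real \<Rightarrow> real \<Rightarrow> 'a star_alg) \<Rightarrow> (real \<Rightarrow> real \<Rightarrow> real \<Rightarrow> 'a \<Rightarrow> 'a tensor) \<Rightarrow>
   (real \<Rightarrow> real \<Rightarrow> 'a) \<Rightarrow> real set \<Rightarrow> 'a tensor \<Rightarrow> 'a limit" where
  "partition_emb A D p =
     limit_emb all_partitions (\<lambda>I. tensor (factors A I)) (refine_ext A D p)"

definition interval_emb ::
  "(real \<Rightarrow> real \<Rightarrow> 'a star_alg) \<Rightarrow> (real \<Rightarrow> real \<Rightarrow> real \<Rightarrow> 'a \<Rightarrow> 'a tensor) \<Rightarrow>
   (real \<Rightarrow> real \<Rightarrow> 'a) \<Rightarrow> real \<Rightarrow> real \<Rightarrow> 'a \<Rightarrow> 'a limit" where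
  "interval_emb A D p s t a = partition_emb A D p {s, t} (single_tensor (A s t) a)"


section \<open>Co-multiplication and idempotent states\<close>

text \<open>\<open>\<Delta>\<^sub>s\<close> is determined by \<open>\<Delta>\<^sub>s \<Delta>\<^sup>\<times>\<^bsub>I \<union> J\<^esub> = \<Delta>\<^sup>\<times>\<^bsub>I\<^esub> \<otimes> \<Delta>\<^sup>\<times>\<^bsub>J\<^esub>\<close>, which is stated on the elementary tensors
  \<open>x \<otimes> y\<close> in \<open>A\<^bsub>I \<union> J\<^esub> = A\<^bsub>I\<^esub> \<otimes> A\<^bsub>J\<^esub>\<close>.  Uniqueness already holds among all *-homomorphisms;
  injectivity is a consequence.\<close>

definition comult ::
  "(real \<Rightarrow> real \<Rightarrow> 'a star_alg) \<Rightarrow> (real \<Rightarrow> real \<Rightarrow> real \<Rightarrow> 'a \<Rightarrow> 'a tensor) \<Rightarrow>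
   (real \<Rightarrow> real \<Rightarrow> 'a) \<Rightarrow> real \<Rightarrow> 'a limit \<Rightarrow> 'a limit tensor" where
  "comult A D p s = (let L = limit_alg A D p in
     (THE d. d \<in> extensional (carrier L) \<and> star_hom L (tensor [L, L]) d \<and>
       (\<forall>r t. 0 < r \<and> r < s \<and> s < t \<longrightarrow> (\<forall>I\<in>partitions r s. \<forall>J\<in>partitions s t.
          \<forall>x\<in>carrier (tensor (factors A I)). \<forall>y\<in>carrier (tensor (factors A J)).
            d (partition_emb A D p (I \<union> J) (tensor_append (factors A I) (factors A J) x y)) =
            pure [L, L] [partition_emb A D p I x, partition_emb A D p J y]))))"

text \<open>The common value of \<open>\<Delta>\<^sup>\<times>\<^bsub>s,t\<^esub>(p\<^bsub>s,t\<^esub>)\<close>.\<close>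

definition limit_projection ::
  "(real \<Rightarrow> real \<Rightarrow> 'a star_alg) \<Rightarrow> (real \<Rightarrow> real \<Rightarrow> real \<Rightarrow> 'a \<Rightarrow> 'a tensor) \<Rightarrow>
   (real \<Rightarrow> real \<Rightarrow> 'a) \<Rightarrow> 'a limit" where
  "limit_projection A D p =
     (THE q. \<forall>s t. 0 < s \<and> s < t \<longrightarrow> interval_emb A D p s t (p s t) = q)"

definition idempotent_state ::
  "(real \<Rightarrow> real \<Rightarrow> 'a star_alg) \<Rightarrow> (real \<Rightarrow> real \<Rightarrow> real \<Rightarrow> 'a \<Rightarrow> 'a tensor) \<Rightarrow>
   (real \<Rightarrow> real \<Rightarrow> 'a) \<Rightarrow> ('a limit \<Rightarrow> complex) \<Rightarrow> bool" where
  "idempotent_state A D p \<phi> \<longleftrightarrow> (let L = limit_alg A D p in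
     state L \<phi> \<and>
     (\<forall>s>0. \<forall>x\<in>carrier L. tensor_functional [L, L] [\<phi>, \<phi>] (comult A D p s x) = \<phi> x) \<and>
     limit_projection A D p \<notin> left_kernel L \<phi>)"

end

theory Submission
 imports Defs
begin

text \<open>The functionals \<open>\<phi>\<^bsub>I\<^esub> = \<phi>\<^bsub>\<iota>\<^sub>0,\<iota>\<^sub>1\<^esub> \<otimes> \<dots> \<otimes> \<phi>\<^bsub>\<iota>\<^sub>m,\<iota>\<^sub>m\<^sub>+\<^sub>1\<^esub>\<close> are compatible with the refinement
 maps: the co-unit identity takes care of inserted points and \<open>\<phi>\<^bsub>s,t\<^esub>(p\<^bsub>s,t\<^esub>) = 1\<close> of added units.  Hence
 they extend to a state of the limit, which is idempotent because \<open>\<phi>\<^bsub>I \<union> J\<^esub> = \<phi>\<^bsub>I\<^esub> \<otimes> \<phi>\<^bsub>J\<^esub>\<close>.  Conversely,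
 idempotence at the points of \<open>I\<close> forces an idempotent state with these marginals to equal
 \<open>\<phi>\<^bsub>I\<^esub>\<close> on \<open>\<A>\<^bsub>I\<^esub>\<close>, and the images of these algebras are dense.

 Since \<open>\<phi>(x) = \<phi>(pxp)\<close> for a state \<open>\<phi>\<close> with \<open>\<phi>(p) = 1\<close>, the product functional is the vector functional
 of \<open>p\<^sub>I\<close>, which makes it contractive for the minimal norm.  Tensor products of *-homomorphisms are
 contractive because an operator bound in a product of representations can be checked
 one factor at a time on GNS representations of states.\<close>

text \<open>Hilbert spaces are replaced by positive definite kernels on sets of basis symbols:
  vectors are finitely supported combinations, null vectors are kept, and statements about operators
  are inequalities between the seminorms \<open>hn\<close>. A tensor product of representations is
  then a product kernel, and its positivity is the Schur product theorem. The minimal seminorm fits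
  this frame, being defined by the kernels of product states.

  The obstacle is that homomorphisms take values in completed tensor products. Composed with a GNS
  representation, they give an action on a completed space that is not the GNS space of a state list
  of the domain, and no decomposition into cyclic parts is at hand. The bridge is to iterate (u*
  u)^(2^n): any estimate of matrix coefficients with the right exponential rate yields the sharp
  operator norm, whatever its constant. So crude bounds, obtained slice by slice or vector by
  vector, are enough.

  Completion of tensor products and the limit over partitions are the same construction
  \<open>ind_limit\<close>, over a constant system and over partitions; density, extension of maps
  and completeness are proved once for both.\<close>

abbreviation on :: "('k \<Rightarrow>\<^sub>0 complex) => 'k set => bool" (infix "on" 50) where
 "u on S \<equiv> Poly_Mapping.keys u \<subseteq> S"

abbreviation elem :: "'a => 'a star_alg => bool" (infix "el" 50) where
 "x el A \<equiv> x \<in> carrier A"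

abbreviation upto_point :: "real set => real => real set" (infixl "<|" 70) where
 "J <| r \<equiv> J \<inter> {..r}"

abbreviation from_point :: "real set => real => real set" (infixl "|>" 70) where
 "J |> r \<equiv> J \<inter> {r..}"

section \<open>Positive definite kernels\<close>

definition psc :: "complex => ('k \<Rightarrow>\<^sub>0 complex) => ('k \<Rightarrow>\<^sub>0 complex)" where
 "psc c u = Poly_Mapping.map ((*) c) u"

definition lin :: "('k => complex) => ('k \<Rightarrow>\<^sub>0 complex) => complex" where
 "lin g u = (\<Sum>k\<in>Poly_Mapping.keys u. Poly_Mapping.lookup u k * g k)"

text \<open>The bind operation of the free vector space: basis elements are replaced by combinations
  and the result is expanded linearly.\<close>

definition ext :: "('k => 'l \<Rightarrow>\<^sub>0 complex) => ('k \<Rightarrow>\<^sub>0 complex) => ('l \<Rightarrow>\<^sub>0 complex)" where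
 "ext g u = (\<Sum>k\<in>Poly_Mapping.keys u. psc (Poly_Mapping.lookup u k) (g k))"

text \<open>The sesquilinear form of the kernel, conjugate-linear in the first argument. Writing it
  with two uses of \<open>lin\<close> and two conjugations lets every rule for \<open>lin\<close>
  act on either argument.\<close>

definition form :: "('s => 't => complex) => ('s \<Rightarrow>\<^sub>0 complex) => ('t \<Rightarrow>\<^sub>0 complex) => complex" where
 "form K u v = lin (%t. cnj (lin (%s. cnj (K s t)) u)) v"

abbreviation keys :: "('k \<Rightarrow>\<^sub>0 complex) => 'k set" where "keys \<equiv> Poly_Mapping.keys"
abbreviation lookup :: "('k \<Rightarrow>\<^sub>0 complex) => 'k => complex" where "lookup \<equiv> Poly_Mapping.lookup"
abbreviation single :: "'k => complex => ('k \<Rightarrow>\<^sub>0 complex)" where "single \<equiv> Poly_Mapping.single"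

lemma lookup_psc [simp]: "lookup (psc c u) k = c * lookup u k"
 by (simp add: psc_def Poly_Mapping.map.rep_eq when_def)

lemma keys_psc: "(psc c u) on keys u"
 by (auto simp: in_keys_iff)

lemma psc_add: "psc c (u + v) = psc c u + psc c v"
 by (rule poly_mapping_eqI) (simp add: lookup_add algebra_simps)

lemma psc_single [simp]: "psc c (single k d) = single k (c * d)"
 by (rule poly_mapping_eqI) (simp add: lookup_single when_def)

lemma psc_psc [simp]: "psc c (psc d u) = psc (c * d) u"
 by (rule poly_mapping_eqI) simp

lemma psc_1 [simp]: "psc 1 u = u"
 by (rule poly_mapping_eqI) simp

lemma psc_0 [simp]: "psc 0 u = 0" "psc c 0 = 0"
 by (rule poly_mapping_eqI, simp)+

lemma psc_uminus: "psc (- 1) u = - u"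
 by (rule poly_mapping_eqI) simp

lemma psc_add_left: "psc (c + d) u = psc c u + psc d u"
 by (rule poly_mapping_eqI) (simp add: lookup_add algebra_simps)

lemma lin_superset: "finite T ==> u on T ==> lin g u = (\<Sum>k\<in>T. lookup u k * g k)"
 unfolding lin_def by (rule sum.mono_neutral_left) (auto simp: in_keys_iff)

lemma lin_0 [simp]: "lin g 0 = 0" by (simp add: lin_def)
lemma ext_0 [simp]: "ext g 0 = 0" by (simp add: ext_def)

lemma lin_add: "lin g (u + v) = lin g u + lin g v"
proof -
 let ?T = "keys u \<union> keys v"
 have "(u + v) on ?T" by (rule Poly_Mapping.keys_add)
 then have "lin g (u + v) = (\<Sum>k\<in>?T. lookup (u + v) k * g k)" by (intro lin_superset) auto
 also have "... = (\<Sum>k\<in>?T. lookup u k * g k) + (\<Sum>k\<in>?T. lookup v k * g k)"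
  by (simp add: lookup_add sum.distrib[symmetric] algebra_simps)
 finally show ?thesis by (simp add: lin_superset[of ?T])
qed

lemma lookup_ext: "lookup (ext g u) l = lin (%k. lookup (g k) l) u"
 by (simp add: ext_def lin_def lookup_sum)

lemma ext_add: "ext g (u + v) = ext g u + ext g v"
 by (rule poly_mapping_eqI) (simp add: lookup_ext lookup_add lin_add)

lemma lin_psc: "lin g (psc c u) = c * lin g u"
proof -
 have "lin g (psc c u) = (\<Sum>k\<in>keys u. lookup (psc c u) k * g k)"
  by (intro lin_superset) (auto simp: keys_psc[THEN subsetD])
 then show ?thesis by (simp add: lin_def sum_distrib_left algebra_simps)
qed

lemma lin_single [simp]: "lin g (single k c) = c * g k"
 using lin_superset[of "{k}" "single k c" g] by (simp add: lookup_single)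

lemma ext_single [simp]: "ext g (single k c) = psc c (g k)"
 by (rule poly_mapping_eqI) (simp add: lookup_ext)

lemma ext_psc: "ext g (psc c u) = psc c (ext g u)"
 by (rule poly_mapping_eqI) (simp add: lookup_ext lin_psc)

lemma lin_cong: "(!!k. k \<in> keys u ==> f k = g k) ==> lin f u = lin g u"
 by (simp add: lin_def)

lemma ext_cong: "(!!k. k \<in> keys u ==> f k = g k) ==> ext f u = ext g u"
 by (simp add: ext_def)

lemma lin_fun_add: "lin (%k. f k + g k) u = lin f u + lin g u"
 by (simp add: lin_def algebra_simps sum.distrib)

lemma lin_fun_mult: "lin (%k. c * f k) u = c * lin f u"
 by (simp add: lin_def sum_distrib_left mult.left_commute)

lemma lin_fun_mult_right: "lin (%k. f k * c) u = lin f u * c"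
 by (simp add: lin_def sum_distrib_right mult.assoc)

lemma lin_fun_0 [simp]: "lin (%k. 0) u = 0"
 by (simp add: lin_def)

lemma lin_sum: "lin f (\<Sum>i\<in>I. u i) = (\<Sum>i\<in>I. lin f (u i))"
 by (induction I rule: infinite_finite_induct) (simp_all add: lin_add)

lemma lin_ext: "lin f (ext g u) = lin (%k. lin f (g k)) u"
 by (simp add: ext_def lin_sum lin_psc lin_def[of "%k. lin f (g k)"])

lemma ext_ext: "ext f (ext g u) = ext (%k. ext f (g k)) u"
 by (rule poly_mapping_eqI) (simp add: lookup_ext lin_ext)

lemma ext_single_id [simp]: "ext (%k. single k 1) u = u"
 by (rule poly_mapping_eqI) (auto simp: lookup_ext lin_def lookup_single when_def in_keys_iff
  if_distrib[where f="%x. _ * x"] sum.delta' cong: if_cong)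

lemma ext_fun_add: "ext (%k. f k + g k) u = ext f u + ext g u"
 by (rule poly_mapping_eqI) (simp add: lookup_ext lookup_add lin_fun_add)

lemma ext_fun_psc: "ext (%k. psc c (f k)) u = psc c (ext f u)"
 by (rule poly_mapping_eqI) (simp add: lookup_ext lin_fun_mult)

lemma lin_swap: "lin (%t. lin (%s. f s t) u) v = lin (%s. lin (%t. f s t) v) u"
 unfolding lin_def sum_distrib_left by (subst sum.swap) (simp add: algebra_simps)

lemma ext_swap: "ext (%t. ext (%s. f s t) u) v = ext (%s. ext (%t. f s t) v) u"
 by (rule poly_mapping_eqI) (simp add: lookup_ext, rule lin_swap)

lemma keys_ext: "(ext g u) on (\<Union>k\<in>keys u. keys (g k))"
proof
 fix l assume "l \<in> keys (ext g u)"
 then have "lin (%k. lookup (g k) l) u \<noteq> 0" by (simp add: in_keys_iff lookup_ext)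
 then have "\<exists>k\<in>keys u. lookup u k * lookup (g k) l \<noteq> 0"
  unfolding lin_def by (meson sum.neutral)
 then obtain k where "k \<in> keys u" "lookup (g k) l \<noteq> 0" by auto
 then show "l \<in> (\<Union>k\<in>keys u. keys (g k))" by (auto simp: in_keys_iff)
qed

lemma keys_ext_subset: "(!!k. k \<in> keys u ==> (g k) on S) ==> (ext g u) on S"
 using keys_ext[of g u] by blast

lemma keys_add_subset: "u on S ==> v on S ==> (u + v) on S"
 using Poly_Mapping.keys_add[of u v] by blast

lemma keys_diff_subset: "u on S ==> v on S ==> (u - v) on S"
 for u v :: "'s \<Rightarrow>\<^sub>0 complex"
 by (auto simp: in_keys_iff lookup_minus subset_iff) (metis in_keys_iff)

lemma keys_psc_subset: "u on S ==> (psc c u) on S"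
 using keys_psc[of c u] by (rule subset_trans)

lemma keys_single_subset: "s \<in> S ==> (single s c) on S"
 by simp

text \<open>A finitely supported combination is the sum of its terms, so linear statements reduce to
  single basis elements; the support condition is carried along for both the new term and the
  remainder.\<close>

lemma finsupp_induct [consumes 1, case_names zero add]:
 fixes u :: "'s \<Rightarrow>\<^sub>0 complex"
 assumes "u on S" and "P 0"
  and "!!k c u. k \<in> S ==> u on S ==> P u ==> P (single k c + u)"
 shows "P u"
proof -
 have "P (\<Sum>k\<in>F. single k (lookup u k)) \<and> (\<Sum>k\<in>F. single k (lookup u k)) on S"
  if "finite F" "F \<subseteq> keys u" for F
  using that
 proof (induction F)
  case (insert x F)
  then have IH: "P (\<Sum>k\<in>F. single k (lookup u k))"
   and sub: "(\<Sum>k\<in>F. single k (lookup u k)) on S" and x: "x \<in> S"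
   using assms(1) by auto
  have "(single x (lookup u x) + (\<Sum>k\<in>F. single k (lookup u k))) on S"
   using sub x by (intro keys_add_subset) auto
  then show ?case using assms(3)[OF x sub IH] insert.hyps by simp
 qed (simp add: assms(2))
 from this[of "keys u"] have "P (\<Sum>k\<in>keys u. single k (lookup u k))" by simp
 also have "(\<Sum>k\<in>keys u. single k (lookup u k)) = ext (%k. single k 1) u"
  unfolding ext_def psc_single by simp
 finally show ?thesis by simp
qed

lemma form_conv: "form K u v = cnj (lin (%s. cnj (lin (K s) v)) u)"
proof -
 have "form K u v = (\<Sum>t\<in>keys v. \<Sum>s\<in>keys u. lookup v t * (cnj (lookup u s) * K s t))"
  by (simp add: form_def lin_def sum_distrib_left)
 also have "... = (\<Sum>s\<in>keys u. \<Sum>t\<in>keys v. lookup v t * (cnj (lookup u s) * K s t))"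
  by (rule sum.swap)
 also have "... = cnj (lin (%s. cnj (lin (K s) v)) u)"
  by (simp add: lin_def sum_distrib_left algebra_simps)
 finally show ?thesis .
qed

lemma form_add_right: "form K u (v + w) = form K u v + form K u w"
 by (simp add: form_def lin_add)

lemma form_add_left: "form K (u + v) w = form K u w + form K v w"
 by (simp add: form_conv lin_add)

lemma form_psc_right: "form K u (psc c v) = c * form K u v"
 by (simp add: form_def lin_psc)

lemma form_psc_left: "form K (psc c u) v = cnj c * form K u v"
 by (simp add: form_conv lin_psc)

lemma form_0 [simp]: "form K 0 v = 0" "form K u 0 = 0"
 by (simp_all add: form_def)

lemma form_diff_right: "form K u (v - w) = form K u v - form K u w"
 by (metis add_diff_cancel_right' diff_add_cancel form_add_right)

lemma form_diff_left: "form K (u - v) w = form K u w - form K v w"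
 by (metis add_diff_cancel_right' diff_add_cancel form_add_left)

lemma form_uminus: "form K (- u) v = - form K u v" "form K u (- v) = - form K u v"
 using form_diff_left[of K 0 u v] form_diff_right[of K u 0 v] by simp_all

lemma form_single [simp]: "form K (single s c) (single t d) = cnj c * d * K s t"
 by (simp add: form_def)

lemma form_ext_right: "form K u (ext g v) = lin (%t. form K u (g t)) v"
 by (simp add: form_def lin_ext)

lemma form_ext_left: "form K (ext g u) v = cnj (lin (%s. cnj (form K (g s) v)) u)"
 by (simp add: form_conv lin_ext)

lemma form_ext: "form K (ext g u) (ext h v) = form (%s t. form K (g s) (h t)) u v"
 unfolding form_ext_right form_ext_left form_def[of "%s t. form K (g s) (h t)"] ..

lemma form_cong:
 "(!!s t. s \<in> keys u ==> t \<in> keys v ==> K s t = L s t) ==> form K u v = form L u v"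
 unfolding form_def by (intro lin_cong arg_cong[of _ _ cnj]) simp

lemma form_fun_add: "form (%s t. K s t + L s t) u v = form K u v + form L u v"
 by (simp add: form_def lin_fun_add)

lemma form_fun_mult: "form (%s t. c * K s t) u v = c * form K u v"
 unfolding form_conv by (simp add: lin_fun_mult)

lemma form_fun_diff: "form (%s t. K s t - L s t) u v = form K u v - form L u v"
 using form_fun_add[of K "%s t. - 1 * L s t" u v] unfolding form_fun_mult by simp

lemma form_fun_0 [simp]: "form (%s t. 0) u v = 0"
 by (simp add: form_def)

lemma form_fun_sum: "form (%s t. \<Sum>i\<in>I. K i s t) u v = (\<Sum>i\<in>I. form (K i) u v)"
 by (induction I rule: infinite_finite_induct) (simp_all add: form_fun_add)

lemma form_rank_one: "form (%s t. cnj (f s) * g t) u v = cnj (lin f u) * lin g v"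
 by (simp add: form_conv lin_fun_mult lin_fun_mult_right)

text \<open>A crude weighted l1 estimate. It only serves to bound matrix coefficients up to a
  constant depending on the vector; power iteration later removes the constant.\<close>

lemma form_bound:
 assumes "!!s t. s \<in> keys u ==> t \<in> keys v ==> cmod (K s t) <= C * (a s * b t)"
 shows "cmod (form K u v) \<le>
  C * ((\<Sum>s\<in>keys u. cmod (lookup u s) * a s) * (\<Sum>t\<in>keys v. cmod (lookup v t) * b t))"
proof -
 have "form K u v = (\<Sum>t\<in>keys v. \<Sum>s\<in>keys u. lookup v t * (cnj (lookup u s) * K s t))"
  by (simp add: form_def lin_def sum_distrib_left)
 also have "cmod ... <= (\<Sum>t\<in>keys v. \<Sum>s\<in>keys u. cmod (lookup v t * (cnj (lookup u s) * K s t)))"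
  by (rule order_trans[OF norm_sum sum_mono[OF norm_sum]])
 also have "... <= (\<Sum>t\<in>keys v. \<Sum>s\<in>keys u.
   cmod (lookup v t) * (cmod (lookup u s) * (C * (a s * b t))))"
  by (intro sum_mono) (simp add: norm_mult mult_left_mono assms)
 also have "... = C * ((\<Sum>s\<in>keys u. cmod (lookup u s) * a s) * (\<Sum>t\<in>keys v. cmod (lookup v t) * b t))"
  unfolding sum_product unfolding sum_distrib_left
  by (subst sum.swap) (simp add: algebra_simps)
 finally show ?thesis .
qed

text \<open>Positive semidefiniteness. Membership in the nonnegative reals includes vanishing of the
  imaginary part, which is what makes the kernel Hermitian.\<close>

definition pd :: "'s set => ('s => 's => complex) => bool" where
 "pd S K \<longleftrightarrow> (\<forall>w. w on S \<longrightarrow> form K w w \<in> \<real>\<^sub>\<ge>\<^sub>0)"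

definition hn :: "('s => 's => complex) => ('s \<Rightarrow>\<^sub>0 complex) => real" where
 "hn K w = sqrt (Re (form K w w))"

context
 fixes S :: "'s set" and K
 assumes pd: "pd S K"
begin

lemma pd_form: "w on S ==> form K w w \<in> \<real>\<^sub>\<ge>\<^sub>0"
 using pd by (simp add: pd_def)

lemma pd_form_Re: "w on S ==> 0 <= Re (form K w w)"
 using pd_form complex_nonneg_Reals_iff by blast

lemma pd_form_of_real: "w on S ==> form K w w = complex_of_real (Re (form K w w))"
 using pd_form complex_nonneg_Reals_iff complex_is_Real_iff by (metis of_real_Re)

text \<open>Polarization: the values at \<open>u + v\<close> and \<open>u + i v\<close> are real,
  and their imaginary parts give the imaginary and the real part of the claim.\<close>

lemma pd_herm: assumes u: "u on S" and v: "v on S" shows "form K v u = cnj (form K u v)"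
proof -
 have im: "Im (form K w w) = 0" if "w on S" for w
  using pd_form[OF that] complex_nonneg_Reals_iff by blast
 have "Im (form K (u + v) (u + v)) = 0"
  by (intro im keys_add_subset u v)
 then have 1: "Im (form K u v) + Im (form K v u) = 0"
  using im[OF u] im[OF v] by (simp add: form_add_left form_add_right)
 have "Im (form K (u + psc \<i> v) (u + psc \<i> v)) = 0"
  by (intro im keys_add_subset keys_psc_subset u v)
 then have 2: "Re (form K u v) = Re (form K v u)"
  using im[OF u] im[OF v] by (simp add: form_add_left form_add_right form_psc_left form_psc_right)
 show ?thesis using 1 2 by (simp add: complex_eq_iff)
qed

lemma pd_herm_kernel: "s \<in> S ==> t \<in> S ==> K t s = cnj (K s t)"
 using pd_herm[of "single s 1" "single t 1"] by simp

lemma hn_nonneg: "w on S ==> 0 <= hn K w"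
 by (simp add: hn_def pd_form_Re)

lemma hn_sq: "w on S ==> (hn K w)\<^sup>2 = Re (form K w w)"
 by (simp add: hn_def pd_form_Re)

lemma pd_cs_sq:
 assumes u: "u on S" and v: "v on S"
 shows "(cmod (form K u v))\<^sup>2 <= Re (form K u u) * Re (form K v v)"
proof -
 define c where "c = form K u v"
 define a where "a = Re (form K u u)"
 define b where "b = Re (form K v v)"
 have a: "form K u u = of_real a" and b: "form K v v = of_real b"
  using pd_form_of_real u v a_def b_def by auto
 have vu: "form K v u = cnj c" using pd_herm[OF u v] c_def by simp
 have ab: "0 <= a" "0 <= b" using pd_form_Re u v a_def b_def by auto
 \<comment> \<open>Positivity at \<open>r u - t v\<close>, with a complex weight \<open>r\<close>
   and a real weight \<open>t\<close>. Both cases below are choices of these two numbers, as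
   \<open>a\<close> may vanish.\<close>
 have gen: "0 <= (cmod r)\<^sup>2 * a - 2 * t * Re (cnj r * c) + t\<^sup>2 * b" for r and t :: real
 proof -
  have "0 <= Re (form K (psc r u - psc t v) (psc r u - psc t v))"
   by (intro pd_form_Re keys_diff_subset keys_psc_subset u v)
  also have "form K (psc r u - psc t v) (psc r u - psc t v) =
    r * cnj r * a - t * (cnj r * c) - t * cnj (cnj r * c) + t\<^sup>2 * b"
   by (simp add: form_diff_left form_diff_right form_psc_left form_psc_right a b vu c_def[symmetric]
     power2_eq_square algebra_simps)
  also have "r * cnj r = of_real ((cmod r)\<^sup>2)" by (simp only: complex_norm_square)
  finally show ?thesis by simp
 qed
 have rc: "Re (cnj c * c) = (cmod c)\<^sup>2" unfolding cmod_power2 by (simp add: power2_eq_square)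
 have "(cmod c)\<^sup>2 <= a * b"
 proof (cases "a = 0")
  case False
  have "0 <= (cmod c)\<^sup>2 * a - 2 * a * (cmod c)\<^sup>2 + a\<^sup>2 * b"
   using gen[of c a] unfolding rc by simp
  then have "0 <= a * (a * b - (cmod c)\<^sup>2)" by (simp add: power2_eq_square algebra_simps)
  with False ab show ?thesis by (simp add: zero_le_mult_iff)
 next
  case True
  show ?thesis
  proof (rule ccontr)
   assume "\<not> ?thesis"
   then have pos: "(cmod c)\<^sup>2 > 0" using True by auto
   \<comment> \<open>If \<open>a = 0\<close> but \<open>c\<close> is nonzero, this multiple of
     \<open>c\<close> makes the cross term too large: with \<open>t = 1\<close>, positivity would
     give \<open>0 <= - 2 * (b + 1) + b\<close>.\<close>
   have "cnj (of_real ((b + 1) / (cmod c)\<^sup>2) * c) * c = of_real (b + 1)"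
    using pos by (simp add: mult.assoc complex_norm_square[symmetric] mult.commute[of "cnj c"])
   then have "0 <= - 2 * (b + 1) + b"
    using gen[of "of_real ((b + 1) / (cmod c)\<^sup>2) * c" 1] True by simp
   then show False using ab by simp
  qed
 qed
 then show ?thesis by (simp add: a_def b_def c_def)
qed

lemma pd_cs:
 assumes u: "u on S" and v: "v on S"
 shows "cmod (form K u v) <= hn K u * hn K v"
 using real_sqrt_le_mono[OF pd_cs_sq[OF u v]] by (simp add: hn_def real_sqrt_mult)

lemma hn_triangle:
 assumes u: "u on S" and v: "v on S"
 shows "hn K (u + v) <= hn K u + hn K v"
proof (rule power2_le_imp_le)
 have "(hn K (u + v))\<^sup>2 = Re (form K u u) + 2 * Re (form K u v) + Re (form K v v)"
  using pd_herm[OF u v] by (simp add: hn_sq keys_add_subset u v form_add_left form_add_right)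
 also have "... <= Re (form K u u) + 2 * (hn K u * hn K v) + Re (form K v v)"
  using pd_cs[OF u v] complex_Re_le_cmod[of "form K u v"] by linarith
 also have "... = (hn K u + hn K v)\<^sup>2"
  by (simp add: hn_sq[symmetric] u v power2_sum)
 finally show "(hn K (u + v))\<^sup>2 <= (hn K u + hn K v)\<^sup>2" .
qed (simp add: hn_nonneg u v)

end

lemma hn_psc: "hn K (psc c u) = cmod c * hn K u"
proof -
 have "form K (psc c u) (psc c u) = (c * cnj c) * form K u u"
  by (simp add: form_psc_left form_psc_right)
 also have "c * cnj c = of_real ((cmod c)\<^sup>2)" by (simp only: complex_norm_square)
 finally show ?thesis by (simp add: hn_def real_sqrt_mult)
qed

lemma pd_subset: "pd S K ==> T \<subseteq> S ==> pd T K"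
 by (auto simp: pd_def)

lemma pd_cong: "pd S K ==> (!!s t. s \<in> S ==> t \<in> S ==> K s t = L s t) ==> pd S L"
 unfolding pd_def by (metis form_cong subsetD)

lemma pd_pullback:
 fixes g :: "'a => 'b \<Rightarrow>\<^sub>0 complex"
 assumes "pd S K" "!!t. t \<in> T ==> (g t) on S"
 shows "pd T (%s t. form K (g s) (g t))"
 unfolding pd_def form_ext[symmetric]
proof (intro allI impI)
 fix w :: "'a \<Rightarrow>\<^sub>0 complex" assume "w on T"
 then have "(ext g w) on S" using assms(2) by (intro keys_ext_subset) auto
 then show "form K (ext g w) (ext g w) \<in> \<real>\<^sub>\<ge>\<^sub>0" using assms(1) by (simp add: pd_def)
qed

text \<open>Cholesky decomposition by induction on the number of points. If the new diagonal entry
  vanishes, Cauchy-Schwarz kills its row and column; otherwise the Schur complement is positive on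
  the remaining points, and \<open>K\<close> differs from it by one rank-one term.\<close>

lemma gram_decomposition:
 fixes K :: "'a => 'a => complex"
 assumes "finite F" "pd F K"
 shows "\<exists>(n::nat) f. \<forall>s\<in>F. \<forall>t\<in>F. K s t = (\<Sum>i<n. cnj (f i s) * f i t)"
 using assms
proof (induction F arbitrary: K rule: finite_induct)
 case empty
 show ?case by simp
next
 case (insert x F K)
 have pdF: "pd F K" using insert.prems by (rule pd_subset) auto
 have K: "u on insert x F ==> v on insert x F ==>
   (cmod (form K u v))\<^sup>2 <= Re (form K u u) * Re (form K v v)" for u v
  by (rule pd_cs_sq[OF insert.prems])
 have herm: "s \<in> insert x F ==> t \<in> insert x F ==> K t s = cnj (K s t)" for s t
  by (rule pd_herm_kernel[OF insert.prems])
 define a where "a = Re (K x x)"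
 have a0: "0 <= a" and Kxx: "K x x = of_real a"
  using pd_form_Re[OF insert.prems, of "single x 1"] pd_form_of_real[OF insert.prems, of "single x 1"]
  by (simp_all add: a_def)
 show ?case
 proof (cases "a = 0")
  case True
  have z: "K x s = 0" if "s \<in> insert x F" for s
   using K[of "single x 1" "single s 1"] that True by (simp add: a_def)
  then have z': "K s x = 0" if "s \<in> insert x F" for s using herm[of x s] that by simp
  obtain n f where f: "\<forall>s\<in>F. \<forall>t\<in>F. K s t = (\<Sum>i<n::nat. cnj (f i s) * f i t)"
   using insert.IH[OF pdF] by blast
  have "\<forall>s\<in>insert x F. \<forall>t\<in>insert x F.
    K s t = (\<Sum>i<n. cnj (((f i)(x := 0)) s) * ((f i)(x := 0)) t)"
   using f z z' insert.hyps by (auto intro!: sum.cong)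
  then show ?thesis by (intro exI[of _ n] exI[of _ "%i. (f i)(x := 0)"]) simp
 next
  case False
  with a0 have a: "a > 0" by simp
  \<comment> \<open>The Schur complement of the pivot \<open>a = K x x\<close>; it vanishes in the
    row and the column of \<open>x\<close>.\<close>
  define L where "L s t = K s t - K s x * K x t / a" for s t
  have "pd F L"
   unfolding pd_def
  proof (intro allI impI)
   fix w :: "'a \<Rightarrow>\<^sub>0 complex" assume w: "w on F"
   then have w': "w on insert x F" by auto
   have "form L w w = form K w w - form (%s t. cnj (K x s) * (K x t / a)) w w"
    unfolding form_fun_diff[symmetric]
   proof (rule form_cong)
    fix s t assume "s \<in> keys w" "t \<in> keys w"
    then have "K s x = cnj (K x s)" using w by (intro herm) auto
    then show "L s t = K s t - cnj (K x s) * (K x t / a)" by (simp add: L_def)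
   qed
   also have "form (%s t. cnj (K x s) * (K x t / a)) w w = cnj (lin (K x) w) * lin (K x) w / a"
    unfolding form_rank_one using lin_fun_mult_right[of "K x" "1 / of_real a" w] by simp
   also have "... = of_real ((cmod (lin (K x) w))\<^sup>2 / a)"
    by (simp only: complex_norm_square of_real_divide) (simp add: mult.commute)
   also have "lin (K x) w = form K (single x 1) w" by (simp add: form_conv)
   finally have L: "form L w w = form K w w - of_real ((cmod (form K (single x 1) w))\<^sup>2 / a)" .
   have "(cmod (form K (single x 1) w))\<^sup>2 <= a * Re (form K w w)"
    using K[of "single x 1" w] w' by (simp add: a_def)
   then have "(cmod (form K (single x 1) w))\<^sup>2 / a <= Re (form K w w)"
    using a by (simp add: field_simps)
   moreover have "form K w w = of_real (Re (form K w w))" by (rule pd_form_of_real[OF pdF w])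
   then have "Im (form K w w) = 0" by (metis Im_complex_of_real)
   ultimately show "form L w w \<in> \<real>\<^sub>\<ge>\<^sub>0" unfolding L by (simp add: complex_nonneg_Reals_iff)
  qed
  from insert.IH[OF this]
  obtain n f where f: "\<forall>s\<in>F. \<forall>t\<in>F. L s t = (\<Sum>i<n::nat. cnj (f i s) * f i t)" by blast
  \<comment> \<open>The old vectors are extended by 0 at \<open>x\<close>; the new one is the row of
    \<open>x\<close> divided by the square root of the pivot.\<close>
  define g where "g i = (if i < n then (f i)(x := 0) else (%s. K x s / sqrt a))" for i
  have "K s t = (\<Sum>i<Suc n. cnj (g i s) * g i t)" if s: "s \<in> insert x F" and t: "t \<in> insert x F" for s t
  proof -
   have "K s t = L s t + K s x * K x t / a" by (simp add: L_def)
   also have "K s x * K x t / a = cnj (g n s) * g n t"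
   proof -
    have "complex_of_real (sqrt a) * complex_of_real (sqrt a) = a"
     using a by (metis of_real_mult real_sqrt_mult_self abs_of_pos)
    then show ?thesis using herm[OF s, of x] by (simp add: g_def)
   qed
   also have "L s t = (\<Sum>i<n. cnj (g i s) * g i t)"
   proof (cases "s = x \<or> t = x")
    case True
    then have "L s t = 0" using a Kxx by (auto simp: L_def)
    moreover have "(\<Sum>i<n. cnj (g i s) * g i t) = 0" using True by (auto simp: g_def)
    ultimately show ?thesis by simp
   next
    case False
    then show ?thesis using s t f by (auto simp: g_def)
   qed
   finally show ?thesis by simp
  qed
  then show ?thesis by blast
 qed
qed

definition pkernel :: "('s => 's => complex) => ('t => 't => complex) => 's \<times> 't => 's \<times> 't => complex" where
 "pkernel K L = (%x y. K (fst x) (fst y) * L (snd x) (snd y))"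

lemma pkernel_Pair [simp]: "pkernel K L (s, t) (s', t') = K s s' * L t t'"
 by (simp add: pkernel_def)

text \<open>Decomposing one factor suffices: if \<open>K\<close> is a sum of rank-one kernels given
  by functions \<open>f i\<close>, the product form at \<open>w\<close> is the sum of the values of
  the form of \<open>L\<close> at the vectors obtained by contracting \<open>w\<close> with
  \<open>f i\<close>.\<close>

theorem schur_product:
 assumes "pd S K" "pd T L"
 shows "pd (S \<times> T) (pkernel K L)"
 unfolding pd_def
proof (intro allI impI)
 fix w :: "'a \<times> 'b \<Rightarrow>\<^sub>0 complex" assume w: "w on S \<times> T"
 let ?F = "fst ` keys w"
 have "pd ?F K" using assms(1) by (rule pd_subset) (use w in force)
 then obtain n f where f: "\<forall>s\<in>?F. \<forall>t\<in>?F. K s t = (\<Sum>i<n::nat. cnj (f i s) * f i t)"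
  using gram_decomposition[of ?F K] by auto
 define v where "v i = ext (%x. single (snd x) (f i (fst x))) w" for i
 have v: "(v i) on T" for i
  unfolding v_def using w by (intro keys_ext_subset) auto
 have "form (pkernel K L) w w =
   form (%x y. \<Sum>i<n. form L (single (snd x) (f i (fst x))) (single (snd y) (f i (fst y)))) w w"
  using f by (intro form_cong) (auto simp: pkernel_def sum_distrib_right split: prod.splits)
 also have "... = (\<Sum>i<n. form L (v i) (v i))"
  by (simp only: form_fun_sum v_def form_ext)
 also have "... \<in> \<real>\<^sub>\<ge>\<^sub>0"
 proof -
  have "form L (v i) (v i) \<in> \<real>\<^sub>\<ge>\<^sub>0" for i using assms(2) v by (simp add: pd_def)
  then show ?thesis
   by (induction n) (simp_all add: nonneg_Reals_add_I)
 qed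
 finally show "form (pkernel K L) w w \<in> \<real>\<^sub>\<ge>\<^sub>0" .
qed

section \<open>Representations of *-semigroups on positive definite kernels\<close>

text \<open>Bilinear extension of a map on basis elements. With three independent types the same
  operation is the action on vectors, the product of the semigroup algebra, and the product of
  formal tensors.\<close>

definition av :: "('m => 's => 't) => ('m \<Rightarrow>\<^sub>0 complex) => ('s \<Rightarrow>\<^sub>0 complex) => ('t \<Rightarrow>\<^sub>0 complex)" where
 "av act u w = ext (%m. ext (%s. single (act m s) 1) w) u"

definition pst :: "('m => 'n) => ('m \<Rightarrow>\<^sub>0 complex) => ('n \<Rightarrow>\<^sub>0 complex)" where
 "pst st u = (\<Sum>m\<in>keys u. single (st m) (cnj (lookup u m)))"

text \<open>An operator norm bound in the seminorm of \<open>K\<close>. In particular null vectors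
  go to null vectors, so no quotient has to be formed.\<close>

definition opbd :: "'s set => ('m => 's => 's) => ('s => 's => complex) => ('m \<Rightarrow>\<^sub>0 complex) => real => bool" where
 "opbd S act K u N \<longleftrightarrow> (\<forall>w. w on S \<longrightarrow> hn K (av act u w) <= N * hn K w)"

lemma av_add_left: "av act (u + v) w = av act u w + av act v w"
 by (simp add: av_def ext_add)

lemma av_add_right: "av act u (v + w) = av act u v + av act u w"
 by (simp add: av_def ext_add ext_fun_add)

lemma av_psc_left: "av act (psc c u) w = psc c (av act u w)"
 by (simp add: av_def ext_psc)

lemma av_psc_right: "av act u (psc c w) = psc c (av act u w)"
 by (simp add: av_def ext_psc ext_fun_psc)

lemma av_single: "av act (single m c) (single s d) = single (act m s) (c * d)"
 by (simp add: av_def)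

lemma av_single_left: "av act (single m 1) w = ext (%s. single (act m s) 1) w"
 by (simp add: av_def)

lemma av_0 [simp]: "av act 0 w = 0" "av act u 0 = 0"
proof -
 have "av act u (psc 0 0) = psc 0 (av act u 0)" by (rule av_psc_right)
 then show "av act u 0 = 0" by simp
qed (simp add: av_def)

lemma av_diff_left: "av act (u - v) w = av act u w - av act v w"
 by (metis add_diff_cancel_right' av_add_left diff_add_cancel)

lemma av_diff_right: "av act u (v - w) = av act u v - av act u w"
 by (metis add_diff_cancel_right' av_add_right diff_add_cancel)

lemma av_eq_ext: "av act u w = ext (%m. av act (single m 1) w) u"
 by (simp add: av_def)

lemma lin_av: "lin f (av act u w) = lin (%m. lin (%s. f (act m s)) w) u"
 by (simp add: av_def lin_ext)

lemma form_av_right: "form K z (av act u w) = lin (%m. form K z (av act (single m 1) w)) u"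
 by (subst av_eq_ext) (rule form_ext_right)

lemma form_av_av:
 "form K (av act u w) (av act' u' w') =
  form (%m m'. form (%s s'. K (act m s) (act' m' s')) w w') u u'"
 unfolding av_def form_ext by simp

lemma keys_av:
 assumes "u on M" "w on S" "!!m s. m \<in> M ==> s \<in> S ==> act m s \<in> T"
 shows "(av act u w) on T"
 unfolding av_def using assms by (intro keys_ext_subset) auto

lemma keys_pst: "u on M ==> (!!m. m \<in> M ==> st m \<in> M') ==> (pst st u) on M'"
proof -
 assume *: "u on M" "!!m. m \<in> M ==> st m \<in> M'"
 have "(\<Sum>m\<in>F. single (st m) (cnj (lookup u m))) on M'" if "finite F" "F \<subseteq> keys u" for F
  using that
 proof (induction F)
  case (insert x F)
  then have "(single (st x) (cnj (lookup u x)) + (\<Sum>m\<in>F. single (st m) (cnj (lookup u m)))) on M'"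
   using * by (intro keys_add_subset keys_single_subset) auto
  then show ?case using insert.hyps by simp
 qed simp
 then show ?thesis by (simp add: pst_def)
qed

lemma lin_pst: "lin f (pst st u) = cnj (lin (%m. cnj (f (st m))) u)"
 unfolding pst_def lin_sum lin_single by (simp add: lin_def)

lemma pst_add: "pst st (u + v) = pst st u + pst st v"
 by (rule poly_mapping_eqI)
  (metis (no_types) lin_pst lin_add complex_cnj_add lookup_add lookup_ext ext_single_id)

text \<open>Iterating \<open>conv\<close> gives \<open>P * b 0 ^ 2 ^ n <= P ^ 2 ^ n * b n\<close>;
  with the growth bound, all powers \<open>(b 0 / (P * R)) ^ 2 ^ n\<close> stay below
  \<open>C / P\<close>, so the base is at most 1. The cases \<open>P = 0\<close> and
  \<open>R = 0\<close> are separate because of the division.\<close>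

lemma power_growth_bound:
 fixes b :: "nat => real"
 assumes b: "!!n. 0 <= b n" and conv: "!!n. (b n)\<^sup>2 <= P * b (Suc n)"
  and growth: "!!n. b n <= C * R ^ (2 ^ n)" and P: "0 <= P" and R: "0 <= R"
 shows "b 0 <= P * R"
proof (cases "P = 0 \<or> R = 0")
 case True
 then have "P = 0 \<or> b 1 = 0" using growth[of 1] b[of 1] by auto
 then have "(b 0)\<^sup>2 <= 0" using conv[of 0] by auto
 then have "b 0 = 0" by simp
 with True show ?thesis by auto
next
 case False
 with P R have PR: "0 < P" "0 < R" "0 < P * R" by auto
 have pow: "P * (b 0) ^ (2 ^ n) <= P ^ (2 ^ n) * b n" for n
 proof (induction n)
  case (Suc n)
  have "P * (P * b 0 ^ 2 ^ Suc n) = (P * (b 0) ^ (2 ^ n))\<^sup>2"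
   by (simp add: power2_eq_square power_mult_distrib power_add[symmetric] mult_2)
  also have "... <= (P ^ (2 ^ n) * b n)\<^sup>2"
   using Suc.IH PR b by (intro power_mono) auto
  also have "... = P ^ (2 ^ Suc n) * (b n)\<^sup>2"
   by (simp add: power2_eq_square power_mult_distrib power_add[symmetric] mult_2)
  also have "... <= P ^ (2 ^ Suc n) * (P * b (Suc n))"
   using PR by (intro mult_left_mono conv) auto
  finally have "P * (P * b 0 ^ 2 ^ Suc n) <= P * (P ^ (2 ^ Suc n) * b (Suc n))"
   by (simp add: mult.left_commute)
  then show ?case using PR by (simp only: mult_le_cancel_left_pos)
 qed simp
 show ?thesis
 proof (rule ccontr)
  assume neg: "\<not> ?thesis"
  define x where "x = b 0 / (P * R)"
  have x: "1 < x" using neg PR by (simp add: x_def field_simps)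
  have le: "x ^ (2 ^ n) <= C / P" for n
  proof -
   have "P * (b 0) ^ (2 ^ n) <= P ^ (2 ^ n) * (C * R ^ (2 ^ n))"
    using order_trans[OF pow[of n] mult_left_mono[OF growth[of n], of "P ^ (2 ^ n)"]] PR by simp
   then show ?thesis using PR
    by (simp add: x_def power_divide power_mult_distrib field_simps)
  qed
  obtain n where "C / P < x ^ n" using real_arch_pow[OF x] by blast
  also have "... <= x ^ (2 ^ n)" using x by (intro power_increasing) (auto simp: less_imp_le)
  finally show False using le[of n] by simp
 qed
qed

text \<open>A representation of a semigroup with involution on a kernel space. Multiplicativity is
  demanded only inside \<open>K\<close>: actions defined through chosen representatives respect
  products only up to null vectors.\<close>

locale star_rep =
 fixes M :: "'m set" and mul :: "'m => 'm => 'm" and st :: "'m => 'm"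
  and S :: "'s set" and act :: "'m => 's => 's" and K :: "'s => 's => complex"
 assumes mul_closed: "m \<in> M ==> n \<in> M ==> mul m n \<in> M"
  and st_closed: "m \<in> M ==> st m \<in> M"
  and act_closed: "m \<in> M ==> s \<in> S ==> act m s \<in> S"
  and pd: "pd S K"
  and adj: "m \<in> M ==> s \<in> S ==> t \<in> S ==> K (act m s) t = K s (act (st m) t)"
  and act_mul: "m \<in> M ==> n \<in> M ==> r \<in> S ==> s \<in> S ==>
   K r (act (mul m n) s) = K r (act m (act n s))"
begin

lemma keys_act: "u on M ==> w on S ==> (av act u w) on S"
 by (rule keys_av) (auto intro: act_closed)

lemma keys_mul: "u on M ==> v on M ==> (av mul u v) on M"
 by (rule keys_av) (auto intro: mul_closed)

lemma keys_star: "u on M ==> (pst st u) on M"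
 by (rule keys_pst) (auto intro: st_closed)

lemma form_adj1:
 assumes "m \<in> M" "z on S" "w on S"
 shows "form K (av act (single m 1) z) w = form K z (av act (single (st m) 1) w)"
proof -
 have "form K (av act (single m 1) z) (ext (%t. single t 1) w) = form (%s t. K (act m s) t) z w"
  unfolding av_single_left form_ext by simp
 also have "... = form (%s t. K s (act (st m) t)) z w"
  using assms by (intro form_cong adj) auto
 also have "... = form K (ext (%s. single s 1) z) (av act (single (st m) 1) w)"
  unfolding av_single_left form_ext by simp
 finally show ?thesis by simp
qed

lemma form_adj:
 assumes "u on M" "z on S" "w on S"
 shows "form K (av act u z) w = form K z (av act (pst st u) w)"
proof -
 have "form K (av act u z) w = cnj (lin (%m. cnj (form K (av act (single m 1) z) w)) u)"
  by (subst av_eq_ext) (rule form_ext_left)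
 also have "... = cnj (lin (%m. cnj (form K z (av act (single (st m) 1) w))) u)"
  using assms by (intro arg_cong[of _ _ cnj] lin_cong) (simp add: form_adj1 subset_iff)
 also have "... = form K z (av act (pst st u) w)"
  unfolding form_av_right[of K z act "pst st u"] lin_pst ..
 finally show ?thesis .
qed

lemma form_mul:
 assumes "u on M" "v on M" "z on S" "w on S"
 shows "form K z (av act (av mul u v) w) = form K z (av act u (av act v w))"
proof -
 have "form K z (av act (av mul u v) w) =
   lin (%m. lin (%n. form K z (av act (single (mul m n) 1) w)) v) u"
  by (subst form_av_right) (simp add: lin_av)
 also have "... = lin (%m. lin (%n. form K z (av act (single m 1) (av act (single n 1) w))) v) u"
 proof (intro lin_cong)
  fix m n assume "m \<in> keys u" "n \<in> keys v"
  then have mn: "m \<in> M" "n \<in> M" using assms by auto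
  have "form K (ext (%s. single s 1) z) (av act (single (mul m n) 1) w) =
    form (%s t. K s (act (mul m n) t)) z w"
   unfolding av_single_left form_ext by simp
  also have "... = form (%s t. K s (act m (act n t))) z w"
   using mn assms by (intro form_cong act_mul) auto
  also have "... = form K (ext (%s. single s 1) z) (av act (single m 1) (av act (single n 1) w))"
   unfolding av_single_left ext_ext form_ext by simp
  finally show "form K z (av act (single (mul m n) 1) w) =
    form K z (av act (single m 1) (av act (single n 1) w))" by simp
 qed
 also have "... = lin (%m. form K z (av act (single m 1) (av act v w))) u"
  by (subst (2) av_eq_ext) (simp add: av_single_left ext_ext form_ext_right)
 also have "... = form K z (av act u (av act v w))" by (rule form_av_right[symmetric])
 finally show ?thesis .
qed

text \<open>Equal pairings with all vectors of the space mean that the difference is a null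
  vector.\<close>

lemma hn_eqI:
 assumes "x on S" "y on S" "!!z. z on S ==> form K z x = form K z y"
 shows "hn K x = hn K y"
proof -
 have "form K x x = form K x y" "form K y x = form K y y" using assms by auto
 moreover have "form K x y = cnj (form K y x)" by (rule pd_herm[OF pd assms(2,1)])
 ultimately show ?thesis by (simp add: hn_def)
qed

lemma hn_mul:
 assumes "u on M" "v on M" "w on S"
 shows "hn K (av act (av mul u v) w) = hn K (av act u (av act v w))"
 by (intro hn_eqI keys_act keys_mul form_mul assms)

lemma opbd_mult:
 assumes u: "u on M" and v: "v on M"
  and "opbd S act K u N" "opbd S act K v N'" "0 <= N"
 shows "opbd S act K (av mul u v) (N * N')"
 unfolding opbd_def
proof (intro allI impI)
 fix w assume w: "w on S"
 have "hn K (av act (av mul u v) w) = hn K (av act u (av act v w))" by (rule hn_mul[OF u v w])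
 also have "... <= N * hn K (av act v w)"
  using assms(3) keys_act[OF v w] by (simp add: opbd_def)
 also have "... <= N * (N' * hn K w)"
  using assms(4,5) w by (intro mult_left_mono) (auto simp: opbd_def)
 finally show "hn K (av act (av mul u v) w) <= N * N' * hn K w" by (simp add: mult.assoc)
qed

text \<open>For \<open>z = u* w\<close> one has \<open>||z||^2 = <u z, w> <= N ||z|| ||w||\<close>,
  and one factor \<open>||z||\<close> cancels.\<close>

lemma opbd_star:
 assumes u: "u on M" and bd: "opbd S act K u N" and N: "0 <= N"
 shows "opbd S act K (pst st u) N"
 unfolding opbd_def
proof (intro allI impI)
 fix w assume w: "w on S"
 let ?z = "av act (pst st u) w"
 have z: "?z on S" by (intro keys_act keys_star u w)
 have "(hn K ?z)\<^sup>2 = Re (form K (av act u ?z) w)"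
  by (simp add: hn_sq[OF pd z] form_adj[OF u z w])
 also have "... <= hn K (av act u ?z) * hn K w"
  using complex_Re_le_cmod pd_cs[OF pd keys_act[OF u z] w] by (rule order_trans)
 also have "... <= (N * hn K ?z) * hn K w"
  using bd z hn_nonneg[OF pd w] by (intro mult_right_mono) (auto simp: opbd_def)
 finally have "hn K ?z * hn K ?z <= hn K ?z * (N * hn K w)"
  by (simp add: power2_eq_square algebra_simps)
 then show "hn K ?z <= N * hn K w"
  using hn_nonneg[OF pd z] hn_nonneg[OF pd w] N
  by (cases "hn K ?z = 0") (auto simp: mult_le_cancel_left)
qed

lemma opbd_add:
 assumes "u on M" "v on M" "opbd S act K u N" "opbd S act K v N'"
 shows "opbd S act K (u + v) (N + N')"
 unfolding opbd_def
proof (intro allI impI)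
 fix w assume w: "w on S"
 have "hn K (av act (u + v) w) <= hn K (av act u w) + hn K (av act v w)"
  unfolding av_add_left by (intro hn_triangle[OF pd] keys_act assms w)
 then show "hn K (av act (u + v) w) <= (N + N') * hn K w"
  using assms(3,4) w unfolding opbd_def by (force simp: distrib_right)
qed

lemma opbd_psc: "opbd S act K u N ==> opbd S act K (psc c u) (cmod c * N)"
 by (auto simp: opbd_def av_psc_left hn_psc mult.assoc intro!: mult_left_mono)

text \<open>The elements \<open>(u* u)^(2^n)\<close>, beginning with \<open>u* u\<close> itself, so
  that all of them are symmetric with respect to the form.\<close>

fun sq_power :: "('m \<Rightarrow>\<^sub>0 complex) => nat => ('m \<Rightarrow>\<^sub>0 complex)" where
 "sq_power u 0 = av mul (pst st u) u"
| "sq_power u (Suc n) = av mul (sq_power u n) (sq_power u n)"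

lemma keys_sq_power: "u on M ==> (sq_power u n) on M"
 by (induction n) (simp_all add: keys_mul keys_star)

lemma opbd_sq_power:
 "u on M ==> opbd S act K u N ==> 0 <= N ==> opbd S act K (sq_power u n) ((N\<^sup>2) ^ (2 ^ n))"
proof (induction n)
 case 0
 then show ?case using opbd_mult[OF keys_star, of u u N N] opbd_star[of u N]
  by (simp add: power2_eq_square)
next
 case (Suc n)
 then have "opbd S act K (sq_power u n) ((N\<^sup>2) ^ (2 ^ n))" by simp
 from opbd_mult[OF keys_sq_power keys_sq_power this this] Suc.prems show ?case
  by (simp add: power_add[symmetric] mult_2)
qed

lemma sq_power_0:
 assumes "u on M" "w on S" "z on S"
 shows "form K z (av act (sq_power u 0) w) = form K (av act u z) (av act u w)"
 using assms form_mul[OF keys_star, of u u z w] form_adj[of u z "av act u w"] keys_act[of u w] by simp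

text \<open>No equation between \<open>pst st (sq_power u n)\<close> and \<open>sq_power u n\<close>
  is available in the semigroup algebra. Symmetry is therefore proved for the form, where squares of
  symmetric operators are symmetric.\<close>

lemma sq_power_self_adjoint:
 assumes "u on M" "w on S" "z on S"
 shows "form K (av act (sq_power u n) z) w = form K z (av act (sq_power u n) w)"
 using assms(2,3)
proof (induction n arbitrary: w z)
 case 0
 have k: "(av act (sq_power u 0) z) on S" by (intro keys_act keys_sq_power 0 assms)
 have "form K (av act (sq_power u 0) z) w = cnj (form K w (av act (sq_power u 0) z))"
  using pd_herm[OF pd _ k] 0 by simp
 also have "... = cnj (form K (av act u w) (av act u z))" using sq_power_0 assms 0 by metis
 also have "... = form K (av act u z) (av act u w)"
  using pd_herm[OF pd keys_act keys_act] assms 0 by metis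
 finally show ?case using sq_power_0 assms 0 by metis
next
 case (Suc n)
 let ?y = "sq_power u n"
 have y: "?y on M" by (rule keys_sq_power[OF assms(1)])
 have k: "(av act (av mul ?y ?y) z) on S" "(av act ?y z) on S" "(av act ?y w) on S"
   "(av act ?y (av act ?y z)) on S"
  by (intro keys_act keys_mul y Suc.prems)+
 have "form K (av act (av mul ?y ?y) z) w = cnj (form K w (av act (av mul ?y ?y) z))"
  by (rule pd_herm[OF pd Suc.prems(1) k(1)])
 also have "... = cnj (form K w (av act ?y (av act ?y z)))" using form_mul[OF y y] Suc by simp
 also have "... = form K (av act ?y (av act ?y z)) w"
  by (rule pd_herm[OF pd Suc.prems(1) k(4), symmetric])
 also have "... = form K (av act ?y z) (av act ?y w)" using Suc k by simp
 also have "... = form K z (av act ?y (av act ?y w))" using Suc k by simp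
 also have "... = form K z (av act (av mul ?y ?y) w)" using form_mul[OF y y] Suc by simp
 finally show ?case by simp
qed

lemma sq_power_Suc:
 assumes "u on M" "w on S"
 shows "form K w (av act (sq_power u (Suc n)) w) =
  form K (av act (sq_power u n) w) (av act (sq_power u n) w)"
proof -
 have y: "(sq_power u n) on M" by (rule keys_sq_power[OF assms(1)])
 have k: "(av act (sq_power u n) w) on S" by (rule keys_act[OF y assms(2)])
 show ?thesis
  using form_mul[OF y y assms(2) assms(2)] sq_power_self_adjoint[OF assms(1) k assms(2)] by simp
qed

text \<open>Squaring repeatedly in the Cauchy--Schwarz inequality removes the constant \<open>C\<close>.\<close>

lemma power_bound:
 assumes u: "u on M" and w: "w on S" and R: "0 <= R"
  and growth: "!!n. cmod (form K w (av act (sq_power u n) w)) <= C * R ^ (2 ^ n)"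
 shows "(hn K (av act u w))\<^sup>2 <= (hn K w)\<^sup>2 * R"
proof -
 define b where "b n = cmod (form K w (av act (sq_power u n) w))" for n
 have "b 0 <= (hn K w)\<^sup>2 * R"
 proof (rule power_growth_bound)
  fix n
  have y: "(av act (sq_power u n) w) on S" by (intro keys_act keys_sq_power u w)
  have "(b n)\<^sup>2 <= (hn K w)\<^sup>2 * (hn K (av act (sq_power u n) w))\<^sup>2"
   unfolding b_def power_mult_distrib[symmetric]
   by (intro power_mono pd_cs[OF pd w y]) simp
  also have "(hn K (av act (sq_power u n) w))\<^sup>2 <= b (Suc n)"
   unfolding b_def sq_power_Suc[OF u w] hn_sq[OF pd y] by (rule complex_Re_le_cmod)
  finally show "(b n)\<^sup>2 <= (hn K w)\<^sup>2 * b (Suc n)" by (simp add: mult_left_mono)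
 qed (use growth R in \<open>auto simp: b_def\<close>)
 moreover have "(hn K (av act u w))\<^sup>2 <= b 0"
  unfolding b_def sq_power_0[OF u w w] hn_sq[OF pd keys_act[OF u w]] by (rule complex_Re_le_cmod)
 ultimately show ?thesis by simp
qed

text \<open>Reduces an operator bound to exponential growth of diagonal coefficients at rate
  \<open>N^2\<close>, where the constant may depend on the vector. Through it crude estimates such
  as \<open>form_bound\<close> become sharp.\<close>

lemma opbdI_power_bound:
 assumes u: "u on M" and N: "0 <= N"
  and growth: "!!w. w on S ==>
   \<exists>C. \<forall>n. cmod (form K w (av act (sq_power u n) w)) <= C * (N\<^sup>2) ^ (2 ^ n)"
 shows "opbd S act K u N"
 unfolding opbd_def
proof (intro allI impI)
 fix w assume w: "w on S"
 from growth[OF w] obtain C where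
  C: "!!n. cmod (form K w (av act (sq_power u n) w)) <= C * (N\<^sup>2) ^ (2 ^ n)" by blast
 from power_bound[OF u w _ C] have "(hn K (av act u w))\<^sup>2 <= (N * hn K w)\<^sup>2"
  by (simp add: power_mult_distrib mult.commute)
 then show "hn K (av act u w) <= N * hn K w"
  by (rule power2_le_imp_le) (use N hn_nonneg[OF pd w] in simp)
qed

text \<open>The cyclic representation generated by \<open>w\<close>, pulled back to the semigroup:
  the symbol \<open>m\<close> stands for the vector \<open>m w\<close>.\<close>

definition gns_kernel :: "('s \<Rightarrow>\<^sub>0 complex) => 'm => 'm => complex" where
 "gns_kernel w m n = form K (av act (single m 1) w) (av act (single n 1) w)"

lemma form_gns_kernel: "form (gns_kernel w) u v = form K (av act u w) (av act v w)"
 unfolding gns_kernel_def av_eq_ext[of act u] av_eq_ext[of act v] form_ext ..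

lemma hn_gns_kernel: "hn (gns_kernel w) u = hn K (av act u w)"
 by (simp add: hn_def form_gns_kernel)

text \<open>All laws come from the action on \<open>w\<close>. The delicate one is associativity of
  left multiplication: \<open>form_mul\<close> regroups only the outermost factors in front of a
  vector, so to regroup below \<open>m\<close> one moves \<open>m\<close> to the other side of the
  form and back.\<close>

lemma star_rep_gns:
 assumes w: "w on S"
 shows "star_rep M mul st M mul (gns_kernel w)"
proof
 have k: "(av act (single m 1) w) on S" if "m \<in> M" for m
  by (intro keys_act w) (use that in simp)
 show "pd M (gns_kernel w)"
  unfolding gns_kernel_def by (intro pd_pullback[OF pd] k)
 have ml: "form K z (av act (single (mul m n) 1) w) =
   form K z (av act (single m 1) (av act (single n 1) w))" if "m \<in> M" "n \<in> M" "z on S" for m n z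
  using form_mul[of "single m 1" "single n 1" z w] that w by (simp add: av_single)
 fix m n r assume mnr: "m \<in> M" "n \<in> M" "r \<in> M"
 have "form K (av act (single (mul m n) 1) w) (av act (single r 1) w) =
   cnj (form K (av act (single r 1) w) (av act (single (mul m n) 1) w))"
  by (intro pd_herm[OF pd] k mul_closed mnr)
 also have "... = cnj (form K (av act (single r 1) w) (av act (single m 1) (av act (single n 1) w)))"
  using ml mnr k by simp
 also have "... = form K (av act (single m 1) (av act (single n 1) w)) (av act (single r 1) w)"
  by (intro pd_herm[OF pd, symmetric] k keys_act mnr) (use mnr in simp)
 also have "... = form K (av act (single n 1) w) (av act (single (st m) 1) (av act (single r 1) w))"
  using form_adj1 mnr k by simp
 also have "... = form K (av act (single n 1) w) (av act (single (mul (st m) r) 1) w)"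
  using ml mnr k st_closed by simp
 finally show "gns_kernel w (mul m n) r = gns_kernel w n (mul (st m) r)"
  by (simp add: gns_kernel_def)
next
 fix m n r s assume "m \<in> M" "n \<in> M" "r \<in> M" "s \<in> M"
 have k: "(av act (single m 1) w) on S" if "m \<in> M" for m
  by (intro keys_act w) (use that in simp)
 have ml: "form K z (av act (single (mul m n) 1) w) =
   form K z (av act (single m 1) (av act (single n 1) w))" if "m \<in> M" "n \<in> M" "z on S" for m n z
  using form_mul[of "single m 1" "single n 1" z w] that w by (simp add: av_single)
 have assoc: "form K z (av act (single (mul (mul m n) s) 1) w) =
   form K z (av act (single (mul m (mul n s)) 1) w)" if z: "z on S" for z
 proof -
  note mns = \<open>m \<in> M\<close> \<open>n \<in> M\<close> \<open>s \<in> M\<close>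
  have s1: "(single m 1) on M" "(single n 1) on M" using mns by auto
  let ?sw = "av act (single s 1) w"
  have "form K z (av act (single (mul (mul m n) s) 1) w) = form K z (av act (single (mul m n) 1) ?sw)"
   using ml mns z mul_closed by simp
  also have "... = form K z (av act (single m 1) (av act (single n 1) ?sw))"
   using form_mul[OF s1 z k[OF mns(3)]] by (simp add: av_single)
  also have "... = cnj (form K (av act (single m 1) (av act (single n 1) ?sw)) z)"
   by (intro pd_herm[OF pd] z keys_act k mns s1)
  also have "... = cnj (form K (av act (single n 1) ?sw) (av act (single (st m) 1) z))"
   using form_adj1 mns z k keys_act s1 by simp
  also have "... = form K (av act (single (st m) 1) z) (av act (single n 1) ?sw)"
   by (intro pd_herm[OF pd, symmetric] z keys_act k mns s1) (use st_closed mns in auto)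
  also have "... = form K (av act (single (st m) 1) z) (av act (single (mul n s) 1) w)"
   using ml mns z keys_act[of "single (st m) 1" z] st_closed by simp
  also have "... = cnj (form K (av act (single (mul n s) 1) w) (av act (single (st m) 1) z))"
   by (intro pd_herm[OF pd] z keys_act k mns s1 mul_closed w) (use st_closed mns mul_closed in auto)
  also have "... = cnj (form K (av act (single m 1) (av act (single (mul n s) 1) w)) z)"
   using form_adj1[OF mns(1) k[OF mul_closed[OF mns(2,3)]] z] by simp
  also have "... = form K z (av act (single m 1) (av act (single (mul n s) 1) w))"
   by (intro pd_herm[OF pd, symmetric] z keys_act k mns s1 mul_closed)
  also have "... = form K z (av act (single (mul m (mul n s)) 1) w)"
   using ml mns z mul_closed by simp
  finally show ?thesis .
 qed
 show "gns_kernel w r (mul (mul m n) s) = gns_kernel w r (mul m (mul n s))"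
  unfolding gns_kernel_def by (rule assoc[OF k[OF \<open>r \<in> M\<close>]])
qed (auto intro: mul_closed st_closed)

text \<open>The vector functionals of a representation determine operator norms, even though a vector
 need not lie in its own cyclic subspace.\<close>

lemma opbd_from_gns:
 assumes u: "u on M" and N: "0 < N"
  and bd: "!!w. w on S ==> opbd M mul (gns_kernel w) u N"
 shows "opbd S act K u N"
proof (rule opbdI_power_bound[OF u])
 fix w assume w: "w on S"
 interpret G: star_rep M mul st M mul "gns_kernel w" by (rule star_rep_gns[OF w])
 let ?y = "sq_power u" and ?R = "N\<^sup>2"
 define h where "h n = hn (gns_kernel w) (?y n)" for n
 have Geq: "G.sq_power u n = ?y n" for n by (induction n) simp_all
 have y: "(?y n) on M" for n by (rule keys_sq_power[OF u])
 have R: "0 < ?R" using N by simp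
 have ob: "opbd M mul (gns_kernel w) (?y n) (?R ^ (2 ^ n))" for n
  using G.opbd_sq_power[OF u bd[OF w]] N Geq by simp
 \<comment> \<open>The vectors \<open>?y n w\<close> lie in the cyclic subspace even if
   \<open>w\<close> does not, so the assumed bound applies to all steps after the initial one. The
   division by \<open>?R\<close> accounts for the exponents
   \<open>1 + 2 + ... + 2^(n-1) = 2^n - 1\<close>.\<close>
 have "h n <= h 0 / ?R * ?R ^ (2 ^ n)" for n
 proof (induction n)
  case (Suc n)
  have "h (Suc n) <= ?R ^ (2 ^ n) * h n" using ob[of n] y[of n] by (simp add: opbd_def h_def)
  also have "... <= ?R ^ (2 ^ n) * (h 0 / ?R * ?R ^ (2 ^ n))" by (intro mult_left_mono Suc) simp
  finally show ?case by (simp add: mult_2 power_add algebra_simps)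
 qed (use R in simp)
 then have "(h n)\<^sup>2 <= (h 0 / ?R * ?R ^ (2 ^ n))\<^sup>2" for n
  using hn_nonneg[OF G.pd y] by (intro power_mono) (simp_all add: h_def)
 moreover have "(h 0 / ?R * ?R ^ (2 ^ n))\<^sup>2 = (h 0 / ?R)\<^sup>2 * ?R ^ (2 ^ Suc n)" for n
  unfolding power_mult_distrib power_mult[symmetric] by (simp add: mult.commute)
 ultimately have h2: "(h n)\<^sup>2 <= (h 0 / ?R)\<^sup>2 * ?R ^ (2 ^ Suc n)" for n by metis
 \<comment> \<open>The second summand only covers \<open>n = 0\<close>, where the coefficient is not
   yet of the form \<open>(h k)^2\<close>.\<close>
 define C where "C = (h 0 / ?R)\<^sup>2 + cmod (form K w (av act (?y 0) w)) / ?R"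
 show "\<exists>C. \<forall>n. cmod (form K w (av act (?y n) w)) <= C * ?R ^ (2 ^ n)"
 proof (intro exI[of _ C] allI)
  fix n
  show "cmod (form K w (av act (?y n) w)) <= C * ?R ^ (2 ^ n)"
  proof (cases n)
   case 0
   then show ?thesis using R by (simp add: C_def distrib_right)
  next
   case (Suc k)
   have k: "(av act (?y k) w) on S" by (intro keys_act y w)
   have "cmod (form K w (av act (?y n) w)) = (h k)\<^sup>2"
    unfolding Suc sq_power_Suc[OF u w] h_def hn_gns_kernel hn_sq[OF pd k]
    by (subst pd_form_of_real[OF pd k]) (use pd_form_Re[OF pd k] in simp)
   also have "... <= (h 0 / ?R)\<^sup>2 * ?R ^ (2 ^ n)" using h2 Suc by simp
   also have "... <= C * ?R ^ (2 ^ n)" using R by (intro mult_right_mono) (simp_all add: C_def)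
   finally show ?thesis .
  qed
 qed
qed (use N in simp)

end

section \<open>Product representations and slicing\<close>

definition pact :: "('m => 's => 's') => ('m => 't => 't') => 'm => 's \<times> 't => 's' \<times> 't'" where
 "pact act1 act2 m = map_prod (act1 m) (act2 m)"

text \<open>The second factor is acted on through a homomorphism \<open>q\<close>, since the
  semigroup will consist of concatenated lists, one half of which acts on that factor. Positivity is
  \<open>schur_product\<close>.\<close>

lemma star_rep_product:
 assumes "star_rep M mul st S1 act1 K1" "star_rep M2 mul2 st2 S2 act2 K2"
  and q: "!!m. m \<in> M ==> q m \<in> M2" "!!m n. m \<in> M ==> n \<in> M ==> q (mul m n) = mul2 (q m) (q n)"
   "!!m. m \<in> M ==> q (st m) = st2 (q m)"
 shows "star_rep M mul st (S1 \<times> S2) (pact act1 (%m. act2 (q m))) (pkernel K1 K2)"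
proof -
 interpret R1: star_rep M mul st S1 act1 K1 by fact
 interpret R2: star_rep M2 mul2 st2 S2 act2 K2 by fact
 show ?thesis
 proof
  show "pd (S1 \<times> S2) (pkernel K1 K2)" by (rule schur_product[OF R1.pd R2.pd])
 next
  fix m x assume "m \<in> M" "x \<in> S1 \<times> S2"
  then show "pact act1 (%m. act2 (q m)) m x \<in> S1 \<times> S2"
   using R1.act_closed R2.act_closed q(1) by (cases x) (simp add: pact_def)
 qed (auto simp: pact_def pkernel_def q R1.adj R2.adj R1.act_mul R2.act_mul
   R1.mul_closed R1.st_closed)
qed

definition tens :: "'s => ('t \<Rightarrow>\<^sub>0 complex) => ('s \<times> 't \<Rightarrow>\<^sub>0 complex)" where
 "tens k z = ext (%t. single (k, t) 1) z"

lemma form_tens: "form (pkernel K1 K2) (tens k z) (tens l w) = K1 k l * form K2 z w"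
 unfolding tens_def form_ext by (simp add: form_fun_mult)

lemma hn_tens: "K1 k k = of_real c ==> hn (pkernel K1 K2) (tens k z) = sqrt c * hn K2 z"
 by (simp add: hn_def form_tens real_sqrt_mult)

text \<open>A representation that is contractive for the norm given by the family \<open>K' \<phi>\<close> may replace this
 family in a product: matrix coefficients of an operator on the product are controlled by slicing
 the second factor off, and power iteration turns this into a norm bound.\<close>

theorem opbd_product_replace:
 assumes R1: "star_rep M mul st S1 act1 K1"
  and R2: "star_rep M2 mul2 st2 S2 act2 K2"
  and RF: "!!\<phi>. \<phi> \<in> \<Phi> ==> star_rep M2 mul2 st2 S' act' (K' \<phi>)"
  and q: "!!m. m \<in> M ==> q m \<in> M2" "!!m n. m \<in> M ==> n \<in> M ==> q (mul m n) = mul2 (q m) (q n)"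
   "!!m. m \<in> M ==> q (st m) = st2 (q m)"
  and contr: "!!c B. c on M2 ==> 0 <= B ==> (!!\<phi>. \<phi> \<in> \<Phi> ==> opbd S' act' (K' \<phi>) c B) ==>
   opbd S2 act2 K2 c B"
  and u: "u on M" and N: "0 <= N"
  and bd: "!!\<phi>. \<phi> \<in> \<Phi> ==>
   opbd (S1 \<times> S') (pact act1 (%m. act' (q m))) (pkernel K1 (K' \<phi>)) u N"
 shows "opbd (S1 \<times> S2) (pact act1 (%m. act2 (q m))) (pkernel K1 K2) u N"
proof -
 interpret R1: star_rep M mul st S1 act1 K1 by fact
 interpret R2: star_rep M2 mul2 st2 S2 act2 K2 by fact
 let ?a = "pact act1 (%m. act2 (q m))" and ?a' = "pact act1 (%m. act' (q m))"
 have RP: "star_rep M mul st (S1 \<times> S2) ?a (pkernel K1 K2)"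
  by (rule star_rep_product[OF R1 R2 q])
 interpret P: star_rep M mul st "S1 \<times> S2" ?a "pkernel K1 K2" by (fact RP)
 define n1 where "n1 s = hn K1 (single s 1)" for s
 define n2 where "n2 s = hn K2 (single s 1)" for s
 have n1: "s \<in> S1 ==> 0 <= n1 s" and n2: "t \<in> S2 ==> 0 <= n2 t" for s t
  unfolding n1_def n2_def by (intro hn_nonneg[OF R1.pd] hn_nonneg[OF R2.pd]; simp)+
 have K11: "K1 k k = of_real ((n1 k)\<^sup>2)" if "k \<in> S1" for k
  using pd_form_of_real[OF R1.pd, of "single k 1"] hn_sq[OF R1.pd, of "single k 1"] that
  by (simp add: n1_def)
 \<comment> \<open>The slice map for the matrix coefficient of \<open>act1\<close> at
   \<open>k\<close> and \<open>l\<close>: it turns \<open>x\<close>, acting on the product, into an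
   element acting on the second factor alone. It does not involve the second representation, so the
   same element is compared under \<open>K2\<close> and under every
   \<open>K' \<phi>\<close>.\<close>
 define slice where "slice x k l = ext (%m. single (q m) (K1 k (act1 m l))) x" for x k l
 have slice_keys: "(slice x k l) on M2" if "x on M" for x k l
  unfolding slice_def using that q(1) by (intro keys_ext_subset) auto
 have slice_bd: "opbd S' act' (K' \<phi>) (slice x k l) (B * n1 k * n1 l)"
  if x: "x on M" and k: "k \<in> S1" and l: "l \<in> S1" and B: "0 <= B" and phi: "\<phi> \<in> \<Phi>"
   and bd: "opbd (S1 \<times> S') ?a' (pkernel K1 (K' \<phi>)) x B" for x k l B \<phi>
  unfolding opbd_def
 proof (intro allI impI)
  fix z assume z: "z on S'"
  interpret F: star_rep M2 mul2 st2 S' act' "K' \<phi>" using RF phi .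
  interpret PF: star_rep M mul st "S1 \<times> S'" ?a' "pkernel K1 (K' \<phi>)"
   by (rule star_rep_product[OF R1 F.star_rep_axioms q])
  \<comment> \<open>Pairing \<open>k tensor ?e\<close> with \<open>x (l tensor z)\<close> gives the
    squared norm of \<open>?e\<close>, so the bound for \<open>x\<close> yields the bound for the
    slice after cancelling one factor.\<close>
  let ?e = "av act' (slice x k l) z"
  have e: "?e on S'" by (intro F.keys_act slice_keys x z)
  have tk: "(tens k' y) on S1 \<times> S'" if "y on S'" "k' \<in> S1" for y k'
   unfolding tens_def using that by (intro keys_ext_subset) auto
  have nt: "hn (pkernel K1 (K' \<phi>)) (tens k' y) = n1 k' * hn (K' \<phi>) y"
   if "k' \<in> S1" for y k' using hn_tens[of K1 k' "(n1 k')\<^sup>2"] K11[OF that] n1[OF that] by simp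
  have "form (pkernel K1 (K' \<phi>)) (tens k ?e) (av ?a' x (tens l z)) =
    lin (%m. form (pkernel K1 (K' \<phi>)) (tens k ?e) (tens (act1 m l) (av act' (single (q m) 1) z))) x"
   by (subst form_av_right) (simp add: av_single_left tens_def ext_ext pact_def)
  also have "... = lin (%m. K1 k (act1 m l) * form (K' \<phi>) ?e (av act' (single (q m) 1) z)) x"
   by (simp add: form_tens)
  also have "... = form (K' \<phi>) ?e ?e"
   unfolding form_av_right[of "K' \<phi>" ?e act' "slice x k l"]
   by (simp add: slice_def lin_ext)
  finally have "(hn (K' \<phi>) ?e)\<^sup>2 = Re (form (pkernel K1 (K' \<phi>)) (tens k ?e) (av ?a' x (tens l z)))"
   by (simp add: hn_sq[OF F.pd e])
  also have "... <= hn (pkernel K1 (K' \<phi>)) (tens k ?e) * hn (pkernel K1 (K' \<phi>)) (av ?a' x (tens l z))"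
   by (rule order_trans[OF complex_Re_le_cmod])
    (intro pd_cs[OF PF.pd] PF.keys_act tk x e z k l)
  also have "... <= (n1 k * hn (K' \<phi>) ?e) * (B * (n1 l * hn (K' \<phi>) z))"
  proof (rule mult_mono)
   show "hn (pkernel K1 (K' \<phi>)) (av ?a' x (tens l z)) <= B * (n1 l * hn (K' \<phi>) z)"
    using bd[unfolded opbd_def, rule_format, OF tk[OF z l]] nt[OF l] by simp
   show "0 <= hn (pkernel K1 (K' \<phi>)) (av ?a' x (tens l z))"
    by (intro hn_nonneg[OF PF.pd] PF.keys_act x tk z l)
  qed (use nt[OF k] n1[OF k] hn_nonneg[OF F.pd e] in simp_all)
  finally have "hn (K' \<phi>) ?e * hn (K' \<phi>) ?e <= hn (K' \<phi>) ?e * (B * n1 k * n1 l * hn (K' \<phi>) z)"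
   by (simp add: power2_eq_square algebra_simps)
  moreover have "0 <= B * n1 k * n1 l * hn (K' \<phi>) z"
   using B n1[OF k] n1[OF l] hn_nonneg[OF F.pd z] by simp
  ultimately show "hn (K' \<phi>) ?e <= B * n1 k * n1 l * hn (K' \<phi>) z"
   using hn_nonneg[OF F.pd e] by (cases "hn (K' \<phi>) ?e = 0") (auto simp: mult_le_cancel_left)
 qed
 have entry: "cmod (form (pkernel K1 K2) (single k 1) (av ?a x (single l 1)))
   <= B * ((n1 (fst k) * n2 (snd k)) * (n1 (fst l) * n2 (snd l)))"
  if x: "x on M" and B: "0 <= B" and k: "k \<in> S1 \<times> S2" and l: "l \<in> S1 \<times> S2"
   and bd: "!!\<phi>. \<phi> \<in> \<Phi> ==> opbd (S1 \<times> S') ?a' (pkernel K1 (K' \<phi>)) x B" for x B k l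
 proof -
  obtain k1 k2 l1 l2 where kl: "k = (k1, k2)" "l = (l1, l2)" by fastforce
  have mem: "k1 \<in> S1" "k2 \<in> S2" "l1 \<in> S1" "l2 \<in> S2" using k l kl by auto
  let ?c = "slice x k1 l1"
  \<comment> \<open>The slice obeys one bound for all \<open>\<phi>\<close>, and
    \<open>contr\<close> transfers it to \<open>K2\<close>.\<close>
  have ob: "opbd S2 act2 K2 ?c (B * n1 k1 * n1 l1)"
   using B n1 mem slice_bd[OF x mem(1,3) B _ bd] by (intro contr slice_keys x) auto
  have "form (pkernel K1 K2) (single k 1) (av ?a x (single l 1)) =
    form K2 (single k2 1) (av act2 ?c (single l2 1))"
   by (simp add: form_def lin_av kl pact_def slice_def lin_ext)
  also have "cmod ... <= n2 k2 * hn K2 (av act2 ?c (single l2 1))"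
   unfolding n2_def by (intro pd_cs[OF R2.pd] R2.keys_act slice_keys x) (use mem in auto)
  also have "... <= n2 k2 * (B * n1 k1 * n1 l1 * n2 l2)"
   using ob mem n2 unfolding n2_def opbd_def by (intro mult_left_mono) auto
  finally show ?thesis by (simp add: kl algebra_simps)
 qed
 show ?thesis
 proof (rule P.opbdI_power_bound[OF u N])
  fix w assume w: "w on S1 \<times> S2"
  let ?C = "\<Sum>k\<in>keys w. cmod (lookup w k) * (n1 (fst k) * n2 (snd k))"
  have "cmod (form (pkernel K1 K2) w (av ?a (P.sq_power u n) w)) <= (?C * ?C) * (N\<^sup>2) ^ (2 ^ n)" for n
  proof -
   let ?y = "P.sq_power u n"
   have y: "?y on M" by (rule P.keys_sq_power[OF u])
   \<comment> \<open>The powers are formed in the common semigroup algebra, hence are the same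
     elements for all representations and inherit their bounds from \<open>bd\<close>.\<close>
   have ybd: "opbd (S1 \<times> S') ?a' (pkernel K1 (K' \<phi>)) ?y ((N\<^sup>2) ^ (2 ^ n))" if "\<phi> \<in> \<Phi>" for \<phi>
   proof -
    interpret PF: star_rep M mul st "S1 \<times> S'" ?a' "pkernel K1 (K' \<phi>)"
     by (rule star_rep_product[OF R1 RF[OF that] q])
    have "PF.sq_power u n = ?y" by (induction n) simp_all
    then show ?thesis using PF.opbd_sq_power[OF u bd[OF that] N] by metis
   qed
   have "form (pkernel K1 K2) (ext (%s. single s 1) w) (av ?a ?y w) =
     form (%k l. form (pkernel K1 K2) (single k 1) (av ?a ?y (single l 1))) w w"
    by (simp only: av_def ext_swap[of _ w] form_ext) (simp add: ext_swap)
   then have "form (pkernel K1 K2) w (av ?a ?y w) =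
     form (%k l. form (pkernel K1 K2) (single k 1) (av ?a ?y (single l 1))) w w" by simp
   also have "cmod ... <= (N\<^sup>2) ^ (2 ^ n) * (?C * ?C)"
    using w by (intro form_bound entry[OF y _ _ _ ybd]) auto
   finally show ?thesis by (simp add: mult.commute)
  qed
  then show "\<exists>C. \<forall>n. cmod (form (pkernel K1 K2) w (av ?a (P.sq_power u n) w)) <= C * (N\<^sup>2) ^ (2 ^ n)"
   by blast
 qed
qed

text \<open>The map \<open>\<theta>\<close> on basis symbols is isometric and intertwines the
  actions as far as the kernels can see. Only kernel values after the action are compared; the
  symbols themselves need not correspond under \<open>\<theta>\<close>.\<close>

lemma opbd_relabel:
 assumes bd: "opbd S' act' K' u N" and u: "u on M"
  and th: "!!s. s \<in> S ==> \<theta> s \<in> S'" "!!s t. s \<in> S ==> t \<in> S ==> K s t = K' (\<theta> s) (\<theta> t)"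
   "!!m n s t. m \<in> M ==> n \<in> M ==> s \<in> S ==> t \<in> S ==>
    K (act m s) (act n t) = K' (act' m (\<theta> s)) (act' n (\<theta> t))"
 shows "opbd S act K u N"
 unfolding opbd_def
proof (intro allI impI)
 fix w assume w: "w on S"
 let ?w = "ext (%s. single (\<theta> s) 1) w"
 have "form K' ?w ?w = form (%s t. K' (\<theta> s) (\<theta> t)) w w" by (simp add: form_ext)
 also have "... = form K w w" using w by (intro form_cong th(2)[symmetric]) auto
 finally have 1: "hn K' ?w = hn K w" by (simp add: hn_def)
 have "form K' (av act' u ?w) (av act' u ?w) =
   form (%m n. form (%s t. K' (act' m (\<theta> s)) (act' n (\<theta> t))) w w) u u"
  unfolding form_av_av by (simp add: form_ext)
 also have "... = form (%m n. form (%s t. K (act m s) (act n t)) w w) u u"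
  using w u by (intro form_cong) (auto simp: th(3) subset_iff)
 finally have 2: "hn K' (av act' u ?w) = hn K (av act u w)" by (simp add: hn_def form_av_av)
 have "?w on S'" using w th(1) by (intro keys_ext_subset) auto
 then show "hn K (av act u w) <= N * hn K w" using bd 1 2 by (metis opbd_def)
qed

text \<open>The difference of the two sides is \<open>c2 (c1 K1 - L1) K2 + L1 (c2 K2 - L2)\<close>,
  a sum of two products of positive kernels.\<close>

lemma schur_mono:
 assumes pd: "pd S K1" "pd T K2" "pd S L1"
  and le: "pd S (%s t. of_real c1 * K1 s t - L1 s t)" "pd T (%s t. of_real c2 * K2 s t - L2 s t)"
  and c: "0 <= c2" and w: "w on S \<times> T"
 shows "Re (form (pkernel L1 L2) w w) <= c1 * c2 * Re (form (pkernel K1 K2) w w)"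
proof -
 let ?D1 = "%s t. of_real c1 * K1 s t - L1 s t" and ?D2 = "%s t. of_real c2 * K2 s t - L2 s t"
 have "0 <= c2 * Re (form (pkernel ?D1 K2) w w) + Re (form (pkernel L1 ?D2) w w)"
  by (intro add_nonneg_nonneg mult_nonneg_nonneg c pd_form_Re[OF schur_product[of S _ T]] le pd w)
 also have "... = Re (of_real c2 * form (pkernel ?D1 K2) w w + form (pkernel L1 ?D2) w w)"
  by simp
 also have "of_real c2 * form (pkernel ?D1 K2) w w + form (pkernel L1 ?D2) w w =
   of_real (c1 * c2) * form (pkernel K1 K2) w w - form (pkernel L1 L2) w w"
  unfolding form_fun_mult[symmetric] form_fun_add[symmetric] form_fun_diff[symmetric]
  by (simp add: pkernel_def algebra_simps)
 finally show ?thesis by simp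
qed

text \<open>An operator bound for \<open>u\<close> says that \<open>N^2 - u* u\<close> is positive;
  in this form it can be multiplied with a bound on another factor by
  \<open>schur_mono\<close>.\<close>

lemma opbd_iff_pd:
 assumes rep: "star_rep M mul st S act K" and u: "u on M" and bd: "opbd S act K u N" and N: "0 <= N"
 shows "pd S (%s t. of_real (N\<^sup>2) * K s t - form K (av act u (single s 1)) (av act u (single t 1)))"
 unfolding pd_def
proof (intro allI impI)
 interpret star_rep M mul st S act K by fact
 fix w assume w: "w on S"
 have av: "ext (%s. av act u (single s 1)) w = av act u w"
  by (simp add: av_def ext_swap[of _ w])
 have k: "(av act u w) on S" by (intro keys_act u w)
 have "form (%s t. of_real (N\<^sup>2) * K s t - form K (av act u (single s 1)) (av act u (single t 1))) w w
   = of_real (N\<^sup>2) * form K w w - form K (av act u w) (av act u w)"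
  by (simp only: form_fun_diff form_fun_mult form_ext[symmetric] av)
 also have "... = of_real (N\<^sup>2 * (hn K w)\<^sup>2 - (hn K (av act u w))\<^sup>2)"
  using hn_sq[OF pd k] hn_sq[OF pd w] pd_form_of_real[OF pd k] pd_form_of_real[OF pd w] by simp
 also have "... \<in> \<real>\<^sub>\<ge>\<^sub>0"
 proof -
  have "(hn K (av act u w))\<^sup>2 <= (N * hn K w)\<^sup>2"
   using bd w hn_nonneg[OF pd k] by (intro power_mono) (auto simp: opbd_def)
  then have "0 <= N\<^sup>2 * (hn K w)\<^sup>2 - (hn K (av act u w))\<^sup>2" by (simp add: power_mult_distrib)
  then show ?thesis by (simp only: nonneg_Reals_of_real_iff)
 qed
 finally show "form (%s t. of_real (N\<^sup>2) * K s t - form K (av act u (single s 1)) (av act u (single t 1))) w w \<in> \<real>\<^sub>\<ge>\<^sub>0" .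
qed

section \<open>C*-seminormed algebras\<close>

text \<open>The axioms of \<open>cstar_algebra\<close> apart from definiteness of the norm and
  completeness. Formal tensors satisfy them, and inductive limits are formed from such
  algebras.\<close>

locale pre_cstar =
 fixes A :: "'a star_alg"
 assumes add_closed: "x el A ==> y el A ==> add_of A x y el A"
  and zero_closed: "zero_of A el A"
  and scale_closed: "x el A ==> scale_of A c x el A"
  and mult_closed: "x el A ==> y el A ==> mult_of A x y el A"
  and star_closed: "x el A ==> star_of A x el A"
  and add_assoc: "x el A ==> y el A ==> z el A ==>
   add_of A (add_of A x y) z = add_of A x (add_of A y z)"
  and add_comm: "x el A ==> y el A ==> add_of A x y = add_of A y x"
  and add_zero: "x el A ==> add_of A x (zero_of A) = x"
  and minus_self: "x el A ==> minus_of A x x = zero_of A"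
  and scale_one: "x el A ==> scale_of A 1 x = x"
  and scale_scale: "x el A ==> scale_of A c (scale_of A d x) = scale_of A (c * d) x"
  and scale_add: "x el A ==> y el A ==>
   scale_of A c (add_of A x y) = add_of A (scale_of A c x) (scale_of A c y)"
  and add_scale: "x el A ==>
   scale_of A (c + d) x = add_of A (scale_of A c x) (scale_of A d x)"
  and mult_assoc: "x el A ==> y el A ==> z el A ==>
   mult_of A (mult_of A x y) z = mult_of A x (mult_of A y z)"
  and mult_add: "x el A ==> y el A ==> z el A ==>
   mult_of A x (add_of A y z) = add_of A (mult_of A x y) (mult_of A x z)"
  and add_mult: "x el A ==> y el A ==> z el A ==>
   mult_of A (add_of A x y) z = add_of A (mult_of A x z) (mult_of A y z)"
  and scale_mult: "x el A ==> y el A ==>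
   mult_of A (scale_of A c x) y = scale_of A c (mult_of A x y)"
  and mult_scale: "x el A ==> y el A ==>
   mult_of A x (scale_of A c y) = scale_of A c (mult_of A x y)"
  and star_star: "x el A ==> star_of A (star_of A x) = x"
  and star_add: "x el A ==> y el A ==>
   star_of A (add_of A x y) = add_of A (star_of A x) (star_of A y)"
  and star_scale: "x el A ==> star_of A (scale_of A c x) = scale_of A (cnj c) (star_of A x)"
  and star_mult: "x el A ==> y el A ==>
   star_of A (mult_of A x y) = mult_of A (star_of A y) (star_of A x)"
  and norm_nonneg: "x el A ==> 0 <= norm_of A x"
  and norm_add: "x el A ==> y el A ==>
   norm_of A (add_of A x y) <= norm_of A x + norm_of A y"
  and norm_scale: "x el A ==> norm_of A (scale_of A c x) = cmod c * norm_of A x"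
  and norm_mult: "x el A ==> y el A ==>
   norm_of A (mult_of A x y) <= norm_of A x * norm_of A y"
  and cstar_identity: "x el A ==> norm_of A (mult_of A (star_of A x) x) = (norm_of A x)\<^sup>2"
begin

lemmas closed = add_closed zero_closed scale_closed mult_closed star_closed

abbreviation dst :: "'a => 'a => real" where
 "dst x y \<equiv> norm_of A (minus_of A x y)"

lemma add_left_comm: "x el A ==> y el A ==> z el A ==>
  add_of A x (add_of A y z) = add_of A y (add_of A x z)"
 by (metis add_assoc add_comm)

lemmas add_ac = add_assoc add_comm add_left_comm

lemma minus_closed: "x el A ==> y el A ==> minus_of A x y el A"
 by (simp add: minus_of_def closed)

lemma zero_add: "x el A ==> add_of A (zero_of A) x = x"
 by (metis add_comm add_zero zero_closed)

lemma scale_zero: "x el A ==> scale_of A 0 x = zero_of A"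
 using add_scale[of x 1 "-1"] minus_self[of x] by (simp add: minus_of_def scale_one)

lemma scale_zero_right: "scale_of A c (zero_of A) = zero_of A"
 by (metis mult_zero_right scale_scale scale_zero zero_closed)

lemma norm_zero: "norm_of A (zero_of A) = 0"
 using norm_scale[of "zero_of A" 0] by (simp add: zero_closed scale_zero_right)

lemma mult_zero: "x el A ==> mult_of A x (zero_of A) = zero_of A"
 by (metis mult_scale scale_zero mult_closed zero_closed)

lemma zero_mult: "x el A ==> mult_of A (zero_of A) x = zero_of A"
 by (metis scale_mult scale_zero mult_closed zero_closed)

lemma star_zero: "star_of A (zero_of A) = zero_of A"
 by (metis complex_cnj_zero scale_zero star_scale star_closed zero_closed)

lemma minus_zero: "x el A ==> minus_of A x (zero_of A) = x"
 by (simp add: minus_of_def scale_zero_right add_zero)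

lemma minus_add_cancel: "x el A ==> y el A ==> add_of A (minus_of A x y) y = x"
 using minus_self[of y] by (simp add: minus_of_def add_ac closed add_zero)

lemma minus_triangle:
 assumes "x el A" "y el A" "z el A"
 shows "add_of A (minus_of A x y) (minus_of A y z) = minus_of A x z"
proof -
 have "add_of A (minus_of A x y) (minus_of A y z) =
   add_of A (add_of A (minus_of A x y) y) (scale_of A (- 1) z)"
  using assms by (simp add: minus_of_def add_assoc closed)
 then show ?thesis using assms by (simp add: minus_add_cancel) (simp add: minus_of_def)
qed

lemma dst_triangle:
 assumes "x el A" "y el A" "z el A"
 shows "dst x z <= dst x y + dst y z"
 using norm_add[of "minus_of A x y" "minus_of A y z"] assms by (simp add: minus_triangle minus_closed)

lemma dst_nonneg: "x el A ==> y el A ==> 0 <= dst x y"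
 by (simp add: norm_nonneg minus_closed)

lemma minus_scale: "x el A ==> y el A ==>
  minus_of A (scale_of A c x) (scale_of A c y) = scale_of A c (minus_of A x y)"
 by (simp add: minus_of_def scale_add scale_scale closed)

lemma minus_swap: "x el A ==> y el A ==> minus_of A y x = scale_of A (- 1) (minus_of A x y)"
 by (simp add: minus_of_def scale_add scale_scale scale_one add_comm closed)

lemma dst_commute: "x el A ==> y el A ==> dst x y = dst y x"
 by (subst minus_swap) (simp_all add: norm_scale minus_closed)

lemma dst_self: "x el A ==> dst x x = 0"
 by (simp add: minus_self norm_zero)

lemma norm_le_dst: "x el A ==> y el A ==> norm_of A x <= dst x y + norm_of A y"
 using norm_add[of "minus_of A x y" y] by (simp add: minus_add_cancel minus_closed)

lemma norm_diff_le: "x el A ==> y el A ==> \<bar>norm_of A x - norm_of A y\<bar> <= dst x y"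
 using norm_le_dst[of x y] norm_le_dst[of y x] dst_commute[of x y] by simp

lemma minus_add:
 assumes "x el A" "y el A" "x' el A" "y' el A"
 shows "minus_of A (add_of A x x') (add_of A y y') = add_of A (minus_of A x y) (minus_of A x' y')"
 using assms by (simp add: minus_of_def scale_add add_ac closed)

lemma dst_add:
 assumes "x el A" "y el A" "x' el A" "y' el A"
 shows "dst (add_of A x x') (add_of A y y') <= dst x y + dst x' y'"
 using assms by (simp add: minus_add norm_add minus_closed)

lemma dst_scale: "x el A ==> y el A ==>
  dst (scale_of A c x) (scale_of A c y) = cmod c * dst x y"
 by (simp add: minus_scale norm_scale minus_closed)

lemma mult_minus: "x el A ==> y el A ==> z el A ==>
  mult_of A x (minus_of A y z) = minus_of A (mult_of A x y) (mult_of A x z)"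
 by (simp add: minus_of_def mult_add mult_scale closed)

lemma minus_mult: "x el A ==> y el A ==> z el A ==>
  mult_of A (minus_of A x y) z = minus_of A (mult_of A x z) (mult_of A y z)"
 by (simp add: minus_of_def add_mult scale_mult closed)

lemma dst_mult:
 assumes "x el A" "y el A" "x' el A" "y' el A"
 shows "dst (mult_of A x x') (mult_of A y y') <= norm_of A x * dst x' y' + dst x y * norm_of A y'"
proof -
 have "dst (mult_of A x x') (mult_of A y y') \<le>
   dst (mult_of A x x') (mult_of A x y') + dst (mult_of A x y') (mult_of A y y')"
  by (intro dst_triangle closed assms)
 also have "... <= norm_of A x * dst x' y' + dst x y * norm_of A y'"
  unfolding mult_minus[symmetric, OF assms(1,3,4)] minus_mult[symmetric, OF assms(1,2,4)]
  by (intro add_mono norm_mult minus_closed assms)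
 finally show ?thesis .
qed

text \<open>The C*-identity gives \<open>||y||^2 <= ||y*|| ||y||\<close>, which is used for
  \<open>x\<close> and for its adjoint.\<close>

lemma norm_star: assumes "x el A" shows "norm_of A (star_of A x) = norm_of A x"
proof -
 have le: "norm_of A y <= norm_of A (star_of A y)" if y: "y el A" for y
 proof (cases "norm_of A y = 0")
  case False
  then have "0 < norm_of A y" using norm_nonneg[OF y] by simp
  moreover have "norm_of A y * norm_of A y <= norm_of A (star_of A y) * norm_of A y"
   using norm_mult[of "star_of A y" y] cstar_identity[OF y] y by (simp add: star_closed power2_eq_square)
  ultimately show ?thesis by (simp only: mult_le_cancel_right_pos)
 qed (simp add: norm_nonneg star_closed y)
 show ?thesis using le[OF assms] le[of "star_of A x"] assms by (simp add: star_closed star_star)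
qed

lemma minus_star: "x el A ==> y el A ==>
  minus_of A (star_of A x) (star_of A y) = star_of A (minus_of A x y)"
 by (simp add: minus_of_def star_add star_scale closed)

lemma dst_star: "x el A ==> y el A ==> dst (star_of A x) (star_of A y) = dst x y"
 by (simp add: minus_star norm_star minus_closed)

end

sublocale cstar_algebra \<subseteq> pre_cstar
 by standard (rule add_closed zero_closed scale_closed mult_closed star_closed add_assoc add_comm
  add_zero minus_self scale_one scale_scale scale_add add_scale mult_assoc mult_add add_mult
  scale_mult mult_scale star_star star_add star_scale star_mult norm_nonneg norm_add norm_scale
  norm_mult cstar_identity; assumption)+

context cstar_algebra
begin

lemma dst_eq_0: "x el A ==> y el A ==> dst x y = 0 ==> x = y"
 by (metis minus_add_cancel minus_closed norm_eq_zero zero_add)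

lemma dst_lim_unique:
 assumes "(%n. dst (X n) x) \<longlonglongrightarrow> 0" "(%n. dst (X n) y) \<longlonglongrightarrow> 0"
  and "!!n. X n el A" "x el A" "y el A"
 shows "x = y"
proof -
 have "(%n. dst (X n) x + dst (X n) y) \<longlonglongrightarrow> 0 + 0" by (intro tendsto_add assms)
 moreover have "dst x y <= dst (X n) x + dst (X n) y" for n
  using dst_triangle[of x "X n" y] dst_commute[of x "X n"] assms by simp
 ultimately have "dst x y <= 0" by (intro LIMSEQ_le_const[of _ "0 :: real"]) auto
 then show ?thesis using dst_nonneg[of x y] dst_eq_0 assms by force
qed

text \<open>The element \<open>c\<close> is \<open>1 - sqrt (1 - b)\<close>, obtained as a fixed point of \<open>c \<mapsto> (b + c\<^sup>2) / 2\<close>; it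
 exists without an identity element.\<close>

lemma one_minus_sqrt:
 assumes b: "b el A" "star_of A b = b" and nb: "norm_of A b < 1"
 shows "\<exists>c\<in>carrier A. star_of A c = c \<and> scale_of A 2 c = add_of A b (mult_of A c c)"
proof -
 \<comment> \<open>On the ball of radius \<open>\<beta> = norm_of A b < 1\<close>, \<open>F\<close>
   is a self-map with Lipschitz constant \<open>\<beta>\<close>. The iterates from zero are
   self-adjoint, and so is the fixed point.\<close>
 define F where "F c = scale_of A (1/2) (add_of A b (mult_of A c c))" for c
 define C where "C n = (F ^^ n) (zero_of A)" for n
 define \<beta> where "\<beta> = norm_of A b"
 have beta: "0 <= \<beta>" "\<beta> < 1" using norm_nonneg[OF b(1)] nb by (auto simp: \<beta>_def)
 have C_Suc: "C (Suc n) = F (C n)" for n by (simp add: C_def)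
 have Fc: "F c el A" if "c el A" for c using that b by (simp add: F_def closed)
 have Fd: "dst (F c) (F d) <= (norm_of A c + norm_of A d) / 2 * dst c d"
  if "c el A" "d el A" for c d
 proof -
  have "dst (F c) (F d) = dst (add_of A b (mult_of A c c)) (add_of A b (mult_of A d d)) / 2"
   unfolding F_def using that b by (subst dst_scale) (simp_all add: closed)
  also have "... <= (dst b b + dst (mult_of A c c) (mult_of A d d)) / 2"
   using that b by (intro divide_right_mono dst_add closed) auto
  also have "... <= (0 + (norm_of A c * dst c d + dst c d * norm_of A d)) / 2"
   using that b dst_self[OF b(1)] by (intro divide_right_mono add_mono dst_mult) auto
  finally show ?thesis by (simp add: algebra_simps)
 qed
 have C: "C n el A \<and> norm_of A (C n) <= \<beta> \<and> star_of A (C n) = C n" for n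
 proof (induction n)
  case 0
  then show ?case using beta by (simp add: C_def zero_closed norm_zero star_zero)
 next
  case (Suc n)
  let ?c = "C n"
  have "norm_of A (F ?c) = norm_of A (add_of A b (mult_of A ?c ?c)) / 2"
   unfolding F_def using Suc b by (subst norm_scale) (simp_all add: closed)
  also have "... <= (norm_of A b + norm_of A ?c * norm_of A ?c) / 2"
   using norm_add[of b "mult_of A ?c ?c"] norm_mult[of ?c ?c] Suc b by (simp add: closed)
  also have "... <= (\<beta> + \<beta> * 1) / 2"
   using Suc beta norm_nonneg[of ?c] unfolding \<beta>_def[symmetric]
   by (intro divide_right_mono add_mono mult_mono) auto
  finally have "norm_of A (F ?c) <= \<beta>" by simp
  moreover have "star_of A (F ?c) = F ?c"
   using Suc b by (simp add: F_def closed star_scale star_add star_mult)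
  ultimately show ?case using Suc Fc by (simp add: C_Suc)
 qed
 have contr: "dst (C (n + k)) (C n) <= \<beta> ^ n" for n k
 proof (induction n)
  case 0
  have "dst (C k) (C 0) = norm_of A (C k)" using C by (simp add: C_def minus_zero)
  then show ?case using C[of k] beta by simp
 next
  case (Suc n)
  have "dst (C (Suc n + k)) (C (Suc n)) \<le>
    (norm_of A (C (n + k)) + norm_of A (C n)) / 2 * dst (C (n + k)) (C n)"
   using Fd[of "C (n + k)" "C n"] C by (simp add: C_Suc)
  also have "... <= \<beta> * \<beta> ^ n"
   using C[of "n + k"] C[of n] Suc beta dst_nonneg[of "C (n + k)" "C n"]
   by (intro mult_mono) auto
  finally show ?case by simp
 qed
 have "\<forall>e>0. \<exists>N. \<forall>m\<ge>N. \<forall>n\<ge>N. dst (C m) (C n) < e"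
 proof (intro allI impI)
  fix e :: real assume e: "0 < e"
  obtain N where N: "\<beta> ^ N < e / 2"
   using real_arch_pow_inv[of "e / 2" \<beta>] e beta by auto
  have "dst (C m) (C n) < e" if "m \<ge> N" "n \<ge> N" for m n
  proof -
   have "dst (C m) (C n) <= dst (C m) (C N) + dst (C N) (C n)" using C by (intro dst_triangle) auto
   also have "dst (C N) (C n) = dst (C n) (C N)" using C by (intro dst_commute) auto
   finally show ?thesis
    using contr[of N "m - N"] contr[of N "n - N"] that N by simp
  qed
  then show "\<exists>N. \<forall>m\<ge>N. \<forall>n\<ge>N. dst (C m) (C n) < e" by blast
 qed
 from complete[OF _ this] C obtain c where c: "c el A" and lim: "(%n. dst (C n) c) \<longlonglongrightarrow> 0"
  by blast
 have "dst (C n) (star_of A c) = dst (C n) c" for n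
  using dst_star[of "C n" c] C[of n] c by simp
 then have "star_of A c = c" using lim C c
  by (intro dst_lim_unique[of C]) (auto simp: closed)
 moreover have "c = F c"
 proof (rule dst_lim_unique)
  show "(%n. dst (C (Suc n)) c) \<longlonglongrightarrow> 0" using lim by (rule LIMSEQ_Suc)
  show "(%n. dst (C (Suc n)) (F c)) \<longlonglongrightarrow> 0"
  proof (rule Lim_null_comparison)
   show "(%n. (\<beta> + norm_of A c) / 2 * dst (C n) c) \<longlonglongrightarrow> 0"
    using tendsto_mult_left[OF lim, of "(\<beta> + norm_of A c) / 2"] by simp
   have "dst (C (Suc n)) (F c) <= (\<beta> + norm_of A c) / 2 * dst (C n) c" for n
   proof -
    have "dst (C (Suc n)) (F c) <= (norm_of A (C n) + norm_of A c) / 2 * dst (C n) c"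
     using Fd[of "C n" c] C c by (simp add: C_Suc)
    also have "... <= (\<beta> + norm_of A c) / 2 * dst (C n) c"
     using C[of n] c dst_nonneg[of "C n" c] by (intro mult_right_mono) auto
    finally show ?thesis .
   qed
   then show "\<forall>\<^sub>F n in sequentially. norm (dst (C (Suc n)) (F c)) <= (\<beta> + norm_of A c) / 2 * dst (C n) c"
    using C c Fc dst_nonneg by (intro always_eventually allI) simp
  qed
 qed (use C c Fc in auto)
 then have "scale_of A 2 c = scale_of A 2 (F c)" by simp
 then have "scale_of A 2 c = add_of A b (mult_of A c c)"
  unfolding F_def using b c by (simp add: scale_scale scale_one closed)
 ultimately show ?thesis using c by blast
qed

end

section \<open>Representations of C*-algebras on kernels\<close>

locale linear_rep = star_rep "carrier A" "mult_of A" "star_of A" S act K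
 for A :: "'a star_alg" and S :: "'s set" and act :: "'a => 's => 's" and K +
 assumes act_add: "a el A ==> b el A ==> s \<in> S ==> t \<in> S ==>
   K s (act (add_of A a b) t) = K s (act a t) + K s (act b t)"
  and act_scale: "a el A ==> s \<in> S ==> t \<in> S ==>
   K s (act (scale_of A c a) t) = c * K s (act a t)"
begin

definition vector_functional :: "('s \<Rightarrow>\<^sub>0 complex) => 'a => complex" where
 "vector_functional w a = form K w (av act (single a 1) w)"

lemma vector_functional_alt: "vector_functional w a = form (%s t. K s (act a t)) w w"
proof -
 have "form K (ext (%s. single s 1) w) (av act (single a 1) w) = form (%s t. K s (act a t)) w w"
  unfolding av_single_left form_ext by simp
 then show ?thesis by (simp add: vector_functional_def)
qed

context
 fixes w assumes w: "w on S"
begin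

lemma vector_functional_add: "a el A ==> b el A ==>
  vector_functional w (add_of A a b) = vector_functional w a + vector_functional w b"
 unfolding vector_functional_alt form_fun_add[symmetric] using w
 by (intro form_cong) (auto simp: act_add subset_iff)

lemma vector_functional_scale: "a el A ==>
  vector_functional w (scale_of A c a) = c * vector_functional w a"
 unfolding vector_functional_alt form_fun_mult[symmetric] using w
 by (intro form_cong) (auto simp: act_scale subset_iff)

lemma vector_functional_star_mult:
 assumes "a el A" "b el A"
 shows "vector_functional w (mult_of A (star_of A a) b) =
  form K (av act (single a 1) w) (av act (single b 1) w)"
proof -
 have k: "(av act (single b 1) w) on S" by (intro keys_act w) (use assms in simp)
 show ?thesis
  using form_mul[of "single (star_of A a) 1" "single b 1" w w] assms w k st_closed
   form_adj1[OF assms(1) w k]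
  by (simp add: vector_functional_def av_single)
qed

end

end

locale cstar_rep = cstar_algebra A + linear_rep A S act K
 for A :: "'a star_alg" and S :: "'s set" and act :: "'a => 's => 's" and K
begin

text \<open>For \<open>x\<close> of norm below 1 take \<open>c\<close> from
  \<open>one_minus_sqrt\<close> with \<open>b = x* x\<close>, the formal
  \<open>1 - sqrt (1 - b)\<close>. Then \<open>||w||^2 - <w, b w>\<close> equals
  \<open>||w - c w||^2\<close>, which is nonnegative.\<close>

lemma hn_act_le:
 assumes a: "a el A" and w: "w on S"
 shows "hn K (av act (single a 1) w) <= norm_of A a * hn K w"
proof -
 let ?vf = "vector_functional w"
 have unit: "Re (?vf (mult_of A (star_of A x) x)) <= Re (form K w w)"
  if x: "x el A" and nx: "norm_of A x < 1" for x
 proof -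
  let ?b = "mult_of A (star_of A x) x"
  have b: "?b el A" "star_of A ?b = ?b" using x by (simp_all add: closed star_mult star_star)
  have "norm_of A ?b < 1" using nx norm_nonneg[OF x] by (simp add: cstar_identity[OF x] power_less_one_iff)
  from one_minus_sqrt[OF b this] obtain c where c: "c el A" "star_of A c = c"
   and eq: "scale_of A 2 c = add_of A ?b (mult_of A c c)" by blast
  let ?cw = "av act (single c 1) w"
  have cw: "?cw on S" by (intro keys_act w) (use c in simp)
  have "2 * ?vf c = ?vf (add_of A ?b (mult_of A c c))"
   unfolding eq[symmetric] by (rule vector_functional_scale[OF w c(1), symmetric])
  also have "... = ?vf ?b + ?vf (mult_of A c c)"
   by (rule vector_functional_add[OF w b(1)]) (simp add: c closed)
  also have "?vf (mult_of A c c) = form K ?cw ?cw"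
   using vector_functional_star_mult[OF w c(1) c(1)] c by simp
  finally have 2: "2 * ?vf c = ?vf ?b + form K ?cw ?cw" .
  have "form K ?cw w = ?vf c"
   using form_adj1[OF c(1) w w] c by (simp add: vector_functional_def)
  then have "form K (w - ?cw) (w - ?cw) = form K w w - 2 * ?vf c + form K ?cw ?cw"
   by (simp add: form_diff_left form_diff_right vector_functional_def)
  also have "... = form K w w - ?vf ?b" using 2 by simp
  finally have "form K (w - ?cw) (w - ?cw) = form K w w - ?vf ?b" .
  then show ?thesis using pd_form_Re[OF pd keys_diff_subset[OF w cw]] by simp
 qed
 have k: "(av act (single a 1) w) on S" by (intro keys_act w) (use a in simp)
 \<comment> \<open>Scaling by \<open>1 / r\<close> brings the norm below 1 for every radius
   \<open>r\<close> above the norm of \<open>a\<close>; the radii are let down to that norm at the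
   end.\<close>
 have bound: "hn K (av act (single a 1) w) <= r * hn K w" if r: "norm_of A a < r" for r
 proof -
  have r0: "0 < r" using r norm_nonneg[OF a] by simp
  let ?x = "scale_of A (of_real (1 / r)) a"
  have x: "?x el A" using a by (simp add: closed)
  have "norm_of A ?x = norm_of A a / r" using r0 by (simp add: norm_scale a norm_divide)
  then have "norm_of A ?x < 1" using r r0 by simp
  from unit[OF x this]
  have "Re (?vf (mult_of A (star_of A ?x) ?x)) <= Re (form K w w)" .
  moreover have "mult_of A (star_of A ?x) ?x = scale_of A (of_real (1 / r\<^sup>2)) (mult_of A (star_of A a) a)"
   using a by (simp add: closed star_scale scale_mult mult_scale scale_scale power2_eq_square)
  ultimately have "(1 / r\<^sup>2) * (hn K (av act (single a 1) w))\<^sup>2 <= (hn K w)\<^sup>2"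
   using vector_functional_scale[OF w, of "mult_of A (star_of A a) a" "of_real (1 / r\<^sup>2)"]
    vector_functional_star_mult[OF w a a] a
   by (simp add: closed hn_sq[OF pd k] hn_sq[OF pd w])
  then have "(hn K (av act (single a 1) w))\<^sup>2 <= (r * hn K w)\<^sup>2"
   using r0 by (simp add: field_simps power_mult_distrib)
  then show ?thesis by (rule power2_le_imp_le) (use r0 hn_nonneg[OF pd w] in simp)
 qed
 show ?thesis
 proof (rule ccontr)
  assume "\<not> ?thesis"
  then have less: "norm_of A a * hn K w < hn K (av act (single a 1) w)" by simp
  show False
  proof (cases "hn K w = 0")
   case True
   then show False using bound[of "norm_of A a + 1"] less by simp
  next
   case False
   then have h: "0 < hn K w" using hn_nonneg[OF pd w] by simp
   then have "norm_of A a < hn K (av act (single a 1) w) / hn K w" using less by (simp add: field_simps)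
   then obtain r where "norm_of A a < r" "r < hn K (av act (single a 1) w) / hn K w" using dense by blast
   then show False using bound[of r] h by (simp add: field_simps)
  qed
 qed
qed

lemma opbd_single: "a el A ==> opbd S act K (single a 1) (norm_of A a)"
 by (simp add: opbd_def hn_act_le)

end

section \<open>Inductive limits\<close>

lemma cstar_complex_alg: "cstar_algebra complex_alg"
proof
 fix X :: "nat => complex"
 assume "\<forall>e>0. \<exists>N. \<forall>m\<ge>N. \<forall>n\<ge>N. norm_of complex_alg (minus_of complex_alg (X m) (X n)) < e"
 then have "Cauchy X" by (simp add: complex_alg_def minus_of_def Cauchy_def dist_norm)
 then obtain x where "X \<longlonglongrightarrow> x" using Cauchy_convergent convergent_def by blast
 then show "\<exists>x\<in>carrier complex_alg. (%n. norm_of complex_alg (minus_of complex_alg (X n) x)) \<longlonglongrightarrow> 0"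
  by (intro bexI[of _ x]) (simp_all add: complex_alg_def minus_of_def tendsto_norm_zero LIM_zero)
qed (auto simp: complex_alg_def minus_of_def algebra_simps norm_mult norm_triangle_ineq complex_norm_square
  power2_eq_square)

lemma complex_alg_simps [simp]:
 "carrier complex_alg = UNIV" "add_of complex_alg x y = x + y" "zero_of complex_alg = 0"
 "scale_of complex_alg x y = x * y" "mult_of complex_alg x y = x * y" "star_of complex_alg x = cnj x"
 "norm_of complex_alg x = cmod x" "minus_of complex_alg x y = x - y"
 by (simp_all add: complex_alg_def minus_of_def)

lemma lin_closed: "linear_map A B h ==> x el A ==> h x el B"
 and lin_map_add: "linear_map A B h ==> x el A ==> y el A ==>
  h (add_of A x y) = add_of B (h x) (h y)"
 and lin_scale: "linear_map A B h ==> x el A ==> h (scale_of A c x) = scale_of B c (h x)"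
 by (simp_all add: linear_map_def)

lemma linear_map_minus:
 "linear_map A B h ==> pre_cstar A ==> x el A ==> y el A ==>
  h (minus_of A x y) = minus_of B (h x) (h y)"
 by (simp add: minus_of_def lin_map_add lin_scale pre_cstar.scale_closed)

lemma linear_map_zero:
 "linear_map A B h ==> pre_cstar A ==> pre_cstar B ==> h (zero_of A) = zero_of B"
 using lin_scale[of A B h "zero_of A" 0] lin_closed[of A B h "zero_of A"]
 by (simp add: pre_cstar.scale_zero pre_cstar.zero_closed)

lemma hom_linear: "star_hom A B h ==> linear_map A B h"
 and star_hom_mult: "star_hom A B h ==> x el A ==> y el A ==>
  h (mult_of A x y) = mult_of B (h x) (h y)"
 and star_hom_star: "star_hom A B h ==> x el A ==> h (star_of A x) = star_of B (h x)"
 by (simp_all add: star_hom_def)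

text \<open>The last two conditions serve completeness of limits: strictly increasing sequences
  exist, and only finitely many of their terms lie below a given index. Both the naturals and the
  finite partitions satisfy them.\<close>

locale directed_index =
 fixes I :: "'i::order set"
 assumes ne: "I \<noteq> {}"
  and directed: "i \<in> I ==> j \<in> I ==> \<exists>k\<in>I. i <= k \<and> j <= k"
  and finite_below: "j \<in> I ==> finite {i \<in> I. i <= j}"
  and no_max: "i \<in> I ==> \<exists>j\<in>I. i < j"
begin

abbreviation "F \<equiv> net_at_top I"

lemma eventually_net: "eventually P F \<longleftrightarrow> (\<exists>i\<in>I. \<forall>j\<in>I. i <= j \<longrightarrow> P j)"
proof -
 have "eventually P F \<longleftrightarrow> (\<exists>i\<in>I. eventually P (principal {j \<in> I. i <= j}))"
  unfolding net_at_top_def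
 proof (rule eventually_INF_base[OF ne])
  fix a b assume "a \<in> I" "b \<in> I"
  then obtain k where "k \<in> I" "a <= k" "b <= k" using directed by blast
  then show "\<exists>x\<in>I. principal {j \<in> I. x <= j} <= inf (principal {j \<in> I. a <= j}) (principal {j \<in> I. b <= j})"
   by (intro bexI[of _ k]) auto
 qed
 then show ?thesis unfolding eventually_principal by auto
qed

lemma net_nonbot: "F \<noteq> bot"
 unfolding trivial_limit_def eventually_net by auto

lemma eventually_ge: "i \<in> I ==> eventually (%j. j \<in> I \<and> i <= j) F"
 unfolding eventually_net by auto

lemma eventually_in: "eventually (%j. j \<in> I) F"
 unfolding eventually_net using ne by auto

lemma eventually_obtain: "eventually P F ==> \<exists>i\<in>I. P i"
 unfolding eventually_net by auto

lemma eventually_all_ge: "eventually P F ==> eventually (%i. \<forall>j\<in>I. i <= j \<longrightarrow> P j) F"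
 unfolding eventually_net by (meson order_trans)

lemma increasing_sequence:
 assumes "!!n. eventually (P n) F"
 obtains s :: "nat => 'i" where "!!n. s n \<in> I" "!!n. s n < s (Suc n)" "!!n j. j \<in> I ==> s n <= j ==> P n j"
proof -
 have "\<exists>s. \<forall>n. (s n \<in> I \<and> (\<forall>j\<in>I. s n <= j \<longrightarrow> P n j)) \<and> s n < s (Suc n)"
 proof (rule dependent_nat_choice)
  show "\<exists>x. x \<in> I \<and> (\<forall>j\<in>I. x <= j \<longrightarrow> P 0 j)" using assms[of 0] eventually_net by blast
 next
  fix x n assume "x \<in> I \<and> (\<forall>j\<in>I. x <= j \<longrightarrow> P n j)"
  then obtain x' where x': "x' \<in> I" "x < x'" using no_max by blast
  obtain y where y: "y \<in> I" "\<forall>j\<in>I. y <= j \<longrightarrow> P (Suc n) j" using assms eventually_net by blast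
  obtain z where "z \<in> I" "x' <= z" "y <= z" using directed x' y by blast
  then show "\<exists>y. (y \<in> I \<and> (\<forall>j\<in>I. y <= j \<longrightarrow> P (Suc n) j)) \<and> x < y"
   using x' y by (intro exI[of _ z]) (auto intro: order_trans less_le_trans)
 qed
 then show thesis using that by blast
qed

text \<open>Completeness is stated for sequences. Along an increasing sequence of indices that meets
  the Cauchy condition with errors \<open>(1/2) ^ n\<close>, the values converge, and the whole net
  follows them.\<close>

lemma net_cauchy_limit:
 assumes B: "cstar_algebra B" and h: "!!i. i \<in> I ==> h i el B"
  and cauchy: "!!e. 0 < e ==> \<exists>i\<in>I. \<forall>j\<in>I. i <= j \<longrightarrow> norm_of B (minus_of B (h j) (h i)) < e"
 shows "\<exists>b\<in>carrier B. ((%i. norm_of B (minus_of B (h i) b)) \<longlongrightarrow> 0) F"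
proof -
 interpret B: cstar_algebra B by fact
 have ev: "eventually (%i. \<forall>j\<in>I. i <= j \<longrightarrow> B.dst (h j) (h i) < e) F" if e: "0 < e" for e
 proof -
  obtain i where i: "i \<in> I" "!!j. j \<in> I ==> i <= j ==> B.dst (h j) (h i) < e / 2"
   using cauchy[of "e / 2"] e by auto
  have "B.dst (h j) (h k) < e" if "k \<in> I" "i <= k" "j \<in> I" "k <= j" for j k
  proof -
   have "B.dst (h j) (h k) <= B.dst (h j) (h i) + B.dst (h i) (h k)"
    using that i by (intro B.dst_triangle h)
   also have "B.dst (h i) (h k) = B.dst (h k) (h i)" using that i by (intro B.dst_commute h)
   finally show ?thesis using i(2)[of j] i(2)[of k] that order_trans[of i k j] by auto
  qed
  then show ?thesis unfolding eventually_net using i(1) by blast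
 qed
 define P where "P n i \<longleftrightarrow> (\<forall>j\<in>I. i <= j \<longrightarrow> B.dst (h j) (h i) < (1/2) ^ n)" for n :: nat and i
 have evP: "eventually (P n) F" for n unfolding P_def by (rule ev) simp
 obtain s where s: "!!n. s n \<in> I" "!!n. s n < s (Suc n)"
  and sP': "!!n j. j \<in> I ==> s n <= j ==> P n j"
  by (rule increasing_sequence[of P, OF evP]) blast
 note sP = sP'[unfolded P_def]
 have mono: "s m <= s n" if "m <= n" for m n
  using lift_Suc_mono_le[of s, OF less_imp_le[OF s(2)] that] .
 have sd: "B.dst (h (s m)) (h (s n)) < 2 * (1/2) ^ k" if "k <= m" "k <= n" for m n k
 proof -
  have "B.dst (h (s m)) (h (s n)) <= B.dst (h (s m)) (h (s k)) + B.dst (h (s k)) (h (s n))"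
   by (intro B.dst_triangle h s)
  also have "B.dst (h (s k)) (h (s n)) = B.dst (h (s n)) (h (s k))" by (intro B.dst_commute h s)
  also have "B.dst (h (s m)) (h (s k)) < (1/2) ^ k" using sP[of "s k" k] s mono that by auto
  also have "B.dst (h (s n)) (h (s k)) < (1/2) ^ k" using sP[of "s k" k] s mono that by auto
  finally show ?thesis by simp
 qed
 have small: "\<exists>k. 2 * (1/2) ^ k < e" if "0 < e" for e :: real
  using real_arch_pow_inv[of "e / 2" "1/2"] that by (auto simp: field_simps)
 have "\<exists>b\<in>carrier B. (%n. B.dst (h (s n)) b) \<longlonglongrightarrow> 0"
 proof (rule B.complete)
  show "h (s n) el B" for n by (intro h s)
  show "\<forall>e>0. \<exists>N. \<forall>m\<ge>N. \<forall>n\<ge>N. B.dst (h (s m)) (h (s n)) < e"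
   using sd small by (meson less_trans)
 qed
 then obtain b where b: "b el B" "(%n. B.dst (h (s n)) b) \<longlonglongrightarrow> 0" by blast
 have "((%i. B.dst (h i) b) \<longlongrightarrow> 0) F"
  unfolding tendsto_iff
 proof (intro allI impI)
  fix e :: real assume e: "0 < e"
  obtain k where k: "2 * (1/2) ^ k < e / 2" using small[of "e / 2"] e by auto
  have "eventually (%n. B.dst (h (s n)) b < e / 2) sequentially"
   using order_tendstoD(2)[OF b(2), of "e / 2"] e by simp
  then obtain n where n: "n \<ge> k" "B.dst (h (s n)) b < e / 2"
   unfolding eventually_sequentially by (metis nat_le_linear order_refl)
  have "B.dst (h j) b < e" if j: "j \<in> I" "s n <= j" for j
  proof -
   have "B.dst (h j) b <= B.dst (h j) (h (s n)) + B.dst (h (s n)) b"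
    by (intro B.dst_triangle h s j b)
   also have "B.dst (h j) (h (s n)) < (1/2) ^ n" using sP[of "s n" n] s j by auto
   also have "(1/2) ^ n <= (1/2 :: real) ^ k" using n by (intro power_decreasing) auto
   finally show ?thesis using k n e by simp
  qed
  then show "\<forall>\<^sub>F i in F. dist (B.dst (h i) b) 0 < e"
   unfolding eventually_net using s[of n] B.dst_nonneg[OF h b(1)] by (intro bexI[of _ "s n"]) auto
 qed
 with b show ?thesis by blast
qed

end

section \<open>The algebra of coherent nets modulo null nets\<close>

locale ind_system = directed_index I for I :: "'i::order set" +
 fixes N :: "'i => 'b star_alg" and T :: "'i => 'i => 'b => 'b"
 assumes N: "i \<in> I ==> pre_cstar (N i)"
  and T_hom: "i \<in> I ==> j \<in> I ==> i <= j ==> star_hom (N i) (N j) (T i j)"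
  and T_norm: "i \<in> I ==> j \<in> I ==> i <= j ==> x el N i ==>
   norm_of (N j) (T i j x) <= norm_of (N i) x"
  and T_comp: "i \<in> I ==> j \<in> I ==> k \<in> I ==> i <= j ==> j <= k ==> x el N i ==>
   T j k (T i j x) = T i k x"
begin

abbreviation "cn \<equiv> coherent_nets I N T"
abbreviation "cls \<equiv> net_class I N T"
abbreviation "L \<equiv> ind_limit I N T"
abbreviation "emb \<equiv> limit_emb I N T"

definition nd :: "('i => 'b) => ('i => 'b) => 'i => real" where
 "nd f g i = norm_of (N i) (minus_of (N i) (f i) (g i))"

definition null :: "('i => 'b) => ('i => 'b) => bool" where
 "null f g \<longleftrightarrow> (nd f g \<longlongrightarrow> 0) F"

definition padd where "padd f g = (\<lambda>i\<in>I. add_of (N i) (f i) (g i))"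
definition pscale where "pscale c f = (\<lambda>i\<in>I. scale_of (N i) c (f i))"
definition pmult where "pmult f g = (\<lambda>i\<in>I. mult_of (N i) (f i) (g i))"
definition pstar where "pstar f = (\<lambda>i\<in>I. star_of (N i) (f i))"
definition pzero where "pzero = (\<lambda>i\<in>I. zero_of (N i))"
definition "pminus f g = padd f (pscale (- 1) g)"

lemmas N_closed = pre_cstar.closed[OF N]
lemmas T_closed = lin_closed[OF hom_linear[OF T_hom]]

lemma T_minus: "i \<in> I ==> j \<in> I ==> i <= j ==> x el N i ==> y el N i ==>
  T i j (minus_of (N i) x y) = minus_of (N j) (T i j x) (T i j y)"
 by (rule linear_map_minus[OF hom_linear[OF T_hom] N])

lemma T_dst: "i \<in> I ==> j \<in> I ==> i <= j ==> x el N i ==> y el N i ==>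
  norm_of (N j) (minus_of (N j) (T i j x) (T i j y)) <= norm_of (N i) (minus_of (N i) x y)"
 using T_norm[of i j "minus_of (N i) x y"] by (simp add: T_minus pre_cstar.minus_closed[OF N])

definition nets :: "('i => 'b) set" where "nets = (\<Pi>\<^sub>E i\<in>I. carrier (N i))"

lemma nets_mem: "f \<in> nets ==> i \<in> I ==> f i el N i"
 by (auto simp: nets_def)

lemma nets_ops: "f \<in> nets ==> g \<in> nets ==> padd f g \<in> nets" "f \<in> nets ==> pscale c f \<in> nets"
 "f \<in> nets ==> g \<in> nets ==> pmult f g \<in> nets" "f \<in> nets ==> pstar f \<in> nets" "pzero \<in> nets"
 "f \<in> nets ==> g \<in> nets ==> pminus f g \<in> nets"
 by (auto simp: nets_def padd_def pscale_def pmult_def pstar_def pzero_def pminus_def N_closed PiE_iff)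

text \<open>From \<open>i\<close> on, \<open>f\<close> stays within \<open>e\<close> of the images
  of its own value at \<open>i\<close>: a Cauchy condition for nets whose values lie in different
  algebras.\<close>

definition coh :: "('i => 'b) => real => 'i => bool" where
 "coh f e i \<longleftrightarrow> (\<forall>j\<in>I. i <= j \<longrightarrow> norm_of (N j) (minus_of (N j) (f j) (T i j (f i))) < e)"

lemma cn_iff: "f \<in> cn \<longleftrightarrow> f \<in> nets \<and> (\<forall>e>0. \<exists>i\<in>I. coh f e i)"
 by (simp add: coherent_nets_def nets_def coh_def)

lemma cn_nets: "f \<in> cn ==> f \<in> nets"
 by (simp add: cn_iff)

lemma cn_mem: "f \<in> cn ==> i \<in> I ==> f i el N i"
 by (simp add: cn_nets nets_mem)

text \<open>Contractivity of the connecting maps carries the estimate from one index to all larger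
  ones, at the price of a factor 2.\<close>

lemma coh_eventually:
 assumes f: "f \<in> cn" and e: "0 < e" shows "eventually (coh f e) F"
proof -
 obtain i where i: "i \<in> I" "coh f (e / 2) i" using f e by (meson cn_iff half_gt_zero)
 have "coh f e k" if k: "k \<in> I" "i <= k" for k
  unfolding coh_def
 proof (intro ballI impI)
  fix j assume j: "j \<in> I" "k <= j"
  interpret pre_cstar "N j" by (rule N[OF j(1)])
  have ij: "i <= j" using k j by simp
  note fc = cn_mem[OF f]
  have "dst (f j) (T k j (f k)) <= dst (f j) (T i j (f i)) + dst (T i j (f i)) (T k j (f k))"
   using i k j ij by (intro dst_triangle T_closed fc) auto
  also have "dst (f j) (T i j (f i)) < e / 2" using i(2) j ij by (simp add: coh_def)
  also have "dst (T i j (f i)) (T k j (f k)) = dst (T k j (f k)) (T k j (T i k (f i)))"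
   using i k j ij T_comp[OF i(1) k(1) j(1) k(2) j(2) fc[OF i(1)]]
   by (subst dst_commute) (auto intro!: T_closed fc)
  also have "... <= norm_of (N k) (minus_of (N k) (f k) (T i k (f i)))"
   using i k j by (intro T_dst T_closed fc) auto
  also have "... < e / 2" using i(2) k by (simp add: coh_def)
  finally show "dst (f j) (T k j (f k)) < e" by simp
 qed
 then show ?thesis unfolding eventually_net using i(1) by blast
qed

lemma cnI: "f \<in> nets ==> (!!e. 0 < e ==> eventually (coh f e) F) ==> f \<in> cn"
 unfolding cn_iff using eventually_obtain by blast

lemma cn_bounded:
 assumes f: "f \<in> cn"
 shows "\<exists>B>0. eventually (%j. norm_of (N j) (f j) <= B) F"
proof -
 obtain i where i: "i \<in> I" "coh f 1 i" using f cn_iff by (meson zero_less_one)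
 have "norm_of (N j) (f j) <= 1 + norm_of (N i) (f i)" if "j \<in> I" "i <= j" for j
 proof -
  interpret pre_cstar "N j" by (rule N[OF that(1)])
  have "norm_of (N j) (f j) <= dst (f j) (T i j (f i)) + norm_of (N j) (T i j (f i))"
   using that i by (intro norm_le_dst T_closed cn_mem[OF f])
  also have "... <= 1 + norm_of (N i) (f i)"
   using that i T_norm[OF i(1) that cn_mem[OF f i(1)]] by (simp add: coh_def less_imp_le add_mono)
  finally show ?thesis .
 qed
 moreover have "0 < 1 + norm_of (N i) (f i)"
  using pre_cstar.norm_nonneg[OF N[OF i(1)] cn_mem[OF f i(1)]] by simp
 ultimately show ?thesis unfolding eventually_net using i(1) by blast
qed

text \<open>Coherence survives uniform approximation from some index on; this is what puts the
  diagonal net of the completeness proof into \<open>cn\<close>.\<close>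

lemma cn_approx:
 assumes f: "f \<in> nets" and ap: "!!e. 0 < e ==> \<exists>g\<in>cn. eventually (%i. nd f g i < e) F"
 shows "f \<in> cn"
proof (rule cnI[OF f])
 fix e :: real assume e: "0 < e"
 obtain g where g: "g \<in> cn" "eventually (%i. nd f g i < e / 3) F" using ap[of "e / 3"] e by auto
 have "eventually (%i. i \<in> I \<and> coh g (e / 3) i \<and> (\<forall>j\<in>I. i <= j \<longrightarrow> nd f g j < e / 3)) F"
  using coh_eventually[OF g(1), of "e / 3"] eventually_all_ge[OF g(2)] eventually_in e
  by (auto intro!: eventually_conj)
 then show "eventually (coh f e) F"
 proof eventually_elim
  case (elim i)
  show ?case unfolding coh_def
  proof (intro ballI impI)
   fix j assume j: "j \<in> I" "i <= j"
   interpret pre_cstar "N j" by (rule N[OF j(1)])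
   have i: "i \<in> I" using elim by simp
   note c = nets_mem[OF f] cn_mem[OF g(1)]
   have "dst (f j) (T i j (f i)) <= dst (f j) (T i j (g i)) + dst (T i j (g i)) (T i j (f i))"
    using i j by (intro dst_triangle T_closed c)
   also have "dst (f j) (T i j (g i)) <= dst (f j) (g j) + dst (g j) (T i j (g i))"
    using i j by (intro dst_triangle T_closed c)
   also have "dst (f j) (g j) < e / 3" using elim j by (simp add: nd_def)
   also have "dst (g j) (T i j (g i)) < e / 3" using elim j by (simp add: coh_def)
   also have "dst (T i j (g i)) (T i j (f i)) <= norm_of (N i) (minus_of (N i) (g i) (f i))"
    using i j by (intro T_dst c)
   also have "... < e / 3"
    using elim pre_cstar.dst_commute[OF N[OF i], of "g i" "f i"] i c by (simp add: nd_def)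
   finally show "dst (f j) (T i j (f i)) < e" by simp
  qed
 qed
qed

lemma cn_padd: assumes f: "f \<in> cn" and g: "g \<in> cn" shows "padd f g \<in> cn"
proof (rule cnI)
 fix e :: real assume e: "0 < e"
 have "eventually (%i. i \<in> I \<and> coh f (e / 2) i \<and> coh g (e / 2) i) F"
  using coh_eventually[OF f, of "e / 2"] coh_eventually[OF g, of "e / 2"] e eventually_in
  by (auto intro!: eventually_conj)
 then show "eventually (coh (padd f g) e) F"
 proof eventually_elim
  case (elim i)
  show ?case unfolding coh_def
  proof (intro ballI impI)
   fix j assume j: "j \<in> I" "i <= j"
   interpret pre_cstar "N j" by (rule N[OF j(1)])
   have i: "i \<in> I" using elim by simp
   note c = cn_mem[OF f] cn_mem[OF g]
   have "T i j (padd f g i) = add_of (N j) (T i j (f i)) (T i j (g i))"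
    using i j lin_map_add[OF hom_linear[OF T_hom]] c by (simp add: padd_def)
   then have "dst (padd f g j) (T i j (padd f g i)) =
     dst (add_of (N j) (f j) (g j)) (add_of (N j) (T i j (f i)) (T i j (g i)))"
    using j by (simp add: padd_def)
   also have "... <= dst (f j) (T i j (f i)) + dst (g j) (T i j (g i))"
    using i j by (intro dst_add T_closed c)
   also have "... < e" using elim j by (fastforce simp: coh_def)
   finally show "dst (padd f g j) (T i j (padd f g i)) < e" .
  qed
 qed
qed (use f g in \<open>simp add: nets_ops cn_nets\<close>)

lemma cn_pscale: assumes f: "f \<in> cn" shows "pscale c f \<in> cn"
proof (rule cnI)
 fix e :: real assume e: "0 < e"
 have "0 < e / (cmod c + 1)" by (intro divide_pos_pos e add_nonneg_pos) simp_all
 then have "eventually (%i. i \<in> I \<and> coh f (e / (cmod c + 1)) i) F"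
  by (intro eventually_conj eventually_in coh_eventually[OF f])
 then show "eventually (coh (pscale c f) e) F"
 proof eventually_elim
  case (elim i)
  show ?case unfolding coh_def
  proof (intro ballI impI)
   fix j assume j: "j \<in> I" "i <= j"
   interpret pre_cstar "N j" by (rule N[OF j(1)])
   have i: "i \<in> I" using elim by simp
   have p: "0 < cmod c + 1" by (simp add: add_nonneg_pos)
   have "dst (pscale c f j) (T i j (pscale c f i)) = cmod c * dst (f j) (T i j (f i))"
    using i j lin_scale[OF hom_linear[OF T_hom]] cn_mem[OF f]
    by (simp add: pscale_def dst_scale T_closed)
   also have "... <= (cmod c + 1) * dst (f j) (T i j (f i))"
    using i j by (intro mult_right_mono dst_nonneg T_closed cn_mem[OF f]) auto
   also have "... < e" using elim j p by (auto simp: coh_def pos_less_divide_eq mult.commute)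
   finally show "dst (pscale c f j) (T i j (pscale c f i)) < e" .
  qed
 qed
qed (use f in \<open>simp add: nets_ops cn_nets\<close>)

lemma cn_pstar: assumes f: "f \<in> cn" shows "pstar f \<in> cn"
proof (rule cnI)
 fix e :: real assume e: "0 < e"
 have "eventually (%i. i \<in> I \<and> coh f e i) F"
  using coh_eventually[OF f e] eventually_in by (rule eventually_conj[rotated])
 then show "eventually (coh (pstar f) e) F"
 proof eventually_elim
  case (elim i)
  show ?case unfolding coh_def
  proof (intro ballI impI)
   fix j assume j: "j \<in> I" "i <= j"
   interpret pre_cstar "N j" by (rule N[OF j(1)])
   have i: "i \<in> I" using elim by simp
   have "dst (pstar f j) (T i j (pstar f i)) = dst (f j) (T i j (f i))"
    using i j star_hom_star[OF T_hom] cn_mem[OF f] by (simp add: pstar_def dst_star T_closed)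
   then show "dst (pstar f j) (T i j (pstar f i)) < e" using elim j by (simp add: coh_def)
  qed
 qed
qed (use f in \<open>simp add: nets_ops cn_nets\<close>)

lemma cn_pmult: assumes f: "f \<in> cn" and g: "g \<in> cn" shows "pmult f g \<in> cn"
proof (rule cnI)
 fix e :: real assume e: "0 < e"
 obtain B where B: "0 < B" "eventually (%j. norm_of (N j) (f j) <= B) F" using cn_bounded[OF f] by blast
 obtain C where C: "0 < C" "eventually (%j. norm_of (N j) (g j) <= C) F" using cn_bounded[OF g] by blast
 define d where "d = e / (B + C)"
 have d: "0 < d" "(B + C) * d = e" using e B C by (simp_all add: d_def)
 have "eventually (%i. i \<in> I \<and> coh f d i \<and> coh g d i \<and>
   (\<forall>j\<in>I. i <= j \<longrightarrow> norm_of (N j) (f j) <= B) \<and> norm_of (N i) (g i) <= C) F"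
  using coh_eventually[OF f d(1)] coh_eventually[OF g d(1)] eventually_all_ge[OF B(2)] C eventually_in
  by (auto intro!: eventually_conj)
 then show "eventually (coh (pmult f g) e) F"
 proof eventually_elim
  case (elim i)
  show ?case unfolding coh_def
  proof (intro ballI impI)
   fix j assume j: "j \<in> I" "i <= j"
   interpret pre_cstar "N j" by (rule N[OF j(1)])
   have i: "i \<in> I" using elim by simp
   note c = cn_mem[OF f] cn_mem[OF g]
   have "T i j (pmult f g i) = mult_of (N j) (T i j (f i)) (T i j (g i))"
    using i j star_hom_mult[OF T_hom] c by (simp add: pmult_def)
   then have "dst (pmult f g j) (T i j (pmult f g i)) =
     dst (mult_of (N j) (f j) (g j)) (mult_of (N j) (T i j (f i)) (T i j (g i)))"
    using j by (simp add: pmult_def)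
   also have "... <= norm_of (N j) (f j) * dst (g j) (T i j (g i)) +
     dst (f j) (T i j (f i)) * norm_of (N j) (T i j (g i))"
    using i j by (intro dst_mult T_closed c)
   also have "... <= B * dst (g j) (T i j (g i)) + dst (f j) (T i j (f i)) * C"
   proof (intro add_mono mult_mono order_refl)
    show "norm_of (N j) (T i j (g i)) <= C"
     using T_norm[OF i j c(2)[OF i]] elim by (meson order_trans)
   qed (use i j elim B C in \<open>auto intro!: norm_nonneg minus_closed T_closed c\<close>)
   also have "... < B * d + d * C"
    using elim j B C by (intro add_strict_mono mult_strict_left_mono mult_strict_right_mono)
     (auto simp: coh_def)
   finally show "dst (pmult f g j) (T i j (pmult f g i)) < e" using d by (simp add: algebra_simps)
  qed
 qed
qed (use f g in \<open>simp add: nets_ops cn_nets\<close>)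

lemma cn_pzero: "pzero \<in> cn"
proof -
 obtain i where "i \<in> I" using ne by auto
 have "coh pzero e i" if "0 < e" "i \<in> I" for e i
  using that linear_map_zero[OF hom_linear[OF T_hom] N N]
  by (auto simp: coh_def pzero_def pre_cstar.dst_self[OF N] pre_cstar.zero_closed[OF N])
 then show ?thesis using \<open>i \<in> I\<close> by (auto simp: cn_iff nets_ops)
qed

lemma cn_pminus: "f \<in> cn ==> g \<in> cn ==> pminus f g \<in> cn"
 by (simp add: pminus_def cn_padd cn_pscale)

lemmas cn_ops = cn_padd cn_pscale cn_pstar cn_pmult cn_pzero cn_pminus

lemma norm_pminus: "i \<in> I ==> norm_of (N i) (pminus f g i) = nd f g i"
 by (simp add: nd_def pminus_def padd_def pscale_def minus_of_def)

lemma nd_nonneg: "f \<in> nets ==> g \<in> nets ==> i \<in> I ==> 0 <= nd f g i"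
 unfolding nd_def by (intro pre_cstar.dst_nonneg[OF N] nets_mem)

lemma nullI:
 assumes "f \<in> nets" "g \<in> nets" "(h \<longlongrightarrow> 0) F" "eventually (%i. nd f g i <= h i) F"
 shows "null f g"
 unfolding null_def
proof (rule tendsto_sandwich[OF _ assms(4) tendsto_const assms(3)])
 show "\<forall>\<^sub>F n in F. 0 <= nd f g n"
  using eventually_in by eventually_elim (simp add: nd_nonneg assms)
qed

lemma null_refl: "f \<in> nets ==> null f f"
 by (rule nullI[of f f "%_. 0"], auto intro!: eventually_mono[OF eventually_in]
  simp: nd_def pre_cstar.dst_self[OF N] nets_mem)

lemma null_sym: "f \<in> nets ==> g \<in> nets ==> null f g ==> null g f"
 by (rule nullI[of g f "nd f g"], auto intro!: eventually_mono[OF eventually_in]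
  simp: nd_def null_def pre_cstar.dst_commute[OF N] nets_mem)

lemma null_trans:
 assumes c: "f \<in> nets" "g \<in> nets" "h \<in> nets" and n: "null f g" "null g h"
 shows "null f h"
proof (rule nullI[of f h "%i. nd f g i + nd g h i"])
 show "((%i. nd f g i + nd g h i) \<longlongrightarrow> 0) F"
  using tendsto_add[OF n[unfolded null_def]] by simp
 show "\<forall>\<^sub>F i in F. nd f h i <= nd f g i + nd g h i"
  using eventually_in by eventually_elim
   (unfold nd_def, intro pre_cstar.dst_triangle[OF N] nets_mem c)
qed (use c in auto)

lemma null_eventually_eq:
 assumes "f \<in> nets" "g \<in> nets" "eventually (%i. f i = g i) F" shows "null f g"
proof (rule nullI[of f g "%_. 0"])
 show "\<forall>\<^sub>F i in F. nd f g i <= 0"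
  using eventually_in assms(3) by eventually_elim
   (simp add: nd_def pre_cstar.dst_self[OF N] nets_mem assms)
qed (use assms in auto)

lemma cls_def': "cls f = {g \<in> cn. null f g}"
 by (simp add: net_class_def null_def nd_def[abs_def])

lemma cls_eq: assumes f: "f \<in> cn" and g: "g \<in> cn" shows "cls f = cls g \<longleftrightarrow> null f g"
proof
 assume "cls f = cls g"
 moreover have "g \<in> cls g" using g by (simp add: cls_def' null_refl cn_nets)
 ultimately show "null f g" by (auto simp: cls_def')
next
 assume "null f g"
 then show "cls f = cls g"
  unfolding cls_def' using null_trans null_sym f g cn_nets by (metis (no_types, lifting))
qed

lemma rep_cls: assumes f: "f \<in> cn" shows "rep (cls f) \<in> cn" and "null f (rep (cls f))"
proof -
 have "f \<in> cls f" using f by (simp add: cls_def' null_refl cn_nets)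
 then have "rep (cls f) \<in> cls f" unfolding rep_def by (rule someI[of "%h. h \<in> cls f" f])
 then show "rep (cls f) \<in> cn" "null f (rep (cls f))" by (auto simp: cls_def')
qed

lemma carrier_L: "carrier L = cls ` cn"
 by (simp add: ind_limit_def)

lemma cls_in: "f \<in> cn ==> cls f el L"
 by (simp add: carrier_L)

lemma rep_in: "P el L ==> rep P \<in> cn \<and> cls (rep P) = P"
proof -
 assume "P el L"
 then obtain f where f: "f \<in> cn" "P = cls f" by (auto simp: carrier_L)
 then show ?thesis using rep_cls[OF f(1)] cls_eq[OF f(1)] by metis
qed

lemma null_padd:
 assumes c: "f \<in> nets" "g \<in> nets" "f' \<in> nets" "g' \<in> nets" and n: "null f f'" "null g g'"
 shows "null (padd f g) (padd f' g')"
proof (rule nullI[of _ _ "%i. nd f f' i + nd g g' i"])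
 show "((%i. nd f f' i + nd g g' i) \<longlongrightarrow> 0) F" using tendsto_add[OF n[unfolded null_def]] by simp
 show "\<forall>\<^sub>F i in F. nd (padd f g) (padd f' g') i <= nd f f' i + nd g g' i"
  using eventually_in
 proof eventually_elim
  case (elim i)
  then show ?case
   using pre_cstar.dst_add[OF N[OF elim], of "f i" "f' i" "g i" "g' i"] c
   by (simp add: nd_def padd_def nets_mem)
 qed
qed (use c in \<open>auto simp: nets_ops\<close>)

lemma null_pscale:
 assumes c: "f \<in> nets" "f' \<in> nets" and n: "null f f'"
 shows "null (pscale k f) (pscale k f')"
proof (rule nullI[of _ _ "%i. cmod k * nd f f' i"])
 show "((%i. cmod k * nd f f' i) \<longlongrightarrow> 0) F" using tendsto_mult_right_zero n by (simp add: null_def tendsto_mult_right_zero)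
 show "\<forall>\<^sub>F i in F. nd (pscale k f) (pscale k f') i <= cmod k * nd f f' i"
  using eventually_in by eventually_elim
   (use c in \<open>simp add: nd_def pscale_def pre_cstar.dst_scale[OF N] nets_mem\<close>)
qed (use c in \<open>auto simp: nets_ops\<close>)

lemma null_pstar:
 assumes c: "f \<in> nets" "f' \<in> nets" and n: "null f f'"
 shows "null (pstar f) (pstar f')"
proof (rule nullI[of _ _ "nd f f'"])
 show "\<forall>\<^sub>F i in F. nd (pstar f) (pstar f') i <= nd f f' i"
  using eventually_in by eventually_elim
   (use c in \<open>simp add: nd_def pstar_def pre_cstar.dst_star[OF N] nets_mem\<close>)
qed (use c n in \<open>auto simp: nets_ops null_def\<close>)

lemma null_pmult:
 assumes c: "f \<in> cn" "g \<in> cn" "f' \<in> cn" "g' \<in> cn" and n: "null f f'" "null g g'"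
 shows "null (pmult f g) (pmult f' g')"
proof -
 obtain B where B: "0 < B" "eventually (%j. norm_of (N j) (f j) <= B) F" using cn_bounded[OF c(1)] by blast
 obtain C where C: "0 < C" "eventually (%j. norm_of (N j) (g' j) <= C) F" using cn_bounded[OF c(4)] by blast
 show ?thesis
 proof (rule nullI[of _ _ "%i. B * nd g g' i + nd f f' i * C"])
  have "((%i. B * nd g g' i + nd f f' i * C) \<longlongrightarrow> B * 0 + 0 * C) F"
   using n unfolding null_def by (intro tendsto_intros)
  then show "((%i. B * nd g g' i + nd f f' i * C) \<longlongrightarrow> 0) F" by simp
  show "\<forall>\<^sub>F i in F. nd (pmult f g) (pmult f' g') i <= B * nd g g' i + nd f f' i * C"
   using eventually_in B(2) C(2)
  proof eventually_elim
   case (elim i)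
   interpret pre_cstar "N i" by (rule N[OF elim(1)])
   note m = cn_mem[OF c(1) elim(1)] cn_mem[OF c(2) elim(1)] cn_mem[OF c(3) elim(1)] cn_mem[OF c(4) elim(1)]
   have "nd (pmult f g) (pmult f' g') i <= norm_of (N i) (f i) * nd g g' i + nd f f' i * norm_of (N i) (g' i)"
    using dst_mult[of "f i" "f' i" "g i" "g' i"] m elim by (simp add: nd_def pmult_def)
   also have "... <= B * nd g g' i + nd f f' i * C"
    using elim m B(1) by (intro add_mono mult_mono) (auto simp: nd_def dst_nonneg norm_nonneg)
   finally show ?case .
  qed
 qed (use c in \<open>auto simp: nets_ops cn_nets\<close>)
qed

lemma add_cls: "f \<in> cn ==> g \<in> cn ==> add_of L (cls f) (cls g) = cls (padd f g)"
 unfolding ind_limit_def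
 by (simp add: padd_def[symmetric])
  (simp add: cls_eq cn_ops rep_cls null_sym null_padd cn_nets nets_ops)

lemma scale_cls: "f \<in> cn ==> scale_of L c (cls f) = cls (pscale c f)"
 unfolding ind_limit_def
 by (simp add: pscale_def[symmetric])
  (simp add: cls_eq cn_ops rep_cls null_sym null_pscale cn_nets nets_ops)

lemma mult_cls: "f \<in> cn ==> g \<in> cn ==> mult_of L (cls f) (cls g) = cls (pmult f g)"
 unfolding ind_limit_def
 by (simp add: pmult_def[symmetric])
  (simp add: cls_eq cn_ops rep_cls null_sym null_pmult cn_nets nets_ops)

lemma star_cls: "f \<in> cn ==> star_of L (cls f) = cls (pstar f)"
 unfolding ind_limit_def
 by (simp add: pstar_def[symmetric])
  (simp add: cls_eq cn_ops rep_cls null_sym null_pstar cn_nets nets_ops)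

lemma zero_cls: "zero_of L = cls pzero"
 by (simp add: ind_limit_def pzero_def)

lemma minus_cls: "f \<in> cn ==> g \<in> cn ==> minus_of L (cls f) (cls g) = cls (pminus f g)"
 by (simp add: minus_of_def scale_cls add_cls cn_ops pminus_def)

text \<open>For fixed \<open>i\<close> the norms of \<open>T i j (f i)\<close> decrease in
  \<open>j\<close> by contractivity, so they are within \<open>e / 3\<close> of their infimum from
  some index on, and coherence ties \<open>f\<close> to them. The complex numbers serve as the
  complete target of \<open>net_cauchy_limit\<close>.\<close>

lemma norm_convergent: assumes f: "f \<in> cn" shows "\<exists>l. ((%i. norm_of (N i) (f i)) \<longlongrightarrow> l) F"
proof -
 define h where "h i = complex_of_real (norm_of (N i) (f i))" for i
 have "\<exists>b\<in>carrier complex_alg. ((%i. norm_of complex_alg (minus_of complex_alg (h i) b)) \<longlongrightarrow> 0) F"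
 proof (rule net_cauchy_limit[OF cstar_complex_alg])
  fix e :: real assume e: "0 < e"
  obtain i where i: "i \<in> I" "coh f (e / 3) i" using f e cn_iff by (metis divide_pos_pos zero_less_numeral)
  define S where "S = (%j. norm_of (N j) (T i j (f i))) ` {j \<in> I. i <= j}"
  have tc: "T i j (f i) el N j" if "j \<in> I" "i <= j" for j
   using that i by (intro T_closed cn_mem[OF f])
  have S: "bdd_below S" "S \<noteq> {}"
   using i tc pre_cstar.norm_nonneg[OF N] unfolding S_def by (auto intro!: bdd_belowI[of _ 0])
  obtain y where "y \<in> S" "y < Inf S + e / 3" using cInf_lessD[OF S(2), of "Inf S + e / 3"] e by auto
  then obtain k where k: "k \<in> I" "i <= k" "norm_of (N k) (T i k (f i)) < Inf S + e / 3"
   by (auto simp: S_def)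
  have 1: "\<bar>norm_of (N j) (f j) - norm_of (N j) (T i j (f i))\<bar> < e / 3" if "j \<in> I" "i <= j" for j
   using pre_cstar.norm_diff_le[OF N[OF that(1)] cn_mem[OF f that(1)] tc[OF that]] i that
   by (force simp: coh_def)
  have 2: "Inf S <= norm_of (N j) (T i j (f i))" "norm_of (N j) (T i j (f i)) < Inf S + e / 3"
   if "j \<in> I" "k <= j" for j
  proof -
   have ij: "i <= j" using k that by simp
   show "Inf S <= norm_of (N j) (T i j (f i))" using that ij S by (intro cInf_lower) (auto simp: S_def)
   have "norm_of (N j) (T i j (f i)) = norm_of (N j) (T k j (T i k (f i)))"
    using T_comp[OF i(1) k(1) that(1) k(2) that(2) cn_mem[OF f i(1)]] by simp
   also have "... <= norm_of (N k) (T i k (f i))" using k that tc by (intro T_norm) auto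
   finally show "norm_of (N j) (T i j (f i)) < Inf S + e / 3" using k by simp
  qed
  have "\<bar>norm_of (N j) (f j) - norm_of (N k) (f k)\<bar> < e" if "j \<in> I" "k <= j" for j
   using 1[OF that(1) order_trans[OF k(2) that(2)]] 1[OF k(1,2)] 2[OF that] 2[OF k(1) order_refl]
   by linarith
  then show "\<exists>i\<in>I. \<forall>j\<in>I. i <= j \<longrightarrow> norm_of complex_alg (minus_of complex_alg (h j) (h i)) < e"
   using k(1) by (intro bexI[of _ k]) (auto simp: h_def norm_of_real simp flip: of_real_diff)
 qed simp
 then obtain b where "((%i. cmod (h i - b)) \<longlongrightarrow> 0) F" by auto
 then have "(h \<longlongrightarrow> b) F" by (simp add: tendsto_norm_zero_iff LIM_zero_iff)
 then have "((%i. Re (h i)) \<longlongrightarrow> Re b) F" by (rule tendsto_Re)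
 then show ?thesis by (auto simp: h_def)
qed

lemma norm_tendsto:
 assumes f: "f \<in> cn" shows "((%i. norm_of (N i) (f i)) \<longlongrightarrow> norm_of L (cls f)) F"
proof -
 let ?r = "rep (cls f)"
 obtain l where l: "((%i. norm_of (N i) (?r i)) \<longlongrightarrow> l) F" using norm_convergent rep_cls(1)[OF f] by blast
 then have "norm_of L (cls f) = l" by (simp add: ind_limit_def tendsto_Lim[OF net_nonbot])
 moreover have "((%i. norm_of (N i) (f i) - norm_of (N i) (?r i)) \<longlongrightarrow> 0) F"
 proof (rule Lim_null_comparison)
  show "\<forall>\<^sub>F i in F. norm (norm_of (N i) (f i) - norm_of (N i) (?r i)) <= nd f ?r i"
   using eventually_in by eventually_elim
    (auto simp: nd_def intro!: pre_cstar.norm_diff_le[OF N] cn_mem f rep_cls)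
  show "(nd f ?r \<longlongrightarrow> 0) F" using rep_cls(2)[OF f] by (simp add: null_def)
 qed
 ultimately show ?thesis using tendsto_add[OF l] by fastforce
qed

lemma norm_unique: "f \<in> cn ==> ((%i. norm_of (N i) (f i)) \<longlongrightarrow> l) F ==> norm_of L (cls f) = l"
 using tendsto_unique[OF net_nonbot norm_tendsto] by blast

lemma nd_tendsto:
 assumes f: "f \<in> cn" and g: "g \<in> cn"
 shows "(nd f g \<longlongrightarrow> norm_of L (minus_of L (cls f) (cls g))) F"
proof -
 have "((%i. norm_of (N i) (pminus f g i)) \<longlongrightarrow> norm_of L (minus_of L (cls f) (cls g))) F"
  using norm_tendsto[OF cn_pminus[OF f g]] by (simp add: minus_cls f g)
 then show ?thesis
  by (rule Lim_transform_eventually) (use eventually_in in \<open>auto elim!: eventually_mono simp: norm_pminus\<close>)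
qed

lemma norm_le_eventually:
 assumes f: "f \<in> cn" and "eventually (%i. norm_of (N i) (f i) <= c) F"
 shows "norm_of L (cls f) <= c"
 by (rule tendsto_upperbound[OF norm_tendsto[OF f] assms(2) net_nonbot])

lemma dist_le_eventually:
 assumes "f \<in> cn" "g \<in> cn" "eventually (%i. nd f g i <= c) F"
 shows "norm_of L (minus_of L (cls f) (cls g)) <= c"
 by (rule tendsto_upperbound[OF nd_tendsto[OF assms(1,2)] assms(3) net_nonbot])

text \<open>Algebraic identities hold for nets index by index; norm relations pass to the limit by
  \<open>norm_tendsto\<close>.\<close>

lemma pre_cstar_ind_limit: "pre_cstar L"
proof -
 note ops = add_cls scale_cls mult_cls star_cls zero_cls minus_cls cn_ops
 note pdefs = padd_def pscale_def pmult_def pstar_def pzero_def pminus_def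
 have C: "\<exists>f\<in>cn. x = cls f" if "x el L" for x using that by (auto simp: carrier_L)
 have le_lim: "norm_of L (cls f) <= l" if "f \<in> cn" "(g \<longlongrightarrow> l) F" "!!i. i \<in> I ==> norm_of (N i) (f i) <= g i"
  for f g l
  by (rule tendsto_le[OF net_nonbot that(2) norm_tendsto[OF that(1)]])
   (use eventually_in that(3) in \<open>auto elim: eventually_mono\<close>)
 have eq_lim: "norm_of L (cls f) = l" if "f \<in> cn" "(g \<longlongrightarrow> l) F" "!!i. i \<in> I ==> norm_of (N i) (f i) = g i"
  for f g l
 proof (rule norm_unique[OF that(1)])
  show "((%i. norm_of (N i) (f i)) \<longlongrightarrow> l) F"
   by (rule Lim_transform_eventually[OF that(2)]) (use eventually_in that(3) in \<open>auto elim!: eventually_mono\<close>)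
 qed
 show ?thesis
 proof
  fix x y z c d
  assume x: "x el L"
  then obtain f where f: "f \<in> cn" "x = cls f" using C by blast
  note fm = cn_mem[OF f(1)]
  show "scale_of L c x el L" "star_of L x el L"
   using f by (simp_all add: ops cls_in)
  show "add_of L x (zero_of L) = x" using f
   by (simp add: ops) (intro arg_cong[of _ _ cls] ext, use cn_nets[OF f(1)] in
    \<open>auto simp: pdefs pre_cstar.add_zero[OF N] fm nets_def PiE_iff extensional_def\<close>)
  show "minus_of L x x = zero_of L" using f
   by (simp add: ops) (intro arg_cong[of _ _ cls] ext,
    auto simp: pdefs pre_cstar.minus_self[OF N, unfolded minus_of_def] fm)
  show "scale_of L 1 x = x" using f
   by (simp add: ops) (intro arg_cong[of _ _ cls] ext, use cn_nets[OF f(1)] in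
    \<open>auto simp: pdefs pre_cstar.scale_one[OF N] fm nets_def PiE_iff extensional_def\<close>)
  show "scale_of L c (scale_of L d x) = scale_of L (c * d) x"
   "scale_of L (c + d) x = add_of L (scale_of L c x) (scale_of L d x)"
   "star_of L (scale_of L c x) = scale_of L (cnj c) (star_of L x)"
   using f by (simp_all add: ops) (intro arg_cong[of _ _ cls] ext; auto simp: pdefs pre_cstar.scale_scale[OF N] pre_cstar.add_scale[OF N] pre_cstar.star_scale[OF N] fm)+
  show "star_of L (star_of L x) = x" using f
   by (simp add: ops) (intro arg_cong[of _ _ cls] ext, use cn_nets[OF f(1)] in
    \<open>auto simp: pdefs pre_cstar.star_star[OF N] fm nets_def PiE_iff extensional_def\<close>)
  show "0 <= norm_of L x"
   using tendsto_lowerbound[OF norm_tendsto[OF f(1)] eventually_mono[OF eventually_in] net_nonbot]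
    pre_cstar.norm_nonneg[OF N] fm f(2) by blast
  show "norm_of L (scale_of L c x) = cmod c * norm_of L x"
   unfolding f(2) scale_cls[OF f(1)]
   by (rule eq_lim[OF cn_pscale[OF f(1)] tendsto_mult_left[OF norm_tendsto[OF f(1)]]])
    (simp add: pscale_def pre_cstar.norm_scale[OF N] fm)
  show "norm_of L (mult_of L (star_of L x) x) = (norm_of L x)\<^sup>2"
   unfolding f(2) star_cls[OF f(1)] mult_cls[OF cn_pstar[OF f(1)] f(1)]
   by (rule eq_lim[OF cn_pmult[OF cn_pstar[OF f(1)] f(1)] tendsto_power[OF norm_tendsto[OF f(1)]]])
    (simp add: pmult_def pstar_def pre_cstar.cstar_identity[OF N] fm)
  assume y: "y el L"
  then obtain g where g: "g \<in> cn" "y = cls g" using C by blast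
  note gm = cn_mem[OF g(1)]
  show "add_of L x y el L" "mult_of L x y el L"
   using f g by (simp_all add: ops cls_in)
  show "add_of L x y = add_of L y x"
   "scale_of L c (add_of L x y) = add_of L (scale_of L c x) (scale_of L c y)"
   "mult_of L (scale_of L c x) y = scale_of L c (mult_of L x y)"
   "mult_of L x (scale_of L c y) = scale_of L c (mult_of L x y)"
   "star_of L (add_of L x y) = add_of L (star_of L x) (star_of L y)"
   "star_of L (mult_of L x y) = mult_of L (star_of L y) (star_of L x)"
   using f g by (simp_all add: ops) (intro arg_cong[of _ _ cls] ext; auto simp: pdefs pre_cstar.add_comm[OF N] pre_cstar.scale_add[OF N] pre_cstar.scale_mult[OF N] pre_cstar.mult_scale[OF N] pre_cstar.star_add[OF N] pre_cstar.star_mult[OF N] fm gm)+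
  show "norm_of L (add_of L x y) <= norm_of L x + norm_of L y"
   unfolding f(2) g(2) add_cls[OF f(1) g(1)]
   by (rule le_lim[OF cn_padd[OF f(1) g(1)] tendsto_add[OF norm_tendsto[OF f(1)] norm_tendsto[OF g(1)]]])
    (simp add: padd_def pre_cstar.norm_add[OF N] fm gm)
  show "norm_of L (mult_of L x y) <= norm_of L x * norm_of L y"
   unfolding f(2) g(2) mult_cls[OF f(1) g(1)]
   by (rule le_lim[OF cn_pmult[OF f(1) g(1)] tendsto_mult[OF norm_tendsto[OF f(1)] norm_tendsto[OF g(1)]]])
    (simp add: pmult_def pre_cstar.norm_mult[OF N] fm gm)
  assume z: "z el L"
  then obtain h where h: "h \<in> cn" "z = cls h" using C by blast
  note hm = cn_mem[OF h(1)]
  show "add_of L (add_of L x y) z = add_of L x (add_of L y z)"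
   "mult_of L (mult_of L x y) z = mult_of L x (mult_of L y z)"
   "mult_of L x (add_of L y z) = add_of L (mult_of L x y) (mult_of L x z)"
   "mult_of L (add_of L x y) z = add_of L (mult_of L x z) (mult_of L y z)"
   using f g h by (simp_all add: ops) (intro arg_cong[of _ _ cls] ext; auto simp: pdefs pre_cstar.add_assoc[OF N] pre_cstar.mult_assoc[OF N] pre_cstar.mult_add[OF N] pre_cstar.add_mult[OF N] fm gm hm)+
 qed (simp add: zero_cls cls_in cn_ops)
qed

text \<open>Completeness is a diagonal argument: choose a net for each term of a Cauchy sequence of
  classes, and let the diagonal net follow the \<open>n\<close>-th of them on a region of indices
  that moves off with \<open>n\<close>.\<close>

lemma cstar_ind_limit: "cstar_algebra L"
proof -
 interpret P: pre_cstar L by (rule pre_cstar_ind_limit)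
 have eqz: "norm_of L x = 0 \<longleftrightarrow> x = zero_of L" if "x el L" for x
 proof
  assume 0: "norm_of L x = 0"
  obtain f where f: "f \<in> cn" "x = cls f" using \<open>x el L\<close> by (auto simp: carrier_L)
  have "null f pzero"
  proof (rule nullI[OF cn_nets[OF f(1)] cn_nets[OF cn_pzero]])
   show "((%i. norm_of (N i) (f i)) \<longlongrightarrow> 0) F" using norm_tendsto[OF f(1)] 0 f by simp
   show "\<forall>\<^sub>F i in F. nd f pzero i <= norm_of (N i) (f i)"
    using eventually_in by eventually_elim
     (simp add: nd_def pzero_def pre_cstar.minus_zero[OF N] cn_mem[OF f(1)])
  qed
  then show "x = zero_of L" using f by (simp add: zero_cls cls_eq cn_pzero)
 qed (simp add: P.norm_zero)
 have compl: "\<exists>x\<in>carrier L. (%n. P.dst (X n) x) \<longlonglongrightarrow> 0"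
  if X: "!!n. X n el L" and cauchy: "\<forall>e>0. \<exists>N. \<forall>m\<ge>N. \<forall>n\<ge>N. P.dst (X m) (X n) < e"
  for X :: "nat => _"
 proof -
  define f where "f n = rep (X n)" for n
  have f: "f n \<in> cn" "X n = cls (f n)" for n using rep_in[OF X] by (auto simp: f_def)
  \<comment> \<open>Holds at the indices where net \<open>n\<close> is as close to all earlier nets
    as their classes are, up to \<open>(1/2) ^ n\<close>.\<close>
  define P where "P n i \<longleftrightarrow> (\<forall>m\<in>{..n}. nd (f n) (f m) i < P.dst (X n) (X m) + (1/2) ^ n)" for n i
  have "eventually (P n) F" for n
   unfolding P_def
  proof (rule eventually_ball_finite, simp, intro ballI)
   fix m
   have "(nd (f n) (f m) \<longlongrightarrow> P.dst (X n) (X m)) F" unfolding f(2) by (rule nd_tendsto) (rule f)+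
   then show "\<forall>\<^sub>F i in F. nd (f n) (f m) i < P.dst (X n) (X m) + (1/2) ^ n"
    by (rule order_tendstoD) simp
  qed
  then obtain s where s: "!!n. s n \<in> I" "!!n. s n < s (Suc n)"
   and sP: "!!n j. j \<in> I ==> s n <= j ==> P n j"
   by (rule increasing_sequence[of P]) blast
  have sm: "strict_mono s" using s(2) by (simp add: strict_mono_Suc_iff)
  have fin: "finite {n. s n <= j}" if "j \<in> I" for j
  proof (rule finite_imageD[of s])
   show "finite (s ` {n. s n <= j})"
    by (rule finite_subset[OF _ finite_below[OF that]]) (use s in auto)
   show "inj_on s {n. s n <= j}" using sm strict_mono_imp_inj_on inj_on_subset by blast
  qed
  \<comment> \<open>The last \<open>n\<close> with \<open>s n <= j\<close>. It exists because only
    finitely many indices lie below \<open>j\<close> and \<open>s\<close> is injective. Where no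
    such \<open>n\<close> exists, the net \<open>g\<close> is set to zero, which no limit
    sees.\<close>
  define \<nu> where "\<nu> j = Max {n. s n <= j}" for j
  define g where "g = (\<lambda>j\<in>I. if {n. s n <= j} = {} then zero_of (N j) else f (\<nu> j) j)"
  have g: "g \<in> nets"
   unfolding nets_def g_def using N_closed(2) cn_mem[OF f(1)] by (auto simp: PiE_iff)
  have close: "nd g (f m) j < P.dst (X (\<nu> j)) (X m) + (1/2) ^ (\<nu> j) \<and> m <= \<nu> j"
   if j: "j \<in> I" "s m <= j" for j m
  proof -
   have ne: "{n. s n <= j} \<noteq> {}" and m: "m <= \<nu> j" using j fin[OF j(1)] by (auto simp: \<nu>_def)
   have "s (\<nu> j) <= j" unfolding \<nu>_def using Max_in[OF fin[OF j(1)] ne] by simp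
   then have "P (\<nu> j) j" by (rule sP[OF j(1)])
   then show ?thesis using m ne j(1) by (auto simp: P_def nd_def g_def)
  qed
  have key: "\<exists>M. \<forall>m\<ge>M. eventually (%j. nd g (f m) j < e) F" if e: "0 < e" for e
  proof -
   obtain M1 where M1: "!!m n. M1 <= m ==> M1 <= n ==> P.dst (X m) (X n) < e / 2"
    using cauchy e half_gt_zero by metis
   obtain M2 where M2: "(1/2 :: real) ^ M2 < e / 2" using real_arch_pow_inv[of "e / 2" "1/2"] e by auto
   have "nd g (f m) j < e" if m: "max M1 M2 <= m" and j: "j \<in> I" "s m <= j" for m j
   proof -
    have "(1/2 :: real) ^ \<nu> j <= (1/2) ^ M2"
     using close[OF j] m by (intro power_decreasing) auto
    moreover have "P.dst (X (\<nu> j)) (X m) < e / 2" using close[OF j] m by (intro M1) auto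
    ultimately show ?thesis using close[OF j] M2 by linarith
   qed
   then show ?thesis unfolding eventually_net using s(1) by blast
  qed
  have gcn: "g \<in> cn"
   using cn_approx[OF g] key f(1) by (meson order_refl)
  have "(%n. P.dst (X n) (cls g)) \<longlonglongrightarrow> 0"
  proof (rule LIMSEQ_I)
   fix e :: real assume e: "0 < e"
   obtain M where M: "!!m. M <= m ==> eventually (%j. nd g (f m) j < e / 2) F"
    using key[of "e / 2"] e by auto
   have "P.dst (X m) (cls g) < e" if "M <= m" for m
   proof -
    have "P.dst (cls g) (X m) <= e / 2" unfolding f(2)
     by (intro dist_le_eventually gcn f eventually_mono[OF M[OF that]]) simp
    then show ?thesis using P.dst_commute[OF X cls_in[OF gcn]] e by (simp add: less_le_trans)
   qed
   then show "\<exists>no. \<forall>n\<ge>no. norm (P.dst (X n) (cls g) - 0) < e"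
    using P.dst_nonneg[OF X cls_in[OF gcn]] by auto
  qed
  then show ?thesis using cls_in[OF gcn] by blast
 qed
 show ?thesis
 proof
  fix X :: "nat => _"
  assume "!!n. X n el L" "\<forall>e>0. \<exists>N. \<forall>m\<ge>N. \<forall>n\<ge>N. P.dst (X m) (X n) < e"
  then show "\<exists>x\<in>carrier L. (%n. P.dst (X n) x) \<longlonglongrightarrow> 0" by (rule compl)
 qed (rule P.add_closed P.zero_closed P.scale_closed P.mult_closed P.star_closed P.add_assoc P.add_comm
  P.add_zero P.minus_self P.scale_one P.scale_scale P.scale_add P.add_scale P.mult_assoc P.mult_add
  P.add_mult P.scale_mult P.mult_scale P.star_star P.star_add P.star_scale P.star_mult P.norm_nonneg
  P.norm_add P.norm_scale P.norm_mult P.cstar_identity eqz; assumption)+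
qed

section \<open>Canonical embeddings and maps out of the limit\<close>

definition embnet :: "'i => 'b => 'i => 'b" where
 "embnet i x = (\<lambda>j\<in>I. if i <= j then T i j x else zero_of (N j))"

lemma emb_cls: "emb i x = cls (embnet i x)"
 by (simp add: limit_emb_def embnet_def)

lemma embnet_nets: "i \<in> I ==> x el N i ==> embnet i x \<in> nets"
 by (auto simp: embnet_def nets_def PiE_iff intro: T_closed N_closed)

lemma embnet_cn: assumes "i \<in> I" "x el N i" shows "embnet i x \<in> cn"
proof (rule cnI[OF embnet_nets[OF assms]])
 fix e :: real assume e: "0 < e"
 show "eventually (coh (embnet i x) e) F"
  using eventually_ge[OF assms(1)]
 proof eventually_elim
  case (elim k)
  show ?case unfolding coh_def
  proof (intro ballI impI)
   fix j assume j: "j \<in> I" "k <= j"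
   have "i <= j" using elim j by auto
   then have "embnet i x j = T i j x" "T k j (embnet i x k) = T i j x"
    using j elim assms by (auto simp: embnet_def T_comp)
   then show "norm_of (N j) (minus_of (N j) (embnet i x j) (T k j (embnet i x k))) < e"
    using e j \<open>i <= j\<close> assms by (simp add: pre_cstar.dst_self[OF N] T_closed)
  qed
 qed
qed

lemma emb_in: "i \<in> I ==> x el N i ==> emb i x el L"
 by (simp add: emb_cls cls_in embnet_cn)

lemma emb_comp:
 assumes "i \<in> I" "k \<in> I" "i <= k" "x el N i"
 shows "emb k (T i k x) = emb i x"
proof -
 have t: "T i k x el N k" using assms by (intro T_closed)
 have "null (embnet k (T i k x)) (embnet i x)"
 proof (rule null_eventually_eq)
  show "\<forall>\<^sub>F j in F. embnet k (T i k x) j = embnet i x j"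
   using eventually_ge[OF assms(2)] by eventually_elim
    (use assms in \<open>auto simp: embnet_def T_comp intro: order_trans\<close>)
 qed (use assms t in \<open>auto intro: embnet_nets\<close>)
 then show ?thesis using assms t by (simp add: emb_cls cls_eq embnet_cn)
qed

lemma emb_star_hom: assumes i: "i \<in> I" shows "star_hom (N i) L (emb i)"
proof -
 interpret pre_cstar "N i" by (rule N[OF i])
 have h: "j \<in> I ==> i <= j ==> star_hom (N i) (N j) (T i j)" for j by (rule T_hom[OF i])
 note hs = lin_map_add[OF hom_linear[OF h]] lin_scale[OF hom_linear[OF h]]
  star_hom_mult[OF h] star_hom_star[OF h]
 have zs: "j \<in> I ==> add_of (N j) (zero_of (N j)) (zero_of (N j)) = zero_of (N j)"
  "j \<in> I ==> scale_of (N j) c (zero_of (N j)) = zero_of (N j)"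
  "j \<in> I ==> mult_of (N j) (zero_of (N j)) (zero_of (N j)) = zero_of (N j)"
  "j \<in> I ==> star_of (N j) (zero_of (N j)) = zero_of (N j)" for j c
  using pre_cstar.zero_add[OF N] pre_cstar.zero_mult[OF N] pre_cstar.scale_zero_right[OF N]
   pre_cstar.star_zero[OF N] pre_cstar.zero_closed[OF N] by auto
 show ?thesis
  unfolding star_hom_def linear_map_def emb_cls
 proof (intro conjI allI ballI)
  fix x y c assume x: "x el N i"
  show "cls (embnet i x) el L" by (intro cls_in embnet_cn i x)
  show "cls (embnet i (scale_of (N i) c x)) = scale_of L c (cls (embnet i x))"
   unfolding scale_cls[OF embnet_cn[OF i x]] by (rule arg_cong[of _ _ cls])
    (auto simp: embnet_def pscale_def hs zs x fun_eq_iff)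
  show "cls (embnet i (star_of (N i) x)) = star_of L (cls (embnet i x))"
   unfolding star_cls[OF embnet_cn[OF i x]] by (rule arg_cong[of _ _ cls])
    (auto simp: embnet_def pstar_def hs zs x fun_eq_iff)
  assume y: "y el N i"
  show "cls (embnet i (add_of (N i) x y)) = add_of L (cls (embnet i x)) (cls (embnet i y))"
   unfolding add_cls[OF embnet_cn[OF i x] embnet_cn[OF i y]] by (rule arg_cong[of _ _ cls])
    (auto simp: embnet_def padd_def hs zs x y fun_eq_iff)
  show "cls (embnet i (mult_of (N i) x y)) = mult_of L (cls (embnet i x)) (cls (embnet i y))"
   unfolding mult_cls[OF embnet_cn[OF i x] embnet_cn[OF i y]] by (rule arg_cong[of _ _ cls])
    (auto simp: embnet_def pmult_def hs zs x y fun_eq_iff)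
 qed
qed

lemma norm_emb_le: assumes "i \<in> I" "x el N i" shows "norm_of L (emb i x) <= norm_of (N i) x"
 unfolding emb_cls
proof (rule norm_le_eventually[OF embnet_cn[OF assms]])
 show "\<forall>\<^sub>F j in F. norm_of (N j) (embnet i x j) <= norm_of (N i) x"
  using eventually_ge[OF assms(1)] by eventually_elim (use assms in \<open>simp add: embnet_def T_norm\<close>)
qed

text \<open>The images of the values of a representing net approximate its class; this is the
  meaning of coherence.\<close>

lemma emb_dense:
 assumes f: "f \<in> cn" and e: "0 < e"
 shows "eventually (%i. i \<in> I \<and> norm_of L (minus_of L (cls f) (emb i (f i))) < e) F"
proof -
 have "eventually (%i. i \<in> I \<and> coh f (e / 2) i) F"
  using coh_eventually[OF f, of "e / 2"] eventually_in e by (auto intro!: eventually_conj)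
 then show ?thesis
 proof eventually_elim
  case (elim i)
  have c: "embnet i (f i) \<in> cn" using elim by (intro embnet_cn cn_mem[OF f]) auto
  have "norm_of L (minus_of L (cls f) (cls (embnet i (f i)))) <= e / 2"
  proof (rule dist_le_eventually[OF f c])
   have "\<forall>\<^sub>F j in F. j \<in> I \<and> i <= j" using elim by (intro eventually_ge) simp
   then show "\<forall>\<^sub>F j in F. nd f (embnet i (f i)) j <= e / 2"
    by eventually_elim (use elim in \<open>auto simp: nd_def embnet_def coh_def less_imp_le\<close>)
  qed
  then show ?case using elim e by (simp add: emb_cls)
 qed
qed

text \<open>Density of the embedded algebras. Agreement is asked at cofinally many indices, as
  \<open>emb i\<close> factors through \<open>emb j\<close>; for partitions this allows passing to
  those that contain a prescribed point.\<close>

lemma ind_limit_map_eqI: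
 assumes B: "cstar_algebra B" and h: "bounded_linear_map L B h" and h': "bounded_linear_map L B h'"
  and eq: "!!i. i \<in> I ==> \<exists>j\<in>I. i <= j \<and> (\<forall>x\<in>carrier (N j). h (emb j x) = h' (emb j x))"
  and P: "P el L"
 shows "h P = h' P"
proof -
 interpret B: cstar_algebra B by fact
 interpret L: pre_cstar L by (rule pre_cstar_ind_limit)
 obtain C where C: "!!x. x el L ==> norm_of B (h x) <= C * norm_of L x" and lh: "linear_map L B h"
  using h by (auto simp: bounded_linear_map_def)
 obtain C' where C': "!!x. x el L ==> norm_of B (h' x) <= C' * norm_of L x" and lh': "linear_map L B h'"
  using h' by (auto simp: bounded_linear_map_def)
 obtain f where f: "f \<in> cn" "P = cls f" using P by (auto simp: carrier_L)
 define D where "D = \<bar>C\<bar> + \<bar>C'\<bar> + 1"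
 have D: "0 < D" by (simp add: D_def)
 have "B.dst (h P) (h' P) <= e" if e: "0 < e" for e
 proof -
  obtain i where i: "i \<in> I" "L.dst P (emb i (f i)) < e / D"
   using eventually_obtain[OF emb_dense[OF f(1), of "e / D"]] e D f by auto
  let ?y = "emb i (f i)"
  have fi: "f i el N i" by (rule cn_mem[OF f(1) i(1)])
  have y: "?y el L" by (rule emb_in[OF i(1) fi])
  obtain j where j: "j \<in> I" "i <= j" "\<forall>x\<in>carrier (N j). h (emb j x) = h' (emb j x)" using eq[OF i(1)] by blast
  have "h (emb j (T i j (f i))) = h' (emb j (T i j (f i)))" using i j T_closed fi by blast
  then have hy: "h ?y = h' ?y" using emb_comp[OF i(1) j(1,2) fi] by simp
  have "B.dst (h P) (h' P) <= B.dst (h P) (h ?y) + B.dst (h ?y) (h' P)"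
   using P y by (intro B.dst_triangle lin_closed[OF lh] lin_closed[OF lh'])
  also have "B.dst (h P) (h ?y) = norm_of B (h (minus_of L P ?y))"
   using linear_map_minus[OF lh L.pre_cstar_axioms P y] by simp
  also have "B.dst (h ?y) (h' P) = B.dst (h' P) (h' ?y)"
   unfolding hy using P y by (intro B.dst_commute lin_closed[OF lh'])
  also have "... = norm_of B (h' (minus_of L P ?y))"
   using linear_map_minus[OF lh' L.pre_cstar_axioms P y] by simp
  also have "norm_of B (h (minus_of L P ?y)) + ... <= C * L.dst P ?y + C' * L.dst P ?y"
   using C C' P y by (intro add_mono) (auto simp: L.minus_closed)
  also have "... <= \<bar>C\<bar> * L.dst P ?y + \<bar>C'\<bar> * L.dst P ?y + L.dst P ?y"
  proof -
   have "0 <= L.dst P ?y" by (rule L.dst_nonneg[OF P y])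
   then show ?thesis using mult_right_mono[of C "\<bar>C\<bar>" "L.dst P ?y"] mult_right_mono[of C' "\<bar>C'\<bar>" "L.dst P ?y"]
     abs_ge_self[of C] abs_ge_self[of C'] by linarith
  qed
  also have "... = D * L.dst P ?y" by (simp add: D_def algebra_simps)
  also have "... <= e" using i(2) D by (simp add: pos_less_divide_eq mult.commute less_imp_le)
  finally show ?thesis .
 qed
 then have "B.dst (h P) (h' P) <= 0" using field_le_epsilon[of _ "0 :: real"] by simp
 then show ?thesis
  using B.dst_nonneg[of "h P" "h' P"] B.dst_eq_0 lin_closed[OF lh P] lin_closed[OF lh' P]
  by force
qed

text \<open>The value at a class is the limit of \<open>h i (f i)\<close> along a representing net,
  which exists by coherence and the uniform bound. The chosen representative enters only the
  definition of \<open>H\<close>; \<open>Hlim\<close> and \<open>HI\<close> replace it by any other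
  one.\<close>

lemma ind_limit_extension:
 assumes B: "cstar_algebra B" and h: "!!i. i \<in> I ==> linear_map (N i) B (h i)"
  and hC: "!!i x. i \<in> I ==> x el N i ==> norm_of B (h i x) <= C * norm_of (N i) x" and C: "0 <= C"
  and hT: "!!i j x. i \<in> I ==> j \<in> I ==> i <= j ==> x el N i ==> h j (T i j x) = h i x"
 obtains H where "H \<in> extensional (carrier L)" "bounded_linear_map L B H"
  "!!x. x el L ==> norm_of B (H x) <= C * norm_of L x"
  "!!i x. i \<in> I ==> x el N i ==> H (emb i x) = h i x"
  "(!!i. i \<in> I ==> star_hom (N i) B (h i)) ==> star_hom L B H"
proof -
 interpret B: cstar_algebra B by fact
 interpret L: cstar_algebra L by (rule cstar_ind_limit)
 have hc: "h i (f i) el B" if "f \<in> cn" "i \<in> I" for f i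
  by (rule lin_closed[OF h cn_mem]) (use that in auto)
 have hd: "B.dst (h i x) (h i y) <= C * norm_of (N i) (minus_of (N i) x y)"
  if "i \<in> I" "x el N i" "y el N i" for i x y
  using hC[OF that(1), of "minus_of (N i) x y"] linear_map_minus[OF h N] that pre_cstar.minus_closed[OF N]
  by simp
 have lim: "\<exists>b\<in>carrier B. ((%i. B.dst (h i (f i)) b) \<longlongrightarrow> 0) F" if f: "f \<in> cn" for f
 proof (rule net_cauchy_limit[OF B hc[OF f]])
  fix e :: real assume e: "0 < e"
  have "0 < e / (C + 1)" using e C by simp
  then obtain i where i: "i \<in> I" "coh f (e / (C + 1)) i" using f cn_iff by blast
  have "B.dst (h j (f j)) (h i (f i)) < e" if j: "j \<in> I" "i <= j" for j
  proof -
   interpret pre_cstar "N j" by (rule N[OF j(1)])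
   have t: "T i j (f i) el N j" using i j cn_mem[OF f] by (intro T_closed)
   have fj: "f j el N j" by (rule cn_mem[OF f j(1)])
   have "B.dst (h j (f j)) (h j (T i j (f i))) <= C * dst (f j) (T i j (f i))"
    by (rule hd[OF j(1) fj t])
   also have "... <= (C + 1) * dst (f j) (T i j (f i))"
    by (rule mult_right_mono) (use dst_nonneg[OF fj t] in auto)
   also have "... < e" using i j C by (auto simp: coh_def pos_less_divide_eq mult.commute)
   finally show ?thesis using hT[OF i(1) j cn_mem[OF f i(1)]] by simp
  qed
  then show "\<exists>i\<in>I. \<forall>j\<in>I. i <= j \<longrightarrow> B.dst (h j (f j)) (h i (f i)) < e" using i(1) by blast
 qed
 have uniq: "b = b'" if "((%i. B.dst (u i) b) \<longlongrightarrow> 0) F" "((%i. B.dst (u i) b') \<longlongrightarrow> 0) F"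
  "b el B" "b' el B" "!!i. i \<in> I ==> u i el B" for u b b'
 proof -
  have "((%i. B.dst (u i) b + B.dst (u i) b') \<longlongrightarrow> 0 + 0) F" using that by (intro tendsto_add)
  moreover have "\<forall>\<^sub>F i in F. B.dst b b' <= B.dst (u i) b + B.dst (u i) b'"
   using eventually_in
  proof eventually_elim
   case (elim i)
   then show ?case using B.dst_triangle[of b "u i" b'] B.dst_commute[of b "u i"] that by simp
  qed
  ultimately have "B.dst b b' <= 0" using tendsto_lowerbound net_nonbot by fastforce
  then show ?thesis using B.dst_nonneg[of b b'] B.dst_eq_0 that by force
 qed
 define H where "H = (\<lambda>P\<in>carrier L. SOME b. b el B \<and> ((%i. B.dst (h i (rep P i)) b) \<longlongrightarrow> 0) F)"
 have H0: "H P el B \<and> ((%i. B.dst (h i (rep P i)) (H P)) \<longlongrightarrow> 0) F" if P: "P el L" for P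
 proof -
  have "\<exists>b. b el B \<and> ((%i. B.dst (h i (rep P i)) b) \<longlongrightarrow> 0) F"
   using lim[of "rep P"] rep_in[OF P] by blast
  from someI_ex[OF this] show ?thesis using P by (simp add: H_def)
 qed
 have Hc: "H P el B" if "P el L" for P using H0 that by blast
 have Hlim: "((%i. B.dst (h i (f i)) (H (cls f))) \<longlongrightarrow> 0) F" if f: "f \<in> cn" for f
 proof (rule tendsto_sandwich[OF _ _ tendsto_const])
  let ?r = "rep (cls f)"
  note r = rep_cls[OF f]
  have P: "cls f el L" by (rule cls_in[OF f])
  show "\<forall>\<^sub>F i in F. 0 <= B.dst (h i (f i)) (H (cls f))"
   using eventually_in by eventually_elim (intro B.dst_nonneg hc Hc f P)
  have "((%i. C * nd f ?r i + B.dst (h i (?r i)) (H (cls f))) \<longlongrightarrow> C * 0 + 0) F"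
   using r(2) H0[OF P] unfolding null_def by (intro tendsto_add tendsto_mult_left) auto
  then show "((%i. C * nd f ?r i + B.dst (h i (?r i)) (H (cls f))) \<longlongrightarrow> 0) F" by simp
  show "\<forall>\<^sub>F i in F. B.dst (h i (f i)) (H (cls f)) <= C * nd f ?r i + B.dst (h i (?r i)) (H (cls f))"
   using eventually_in
  proof eventually_elim
   case (elim i)
   have "B.dst (h i (f i)) (H (cls f)) <= B.dst (h i (f i)) (h i (?r i)) + B.dst (h i (?r i)) (H (cls f))"
    using elim by (intro B.dst_triangle hc Hc f r P)
   then show ?case using hd[OF elim cn_mem[OF f elim] cn_mem[OF r(1) elim]] by (simp add: nd_def)
  qed
 qed
 have HI: "H (cls f) = b" if "f \<in> cn" "b el B" "((%i. B.dst (h i (f i)) b) \<longlongrightarrow> 0) F" for f b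
  using uniq[OF Hlim[OF that(1)] that(3) Hc[OF cls_in[OF that(1)]] that(2)] hc[OF that(1)] by blast
 have null_le: "((%i. B.dst (u i) b) \<longlongrightarrow> 0) F"
  if "(k \<longlongrightarrow> 0) F" "!!i. i \<in> I ==> B.dst (u i) b <= k i" "!!i. i \<in> I ==> u i el B" "b el B" for u b k
 proof (rule tendsto_sandwich[OF _ _ tendsto_const that(1)])
  show "\<forall>\<^sub>F i in F. 0 <= B.dst (u i) b"
   using eventually_in by eventually_elim (intro B.dst_nonneg that)
  show "\<forall>\<^sub>F i in F. B.dst (u i) b <= k i"
   using eventually_in by eventually_elim (intro that)
 qed
 have norm_lim: "((%i. norm_of B (h i (f i))) \<longlongrightarrow> norm_of B (H (cls f))) F" if f: "f \<in> cn" for f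
 proof -
  have "((%i. norm_of B (h i (f i)) - norm_of B (H (cls f))) \<longlongrightarrow> 0) F"
  proof (rule Lim_null_comparison[OF _ Hlim[OF f]])
   show "\<forall>\<^sub>F i in F. norm (norm_of B (h i (f i)) - norm_of B (H (cls f))) <= B.dst (h i (f i)) (H (cls f))"
    using eventually_in by eventually_elim
     (simp, intro B.norm_diff_le hc Hc cls_in f)
  qed
  then show ?thesis by (simp add: LIM_zero_iff)
 qed
 have Hnorm: "norm_of B (H x) <= C * norm_of L x" if "x el L" for x
 proof -
  obtain f where f: "f \<in> cn" "x = cls f" using \<open>x el L\<close> by (auto simp: carrier_L)
  show ?thesis unfolding f(2)
  proof (rule tendsto_le[OF net_nonbot tendsto_mult_left[OF norm_tendsto[OF f(1)]] norm_lim[OF f(1)]])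
   show "\<forall>\<^sub>F i in F. norm_of B (h i (f i)) <= C * norm_of (N i) (f i)"
    using eventually_in by eventually_elim (intro hC cn_mem[OF f(1)])
  qed
 qed
 have Hlin: "linear_map L B H"
  unfolding linear_map_def
 proof (intro conjI allI ballI)
  fix x c assume "x el L"
  then obtain f where f: "f \<in> cn" "x = cls f" by (auto simp: carrier_L)
  show "H x el B" using Hc f cls_in by simp
  show "H (scale_of L c x) = scale_of B c (H x)"
   unfolding f(2) scale_cls[OF f(1)]
  proof (rule HI[OF cn_pscale[OF f(1)]], rule B.scale_closed[OF Hc[OF cls_in[OF f(1)]]], rule null_le)
   show "((%i. cmod c * B.dst (h i (f i)) (H (cls f))) \<longlongrightarrow> 0) F"
    using tendsto_mult_right_zero[OF Hlim[OF f(1)]] .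
   show "i \<in> I ==> B.dst (h i (pscale c f i)) (scale_of B c (H (cls f))) <= cmod c * B.dst (h i (f i)) (H (cls f))" for i
    using lin_scale[OF h cn_mem[OF f(1)]] B.dst_scale[OF hc[OF f(1)] Hc[OF cls_in[OF f(1)]]]
    by (simp add: pscale_def)
  qed (use f in \<open>auto intro: hc cn_ops B.scale_closed Hc cls_in\<close>)
  fix y assume "y el L"
  then obtain g where g: "g \<in> cn" "y = cls g" by (auto simp: carrier_L)
  show "H (add_of L x y) = add_of B (H x) (H y)"
   unfolding f(2) g(2) add_cls[OF f(1) g(1)]
  proof (rule HI[OF cn_padd[OF f(1) g(1)]], rule B.add_closed[OF Hc[OF cls_in[OF f(1)]] Hc[OF cls_in[OF g(1)]]], rule null_le)
   show "((%i. B.dst (h i (f i)) (H (cls f)) + B.dst (h i (g i)) (H (cls g))) \<longlongrightarrow> 0) F"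
    using tendsto_add[OF Hlim[OF f(1)] Hlim[OF g(1)]] by simp
   show "i \<in> I ==> B.dst (h i (padd f g i)) (add_of B (H (cls f)) (H (cls g)))
     <= B.dst (h i (f i)) (H (cls f)) + B.dst (h i (g i)) (H (cls g))" for i
    using lin_map_add[OF h cn_mem[OF f(1)] cn_mem[OF g(1)]]
     B.dst_add[OF hc[OF f(1)] Hc[OF cls_in[OF f(1)]] hc[OF g(1)] Hc[OF cls_in[OF g(1)]]]
    by (simp add: padd_def)
  qed (use f g in \<open>auto intro: hc cn_ops B.add_closed Hc cls_in\<close>)
 qed
 show thesis
 proof (rule that)
  show "H \<in> extensional (carrier L)" by (simp add: H_def)
  show "bounded_linear_map L B H" using Hlin Hnorm by (auto simp: bounded_linear_map_def)
  show "norm_of B (H x) <= C * norm_of L x" if "x el L" for x using Hnorm that .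
  show "H (emb i x) = h i x" if ix: "i \<in> I" "x el N i" for i x
   unfolding emb_cls
  proof (rule HI[OF embnet_cn[OF ix] lin_closed[OF h[OF ix(1)] ix(2)]])
   show "((%j. B.dst (h j (embnet i x j)) (h i x)) \<longlongrightarrow> 0) F"
   proof (rule Lim_transform_eventually[OF tendsto_const])
    show "\<forall>\<^sub>F j in F. 0 = B.dst (h j (embnet i x j)) (h i x)"
     using eventually_ge[OF ix(1)] by eventually_elim
      (use ix in \<open>simp add: embnet_def hT B.dst_self lin_closed[OF h]\<close>)
   qed
  qed
  assume sh: "!!i. i \<in> I ==> star_hom (N i) B (h i)"
  show "star_hom L B H"
   unfolding star_hom_def
  proof (intro conjI ballI Hlin)
   fix x assume "x el L"
   then obtain f where f: "f \<in> cn" "x = cls f" by (auto simp: carrier_L)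
   note Hf = Hc[OF cls_in[OF f(1)]]
   show "H (star_of L x) = star_of B (H x)"
    unfolding f(2) star_cls[OF f(1)]
   proof (rule HI[OF cn_pstar[OF f(1)] B.star_closed[OF Hf]], rule null_le[OF Hlim[OF f(1)]])
    show "i \<in> I ==> B.dst (h i (pstar f i)) (star_of B (H (cls f))) <= B.dst (h i (f i)) (H (cls f))" for i
     using star_hom_star[OF sh cn_mem[OF f(1)]] B.dst_star[OF hc[OF f(1)] Hf] by (simp add: pstar_def)
   qed (use f in \<open>auto intro: hc cn_ops B.star_closed Hc cls_in\<close>)
   fix y assume "y el L"
   then obtain g where g: "g \<in> cn" "y = cls g" by (auto simp: carrier_L)
   note Hg = Hc[OF cls_in[OF g(1)]]
   show "H (mult_of L x y) = mult_of B (H x) (H y)"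
    unfolding f(2) g(2) mult_cls[OF f(1) g(1)]
   proof (rule HI[OF cn_pmult[OF f(1) g(1)] B.mult_closed[OF Hf Hg]], rule null_le)
    let ?k = "%i. norm_of B (h i (f i)) * B.dst (h i (g i)) (H (cls g)) +
      B.dst (h i (f i)) (H (cls f)) * norm_of B (H (cls g))"
    have "(?k \<longlongrightarrow> norm_of B (H (cls f)) * 0 + 0 * norm_of B (H (cls g))) F"
     by (intro tendsto_add tendsto_mult norm_lim Hlim f g tendsto_const)
    then show "(?k \<longlongrightarrow> 0) F" by simp
    show "i \<in> I ==> B.dst (h i (pmult f g i)) (mult_of B (H (cls f)) (H (cls g))) <= ?k i" for i
     using star_hom_mult[OF sh cn_mem[OF f(1)] cn_mem[OF g(1)]]
      B.dst_mult[OF hc[OF f(1)] Hf hc[OF g(1)] Hg] by (simp add: pmult_def)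
   qed (use f g in \<open>auto intro: hc cn_ops B.mult_closed Hc cls_in\<close>)
  qed
 qed
qed

end

section \<open>Formal tensors and the minimal norm\<close>

definition lset :: "'a star_alg list => 'a list set" where
 "lset As = listset (map carrier As)"

definition lmul :: "'a star_alg list => 'a list => 'a list => 'a list" where
 "lmul As as bs = map2 (%A (a, b). mult_of A a b) As (zip as bs)"

definition lstar :: "'a star_alg list => 'a list => 'a list" where
 "lstar As as = map2 star_of As as"

definition lprod :: "('a => complex) list => 'a list => complex" where
 "lprod \<phi>s as = prod_list (map2 (%\<phi> a. \<phi> a) \<phi>s as)"

text \<open>The GNS inner product \<open>\<phi>(a* b)\<close> of a product functional, with lists as
  elementary tensors.\<close>

definition skernel :: "'a star_alg list => ('a => complex) list => 'a list => 'a list => complex" where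
 "skernel As \<phi>s as bs = lprod \<phi>s (lmul As (lstar As as) bs)"

lemma lmul_simps [simp]: "lmul [] as bs = []" "lmul (A # As) (a # as) (b # bs) = mult_of A a b # lmul As as bs"
 by (simp_all add: lmul_def)

lemma lstar_simps [simp]: "lstar [] as = []" "lstar (A # As) (a # as) = star_of A a # lstar As as"
 by (simp_all add: lstar_def)

lemma lprod_simps [simp]: "lprod [] as = 1" "lprod (\<phi> # \<phi>s) (a # as) = \<phi> a * lprod \<phi>s as"
 by (simp_all add: lprod_def)

lemma lset_simps [simp]: "lset [] = {[]}" "a # as \<in> lset (A # As) \<longleftrightarrow> a el A \<and> as \<in> lset As"
 by (auto simp: lset_def set_Cons_def)

lemma lset_ConsE: "xs \<in> lset (A # As) ==>
  (!!a as. xs = a # as ==> a el A ==> as \<in> lset As ==> P) ==> P"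
 by (auto simp: lset_def set_Cons_def)

lemma lset_length: "as \<in> lset As ==> length as = length As"
 by (induction As arbitrary: as) (auto elim!: lset_ConsE)

lemma lset_append: "as \<in> lset As ==> bs \<in> lset Bs ==> as @ bs \<in> lset (As @ Bs)"
 by (induction As arbitrary: as) (auto elim!: lset_ConsE)

lemma lset_split:
 "cs \<in> lset (As @ Bs) ==> take (length As) cs \<in> lset As \<and> drop (length As) cs \<in> lset Bs"
proof (induction As arbitrary: cs)
 case (Cons A As)
 from Cons.prems have "cs \<in> lset (A # (As @ Bs))" by simp
 then show ?case using Cons.IH by (auto elim!: lset_ConsE)
qed simp

lemma lmul_append: "length as = length As ==> length as' = length As ==>
  lmul (As @ Bs) (as @ bs) (as' @ bs') = lmul As as as' @ lmul Bs bs bs'"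
 by (simp add: lmul_def)

lemma lstar_append: "length as = length As ==> lstar (As @ Bs) (as @ bs) = lstar As as @ lstar Bs bs"
 by (simp add: lstar_def)

lemma lprod_append: "length as = length \<phi>s ==> lprod (\<phi>s @ \<psi>s) (as @ bs) = lprod \<phi>s as * lprod \<psi>s bs"
 by (simp add: lprod_def)

lemma formal_scale_psc: "formal_scale = psc"
 by (intro ext) (simp add: formal_scale_def psc_def)

lemma psc_sum: "psc c (\<Sum>i\<in>I. u i) = (\<Sum>i\<in>I. psc c (u i))"
 by (rule poly_mapping_eqI) (simp add: lookup_sum sum_distrib_left)

lemma formal_mult_av: "formal_mult As u v = av (lmul As) u v"
 by (simp add: formal_mult_def av_def ext_def lmul_def[symmetric] psc_sum)

lemma formal_star_pst: "formal_star As u = pst (lstar As) u"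
 by (simp add: formal_star_def pst_def lstar_def)

lemma formal_functional_lin: "formal_functional \<phi>s u = lin (lprod \<phi>s) u"
 by (simp add: formal_functional_def lin_def lprod_def)

text \<open>Translates the quantities in \<open>min_norm\<close> into kernel language:
  \<open>\<phi>(u* v)\<close> is the GNS form, so the quotients there are quotients of values of
  \<open>hn\<close>.\<close>

lemma formal_functional_form:
 "formal_functional \<phi>s (formal_mult As (formal_star As u) v) = form (skernel As \<phi>s) u v"
 by (simp add: formal_functional_lin formal_mult_av formal_star_pst lin_av lin_pst form_conv skernel_def[abs_def])

lemma formal_append_ext: "formal_append u v = ext (%as. ext (%bs. single (as @ bs) 1) v) u"
 by (simp add: formal_append_def ext_def psc_sum)

text \<open>Identities between formal tensors are proved by testing with arbitrary functionals: both
  sides become iterated \<open>lin\<close>, where \<open>lin_swap\<close> and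
  \<open>lin_cong\<close> apply.\<close>

lemma lin_extensionality: "(!!f. lin f u = lin f v) ==> u = v"
proof (rule poly_mapping_eqI)
 fix k assume *: "!!f. lin f u = lin f v"
 have "lookup u k = lin (%j. if j = k then 1 else 0) u" for u :: "'a \<Rightarrow>\<^sub>0 complex"
  by (auto simp: lin_def if_distrib[where f="%x. _ * x"] sum.delta' in_keys_iff cong: if_cong)
 then show "lookup u k = lookup v k" using * by metis
qed

lemma cstar_pre: "cstar_algebra A ==> pre_cstar A"
proof -
 assume "cstar_algebra A"
 then interpret cstar_algebra A .
 show ?thesis by unfold_locales
qed

lemma linear_functional_zero: "linear_map A complex_alg f ==> cstar_algebra A ==> f (zero_of A) = 0"
 using linear_map_zero[of A complex_alg f] cstar_complex_alg by (simp add: cstar_pre)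

text \<open>A formal combination of elements of an algebra acts on linear functionals like the
  element it sums to. Positivity of a functional on single elements thereby yields positivity of its
  kernel on combinations.\<close>

lemma represent_combination:
 assumes A: "cstar_algebra A" and w: "w on carrier A"
 shows "\<exists>x\<in>carrier A. \<forall>f. linear_map A complex_alg f \<longrightarrow> lin f w = f x"
 using w
proof (induction w rule: finsupp_induct)
 case zero
 interpret cstar_algebra A by fact
 show ?case using zero_closed linear_functional_zero[OF _ A] by (intro bexI[of _ "zero_of A"]) auto
next
 case (add k c w)
 interpret cstar_algebra A by fact
 obtain x where x: "x el A" "\<forall>f. linear_map A complex_alg f \<longrightarrow> lin f w = f x" using add by blast
 show ?case
  by (intro bexI[of _ "add_of A (scale_of A c k) x"])
   (use x add in \<open>auto simp: lin_add lin_map_add lin_scale closed\<close>)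
qed

definition functional_kernel :: "'a star_alg => ('a => complex) => 'a => 'a => complex" where
 "functional_kernel A \<phi> a b = \<phi> (mult_of A (star_of A a) b)"

text \<open>A state without the normalization; vector functionals are of this kind before
  scaling.\<close>

definition positive_functional :: "'a star_alg => ('a => complex) => bool" where
 "positive_functional A \<phi> \<longleftrightarrow> linear_map A complex_alg \<phi> \<and>
   (\<forall>x\<in>carrier A. \<phi> (mult_of A (star_of A x) x) \<in> \<real>\<^sub>\<ge>\<^sub>0)"

lemma state_positive: "state A \<phi> ==> positive_functional A \<phi>"
 by (simp add: state_def positive_functional_def)

lemma pd_functional_kernel:
 assumes A: "cstar_algebra A" and phi: "positive_functional A \<phi>"
 shows "pd (carrier A) (functional_kernel A \<phi>)"
 unfolding pd_def
proof (intro allI impI)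
 interpret cstar_algebra A by fact
 fix w :: "'a \<Rightarrow>\<^sub>0 complex" assume w: "w on carrier A"
 have lin: "linear_map A complex_alg \<phi>" using phi by (simp add: positive_functional_def)
 obtain x where x: "x el A" "!!f. linear_map A complex_alg f ==> lin f w = f x"
  using represent_combination[OF A w] by blast
 have 1: "lin (functional_kernel A \<phi> a) w = \<phi> (mult_of A (star_of A a) x)" if "a el A" for a
  using that by (subst x(2)) (auto simp: linear_map_def functional_kernel_def mult_add mult_scale closed
    lin_map_add[OF lin] lin_scale[OF lin])
 have "form (functional_kernel A \<phi>) w w = cnj (lin (%a. cnj (\<phi> (mult_of A (star_of A a) x))) w)"
  unfolding form_conv using w 1 by (intro arg_cong[of _ _ cnj] lin_cong) auto
 also have "... = \<phi> (mult_of A (star_of A x) x)"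
  by (subst x(2)) (auto simp: linear_map_def add_mult scale_mult star_add star_scale closed x(1)
    lin_map_add[OF lin] lin_scale[OF lin])
 also have "... \<in> \<real>\<^sub>\<ge>\<^sub>0" using phi x by (simp add: positive_functional_def)
 finally show "form (functional_kernel A \<phi>) w w \<in> \<real>\<^sub>\<ge>\<^sub>0" .
qed

lemma cstar_rep_functional:
 assumes A: "cstar_algebra A" and phi: "positive_functional A \<phi>"
 shows "cstar_rep A (carrier A) (mult_of A) (functional_kernel A \<phi>)"
proof -
 interpret cstar_algebra A by fact
 have lin: "linear_map A complex_alg \<phi>" using phi by (simp add: positive_functional_def)
 show ?thesis
  by (intro cstar_rep.intro linear_rep.intro star_rep.intro linear_rep_axioms.intro A
    pd_functional_kernel phi)
   (auto simp: functional_kernel_def closed star_mult mult_assoc add_mult mult_add scale_mult mult_scale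
    lin_map_add[OF lin] lin_scale[OF lin])
qed

locale cstar_list =
 fixes As :: "'a star_alg list"
 assumes cstar: "A \<in> set As ==> cstar_algebra A"
begin

lemma lmul_closed: "as \<in> lset As ==> bs \<in> lset As ==> lmul As as bs \<in> lset As"
 using cstar
proof (induction As arbitrary: as bs)
 case (Cons A As)
 then interpret A: cstar_algebra A by simp
 from Cons show ?case by (auto elim!: lset_ConsE simp: A.closed)
qed simp

lemma lstar_closed: "as \<in> lset As ==> lstar As as \<in> lset As"
 using cstar
proof (induction As arbitrary: as)
 case (Cons A As)
 then interpret A: cstar_algebra A by simp
 from Cons show ?case by (auto elim!: lset_ConsE simp: A.closed)
qed simp

lemma lmul_assoc: "as \<in> lset As ==> bs \<in> lset As ==> cs \<in> lset As ==>
  lmul As (lmul As as bs) cs = lmul As as (lmul As bs cs)"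
 using cstar
proof (induction As arbitrary: as bs cs)
 case (Cons A As)
 then interpret A: cstar_algebra A by simp
 from Cons show ?case by (auto elim!: lset_ConsE simp: A.mult_assoc)
qed simp

lemma lstar_lmul: "as \<in> lset As ==> bs \<in> lset As ==>
  lstar As (lmul As as bs) = lmul As (lstar As bs) (lstar As as)"
 using cstar
proof (induction As arbitrary: as bs)
 case (Cons A As)
 then interpret A: cstar_algebra A by simp
 from Cons show ?case by (auto elim!: lset_ConsE simp: A.star_mult)
qed simp

lemma lstar_lstar: "as \<in> lset As ==> lstar As (lstar As as) = as"
 using cstar
proof (induction As arbitrary: as)
 case (Cons A As)
 then interpret A: cstar_algebra A by simp
 from Cons show ?case by (auto elim!: lset_ConsE simp: A.star_star)
qed simp

abbreviation "states \<phi>s \<equiv> list_all2 state As \<phi>s"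

text \<open>Factor by factor from \<open>schur_product\<close>, pairs being heads and tails of
  lists. For the empty list the form is the squared modulus of the single coefficient.\<close>

lemma pd_state_kernel: "states \<phi>s ==> pd (lset As) (skernel As \<phi>s)"
 using cstar
proof (induction As arbitrary: \<phi>s)
 case Nil
 have "form (skernel [] []) w w = lookup w [] * cnj (lookup w [])" if "w on {[]}" for w :: "'a list \<Rightarrow>\<^sub>0 complex"
 proof -
  have "lin g w = lookup w [] * g []" for g using lin_superset[of "{[]}" w g] that by simp
  then show ?thesis by (simp add: form_def skernel_def)
 qed
 then have "form (skernel [] []) w w = of_real ((cmod (lookup w []))\<^sup>2)" if "w on {[]}" for w :: "'a list \<Rightarrow>\<^sub>0 complex"
  using that by (simp only: complex_norm_square)
 then show ?case using Nil by (simp add: pd_def)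
next
 case (Cons A As)
 then obtain \<phi> \<psi>s where phi: "\<phi>s = \<phi> # \<psi>s" "state A \<phi>" "list_all2 state As \<psi>s"
  by (auto simp: list_all2_Cons1)
 have A: "cstar_algebra A" using Cons by simp
 have "pd (carrier A \<times> lset As) (pkernel (functional_kernel A \<phi>) (skernel As \<psi>s))"
  using Cons phi A by (intro schur_product pd_functional_kernel state_positive) auto
 then have "pd (lset (A # As)) (%xs ys. form (pkernel (functional_kernel A \<phi>) (skernel As \<psi>s))
   (single (hd xs, tl xs) 1) (single (hd ys, tl ys) 1))"
  by (rule pd_pullback) (auto elim!: lset_ConsE)
 then have "pd (lset (A # As)) (%xs ys. pkernel (functional_kernel A \<phi>) (skernel As \<psi>s) (hd xs, tl xs) (hd ys, tl ys))"
  by simp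
 then show ?case unfolding phi
  by (rule pd_cong) (auto elim!: lset_ConsE simp: skernel_def functional_kernel_def)
qed

lemma star_rep_state: "states \<phi>s ==>
  star_rep (lset As) (lmul As) (lstar As) (lset As) (lmul As) (skernel As \<phi>s)"
 by unfold_locales (auto simp: lmul_closed lstar_closed pd_state_kernel skernel_def lstar_lmul lmul_assoc)

end

lemma cstar_list_Cons: "cstar_list (A # As) \<longleftrightarrow> cstar_algebra A \<and> cstar_list As"
 by (auto simp: cstar_list_def)

lemma cstar_list_append: "cstar_list (As @ Bs) \<longleftrightarrow> cstar_list As \<and> cstar_list Bs"
 by (auto simp: cstar_list_def)

definition pairp :: "('m \<Rightarrow>\<^sub>0 complex) => ('n \<Rightarrow>\<^sub>0 complex) => ('m \<times> 'n \<Rightarrow>\<^sub>0 complex)" where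
 "pairp u v = ext (%a. ext (%b. single (a, b) 1) v) u"

text \<open>The operator \<open>u tensor v\<close> transforms the product kernel into the product of
  the two transformed kernels, so the factorwise inequalities combine by
  \<open>schur_mono\<close>.\<close>

lemma opbd_pairp:
 assumes r1: "star_rep M1 mul1 st1 S1 act1 K1" and r2: "star_rep M2 mul2 st2 S2 act2 K2"
  and u: "u on M1" and v: "v on M2"
  and b1: "opbd S1 act1 K1 u N1" and b2: "opbd S2 act2 K2 v N2" and N: "0 <= N1" "0 <= N2"
 shows "opbd (S1 \<times> S2) (%(m, n). map_prod (act1 m) (act2 n)) (pkernel K1 K2) (pairp u v) (N1 * N2)"
 unfolding opbd_def
proof (intro allI impI)
 interpret R1: star_rep M1 mul1 st1 S1 act1 K1 by fact
 interpret R2: star_rep M2 mul2 st2 S2 act2 K2 by fact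
 fix w assume w: "w on S1 \<times> S2"
 define L1 where "L1 s t = form K1 (av act1 u (single s 1)) (av act1 u (single t 1))" for s t
 define L2 where "L2 s t = form K2 (av act2 v (single s 1)) (av act2 v (single t 1))" for s t
 let ?a = "%(m, n). map_prod (act1 m) (act2 n)"
 have k1: "(av act1 u (single s 1)) on S1" if "s \<in> S1" for s by (intro R1.keys_act u) (use that in simp)
 have e: "av ?a (pairp u v) w = ext (%s. pairp (av act1 u (single (fst s) 1)) (av act2 v (single (snd s) 1))) w"
  by (rule lin_extensionality)
   (simp add: lin_av pairp_def lin_ext lin_swap[where v=w] map_prod_def case_prod_unfold)
 have pf: "form (pkernel K1 K2) (pairp x y) (pairp x' y') = form K1 x x' * form K2 y y'" for x y x' y'
 proof -
  have "form (pkernel K1 K2) (pairp x y) (pairp x' y') = form (%a a'. form K2 y y' * K1 a a') x x'"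
   unfolding pairp_def form_ext by (simp add: form_fun_mult mult.commute)
  then show ?thesis by (simp add: form_fun_mult)
 qed
 have "form (pkernel K1 K2) (av ?a (pairp u v) w) (av ?a (pairp u v) w) = form (pkernel L1 L2) w w"
  unfolding e form_ext pf by (simp add: pkernel_def L1_def L2_def)
 moreover have "Re (form (pkernel L1 L2) w w) <= N1\<^sup>2 * N2\<^sup>2 * Re (form (pkernel K1 K2) w w)"
 proof (rule schur_mono[OF R1.pd R2.pd _ _ _ _ w])
  show "pd S1 L1" unfolding L1_def by (rule pd_pullback[OF R1.pd k1])
  show "pd S1 (%s t. of_real (N1\<^sup>2) * K1 s t - L1 s t)"
   unfolding L1_def by (rule opbd_iff_pd[OF r1 u b1 N(1)])
  show "pd S2 (%s t. of_real (N2\<^sup>2) * K2 s t - L2 s t)"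
   unfolding L2_def by (rule opbd_iff_pd[OF r2 v b2 N(2)])
 qed simp
 ultimately have "sqrt (Re (form (pkernel K1 K2) (av ?a (pairp u v) w) (av ?a (pairp u v) w)))
   <= sqrt ((N1 * N2)\<^sup>2 * Re (form (pkernel K1 K2) w w))"
  by (simp add: power_mult_distrib)
 then show "hn (pkernel K1 K2) (av ?a (pairp u v) w) <= N1 * N2 * hn (pkernel K1 K2) w"
  using N by (simp add: hn_def real_sqrt_mult)
qed

lemma av_pmap: "av act (ext (%m. single (q m) 1) u) w = av (%m. act (q m)) u w"
 by (simp add: av_def ext_ext)

lemma skernel_append:
 assumes "cstar_list As" "as \<in> lset As" "as' \<in> lset As" "length \<phi>s = length As"
 shows "skernel (As @ Bs) (\<phi>s @ \<psi>s) (as @ bs) (as' @ bs') =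
  skernel As \<phi>s as as' * skernel Bs \<psi>s bs bs'"
 using assms cstar_list.lmul_closed[OF assms(1) cstar_list.lstar_closed[OF assms(1,2)] assms(3)]
  cstar_list.lstar_closed[OF assms(1,2)]
 by (simp add: skernel_def lstar_append lmul_append lprod_append lset_length)

abbreviation "split_act As Bs \<equiv>
 pact (%m. lmul As (take (length As) m)) (%m. lmul Bs (drop (length As) m))"

text \<open>Cutting a list at \<open>length As\<close> identifies the space of the concatenated
  state list with the product of the two spaces; both directions are relabellings.\<close>

lemma opbd_append_iff:
 assumes As: "cstar_list As" and Bs: "cstar_list Bs" and l: "length \<phi>s = length As"
  and u: "u on lset (As @ Bs)"
 shows "opbd (lset (As @ Bs)) (lmul (As @ Bs)) (skernel (As @ Bs) (\<phi>s @ \<psi>s)) u N \<longleftrightarrow>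
  opbd (lset As \<times> lset Bs) (split_act As Bs) (pkernel (skernel As \<phi>s) (skernel Bs \<psi>s)) u N"
  (is "?L \<longleftrightarrow> ?R")
proof -
 interpret A: cstar_list As by fact
 interpret B: cstar_list Bs by fact
 define K where "K = skernel (As @ Bs) (\<phi>s @ \<psi>s)"
 have K: "K (as @ bs) (as' @ bs') = skernel As \<phi>s as as' * skernel Bs \<psi>s bs bs'"
  if "as \<in> lset As" "as' \<in> lset As" for as as' bs bs'
  unfolding K_def by (rule skernel_append[OF As that l])
 have mul: "lmul (As @ Bs) m (as @ bs) = lmul As (take (length As) m) as @ lmul Bs (drop (length As) m) bs"
  if "m \<in> lset (As @ Bs)" "as \<in> lset As" for m as bs
  using lmul_append[of "take (length As) m" As as Bs "drop (length As) m" bs] lset_length[OF that(1)]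
   lset_length[OF that(2)] by simp
 have sp: "take (length As) s @ drop (length As) s = s" for s :: "'a list" by simp
 show ?thesis
 proof
  assume L: ?L
  show ?R
  proof (rule opbd_relabel[OF L u, of _ "%(as, bs). as @ bs"])
   fix m n s t assume h: "m \<in> lset (As @ Bs)" "n \<in> lset (As @ Bs)" "s \<in> lset As \<times> lset Bs" "t \<in> lset As \<times> lset Bs"
   obtain a b a' b' where st: "s = (a, b)" "t = (a', b')" by fastforce
   show "pkernel (skernel As \<phi>s) (skernel Bs \<psi>s) (split_act As Bs m s) (split_act As Bs n t) =
    skernel (As @ Bs) (\<phi>s @ \<psi>s) (lmul (As @ Bs) m (case s of (as, bs) => as @ bs))
     (lmul (As @ Bs) n (case t of (as, bs) => as @ bs))"
    unfolding K_def[symmetric] using h lset_split[OF h(1)] lset_split[OF h(2)]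
    by (simp add: st mul K pact_def A.lmul_closed)
  qed (auto intro: lset_append simp: K[unfolded K_def])
 next
  assume R: ?R
  show ?L
  proof (rule opbd_relabel[OF R u, of _ "%s. (take (length As) s, drop (length As) s)"])
   fix s t assume h: "s \<in> lset (As @ Bs)" "t \<in> lset (As @ Bs)"
   show "skernel (As @ Bs) (\<phi>s @ \<psi>s) s t = pkernel (skernel As \<phi>s) (skernel Bs \<psi>s)
     (take (length As) s, drop (length As) s) (take (length As) t, drop (length As) t)"
    using K[of "take (length As) s" "take (length As) t" "drop (length As) s" "drop (length As) t"]
     lset_split[OF h(1)] lset_split[OF h(2)] by (simp add: K_def)
   fix m n assume mn: "m \<in> lset (As @ Bs)" "n \<in> lset (As @ Bs)"
   show "skernel (As @ Bs) (\<phi>s @ \<psi>s) (lmul (As @ Bs) m s) (lmul (As @ Bs) n t) =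
     pkernel (skernel As \<phi>s) (skernel Bs \<psi>s)
     (split_act As Bs m (take (length As) s, drop (length As) s))
     (split_act As Bs n (take (length As) t, drop (length As) t))"
    using mul[OF mn(1), of "take (length As) s" "drop (length As) s"]
     mul[OF mn(2), of "take (length As) t" "drop (length As) t"]
     lset_split[OF h(1)] lset_split[OF h(2)] lset_split[OF mn(1)] lset_split[OF mn(2)]
    by (simp add: K K_def[symmetric] pact_def A.lmul_closed)
  qed (use lset_split in blast)
 qed
qed

context cstar_list
begin

text \<open>Induction on the list: the head contributes the bound of a C*-algebra representation,
  and \<open>opbd_pairp\<close> joins it to the tail. Nonnegativity of the product is carried along
  since \<open>opbd_pairp\<close> asks for it.\<close>

lemma opbd_single_list:
 "states \<phi>s ==> as \<in> lset As ==>
  opbd (lset As) (lmul As) (skernel As \<phi>s) (single as 1) (prod_list (map2 norm_of As as))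
  \<and> 0 <= prod_list (map2 norm_of As as)"
 using cstar_list_axioms
proof (induction As arbitrary: \<phi>s as)
 case Nil
 have "av (lmul []) (single [] 1) w = w" if "w on {[]}" for w :: "'a list \<Rightarrow>\<^sub>0 complex"
 proof -
  have "ext (%s. single (lmul [] [] s) 1) w = ext (%s. single s 1) w"
   using that by (intro ext_cong) auto
  then show ?thesis by (simp add: av_single_left)
 qed
 moreover have "lmul [] = (%a b. [] :: 'a list)" by (simp add: fun_eq_iff)
 ultimately show ?case using Nil by (simp add: opbd_def)
next
 case (Cons A As)
 then obtain \<phi> \<psi>s where phi: "\<phi>s = \<phi> # \<psi>s" "state A \<phi>" "list_all2 state As \<psi>s"
  by (auto simp: list_all2_Cons1)
 obtain a bs where as: "as = a # bs" "a el A" "bs \<in> lset As" using Cons by (auto elim!: lset_ConsE)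
 have A: "cstar_algebra A" and L: "cstar_list As" using Cons(4) by (auto simp: cstar_list_Cons)
 interpret A: cstar_algebra A by fact
 interpret L: cstar_list As by fact
 interpret R: cstar_rep A "carrier A" "mult_of A" "functional_kernel A \<phi>"
  by (rule cstar_rep_functional[OF A state_positive[OF phi(2)]])
 have IH: "opbd (lset As) (lmul As) (skernel As \<psi>s) (single bs 1) (prod_list (map2 norm_of As bs))"
  "0 <= prod_list (map2 norm_of As bs)" using Cons.IH[OF phi(3) as(3) L] by auto
 let ?N = "norm_of A a * prod_list (map2 norm_of As bs)"
 have "opbd (carrier A \<times> lset As) (%(m, n). map_prod (mult_of A m) (lmul As n))
   (pkernel (functional_kernel A \<phi>) (skernel As \<psi>s)) (pairp (single a 1) (single bs 1)) ?N"
  using as IH A.norm_nonneg by (intro opbd_pairp[OF R.star_rep_axioms L.star_rep_state[OF phi(3)]] R.opbd_single) auto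
 also have "pairp (single a 1) (single bs 1) = ext (%m. single (hd m, tl m) 1) (single as 1)"
  by (simp add: pairp_def as)
 finally have bd: "opbd (carrier A \<times> lset As) (%m. map_prod (mult_of A (hd m)) (lmul As (tl m)))
   (pkernel (functional_kernel A \<phi>) (skernel As \<psi>s)) (single as 1) ?N"
  unfolding opbd_def av_pmap by simp
 have "opbd (lset (A # As)) (lmul (A # As)) (skernel (A # As) \<phi>s) (single as 1) ?N"
  by (rule opbd_relabel[OF bd, of "lset (A # As)" _ "%s. (hd s, tl s)"])
   (auto elim!: lset_ConsE simp: as phi skernel_def functional_kernel_def)
 then show ?case using as IH A.norm_nonneg by simp
qed

text \<open>The bound comes from the norms of the entries and is therefore uniform in the state
  list, which makes the supremum in \<open>min_norm\<close> finite. Lists of algebras without states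
  are settled separately, as then nothing has to be bounded.\<close>

lemma formal_bounded:
 assumes "u on lset As"
 shows "\<exists>C\<ge>0. \<forall>\<phi>s. states \<phi>s \<longrightarrow> opbd (lset As) (lmul As) (skernel As \<phi>s) u C"
 using assms
proof (induction u rule: finsupp_induct)
 case zero
 show ?case by (intro exI[of _ 0]) (auto simp: opbd_def hn_def)
next
 case (add k c u)
 obtain C where C: "0 <= C" "!!\<phi>s. states \<phi>s ==> opbd (lset As) (lmul As) (skernel As \<phi>s) u C"
  using add by blast
 let ?n = "prod_list (map2 norm_of As k)"
 show ?case
 proof (cases "\<exists>\<phi>s. states \<phi>s")
  case True
  then have n: "0 <= ?n" using opbd_single_list add by blast
  have "opbd (lset As) (lmul As) (skernel As \<phi>s) (single k c + u) (cmod c * ?n + C)" if s: "states \<phi>s" for \<phi>s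
  proof -
   interpret R: star_rep "lset As" "lmul As" "lstar As" "lset As" "lmul As" "skernel As \<phi>s"
    by (rule star_rep_state[OF s])
   have "opbd (lset As) (lmul As) (skernel As \<phi>s) (psc c (single k 1)) (cmod c * ?n)"
    using R.opbd_psc opbd_single_list[OF s add(1)] by blast
   then show ?thesis using C(2)[OF s] add by (intro R.opbd_add) auto
  qed
  then show ?thesis using n C by (intro exI[of _ "cmod c * ?n + C"]) auto
 qed auto
qed

lemma min_norm_set:
 "min_norm As u = Sup (insert 0 {hn (skernel As \<phi>s) (av (lmul As) u v) / hn (skernel As \<phi>s) v | \<phi>s v.
   states \<phi>s \<and> v on lset As \<and> form (skernel As \<phi>s) v v \<noteq> 0})"
 unfolding min_norm_def real_sqrt_divide formal_tensors_def hn_def formal_mult_av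
  formal_functional_form[unfolded formal_mult_av] lset_def[symmetric] by simp

lemma form_nonzero:
 assumes "states \<phi>s" "v on lset As" "form (skernel As \<phi>s) v v \<noteq> 0"
 shows "0 < hn (skernel As \<phi>s) v"
 using pd_form_of_real[OF pd_state_kernel[OF assms(1)] assms(2)] hn_nonneg[OF pd_state_kernel[OF assms(1)] assms(2)]
  assms(3) by (cases "hn (skernel As \<phi>s) v = 0") (auto simp: hn_def)

lemma min_norm_bdd:
 assumes u: "u on lset As"
 shows "bdd_above (insert 0 {hn (skernel As \<phi>s) (av (lmul As) u v) / hn (skernel As \<phi>s) v | \<phi>s v.
   states \<phi>s \<and> v on lset As \<and> form (skernel As \<phi>s) v v \<noteq> 0})"
proof -
 obtain C where C: "0 <= C" "!!\<phi>s. states \<phi>s ==> opbd (lset As) (lmul As) (skernel As \<phi>s) u C"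
  using formal_bounded[OF u] by blast
 show ?thesis
 proof (rule bdd_aboveI[of _ C])
  fix x assume "x \<in> insert 0 {hn (skernel As \<phi>s) (av (lmul As) u v) / hn (skernel As \<phi>s) v | \<phi>s v.
   states \<phi>s \<and> v on lset As \<and> form (skernel As \<phi>s) v v \<noteq> 0}"
  then show "x <= C"
  proof
   assume "x \<in> {hn (skernel As \<phi>s) (av (lmul As) u v) / hn (skernel As \<phi>s) v | \<phi>s v.
    states \<phi>s \<and> v on lset As \<and> form (skernel As \<phi>s) v v \<noteq> 0}"
   then obtain \<phi>s v where x: "x = hn (skernel As \<phi>s) (av (lmul As) u v) / hn (skernel As \<phi>s) v"
    and v: "states \<phi>s" "v on lset As" "form (skernel As \<phi>s) v v \<noteq> 0" by blast
   show ?thesis unfolding x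
    using C(2)[OF v(1)] v form_nonzero[OF v] by (simp add: opbd_def pos_divide_le_eq)
  qed (use C in simp)
 qed
qed

lemma min_norm_ge0: "u on lset As ==> 0 <= min_norm As u"
 unfolding min_norm_set by (rule cSup_upper[OF _ min_norm_bdd]) auto

text \<open>The supremum runs over vectors of nonzero norm; null vectors are sent to null vectors by
  \<open>formal_bounded\<close>.\<close>

lemma opbd_min_norm:
 assumes u: "u on lset As" and s: "states \<phi>s"
 shows "opbd (lset As) (lmul As) (skernel As \<phi>s) u (min_norm As u)"
 unfolding opbd_def
proof (intro allI impI)
 fix w assume w: "w on lset As"
 note pd = pd_state_kernel[OF s]
 show "hn (skernel As \<phi>s) (av (lmul As) u w) <= min_norm As u * hn (skernel As \<phi>s) w"
 proof (cases "form (skernel As \<phi>s) w w = 0")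
  case True
  obtain C where "opbd (lset As) (lmul As) (skernel As \<phi>s) u C" using formal_bounded[OF u] s by blast
  then have "hn (skernel As \<phi>s) (av (lmul As) u w) <= C * hn (skernel As \<phi>s) w"
   using w by (simp add: opbd_def)
  then show ?thesis using True by (simp add: hn_def)
 next
  case False
  have "hn (skernel As \<phi>s) (av (lmul As) u w) / hn (skernel As \<phi>s) w <= min_norm As u"
   unfolding min_norm_set by (rule cSup_upper[OF _ min_norm_bdd[OF u]]) (use s w False in blast)
  then show ?thesis using form_nonzero[OF s w False] by (simp add: pos_divide_le_eq)
 qed
qed

lemma min_norm_le:
 assumes N: "0 <= N" and bd: "!!\<phi>s. states \<phi>s ==> opbd (lset As) (lmul As) (skernel As \<phi>s) u N"
 shows "min_norm As u <= N"
 unfolding min_norm_set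
proof (rule cSup_least)
 fix x assume "x \<in> insert 0 {hn (skernel As \<phi>s) (av (lmul As) u v) / hn (skernel As \<phi>s) v | \<phi>s v.
   states \<phi>s \<and> v on lset As \<and> form (skernel As \<phi>s) v v \<noteq> 0}"
 then show "x <= N"
 proof
  assume "x \<in> {hn (skernel As \<phi>s) (av (lmul As) u v) / hn (skernel As \<phi>s) v | \<phi>s v.
    states \<phi>s \<and> v on lset As \<and> form (skernel As \<phi>s) v v \<noteq> 0}"
  then obtain \<phi>s v where x: "x = hn (skernel As \<phi>s) (av (lmul As) u v) / hn (skernel As \<phi>s) v"
   and v: "states \<phi>s" "v on lset As" "form (skernel As \<phi>s) v v \<noteq> 0" by blast
  show ?thesis unfolding x
   using bd[OF v(1)] v form_nonzero[OF v] by (simp add: opbd_def pos_divide_le_eq)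
 qed (use N in simp)
qed simp

lemma formal_alg_simps [simp]:
 "carrier (formal_alg As) = {u. u on lset As}" "add_of (formal_alg As) u v = u + v"
 "zero_of (formal_alg As) = 0" "scale_of (formal_alg As) c u = psc c u"
 "mult_of (formal_alg As) u v = av (lmul As) u v" "star_of (formal_alg As) u = pst (lstar As) u"
 "norm_of (formal_alg As) u = min_norm As u"
 by (simp_all add: formal_alg_def formal_tensors_def formal_scale_psc formal_mult_av formal_star_pst lset_def)

lemma formal_alg_minus [simp]: "minus_of (formal_alg As) u v = u - v"
 by (simp add: minus_of_def psc_uminus)

lemma pst_psc: "pst st (psc c u) = psc (cnj c) (pst st u)"
 by (rule lin_extensionality) (simp add: lin_pst lin_psc)

lemma keys_lmul: "u on lset As ==> v on lset As ==> (av (lmul As) u v) on lset As"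
 by (rule keys_av) (auto intro: lmul_closed)

lemma keys_lstar: "u on lset As ==> (pst (lstar As) u) on lset As"
 by (rule keys_pst) (auto intro: lstar_closed)

lemma pre_cstar_formal_alg: "pre_cstar (formal_alg As)"
proof (rule pre_cstar.intro, unfold formal_alg_simps formal_alg_minus mem_Collect_eq)
 fix u v w c d
 assume u: "u on lset As"
 show "(psc c u) on lset As" using u by (simp add: keys_psc_subset)
 show "(pst (lstar As) u) on lset As" using u by (simp add: keys_lstar)
 show "pst (lstar As) (pst (lstar As) u) = u"
 proof (rule lin_extensionality)
  fix f
  show "lin f (pst (lstar As) (pst (lstar As) u)) = lin f u"
   unfolding lin_pst complex_cnj_cnj using u
   by (intro lin_cong) (auto simp: lstar_lstar)
 qed
 show "0 <= min_norm As u" using min_norm_ge0[OF u] by simp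
 have bd: "opbd (lset As) (lmul As) (skernel As \<phi>s) u (min_norm As u)" if "states \<phi>s" for \<phi>s
  by (rule opbd_min_norm[OF u that])
 note rep = star_rep_state
 \<comment> \<open>This inequality, applied to \<open>c\<close> and to \<open>1 / c\<close>, gives
   equality; \<open>c = 0\<close> is separate.\<close>
 have sc: "min_norm As (psc c u) <= cmod c * min_norm As u" if "u on lset As" for c u
  by (rule min_norm_le) (use that min_norm_ge0 in \<open>auto intro!: star_rep.opbd_psc[OF rep] opbd_min_norm\<close>)
 show "min_norm As (psc c u) = cmod c * min_norm As u"
 proof (cases "c = 0")
  case True
  have "min_norm As 0 <= 0" by (rule min_norm_le) (auto simp: opbd_def hn_def)
  then show ?thesis using True min_norm_ge0[of 0] by simp
 next
  case False
  have "cmod c * min_norm As u = cmod c * min_norm As (psc (1 / c) (psc c u))" using False by simp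
  also have "... <= cmod c * (cmod (1 / c) * min_norm As (psc c u))"
   by (intro mult_left_mono sc keys_psc_subset u) simp
  also have "... = min_norm As (psc c u)" using False by (simp add: norm_divide)
  finally show ?thesis using sc[OF u, of c] by simp
 qed
 have su: "(pst (lstar As) u) on lset As" by (rule keys_lstar[OF u])
 have su_bd: "min_norm As (pst (lstar As) u) <= min_norm As u"
  by (intro min_norm_le min_norm_ge0 u star_rep.opbd_star[OF rep] bd)
 have mul_bd: "min_norm As (av (lmul As) x y) <= min_norm As x * min_norm As y"
  if "x on lset As" "y on lset As" for x y
  by (intro min_norm_le mult_nonneg_nonneg min_norm_ge0 that star_rep.opbd_mult[OF rep] opbd_min_norm)
 show "min_norm As (av (lmul As) (pst (lstar As) u) u) = (min_norm As u)\<^sup>2"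
 proof (rule antisym)
  let ?x = "av (lmul As) (pst (lstar As) u) u"
  have x: "?x on lset As" by (intro keys_lmul su u)
  have "min_norm As ?x <= min_norm As (pst (lstar As) u) * min_norm As u" by (rule mul_bd[OF su u])
  also have "... <= min_norm As u * min_norm As u" by (intro mult_right_mono su_bd min_norm_ge0 u)
  finally show "min_norm As (av (lmul As) (pst (lstar As) u) u) <= (min_norm As u)\<^sup>2"
   by (simp add: power2_eq_square)
  \<comment> \<open>The lower half of the C*-identity: in every state list,
    \<open>||u w||^2 = <w, u* u w>\<close>.\<close>
  have "min_norm As u <= sqrt (min_norm As ?x)"
  proof (rule min_norm_le)
   fix \<phi>s assume s: "states \<phi>s"
   interpret R: star_rep "lset As" "lmul As" "lstar As" "lset As" "lmul As" "skernel As \<phi>s"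
    by (rule star_rep_state[OF s])
   show "opbd (lset As) (lmul As) (skernel As \<phi>s) u (sqrt (min_norm As ?x))"
    unfolding opbd_def
   proof (intro allI impI)
    fix w assume w: "w on lset As"
    let ?K = "skernel As \<phi>s"
    have k: "(av (lmul As) u w) on lset As" by (rule R.keys_act[OF u w])
    have "(hn ?K (av (lmul As) u w))\<^sup>2 = Re (form ?K w (av (lmul As) ?x w))"
     using R.sq_power_0[OF u w w] by (simp add: hn_sq[OF R.pd k])
    also have "... <= hn ?K w * hn ?K (av (lmul As) ?x w)"
     by (rule order_trans[OF complex_Re_le_cmod pd_cs[OF R.pd w R.keys_act[OF x w]]])
    also have "... <= hn ?K w * (min_norm As ?x * hn ?K w)"
     using opbd_min_norm[OF x s] w hn_nonneg[OF R.pd w] by (intro mult_left_mono) (auto simp: opbd_def)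
    also have "... = (sqrt (min_norm As ?x) * hn ?K w)\<^sup>2"
     using min_norm_ge0[OF x] by (simp add: power_mult_distrib power2_eq_square)
    finally show "hn ?K (av (lmul As) u w) <= sqrt (min_norm As ?x) * hn ?K w"
     by (rule power2_le_imp_le) (use min_norm_ge0[OF x] hn_nonneg[OF R.pd w] in simp)
   qed
  qed (use min_norm_ge0[OF x] in simp)
  then have "(min_norm As u)\<^sup>2 <= (sqrt (min_norm As ?x))\<^sup>2"
   by (rule power_mono) (rule min_norm_ge0[OF u])
  then show "(min_norm As u)\<^sup>2 <= min_norm As (av (lmul As) (pst (lstar As) u) u)"
   using min_norm_ge0[OF x] by simp
 qed
 assume v: "v on lset As"
 show "(u + v) on lset As" using u v by (simp add: keys_add_subset)
 show "(av (lmul As) u v) on lset As" using u v by (simp add: keys_lmul)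
 show "pst (lstar As) (av (lmul As) u v) =
   av (lmul As) (pst (lstar As) v) (pst (lstar As) u)"
 proof (rule lin_extensionality)
  fix f
  have "lin f (pst (lstar As) (av (lmul As) u v)) = cnj (lin (%a. lin (%b. cnj (f (lstar As (lmul As a b)))) v) u)"
   by (simp add: lin_pst lin_av)
  also have "... = cnj (lin (%a. lin (%b. cnj (f (lmul As (lstar As b) (lstar As a)))) v) u)"
   using u v by (intro arg_cong[of _ _ cnj] lin_cong) (auto simp: lstar_lmul subset_iff)
  also have "... = lin f (av (lmul As) (pst (lstar As) v) (pst (lstar As) u))"
   unfolding lin_av lin_pst complex_cnj_cnj by (subst lin_swap) simp
  finally show "lin f (pst (lstar As) (av (lmul As) u v)) =
    lin f (av (lmul As) (pst (lstar As) v) (pst (lstar As) u))" by simp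
 qed
 show "min_norm As (u + v) <= min_norm As u + min_norm As v"
  by (intro min_norm_le add_nonneg_nonneg min_norm_ge0 u v star_rep.opbd_add[OF rep] opbd_min_norm)
 show "min_norm As (av (lmul As) u v) <= min_norm As u * min_norm As v"
  using mul_bd[OF u v] by simp
 assume w: "w on lset As"
 show "av (lmul As) (av (lmul As) u v) w = av (lmul As) u (av (lmul As) v w)"
 proof (rule lin_extensionality)
  fix f
  show "lin f (av (lmul As) (av (lmul As) u v) w) = lin f (av (lmul As) u (av (lmul As) v w))"
   unfolding lin_av using u v w by (intro lin_cong) (auto simp: lmul_assoc subset_iff)
 qed
qed (auto simp: psc_add psc_add_left add_ac av_add_left av_add_right av_psc_left av_psc_right pst_add pst_psc)

end

text \<open>Every state list of \<open>As @ Bs\<close> splits into two, and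
  \<open>opbd_pairp\<close> bounds the product operator. This makes concatenation continuous on the
  completions.\<close>

lemma min_norm_formal_append:
 assumes As: "cstar_list As" and Bs: "cstar_list Bs" and u: "u on lset As" and v: "v on lset Bs"
 shows "min_norm (As @ Bs) (formal_append u v) <= min_norm As u * min_norm Bs v"
proof -
 interpret A: cstar_list As by fact
 interpret B: cstar_list Bs by fact
 interpret AB: cstar_list "As @ Bs" using As Bs by (simp add: cstar_list_append)
 note nn = A.min_norm_ge0[OF u] B.min_norm_ge0[OF v]
 show ?thesis
 proof (rule AB.min_norm_le)
  fix \<omega> assume "AB.states \<omega>"
  then obtain \<phi>s \<psi>s where w: "\<omega> = \<phi>s @ \<psi>s" "A.states \<phi>s" "B.states \<psi>s" by (auto simp: list_all2_append1)
  have k: "(formal_append u v) on lset (As @ Bs)"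
   unfolding formal_append_ext using u v by (intro keys_ext_subset) (auto intro!: lset_append)
  have "opbd (lset As \<times> lset Bs) (%(m, n). map_prod (lmul As m) (lmul Bs n))
    (pkernel (skernel As \<phi>s) (skernel Bs \<psi>s)) (pairp u v) (min_norm As u * min_norm Bs v)"
   by (intro opbd_pairp[OF A.star_rep_state B.star_rep_state] A.opbd_min_norm B.opbd_min_norm nn w u v)
  also have "pairp u v = ext (%m. single (take (length As) m, drop (length As) m) 1) (formal_append u v)"
   unfolding pairp_def formal_append_ext ext_ext
   using u v by (intro ext_cong) (auto simp: lset_length subset_iff)
  finally have "opbd (lset As \<times> lset Bs) (split_act As Bs)
    (pkernel (skernel As \<phi>s) (skernel Bs \<psi>s)) (formal_append u v) (min_norm As u * min_norm Bs v)"
   unfolding opbd_def av_pmap by (simp add: pact_def[abs_def])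
  then show "opbd (lset (As @ Bs)) (lmul (As @ Bs)) (skernel (As @ Bs) \<omega>) (formal_append u v)
    (min_norm As u * min_norm Bs v)"
   unfolding w(1) using w k As Bs by (subst opbd_append_iff) (auto dest: list_all2_lengthD)
 qed (use nn in simp)
qed

section \<open>Tensor products\<close>

lemma directed_index_nat: "directed_index (UNIV :: nat set)"
proof
 fix i j :: nat
 show "\<exists>k\<in>UNIV. i <= k \<and> j <= k" by (intro bexI[of _ "max i j"]) auto
 show "\<exists>j\<in>UNIV. i < j" by blast
qed auto

lemma net_at_top_nat: "net_at_top (UNIV :: nat set) = sequentially"
 by (rule filter_eqI) (simp add: directed_index.eventually_net[OF directed_index_nat] eventually_sequentially)

text \<open>The canonical map of formal tensors into the completion. Unlike \<open>limit_emb\<close>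
  it mentions no index; \<open>emb_iota\<close> shows that the index makes no difference.\<close>

definition iota :: "'a star_alg list => 'a formal => 'a tensor" where
 "iota As u = tensor_class As (%_. u)"

text \<open>The completion is the limit of a constant system, so density, extension of maps and
  completeness are inherited from \<open>ind_system\<close>.\<close>

sublocale cstar_list \<subseteq> T: ind_system "UNIV :: nat set" "%_. formal_alg As" "%_ _ u. u"
proof -
 interpret directed_index "UNIV :: nat set" by (rule directed_index_nat)
 interpret pre_cstar "formal_alg As" by (rule pre_cstar_formal_alg)
 show "ind_system (UNIV :: nat set) (%_. formal_alg As) (%_ _ u. u)"
  by unfold_locales (auto simp: star_hom_def linear_map_def intro: keys_add_subset keys_psc_subset keys_lmul keys_lstar)
qed

text \<open>Contractive *-homomorphisms. The bound is kept with the map because extensions to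
  completions and estimates of tensor products start from it.\<close>

definition chom :: "'a star_alg => 'b star_alg => ('a => 'b) => bool" where
 "chom A B F \<longleftrightarrow> star_hom A B F \<and> (\<forall>x\<in>carrier A. norm_of B (F x) <= norm_of A x)"

lemma chom_bounded: "chom A B F ==> bounded_linear_map A B F"
 unfolding chom_def bounded_linear_map_def star_hom_def by (metis mult_1)

lemma chom_star_hom: "chom A B F ==> star_hom A B F"
 by (simp add: chom_def)

lemma chom_linear: "chom A B F ==> linear_map A B F"
 by (simp add: chom_def hom_linear)

lemma chom_closed: "chom A B F ==> x el A ==> F x el B"
 by (rule lin_closed[OF chom_linear])

lemma chom_norm: "chom A B F ==> x el A ==> norm_of B (F x) <= norm_of A x"
 by (simp add: chom_def)

lemma star_hom_comp: "star_hom A B F ==> star_hom B C G ==> star_hom A C (%x. G (F x))"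
 by (simp add: star_hom_def linear_map_def)

lemma chom_comp: "chom A B F ==> chom B C G ==> chom A C (%x. G (F x))"
 unfolding chom_def using star_hom_comp[of A B F C G] lin_closed[OF hom_linear[of A B F]]
 by (auto intro: order_trans)

lemma star_hom_cong:
 assumes "star_hom A B F" "pre_cstar A" "!!x. x el A ==> F x = G x"
 shows "star_hom A B G"
 using assms(1,3) by (auto simp: star_hom_def linear_map_def pre_cstar.closed[OF assms(2)])

lemma chom_cong:
 assumes "chom A B F" "pre_cstar A" "!!x. x el A ==> F x = G x"
 shows "chom A B G"
 using star_hom_cong[of A B F G] assms by (auto simp: chom_def)

lemma bounded_linear_map_linear: "bounded_linear_map A B F ==> linear_map A B F"
 by (simp add: bounded_linear_map_def)

lemma bounded_comp:
 assumes "bounded_linear_map A B F" "bounded_linear_map B C G" "pre_cstar B"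
 shows "bounded_linear_map A C (%x. G (F x))"
proof -
 obtain K where K: "!!x. x el A ==> norm_of B (F x) <= K * norm_of A x"
  using assms(1) by (auto simp: bounded_linear_map_def)
 obtain K' where K': "!!x. x el B ==> norm_of C (G x) <= K' * norm_of B x"
  using assms(2) by (auto simp: bounded_linear_map_def)
 have c: "F x el B" if "x el A" for x
  by (rule lin_closed[OF bounded_linear_map_linear[OF assms(1)] that])
 have "norm_of C (G (F x)) <= (\<bar>K'\<bar> * K) * norm_of A x" if x: "x el A" for x
 proof -
  have "norm_of C (G (F x)) <= K' * norm_of B (F x)" by (rule K'[OF c[OF x]])
  also have "... <= \<bar>K'\<bar> * norm_of B (F x)"
   by (intro mult_right_mono pre_cstar.norm_nonneg[OF assms(3)] c x) auto
  also have "... <= \<bar>K'\<bar> * (K * norm_of A x)" by (intro mult_left_mono K x) auto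
  finally show ?thesis by (simp add: mult.assoc)
 qed
 then show ?thesis using assms(1,2) by (auto simp: bounded_linear_map_def linear_map_def)
qed

lemma restrict_UNIV [simp]: "restrict f UNIV = f"
 by (simp add: fun_eq_iff)

context cstar_list
begin

lemma tensor_class_T: "tensor_class As = T.cls"
 by (simp add: tensor_class_def fun_eq_iff)

lemma tensor_T: "tensor As = T.L"
 by (simp add: tensor_def)

lemma cstar_tensor: "cstar_algebra (tensor As)"
 unfolding tensor_T by (rule T.cstar_ind_limit)

lemma cn_formal: "f \<in> T.cn ==> (f n) on lset As"
 using T.cn_mem[of f n] by simp

lemma const_cn: "u on lset As ==> (%_. u) \<in> T.cn"
proof -
 assume u: "u on lset As"
 have "T.embnet 0 u = (%_. u)" by (auto simp: T.embnet_def)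
 then show ?thesis using T.embnet_cn[of 0 u] u by simp
qed

lemma emb_iota: "u on lset As ==> T.emb i u = iota As u"
proof -
 assume u: "u on lset As"
 have "T.emb 0 u = iota As u"
  by (simp add: T.emb_cls T.embnet_def iota_def tensor_class_T restrict_def)
 moreover have "T.emb i u = T.emb 0 u" using T.emb_comp[of 0 i u] u by simp
 ultimately show ?thesis by simp
qed

lemma iota_star_hom: "star_hom (formal_alg As) (tensor As) (iota As)"
 by (rule star_hom_cong[OF T.emb_star_hom[of 0, folded tensor_T] pre_cstar_formal_alg]) (auto simp: emb_iota)

lemma norm_iota: "u on lset As ==> norm_of (tensor As) (iota As u) = min_norm As u"
 unfolding tensor_T iota_def tensor_class_T
 by (rule T.norm_unique[OF const_cn]) auto

lemma chom_iota: "chom (formal_alg As) (tensor As) (iota As)"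
 by (simp add: chom_def iota_star_hom norm_iota)

lemma iota_in: "u on lset As ==> iota As u el tensor As"
 by (rule chom_closed[OF chom_iota]) simp

lemma pure_iota: "pure As as = iota As (single as 1)"
 by (simp add: pure_def iota_def)

lemma pure_in: "as \<in> lset As ==> pure As as el tensor As"
 unfolding pure_iota by (rule iota_in) simp

lemma pure_mult: "as \<in> lset As ==> bs \<in> lset As ==>
  mult_of (tensor As) (pure As as) (pure As bs) = pure As (lmul As as bs)"
 unfolding pure_iota using star_hom_mult[OF iota_star_hom, of "single as 1" "single bs 1"]
 by (simp add: av_single)

lemma pst_single: "pst st (single m 1) = single (st m) 1"
 by (rule lin_extensionality) (simp add: lin_pst)

lemma pure_star: "as \<in> lset As ==> star_of (tensor As) (pure As as) = pure As (lstar As as)"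
 unfolding pure_iota using star_hom_star[OF iota_star_hom, of "single as 1"] by (simp add: pst_single)

lemma rep_tensor: assumes "x el tensor As" shows "rep x \<in> T.cn" "T.cls (rep x) = x"
 using T.rep_in[of x] assms by (auto simp: tensor_T)

lemma tensor_cases: assumes "x el tensor As" obtains f where "f \<in> T.cn" "x = T.cls f"
 using rep_tensor[OF assms] by metis

lemma linear_iota_eqI:
 assumes "linear_map (tensor As) B h" "linear_map (tensor As) B h'" "pre_cstar B"
  and eq: "!!as. as \<in> lset As ==> h (pure As as) = h' (pure As as)" and u: "u on lset As"
 shows "h (iota As u) = h' (iota As u)"
 using u
proof (induction u rule: finsupp_induct)
 case zero
 have z: "iota As 0 = zero_of (tensor As)"
  using linear_map_zero[OF hom_linear[OF iota_star_hom] pre_cstar_formal_alg cstar_pre[OF cstar_tensor]]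
  by simp
 show ?case unfolding z
  using linear_map_zero[OF assms(1) cstar_pre[OF cstar_tensor] assms(3)]
   linear_map_zero[OF assms(2) cstar_pre[OF cstar_tensor] assms(3)] by simp
next
 case (add k c u)
 have "iota As (single k c + u) = add_of (tensor As) (scale_of (tensor As) c (pure As k)) (iota As u)"
  using lin_map_add[OF hom_linear[OF iota_star_hom], of "psc c (single k 1)" u]
   lin_scale[OF hom_linear[OF iota_star_hom], of "single k 1" c] add
  by (simp add: pure_iota)
 moreover have "scale_of (tensor As) c (pure As k) el tensor As"
  using add by (intro pre_cstar.scale_closed[OF cstar_pre[OF cstar_tensor]] pure_in)
 ultimately show ?case using add eq pure_in[OF add(1)] iota_in[OF add(2)]
  by (simp add: lin_map_add[OF assms(1)] lin_map_add[OF assms(2)]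
    lin_scale[OF assms(1)] lin_scale[OF assms(2)])
qed

text \<open>Pure tensors span the formal tensors, whose images are dense.\<close>

lemma tensor_map_eqI:
 assumes "cstar_algebra B" "bounded_linear_map (tensor As) B h" "bounded_linear_map (tensor As) B h'"
  and eq: "!!as. as \<in> lset As ==> h (pure As as) = h' (pure As as)" and x: "x el tensor As"
 shows "h x = h' x"
proof (rule T.ind_limit_map_eqI[OF assms(1) assms(2,3)[unfolded tensor_T]])
 fix i :: nat
 show "\<exists>j\<in>UNIV. i <= j \<and> (\<forall>x\<in>carrier (formal_alg As). h (T.emb j x) = h' (T.emb j x))"
  using linear_iota_eqI[OF bounded_linear_map_linear[OF assms(2)] bounded_linear_map_linear[OF assms(3)]
    cstar_pre[OF assms(1)] eq]
  by (intro bexI[of _ i]) (auto simp: emb_iota)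
qed (use x in \<open>simp add: tensor_T\<close>)

lemma tensor_extension:
 assumes "cstar_algebra B" "linear_map (formal_alg As) B g" "0 <= C"
  and "!!u. u on lset As ==> norm_of B (g u) <= C * min_norm As u"
 obtains H where "H \<in> extensional (carrier (tensor As))" "bounded_linear_map (tensor As) B H"
  "!!x. x el tensor As ==> norm_of B (H x) <= C * norm_of (tensor As) x"
  "!!u. u on lset As ==> H (iota As u) = g u"
  "star_hom (formal_alg As) B g ==> star_hom (tensor As) B H"
proof (rule T.ind_limit_extension[OF assms(1), of "%_. g" C])
 fix H
 assume H: "H \<in> extensional (carrier T.L)" "bounded_linear_map T.L B H"
  "!!x. x el T.L ==> norm_of B (H x) <= C * norm_of T.L x"
  "!!i x. i \<in> UNIV ==> x el formal_alg As ==> H (T.emb i x) = g x"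
  "(!!i. i \<in> UNIV ==> star_hom (formal_alg As) B g) ==> star_hom T.L B H"
 have "H (iota As u) = g u" if "u on lset As" for u
  using H(4)[of 0 u] that emb_iota[OF that, of 0] by simp
 then show thesis using H that[of H] by (simp add: tensor_T)
qed (use assms in auto)

text \<open>Any bounded linear map with the prescribed values on pure tensors satisfies the
  description that defines \<open>tensor_lift\<close>. Both \<open>tensor_map\<close> and
  \<open>tensor_functional\<close> are evaluated in this way.\<close>

lemma tensor_lift_eq:
 assumes "cstar_algebra B" "bounded_linear_map (tensor As) B H"
  and "!!as. as \<in> lset As ==> H (pure As as) = g as" and x: "x el tensor As"
 shows "tensor_lift As B g x = H x"
proof -
 have "tensor_lift As B g = restrict H (carrier (tensor As))"
  unfolding tensor_lift_def lset_def[symmetric]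
 proof (rule the_equality)
  have bl: "bounded_linear_map (tensor As) B (restrict H (carrier (tensor As)))"
   using assms(2) pre_cstar.closed[OF cstar_pre[OF cstar_tensor]]
   by (auto simp: bounded_linear_map_def linear_map_def)
  then show "restrict H (carrier (tensor As)) \<in> extensional (carrier (tensor As)) \<and>
   bounded_linear_map (tensor As) B (restrict H (carrier (tensor As))) \<and>
   (\<forall>as\<in>lset As. restrict H (carrier (tensor As)) (pure As as) = g as)"
   using assms(3) pure_in by auto
  fix h assume h: "h \<in> extensional (carrier (tensor As)) \<and> bounded_linear_map (tensor As) B h \<and>
   (\<forall>as\<in>lset As. h (pure As as) = g as)"
  show "h = restrict H (carrier (tensor As))"
  proof (rule extensionalityI[of _ "carrier (tensor As)"])
   fix x assume "x el tensor As"
   then show "h x = restrict H (carrier (tensor As)) x"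
    using tensor_map_eqI[OF assms(1) _ bl] h assms(3) pure_in by auto
  qed (use h in auto)
 qed
 then show ?thesis using x by simp
qed

end

lemma formal_append_add_left: "formal_append (u + u') v = formal_append u v + formal_append u' v"
 by (simp add: formal_append_ext ext_add)

lemma formal_append_add_right: "formal_append u (v + v') = formal_append u v + formal_append u v'"
 by (simp add: formal_append_ext ext_add ext_fun_add)

lemma formal_append_psc: "formal_append (psc c u) v = psc c (formal_append u v)"
 "formal_append u (psc c v) = psc c (formal_append u v)"
 by (simp_all add: formal_append_ext ext_psc ext_fun_psc)

lemma formal_append_diff: "formal_append (u - u') v = formal_append u v - formal_append u' v"
 "formal_append u (v - v') = formal_append u v - formal_append u v'"
 by (metis add_diff_cancel_right' diff_add_cancel formal_append_add_left,
   metis add_diff_cancel_right' diff_add_cancel formal_append_add_right)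

lemma lin_formal_append: "lin f (formal_append u v) = lin (%a. lin (%b. f (a @ b)) v) u"
 by (simp add: formal_append_ext lin_ext)

lemma keys_formal_append:
 "u on lset As ==> v on lset Bs ==> (formal_append u v) on lset (As @ Bs)"
 unfolding formal_append_ext by (intro keys_ext_subset) (auto intro!: lset_append)

lemma formal_append_assoc: "formal_append (formal_append u v) w = formal_append u (formal_append v w)"
 by (rule lin_extensionality) (simp add: lin_formal_append)

lemma formal_append_single: "formal_append (single as 1) (single bs 1) = single (as @ bs) 1"
 by (simp add: formal_append_ext)

lemma formal_append_Nil: "formal_append u (single [] 1) = u" "formal_append (single [] 1) u = u"
 by (rule lin_extensionality, simp add: lin_formal_append)+

section \<open>Concatenation of tensor products\<close>

locale cstar_lists2 = A: cstar_list As + B: cstar_list Bs for As Bs :: "'a star_alg list"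

sublocale cstar_lists2 \<subseteq> AB: cstar_list "As @ Bs"
 using A.cstar_list_axioms B.cstar_list_axioms by (simp add: cstar_list_append)

context cstar_lists2
begin

lemma formal_append_mult:
 assumes "u on lset As" "u' on lset As" "v on lset Bs" "v' on lset Bs"
 shows "av (lmul (As @ Bs)) (formal_append u v) (formal_append u' v') =
  formal_append (av (lmul As) u u') (av (lmul Bs) v v')"
proof (rule lin_extensionality)
 fix f
 have "lin f (av (lmul (As @ Bs)) (formal_append u v) (formal_append u' v')) =
   lin (%a. lin (%b. lin (%a'. lin (%b'. f (lmul (As @ Bs) (a @ b) (a' @ b'))) v') u') v) u"
  by (simp add: lin_av lin_formal_append)
 also have "... = lin (%a. lin (%b. lin (%a'. lin (%b'. f (lmul As a a' @ lmul Bs b b')) v') u') v) u"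
  using assms by (intro lin_cong) (auto simp: lmul_append lset_length subset_iff)
 also have "... = lin (%a. lin (%a'. lin (%b. lin (%b'. f (lmul As a a' @ lmul Bs b b')) v') v) u') u"
  by (intro lin_cong lin_swap)
 also have "... = lin f (formal_append (av (lmul As) u u') (av (lmul Bs) v v'))"
  by (simp add: lin_av lin_formal_append)
 finally show "lin f (av (lmul (As @ Bs)) (formal_append u v) (formal_append u' v')) =
  lin f (formal_append (av (lmul As) u u') (av (lmul Bs) v v'))" .
qed

lemma formal_append_star:
 assumes "u on lset As"
 shows "pst (lstar (As @ Bs)) (formal_append u v) = formal_append (pst (lstar As) u) (pst (lstar Bs) v)"
proof (rule lin_extensionality)
 fix f
 have "lin f (pst (lstar (As @ Bs)) (formal_append u v)) =
   cnj (lin (%a. lin (%b. cnj (f (lstar (As @ Bs) (a @ b)))) v) u)"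
  by (simp add: lin_pst lin_formal_append)
 also have "... = cnj (lin (%a. lin (%b. cnj (f (lstar As a @ lstar Bs b))) v) u)"
  using assms by (intro arg_cong[of _ _ cnj] lin_cong) (auto simp: lstar_append lset_length subset_iff)
 also have "... = lin f (formal_append (pst (lstar As) u) (pst (lstar Bs) v))"
  by (simp add: lin_pst lin_formal_append)
 finally show "lin f (pst (lstar (As @ Bs)) (formal_append u v)) =
  lin f (formal_append (pst (lstar As) u) (pst (lstar Bs) v))" .
qed

text \<open>The product rule for differences. With bounded factors and small differences, it makes
  termwise concatenations of coherent sequences coherent and null changes null.\<close>

lemma append_dst:
 assumes "u on lset As" "u' on lset As" "v on lset Bs" "v' on lset Bs"
 shows "min_norm (As @ Bs) (formal_append u v - formal_append u' v') \<le>
  min_norm As u * min_norm Bs (v - v') + min_norm As (u - u') * min_norm Bs v'"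
proof -
 interpret N: pre_cstar "formal_alg (As @ Bs)" by (rule AB.pre_cstar_formal_alg)
 have "formal_append u v - formal_append u' v' = formal_append u (v - v') + formal_append (u - u') v'"
  by (simp add: formal_append_diff)
 also have "min_norm (As @ Bs) ... <= min_norm (As @ Bs) (formal_append u (v - v')) + min_norm (As @ Bs) (formal_append (u - u') v')"
  using N.norm_add[of "formal_append u (v - v')" "formal_append (u - u') v'"] assms
  by (simp add: keys_formal_append keys_diff_subset)
 also have "... <= min_norm As u * min_norm Bs (v - v') + min_norm As (u - u') * min_norm Bs v'"
  by (intro add_mono min_norm_formal_append A.cstar_list_axioms B.cstar_list_axioms keys_diff_subset assms)
 finally show ?thesis .
qed

lemma append_cn:
 assumes f: "f \<in> A.T.cn" and g: "g \<in> B.T.cn"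
 shows "(%n. formal_append (f n) (g n)) \<in> AB.T.cn"
proof (rule AB.T.cnI)
 note fk = A.cn_formal[OF f] and gk = B.cn_formal[OF g]
 show "(%n. formal_append (f n) (g n)) \<in> AB.T.nets"
  by (simp add: AB.T.nets_def PiE_iff keys_formal_append[OF fk gk])
 fix e :: real assume e: "0 < e"
 obtain K where K: "0 < K" "eventually (%j. min_norm As (f j) <= K) A.T.F" using A.T.cn_bounded[OF f] by auto
 obtain C where C: "0 < C" "eventually (%j. min_norm Bs (g j) <= C) A.T.F" using B.T.cn_bounded[OF g] by auto
 define d where "d = e / (K + C)"
 have d: "0 < d" "(K + C) * d = e" using e K C by (simp_all add: d_def)
 have "eventually (%i. A.T.coh f d i \<and> B.T.coh g d i \<and>
   (\<forall>j\<in>UNIV. i <= j \<longrightarrow> min_norm As (f j) <= K) \<and> min_norm Bs (g i) <= C) A.T.F"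
  using A.T.coh_eventually[OF f d(1)] B.T.coh_eventually[OF g d(1)] A.T.eventually_all_ge[OF K(2)] C
  by (auto intro!: eventually_conj)
 then show "eventually (AB.T.coh (%n. formal_append (f n) (g n)) e) A.T.F"
 proof eventually_elim
  case (elim i)
  show ?case unfolding AB.T.coh_def AB.formal_alg_minus AB.formal_alg_simps
  proof (intro ballI impI)
   fix j assume j: "i <= j"
   have "min_norm (As @ Bs) (formal_append (f j) (g j) - formal_append (f i) (g i)) \<le>
     min_norm As (f j) * min_norm Bs (g j - g i) + min_norm As (f j - f i) * min_norm Bs (g i)"
    by (rule append_dst[OF fk fk gk gk])
   also have "... <= K * min_norm Bs (g j - g i) + min_norm As (f j - f i) * C"
    using elim j by (intro add_mono mult_mono B.min_norm_ge0 A.min_norm_ge0 keys_diff_subset fk gk)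
     (use K in auto)
   also have "... < K * d + d * C"
    using elim j K C by (intro add_strict_mono mult_strict_left_mono mult_strict_right_mono)
     (auto simp: A.T.coh_def B.T.coh_def)
   finally show "min_norm (As @ Bs) (formal_append (f j) (g j) - formal_append (f i) (g i)) < e"
    using d by (simp add: algebra_simps)
  qed
 qed
qed

text \<open>Independence of the representatives that \<open>tensor_append\<close> picks, by the
  product rule and boundedness. The laws of concatenation are then read off from formal
  tensors.\<close>

lemma append_cls:
 assumes f: "f \<in> A.T.cn" and g: "g \<in> B.T.cn"
 shows "tensor_append As Bs (A.T.cls f) (B.T.cls g) = AB.T.cls (%n. formal_append (f n) (g n))"
proof -
 let ?f = "rep (A.T.cls f)" and ?g = "rep (B.T.cls g)"
 note rf = A.T.rep_cls[OF f] and rg = B.T.rep_cls[OF g]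
 note k = A.cn_formal[OF f] A.cn_formal[OF rf(1)] B.cn_formal[OF g] B.cn_formal[OF rg(1)]
 obtain K where K: "0 < K" "eventually (%j. min_norm As (?f j) <= K) A.T.F" using A.T.cn_bounded[OF rf(1)] by auto
 obtain C where C: "0 < C" "eventually (%j. min_norm Bs (g j) <= C) A.T.F" using B.T.cn_bounded[OF g] by auto
 have "AB.T.null (%n. formal_append (?f n) (?g n)) (%n. formal_append (f n) (g n))"
 proof (rule AB.T.nullI)
  have "A.T.null ?f f" "B.T.null ?g g"
   using A.T.null_sym[OF _ _ rf(2)] B.T.null_sym[OF _ _ rg(2)] f g rf rg
   by (auto simp: A.T.cn_nets B.T.cn_nets)
  then have "((%i. K * min_norm Bs (?g i - g i) + min_norm As (?f i - f i) * C) \<longlongrightarrow> K * 0 + 0 * C) A.T.F"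
   unfolding A.T.null_def B.T.null_def A.T.nd_def[abs_def] B.T.nd_def[abs_def]
    A.formal_alg_minus B.formal_alg_minus A.formal_alg_simps B.formal_alg_simps
   by (intro tendsto_intros)
  then show "((%i. K * min_norm Bs (?g i - g i) + min_norm As (?f i - f i) * C) \<longlongrightarrow> 0) A.T.F" by simp
  show "\<forall>\<^sub>F i in A.T.F. AB.T.nd (%n. formal_append (?f n) (?g n)) (%n. formal_append (f n) (g n)) i \<le>
    K * min_norm Bs (?g i - g i) + min_norm As (?f i - f i) * C"
   using K(2) C(2)
  proof eventually_elim
   case (elim i)
   have "AB.T.nd (%n. formal_append (?f n) (?g n)) (%n. formal_append (f n) (g n)) i \<le>
     min_norm As (?f i) * min_norm Bs (?g i - g i) + min_norm As (?f i - f i) * min_norm Bs (g i)"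
    using append_dst[OF k(2,1) k(4,3)] by (simp add: AB.T.nd_def)
   also have "... <= K * min_norm Bs (?g i - g i) + min_norm As (?f i - f i) * C"
    using elim K by (intro add_mono mult_mono B.min_norm_ge0 A.min_norm_ge0 keys_diff_subset k) auto
   finally show ?case .
  qed
 qed (intro AB.T.cn_nets append_cn f g rf rg)+
 then show ?thesis
  unfolding tensor_append_def AB.tensor_class_T
  by (subst AB.T.cls_eq) (auto intro: append_cn f g rf rg)
qed

lemma append_in: "x el tensor As ==> y el tensor Bs ==>
  tensor_append As Bs x y el tensor (As @ Bs)"
 by (elim A.tensor_cases B.tensor_cases) (simp add: append_cls AB.tensor_T AB.T.cls_in append_cn)

lemma append_pure: "as \<in> lset As ==> bs \<in> lset Bs ==>
  tensor_append As Bs (pure As as) (pure Bs bs) = pure (As @ Bs) (as @ bs)"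
 using append_cls[OF A.const_cn B.const_cn, of "single as 1" "single bs 1"]
 by (simp add: formal_append_single pure_def A.tensor_class_T B.tensor_class_T AB.tensor_class_T)

lemma append_add_left:
 assumes "x el tensor As" "x' el tensor As" "y el tensor Bs"
 shows "tensor_append As Bs (add_of (tensor As) x x') y =
  add_of (tensor (As @ Bs)) (tensor_append As Bs x y) (tensor_append As Bs x' y)"
proof -
 obtain f where f: "f \<in> A.T.cn" "x = A.T.cls f" using A.tensor_cases[OF assms(1)] .
 obtain f' where f': "f' \<in> A.T.cn" "x' = A.T.cls f'" using A.tensor_cases[OF assms(2)] .
 obtain g where g: "g \<in> B.T.cn" "y = B.T.cls g" using B.tensor_cases[OF assms(3)] .
 show ?thesis
  unfolding f f' g A.tensor_T AB.tensor_T A.T.add_cls[OF f(1) f'(1)] append_cls[OF A.T.cn_padd[OF f(1) f'(1)] g(1)]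
   append_cls[OF f(1) g(1)] append_cls[OF f'(1) g(1)] AB.T.add_cls[OF append_cn[OF f(1) g(1)] append_cn[OF f'(1) g(1)]]
  by (simp add: A.T.padd_def AB.T.padd_def formal_append_add_left)
qed

lemma append_add_right:
 assumes "x el tensor As" "y el tensor Bs" "y' el tensor Bs"
 shows "tensor_append As Bs x (add_of (tensor Bs) y y') =
  add_of (tensor (As @ Bs)) (tensor_append As Bs x y) (tensor_append As Bs x y')"
proof -
 obtain f where f: "f \<in> A.T.cn" "x = A.T.cls f" using A.tensor_cases[OF assms(1)] .
 obtain g where g: "g \<in> B.T.cn" "y = B.T.cls g" using B.tensor_cases[OF assms(2)] .
 obtain g' where g': "g' \<in> B.T.cn" "y' = B.T.cls g'" using B.tensor_cases[OF assms(3)] .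
 show ?thesis
  unfolding f g g' B.tensor_T AB.tensor_T B.T.add_cls[OF g(1) g'(1)] append_cls[OF f(1) B.T.cn_padd[OF g(1) g'(1)]]
   append_cls[OF f(1) g(1)] append_cls[OF f(1) g'(1)] AB.T.add_cls[OF append_cn[OF f(1) g(1)] append_cn[OF f(1) g'(1)]]
  by (simp add: B.T.padd_def AB.T.padd_def formal_append_add_right)
qed

lemma append_scale:
 assumes "x el tensor As" "y el tensor Bs"
 shows "tensor_append As Bs (scale_of (tensor As) c x) y = scale_of (tensor (As @ Bs)) c (tensor_append As Bs x y)"
  and "tensor_append As Bs x (scale_of (tensor Bs) c y) = scale_of (tensor (As @ Bs)) c (tensor_append As Bs x y)"
proof -
 obtain f where f: "f \<in> A.T.cn" "x = A.T.cls f" using A.tensor_cases[OF assms(1)] .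
 obtain g where g: "g \<in> B.T.cn" "y = B.T.cls g" using B.tensor_cases[OF assms(2)] .
 show "tensor_append As Bs (scale_of (tensor As) c x) y = scale_of (tensor (As @ Bs)) c (tensor_append As Bs x y)"
  unfolding f g A.tensor_T AB.tensor_T A.T.scale_cls[OF f(1)] append_cls[OF A.T.cn_pscale[OF f(1)] g(1)]
   append_cls[OF f(1) g(1)] AB.T.scale_cls[OF append_cn[OF f(1) g(1)]]
  by (simp add: A.T.pscale_def AB.T.pscale_def formal_append_psc)
 show "tensor_append As Bs x (scale_of (tensor Bs) c y) = scale_of (tensor (As @ Bs)) c (tensor_append As Bs x y)"
  unfolding f g B.tensor_T AB.tensor_T B.T.scale_cls[OF g(1)] append_cls[OF f(1) B.T.cn_pscale[OF g(1)]]
   append_cls[OF f(1) g(1)] AB.T.scale_cls[OF append_cn[OF f(1) g(1)]]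
  by (simp add: B.T.pscale_def AB.T.pscale_def formal_append_psc)
qed

lemma append_mult:
 assumes "x el tensor As" "x' el tensor As" "y el tensor Bs" "y' el tensor Bs"
 shows "mult_of (tensor (As @ Bs)) (tensor_append As Bs x y) (tensor_append As Bs x' y') =
  tensor_append As Bs (mult_of (tensor As) x x') (mult_of (tensor Bs) y y')"
proof -
 obtain f where f: "f \<in> A.T.cn" "x = A.T.cls f" using A.tensor_cases[OF assms(1)] .
 obtain f' where f': "f' \<in> A.T.cn" "x' = A.T.cls f'" using A.tensor_cases[OF assms(2)] .
 obtain g where g: "g \<in> B.T.cn" "y = B.T.cls g" using B.tensor_cases[OF assms(3)] .
 obtain g' where g': "g' \<in> B.T.cn" "y' = B.T.cls g'" using B.tensor_cases[OF assms(4)] .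
 show ?thesis
  unfolding f f' g g' A.tensor_T B.tensor_T AB.tensor_T A.T.mult_cls[OF f(1) f'(1)] B.T.mult_cls[OF g(1) g'(1)]
   append_cls[OF A.T.cn_pmult[OF f(1) f'(1)] B.T.cn_pmult[OF g(1) g'(1)]]
   append_cls[OF f(1) g(1)] append_cls[OF f'(1) g'(1)] AB.T.mult_cls[OF append_cn[OF f(1) g(1)] append_cn[OF f'(1) g'(1)]]
  using f f' g g' by (simp add: A.T.pmult_def B.T.pmult_def AB.T.pmult_def formal_append_mult A.cn_formal B.cn_formal)
qed

lemma append_star:
 assumes "x el tensor As" "y el tensor Bs"
 shows "star_of (tensor (As @ Bs)) (tensor_append As Bs x y) =
  tensor_append As Bs (star_of (tensor As) x) (star_of (tensor Bs) y)"
proof -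
 obtain f where f: "f \<in> A.T.cn" "x = A.T.cls f" using A.tensor_cases[OF assms(1)] .
 obtain g where g: "g \<in> B.T.cn" "y = B.T.cls g" using B.tensor_cases[OF assms(2)] .
 show ?thesis
  unfolding f g A.tensor_T B.tensor_T AB.tensor_T A.T.star_cls[OF f(1)] B.T.star_cls[OF g(1)]
   append_cls[OF A.T.cn_pstar[OF f(1)] B.T.cn_pstar[OF g(1)]] append_cls[OF f(1) g(1)]
   AB.T.star_cls[OF append_cn[OF f(1) g(1)]]
  using f g by (simp add: A.T.pstar_def B.T.pstar_def AB.T.pstar_def formal_append_star A.cn_formal)
qed

lemma append_norm:
 assumes "x el tensor As" "y el tensor Bs"
 shows "norm_of (tensor (As @ Bs)) (tensor_append As Bs x y) <= norm_of (tensor As) x * norm_of (tensor Bs) y"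
proof -
 obtain f where f: "f \<in> A.T.cn" "x = A.T.cls f" using A.tensor_cases[OF assms(1)] .
 obtain g where g: "g \<in> B.T.cn" "y = B.T.cls g" using B.tensor_cases[OF assms(2)] .
 have 1: "((%n. min_norm (As @ Bs) (formal_append (f n) (g n))) \<longlongrightarrow> norm_of (tensor (As @ Bs)) (tensor_append As Bs x y)) A.T.F"
  using AB.T.norm_tendsto[OF append_cn[OF f(1) g(1)]] by (simp add: f g append_cls AB.tensor_T)
 have 2: "((%n. min_norm As (f n) * min_norm Bs (g n)) \<longlongrightarrow> norm_of (tensor As) x * norm_of (tensor Bs) y) A.T.F"
  using tendsto_mult[OF A.T.norm_tendsto[OF f(1)] B.T.norm_tendsto[OF g(1)]] by (simp add: f g A.tensor_T B.tensor_T)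
 show ?thesis
  by (rule tendsto_le[OF A.T.net_nonbot 2 1])
   (intro always_eventually allI min_norm_formal_append A.cstar_list_axioms B.cstar_list_axioms A.cn_formal[OF f(1)] B.cn_formal[OF g(1)])
qed

lemma bounded_append_left:
 assumes "y el tensor Bs"
 shows "bounded_linear_map (tensor As) (tensor (As @ Bs)) (%x. tensor_append As Bs x y)"
 unfolding bounded_linear_map_def linear_map_def
 by (intro conjI exI[of _ "norm_of (tensor Bs) y"])
  (use append_norm assms in \<open>auto simp: append_in append_add_left append_scale mult.commute\<close>)

lemma bounded_append_right:
 assumes "x el tensor As"
 shows "bounded_linear_map (tensor Bs) (tensor (As @ Bs)) (tensor_append As Bs x)"
 unfolding bounded_linear_map_def linear_map_def
 by (intro conjI exI[of _ "norm_of (tensor As) x"])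
  (use append_norm assms in \<open>auto simp: append_in append_add_right append_scale\<close>)

lemma append_eqI:
 assumes B: "cstar_algebra Z" and h: "bounded_linear_map (tensor (As @ Bs)) Z h"
  "bounded_linear_map (tensor (As @ Bs)) Z h'"
  and eq: "!!x y. x el tensor As ==> y el tensor Bs ==>
   h (tensor_append As Bs x y) = h' (tensor_append As Bs x y)"
  and z: "z el tensor (As @ Bs)"
 shows "h z = h' z"
proof (rule AB.tensor_map_eqI[OF B h _ z])
 fix cs assume c: "cs \<in> lset (As @ Bs)"
 then show "h (pure (As @ Bs) cs) = h' (pure (As @ Bs) cs)"
  using eq[OF A.pure_in B.pure_in, of "take (length As) cs" "drop (length As) cs"]
   append_pure[of "take (length As) cs" "drop (length As) cs"] lset_split[OF c] by simp
qed

text \<open>Separate continuity suffices, since density is used in one argument at a time.\<close>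

lemma bilinear_eqI:
 assumes Z: "cstar_algebra Z"
  and hl: "!!y. y el tensor Bs ==> bounded_linear_map (tensor As) Z (%x. h x y)"
  and hr: "!!x. x el tensor As ==> bounded_linear_map (tensor Bs) Z (h x)"
  and kl: "!!y. y el tensor Bs ==> bounded_linear_map (tensor As) Z (%x. k x y)"
  and kr: "!!x. x el tensor As ==> bounded_linear_map (tensor Bs) Z (k x)"
  and eq: "!!as bs. as \<in> lset As ==> bs \<in> lset Bs ==> h (pure As as) (pure Bs bs) = k (pure As as) (pure Bs bs)"
  and x: "x el tensor As" and y: "y el tensor Bs"
 shows "h x y = k x y"
proof (rule A.tensor_map_eqI[OF Z hl[OF y] kl[OF y] _ x])
 fix as assume as: "as \<in> lset As"
 show "h (pure As as) y = k (pure As as) y"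
  by (rule B.tensor_map_eqI[OF Z hr kr _ y]) (use as eq A.pure_in in auto)
qed

end

section \<open>Tensor products of homomorphisms\<close>

lemma form_tendsto:
 assumes "!!s t. s \<in> keys u ==> t \<in> keys v ==> (%n. k n s t) \<longlonglongrightarrow> K s t"
 shows "(%n. form (k n) u v) \<longlonglongrightarrow> form K u v"
proof -
 have e: "form K u v = (\<Sum>t\<in>keys v. \<Sum>s\<in>keys u. lookup v t * (cnj (lookup u s) * K s t))" for K
  by (simp add: form_def lin_def sum_distrib_left)
 show ?thesis unfolding e by (intro tendsto_sum tendsto_mult tendsto_const assms)
qed

lemma opbd_swap:
 assumes "opbd (S1 \<times> S2) (pact a b) (pkernel K1 K2) u N"
 shows "opbd (S2 \<times> S1) (pact b a) (pkernel K2 K1) u N"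
 by (rule opbd_relabel[OF assms subset_UNIV, of _ prod.swap])
  (auto simp: pact_def pkernel_def mult.commute)

context linear_rep
begin

lemma form_act_add:
 assumes "z on S" "w on S" "a el A" "b el A"
 shows "form K z (av act (single (add_of A a b) 1) w) =
  form K z (av act (single a 1) w) + form K z (av act (single b 1) w)"
proof -
 have e: "form K z (av act (single c 1) w) = form (%s t. K s (act c t)) z w" for c
  using form_ext[of K "%s. single s 1" z "%s. single (act c s) 1" w] by (simp add: av_single_left)
 show ?thesis unfolding e form_fun_add[symmetric] using assms by (intro form_cong) (auto simp: act_add subset_iff)
qed

lemma form_act_scale:
 assumes "z on S" "w on S" "a el A"
 shows "form K z (av act (single (scale_of A c a) 1) w) = c * form K z (av act (single a 1) w)"
proof -
 have e: "form K z (av act (single c 1) w) = form (%s t. K s (act c t)) z w" for c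
  using form_ext[of K "%s. single s 1" z "%s. single (act c s) 1" w] by (simp add: av_single_left)
 show ?thesis unfolding e form_fun_mult[symmetric] using assms by (intro form_cong) (auto simp: act_scale subset_iff)
qed

end

text \<open>Vectors of the completed GNS space of a product state are Cauchy sequences of formal tensors.\<close>

locale state_list = cstar_list As for As :: "'a star_alg list" +
 fixes \<phi>s :: "('a => complex) list"
 assumes st: "list_all2 state As \<phi>s"
begin

abbreviation "K \<equiv> skernel As \<phi>s"

sublocale R: star_rep "lset As" "lmul As" "lstar As" "lset As" "lmul As" K
 by (rule star_rep_state[OF st])

definition hs :: "(nat => 'a formal) set" where
 "hs = {f. (\<forall>n. (f n) on lset As) \<and> (\<forall>e>0. \<exists>N. \<forall>m\<ge>N. \<forall>n\<ge>N. hn K (f m - f n) < e)}"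

definition hk :: "(nat => 'a formal) => (nat => 'a formal) => complex" where
 "hk f g = lim (%n. form K (f n) (g n))"

text \<open>An element of the completed algebra acts term by term through its chosen representing
  sequence. Another choice changes the result by a null vector of \<open>hk\<close>, which is why
  the laws of representations are stated inside the kernel.\<close>

definition tact :: "'a tensor => (nat => 'a formal) => (nat => 'a formal)" where
 "tact x f = (%n. av (lmul As) (rep x n) (f n))"

lemma hs_keys: "f \<in> hs ==> (f n) on lset As"
 by (auto simp: hs_def)

lemma hs_cauchy: "f \<in> hs ==> 0 < e ==> \<exists>N. \<forall>m\<ge>N. \<forall>n\<ge>N. hn K (f m - f n) < e"
 by (auto simp: hs_def)

lemma hs_bounded: assumes f: "f \<in> hs" shows "\<exists>B>0. \<exists>N. \<forall>n\<ge>N. hn K (f n) <= B"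
proof -
 obtain N where N: "\<forall>m\<ge>N. \<forall>n\<ge>N. hn K (f m - f n) < 1" using hs_cauchy[OF f, of 1] by auto
 have "hn K (f n) <= 1 + hn K (f N)" if "n \<ge> N" for n
 proof -
  have "hn K (f n) <= hn K (f n - f N) + hn K (f N)"
   using hn_triangle[OF R.pd, of "f n - f N" "f N"] hs_keys[OF f] by (simp add: keys_diff_subset)
  then show ?thesis using N that by (smt (verit) order_refl)
 qed
 moreover have "0 < 1 + hn K (f N)" using hn_nonneg[OF R.pd hs_keys[OF f]] by (simp add: add_pos_nonneg)
 ultimately show ?thesis by blast
qed

lemma hs_conv: assumes f: "f \<in> hs" and g: "g \<in> hs" shows "(%n. form K (f n) (g n)) \<longlonglongrightarrow> hk f g"
proof -
 obtain B N1 where B: "0 < B" "!!n. n \<ge> N1 ==> hn K (f n) <= B" using hs_bounded[OF f] by blast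
 obtain C N2 where C: "0 < C" "!!n. n \<ge> N2 ==> hn K (g n) <= C" using hs_bounded[OF g] by blast
 note k = hs_keys[OF f] hs_keys[OF g]
 have "Cauchy (%n. form K (f n) (g n))"
  unfolding Cauchy_def
 proof (intro allI impI)
  fix e :: real assume e: "0 < e"
  define d where "d = e / (B + C)"
  have d: "0 < d" "(B + C) * d = e" using e B C by (simp_all add: d_def)
  obtain N3 where N3: "!!m n. m \<ge> N3 ==> n \<ge> N3 ==> hn K (f m - f n) < d" using hs_cauchy[OF f d(1)] by blast
  obtain N4 where N4: "!!m n. m \<ge> N4 ==> n \<ge> N4 ==> hn K (g m - g n) < d" using hs_cauchy[OF g d(1)] by blast
  define M where "M = max (max N1 N2) (max N3 N4)"
  have "dist (form K (f m) (g m)) (form K (f n) (g n)) < e" if mn: "m \<ge> M" "n \<ge> M" for m n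
  proof -
   have "form K (f m) (g m) - form K (f n) (g n) = form K (f m - f n) (g m) + form K (f n) (g m - g n)"
    by (simp add: form_diff_left form_diff_right)
   also have "cmod ... <= hn K (f m - f n) * hn K (g m) + hn K (f n) * hn K (g m - g n)"
    by (rule order_trans[OF norm_triangle_ineq add_mono]) (intro pd_cs[OF R.pd] keys_diff_subset k)+
   also have "... <= hn K (f m - f n) * C + B * hn K (g m - g n)"
    using B C mn by (intro add_mono mult_mono hn_nonneg[OF R.pd] keys_diff_subset k) (auto simp: M_def)
   also have "... < d * C + B * d"
    using N3[of m n] N4[of m n] mn B C by (intro add_strict_mono mult_strict_left_mono mult_strict_right_mono) (auto simp: M_def)
   finally show ?thesis using d by (simp add: dist_norm algebra_simps)
  qed
  then show "\<exists>M. \<forall>m\<ge>M. \<forall>n\<ge>M. dist (form K (f m) (g m)) (form K (f n) (g n)) < e" by blast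
 qed
 then show ?thesis unfolding hk_def by (simp add: Cauchy_convergent_iff convergent_LIMSEQ_iff)
qed

lemma hk_unique: "f \<in> hs ==> g \<in> hs ==> (%n. form K (f n) (g n)) \<longlonglongrightarrow> l ==> hk f g = l"
 using LIMSEQ_unique[OF hs_conv] by blast

lemma const_hs: "v on lset As ==> (%_. v) \<in> hs"
 by (auto simp: hs_def hn_def)

lemma hk_const: "v on lset As ==> w on lset As ==> hk (%_. v) (%_. w) = form K v w"
 by (rule hk_unique[OF const_hs const_hs]) auto

text \<open>Nonnegativity of the form at each index \<open>n\<close> passes to the limit, since only
  finitely many sequences occur in \<open>w\<close>.\<close>

lemma pd_hk: "pd hs hk"
 unfolding pd_def
proof (intro allI impI)
 fix w :: "(nat => 'a formal) \<Rightarrow>\<^sub>0 complex" assume w: "w on hs"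
 have lim: "(%n. form (%f g. form K (f n) (g n)) w w) \<longlonglongrightarrow> form hk w w"
  using w by (intro form_tendsto hs_conv) auto
 have "form (%f g. form K (f n) (g n)) w w \<in> \<real>\<^sub>\<ge>\<^sub>0" for n
  using pd_form[OF pd_pullback[OF R.pd, of hs "%f. f n"] w] hs_keys by auto
 then show "form hk w w \<in> \<real>\<^sub>\<ge>\<^sub>0"
  using closed_sequentially[OF closed_nonneg_Reals_complex _ lim] by blast
qed

lemma cn_cauchy: assumes a: "a \<in> T.cn" and e: "0 < e" shows "\<exists>N. \<forall>m\<ge>N. \<forall>n\<ge>N. min_norm As (a m - a n) < e"
proof -
 obtain i where i: "T.coh a (e / 2) i" using a e T.cn_iff by (meson half_gt_zero)
 interpret N: pre_cstar "formal_alg As" by (rule pre_cstar_formal_alg)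
 note k = cn_formal[OF a]
 have "min_norm As (a m - a n) < e" if "m \<ge> i" "n \<ge> i" for m n
 proof -
  have "min_norm As (a m - a n) <= min_norm As (a m - a i) + min_norm As (a i - a n)"
   using N.dst_triangle[of "a m" "a i" "a n"] k by simp
  also have "min_norm As (a i - a n) = min_norm As (a n - a i)"
   using N.dst_commute[of "a i" "a n"] k by simp
  also have "min_norm As (a m - a i) < e / 2" using i that(1) by (simp add: T.coh_def)
  also have "min_norm As (a n - a i) < e / 2" using i that(2) by (simp add: T.coh_def)
  finally show ?thesis by simp
 qed
 then show ?thesis by blast
qed

lemma hn_lmul: "u on lset As ==> w on lset As ==> hn K (av (lmul As) u w) <= min_norm As u * hn K w"
 using opbd_min_norm[OF _ st] by (simp add: opbd_def)

lemma act_hs: assumes a: "a \<in> T.cn" and f: "f \<in> hs" shows "(%n. av (lmul As) (a n) (f n)) \<in> hs"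
 unfolding hs_def
proof (intro CollectI conjI allI impI)
 note k = cn_formal[OF a] hs_keys[OF f]
 show "(av (lmul As) (a n) (f n)) on lset As" for n by (intro R.keys_act k)
 fix e :: real assume e: "0 < e"
 obtain B N1 where B: "0 < B" "!!n. n \<ge> N1 ==> hn K (f n) <= B" using hs_bounded[OF f] by blast
 obtain C where C: "0 < C" "eventually (%j. min_norm As (a j) <= C) T.F" using T.cn_bounded[OF a] by auto
 then obtain N2 where N2: "!!n. n \<ge> N2 ==> min_norm As (a n) <= C"
  unfolding net_at_top_nat eventually_sequentially by blast
 define d where "d = e / (B + C)"
 have d: "0 < d" "(B + C) * d = e" using e B C by (simp_all add: d_def)
 obtain N3 where N3: "!!m n. m \<ge> N3 ==> n \<ge> N3 ==> hn K (f m - f n) < d" using hs_cauchy[OF f d(1)] by blast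
 obtain N4 where N4: "!!m n. m \<ge> N4 ==> n \<ge> N4 ==> min_norm As (a m - a n) < d" using cn_cauchy[OF a d(1)] by blast
 define M where "M = max (max N1 N2) (max N3 N4)"
 have "hn K (av (lmul As) (a m) (f m) - av (lmul As) (a n) (f n)) < e" if mn: "m \<ge> M" "n \<ge> M" for m n
 proof -
  have "av (lmul As) (a m) (f m) - av (lmul As) (a n) (f n) =
    av (lmul As) (a m - a n) (f m) + av (lmul As) (a n) (f m - f n)"
   by (simp add: av_diff_left av_diff_right)
  also have "hn K ... <= hn K (av (lmul As) (a m - a n) (f m)) + hn K (av (lmul As) (a n) (f m - f n))"
   by (intro hn_triangle[OF R.pd] R.keys_act keys_diff_subset k)
  also have "... <= min_norm As (a m - a n) * hn K (f m) + min_norm As (a n) * hn K (f m - f n)"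
   by (intro add_mono hn_lmul keys_diff_subset k)
  also have "... <= min_norm As (a m - a n) * B + C * hn K (f m - f n)"
   using B C N2 mn by (intro add_mono mult_mono hn_nonneg[OF R.pd] min_norm_ge0 keys_diff_subset k) (auto simp: M_def)
  also have "... < d * B + C * d"
   using N3[of m n] N4[of m n] mn B C by (intro add_strict_mono mult_strict_left_mono mult_strict_right_mono) (auto simp: M_def)
  finally show ?thesis using d by (simp add: algebra_simps)
 qed
 then show "\<exists>M. \<forall>m\<ge>M. \<forall>n\<ge>M. hn K (av (lmul As) (a m) (f m) - av (lmul As) (a n) (f n)) < e" by blast
qed

lemma tact_hs: "x el tensor As ==> f \<in> hs ==> tact x f \<in> hs"
 unfolding tact_def by (intro act_hs rep_tensor)

text \<open>Any sequence representing the class computes the same matrix coefficients, so laws of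
  \<open>tact\<close> can be checked on convenient representatives.\<close>

lemma tact_lim:
 assumes a: "a \<in> T.cn" and f: "f \<in> hs" and g: "g \<in> hs"
 shows "(%n. form K (g n) (av (lmul As) (a n) (f n))) \<longlonglongrightarrow> hk g (tact (T.cls a) f)"
proof -
 let ?r = "rep (T.cls a)"
 note r = T.rep_cls[OF a]
 note k = cn_formal[OF a] cn_formal[OF r(1)] hs_keys[OF f] hs_keys[OF g]
 obtain B N1 where B: "0 < B" "!!n. n \<ge> N1 ==> hn K (f n) <= B" using hs_bounded[OF f] by blast
 obtain C N2 where C: "0 < C" "!!n. n \<ge> N2 ==> hn K (g n) <= C" using hs_bounded[OF g] by blast
 have "(%n. form K (g n) (av (lmul As) (?r n) (f n))) \<longlonglongrightarrow> hk g (tact (T.cls a) f)"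
  using hs_conv[OF g tact_hs[OF _ f], of "T.cls a"] T.cls_in[OF a] by (simp add: tact_def tensor_T)
 moreover have "(%n. form K (g n) (av (lmul As) (a n) (f n)) - form K (g n) (av (lmul As) (?r n) (f n))) \<longlonglongrightarrow> 0"
 proof (rule Lim_null_comparison)
  have "(%n. min_norm As (a n - ?r n)) \<longlonglongrightarrow> 0"
   using r(2) by (simp add: T.null_def T.nd_def[abs_def] net_at_top_nat)
  then have "(%n. C * (min_norm As (a n - ?r n) * B)) \<longlonglongrightarrow> C * (0 * B)" by (intro tendsto_intros)
  then show "(%n. C * (min_norm As (a n - ?r n) * B)) \<longlonglongrightarrow> 0" by simp
  have "cmod (form K (g n) (av (lmul As) (a n) (f n)) - form K (g n) (av (lmul As) (?r n) (f n)))
    <= C * (min_norm As (a n - ?r n) * B)" if "n \<ge> max N1 N2" for n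
  proof -
   have "form K (g n) (av (lmul As) (a n) (f n)) - form K (g n) (av (lmul As) (?r n) (f n)) =
     form K (g n) (av (lmul As) (a n - ?r n) (f n))" by (simp add: av_diff_left form_diff_right)
   also have "cmod ... <= hn K (g n) * hn K (av (lmul As) (a n - ?r n) (f n))"
    by (intro pd_cs[OF R.pd] R.keys_act keys_diff_subset k)
   also have "... <= C * (min_norm As (a n - ?r n) * hn K (f n))"
    using C that by (intro mult_mono hn_lmul hn_nonneg[OF R.pd] R.keys_act keys_diff_subset k) auto
   also have "... <= C * (min_norm As (a n - ?r n) * B)"
    using B C that by (intro mult_left_mono min_norm_ge0 keys_diff_subset k) auto
   finally show ?thesis .
  qed
  then show "\<forall>\<^sub>F n in sequentially. cmod (form K (g n) (av (lmul As) (a n) (f n)) - form K (g n) (av (lmul As) (?r n) (f n)))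
    <= C * (min_norm As (a n - ?r n) * B)"
   unfolding eventually_sequentially by blast
 qed
 ultimately show ?thesis using tendsto_add by fastforce
qed

lemma hk_tact:
 assumes "a \<in> T.cn" "f \<in> hs" "g \<in> hs" "(%n. form K (g n) (av (lmul As) (a n) (f n))) \<longlonglongrightarrow> l"
 shows "hk g (tact (T.cls a) f) = l"
 using LIMSEQ_unique[OF tact_lim] assms by blast

lemma cstar_rep_hilbert: "cstar_rep (tensor As) hs tact hk"
proof -
 interpret TA: cstar_algebra "tensor As" by (rule cstar_tensor)
 have "star_rep (carrier (tensor As)) (mult_of (tensor As)) (star_of (tensor As)) hs tact hk"
 proof
  fix x f g assume x: "x el tensor As" and f: "f \<in> hs" and g: "g \<in> hs"
  obtain a where a: "a \<in> T.cn" "x = T.cls a" "a = rep x" using rep_tensor[OF x] by metis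
  show "hk (tact x f) g = hk f (tact (star_of (tensor As) x) g)"
  proof (rule hk_unique[OF tact_hs[OF x f] g])
   have "(%n. form K (f n) (av (lmul As) (T.pstar a n) (g n))) \<longlonglongrightarrow> hk f (tact (T.cls (T.pstar a)) g)"
    by (rule tact_lim[OF T.cn_pstar[OF a(1)] g f])
   moreover have "form K (f n) (av (lmul As) (T.pstar a n) (g n)) = form K (tact x f n) (g n)" for n
    using R.form_adj[OF cn_formal[OF a(1)] hs_keys[OF f] hs_keys[OF g]]
    by (simp add: T.pstar_def tact_def a(3))
   ultimately show "(%n. form K (tact x f n) (g n)) \<longlonglongrightarrow> hk f (tact (star_of (tensor As) x) g)"
    by (simp add: tensor_T a(2) T.star_cls[OF a(1)])
  qed
 next
  fix x y f g assume x: "x el tensor As" and y: "y el tensor As" and g: "g \<in> hs" and f: "f \<in> hs"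
  obtain a where a: "a \<in> T.cn" "x = T.cls a" using rep_tensor[OF x] by metis
  obtain b where b: "b \<in> T.cn" "y = T.cls b" "b = rep y" using rep_tensor[OF y] by metis
  show "hk g (tact (mult_of (tensor As) x y) f) = hk g (tact x (tact y f))"
   unfolding tensor_T a(2) b(2) T.mult_cls[OF a(1) b(1)]
  proof (rule hk_tact[OF T.cn_pmult[OF a(1) b(1)] f g])
   have "(%n. form K (g n) (av (lmul As) (a n) (tact y f n))) \<longlonglongrightarrow> hk g (tact (T.cls a) (tact y f))"
    by (rule tact_lim[OF a(1) tact_hs[OF y f] g])
   moreover have "form K (g n) (av (lmul As) (a n) (tact y f n)) = form K (g n) (av (lmul As) (T.pmult a b n) (f n))" for n
    using R.form_mul[OF cn_formal[OF a(1)] cn_formal[OF b(1)] hs_keys[OF g] hs_keys[OF f]]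
    by (simp add: T.pmult_def tact_def b(3))
   ultimately show "(%n. form K (g n) (av (lmul As) (T.pmult a b n) (f n))) \<longlonglongrightarrow> hk g (tact (T.cls a) (tact (T.cls b) f))"
    by (simp add: b(2))
  qed
 qed (auto intro: TA.mult_closed TA.star_closed tact_hs pd_hk)
 moreover have "hk g (tact (add_of (tensor As) x y) f) = hk g (tact x f) + hk g (tact y f)"
  if x: "x el tensor As" and y: "y el tensor As" and g: "g \<in> hs" and f: "f \<in> hs" for x y f g
 proof -
  obtain a where a: "a \<in> T.cn" "x = T.cls a" using rep_tensor[OF x] by metis
  obtain b where b: "b \<in> T.cn" "y = T.cls b" using rep_tensor[OF y] by metis
  show ?thesis unfolding tensor_T a(2) b(2) T.add_cls[OF a(1) b(1)]
   by (rule hk_tact[OF T.cn_padd[OF a(1) b(1)] f g])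
    (simp add: T.padd_def av_add_left form_add_right tendsto_add tact_lim a b f g)
 qed
 moreover have "hk g (tact (scale_of (tensor As) c x) f) = c * hk g (tact x f)"
  if x: "x el tensor As" and g: "g \<in> hs" and f: "f \<in> hs" for x c f g
 proof -
  obtain a where a: "a \<in> T.cn" "x = T.cls a" using rep_tensor[OF x] by metis
  show ?thesis unfolding tensor_T a(2) T.scale_cls[OF a(1)]
   by (rule hk_tact[OF T.cn_pscale[OF a(1)] f g])
    (simp add: T.pscale_def av_psc_left form_psc_right tendsto_mult_left tact_lim a f g)
 qed
 ultimately show ?thesis
  by (intro cstar_rep.intro linear_rep.intro linear_rep_axioms.intro cstar_tensor) auto
qed

sublocale H: cstar_rep "tensor As" hs tact hk
 by (rule cstar_rep_hilbert)

text \<open>With elements acting on both sides, the left one is moved over as an adjoint, which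
  reduces the limit to \<open>tact_lim\<close>.\<close>

lemma tact_lim2:
 assumes a: "a \<in> T.cn" and b: "b \<in> T.cn" and f: "f \<in> hs" and g: "g \<in> hs"
 shows "(%n. form K (av (lmul As) (a n) (f n)) (av (lmul As) (b n) (g n))) \<longlonglongrightarrow> hk (tact (T.cls a) f) (tact (T.cls b) g)"
proof -
 have x: "T.cls a el tensor As" "T.cls b el tensor As" using T.cls_in a b by (auto simp: tensor_T)
 have ab: "T.pmult (T.pstar a) b \<in> T.cn" by (intro T.cn_pmult T.cn_pstar a b)
 have "hk (tact (T.cls a) f) (tact (T.cls b) g) = hk f (tact (T.cls (T.pmult (T.pstar a) b)) g)"
  using H.adj[OF x(1) f tact_hs[OF x(2) g]] H.act_mul[OF H.star_closed[OF x(1)] x(2) f g]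
  by (simp add: tensor_T T.star_cls a T.mult_cls[OF T.cn_pstar[OF a] b])
 moreover have "(%n. form K (f n) (av (lmul As) (T.pmult (T.pstar a) b n) (g n))) \<longlonglongrightarrow>
   hk f (tact (T.cls (T.pmult (T.pstar a) b)) g)" by (rule tact_lim[OF ab g f])
 moreover have "form K (f n) (av (lmul As) (T.pmult (T.pstar a) b n) (g n)) =
   form K (av (lmul As) (a n) (f n)) (av (lmul As) (b n) (g n))" for n
  using R.form_adj[OF cn_formal[OF a] hs_keys[OF f] R.keys_act[OF cn_formal[OF b] hs_keys[OF g]], of n]
   R.form_mul[OF R.keys_star[OF cn_formal[OF a]] cn_formal[OF b] hs_keys[OF f] hs_keys[OF g], of n]
  by (simp add: T.pmult_def T.pstar_def)
 ultimately show ?thesis by simp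
qed

text \<open>Composition with a homomorphism into the completed tensor product turns its domain into
  a C*-algebra represented on Cauchy sequences, so that \<open>hn_act_le\<close> applies to
  it.\<close>

lemma cstar_rep_star_hom:
 assumes B: "cstar_algebra B" and f: "star_hom B (tensor As) f"
 shows "cstar_rep B hs (%a. tact (f a)) hk"
proof (intro cstar_rep.intro linear_rep.intro linear_rep_axioms.intro B star_rep.intro)
 interpret B: cstar_algebra B by fact
 note fc = lin_closed[OF hom_linear[OF f]]
 show "m el B ==> n el B ==> mult_of B m n el B" for m n by (rule B.mult_closed)
 show "m el B ==> star_of B m el B" for m by (rule B.star_closed)
 show "m el B ==> s \<in> hs ==> tact (f m) s \<in> hs" for m s by (intro tact_hs fc)
 show "pd hs hk" by (rule pd_hk)
 show "m el B ==> s \<in> hs ==> t \<in> hs ==> hk (tact (f m) s) t = hk s (tact (f (star_of B m)) t)" for m s t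
  by (simp add: star_hom_star[OF f] H.adj fc)
 show "m el B ==> n el B ==> r \<in> hs ==> s \<in> hs ==>
   hk r (tact (f (mult_of B m n)) s) = hk r (tact (f m) (tact (f n) s))" for m n r s
  by (simp add: star_hom_mult[OF f] H.act_mul fc)
 show "a el B ==> b el B ==> s \<in> hs ==> t \<in> hs ==>
   hk s (tact (f (add_of B a b)) t) = hk s (tact (f a) t) + hk s (tact (f b) t)" for a b s t
  by (simp add: lin_map_add[OF hom_linear[OF f]] H.act_add fc)
 show "a el B ==> s \<in> hs ==> t \<in> hs ==>
   hk s (tact (f (scale_of B c a)) t) = c * hk s (tact (f a) t)" for a c s t
  by (simp add: lin_scale[OF hom_linear[OF f]] H.act_scale fc)
qed

lemma tact_norm_tendsto:
 assumes x: "x el tensor As" and v: "v on lset As"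
 shows "(%n. hn K (av (lmul As) (rep x n) v)) \<longlonglongrightarrow> sqrt (Re (hk (tact x (%_. v)) (tact x (%_. v))))"
 unfolding hn_def using tact_lim2[OF rep_tensor(1)[OF x] rep_tensor(1)[OF x] const_hs[OF v] const_hs[OF v]]
 by (intro tendsto_real_sqrt tendsto_Re) (simp add: rep_tensor(2)[OF x])

end

context cstar_list
begin

text \<open>The norm in the completion is detected by constant sequences of formal tensors in all
  state lists. For large \<open>n\<close>, \<open>?a n\<close> is within \<open>e\<close> of all
  later terms, and letting these run to the limit bounds its minimal norm by
  \<open>N + e\<close>.\<close>

lemma tensor_norm_le:
 assumes x: "x el tensor As" and N: "0 <= N"
  and bd: "!!\<phi>s v. states \<phi>s ==> v on lset As ==>
   sqrt (Re (state_list.hk As \<phi>s (state_list.tact As x (%_. v)) (state_list.tact As x (%_. v))))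
    <= N * hn (skernel As \<phi>s) v"
 shows "norm_of (tensor As) x <= N"
proof (rule field_le_epsilon)
 fix e :: real assume e: "0 < e"
 let ?a = "rep x"
 note a = rep_tensor[OF x]
 note k = cn_formal[OF a(1)]
 interpret N: pre_cstar "formal_alg As" by (rule pre_cstar_formal_alg)
 obtain i where "T.coh ?a (e / 2) i" using a(1) e T.cn_iff by (meson half_gt_zero)
 then have i: "min_norm As (?a j - ?a i) < e / 2" if "j \<ge> i" for j using that by (simp add: T.coh_def)
 have cau: "min_norm As (?a n - ?a m) <= e" if "n \<ge> i" "m \<ge> i" for m n
  using N.dst_triangle[of "?a n" "?a i" "?a m"] N.dst_commute[of "?a i" "?a m"] i[OF that(1)] i[OF that(2)] k by simp
 have "min_norm As (?a n) <= N + e" if n: "n \<ge> i" for n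
 proof (rule min_norm_le)
  fix \<phi>s assume s: "states \<phi>s"
  interpret S: state_list As \<phi>s by unfold_locales (rule s)
  show "opbd (lset As) (lmul As) (skernel As \<phi>s) (?a n) (N + e)"
   unfolding opbd_def
  proof (intro allI impI)
   fix v assume v: "v on lset As"
   have "hn S.K (av (lmul As) (?a n) v) <= hn S.K (av (lmul As) (?a m) v) + e * hn S.K v" if m: "m \<ge> i" for m
   proof -
    have "av (lmul As) (?a n) v = av (lmul As) (?a m) v + av (lmul As) (?a n - ?a m) v"
     by (simp add: av_diff_left)
    also have "hn S.K ... <= hn S.K (av (lmul As) (?a m) v) + hn S.K (av (lmul As) (?a n - ?a m) v)"
     by (intro hn_triangle[OF S.R.pd] S.R.keys_act keys_diff_subset k v)
    also have "hn S.K (av (lmul As) (?a n - ?a m) v) <= min_norm As (?a n - ?a m) * hn S.K v"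
     by (intro S.hn_lmul keys_diff_subset k v)
    also have "... <= e * hn S.K v"
     by (intro mult_right_mono cau n m hn_nonneg[OF S.R.pd v])
    finally show ?thesis by simp
   qed
   moreover have "(%m. hn S.K (av (lmul As) (?a m) v) + e * hn S.K v) \<longlonglongrightarrow>
     sqrt (Re (S.hk (S.tact x (%_. v)) (S.tact x (%_. v)))) + e * hn S.K v"
    by (intro tendsto_add tendsto_const S.tact_norm_tendsto x v)
   ultimately have "hn S.K (av (lmul As) (?a n) v) \<le>
     sqrt (Re (S.hk (S.tact x (%_. v)) (S.tact x (%_. v)))) + e * hn S.K v"
    by (intro LIMSEQ_le_const) auto
   also have "... <= N * hn S.K v + e * hn S.K v" using bd[OF s v] by simp
   finally show "hn S.K (av (lmul As) (?a n) v) <= (N + e) * hn S.K v" by (simp add: distrib_right)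
  qed
 qed (use N e in simp)
 then have "norm_of T.L (T.cls ?a) <= N + e"
  by (intro T.norm_le_eventually a) (auto simp: net_at_top_nat eventually_sequentially)
 then show "norm_of (tensor As) x <= N + e" using a(2) by (simp add: tensor_T)
qed

text \<open>In each state list the homomorphism induces a representation of \<open>A\<close>, which
  is contractive by \<open>hn_act_le\<close>.\<close>

lemma star_hom_contractive:
 assumes A: "cstar_algebra A" and f: "star_hom A (tensor As) f" and a: "a el A"
 shows "norm_of (tensor As) (f a) <= norm_of A a"
proof (rule tensor_norm_le)
 interpret A: cstar_algebra A by fact
 show fa: "f a el tensor As" by (rule lin_closed[OF hom_linear[OF f] a])
 show "0 <= norm_of A a" by (rule A.norm_nonneg[OF a])
 fix \<phi>s v assume s: "states \<phi>s" and v: "v on lset As"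
 interpret S: state_list As \<phi>s by unfold_locales (rule s)
 interpret FR: cstar_rep A S.hs "%a. S.tact (f a)" S.hk by (rule S.cstar_rep_star_hom[OF A f])
 have "hn S.hk (av (%a. S.tact (f a)) (single a 1) (single (%_. v) 1)) <= norm_of A a * hn S.hk (single (%_. v) 1)"
  by (rule FR.hn_act_le[OF a]) (simp add: S.const_hs v)
 then show "sqrt (Re (S.hk (S.tact (f a) (%_. v)) (S.tact (f a) (%_. v)))) <= norm_of A a * hn S.K v"
  by (simp add: av_single hn_def S.hk_const v)
qed

end

section \<open>Homomorphisms on formal tensors and their extension\<close>

locale formal_hom = C: cstar_list Cs + A: state_list As \<phi>s
 for Cs :: "'c star_alg list" and As :: "'a star_alg list" and \<phi>s +
 fixes g :: "'c formal => 'a tensor"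
 assumes g: "star_hom (formal_alg Cs) (tensor As) g"
begin

abbreviation "lact \<equiv> %m. A.tact (g (single m 1))"

lemma g_closed: "u on lset Cs ==> g u el tensor As"
 using lin_closed[OF hom_linear[OF g], of u] by simp

lemma g_add: "u on lset Cs ==> v on lset Cs ==> g (u + v) = add_of (tensor As) (g u) (g v)"
 using lin_map_add[OF hom_linear[OF g], of u v] by simp

lemma g_psc: "u on lset Cs ==> g (psc c u) = scale_of (tensor As) c (g u)"
 using lin_scale[OF hom_linear[OF g], of u c] by simp

lemma g_mult: "m \<in> lset Cs ==> n \<in> lset Cs ==>
  g (single (lmul Cs m n) 1) = mult_of (tensor As) (g (single m 1)) (g (single n 1))"
 using star_hom_mult[OF g, of "single m 1" "single n 1"] by (simp add: av_single)

lemma g_star: "m \<in> lset Cs ==> g (single (lstar Cs m) 1) = star_of (tensor As) (g (single m 1))"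
 using star_hom_star[OF g, of "single m 1"] by (simp add: C.pst_single)

lemma star_rep_lact: "star_rep (lset Cs) (lmul Cs) (lstar Cs) A.hs lact A.hk"
proof
 have c: "g (single m 1) el tensor As" if "m \<in> lset Cs" for m
  by (rule g_closed) (use that in simp)
 show "m \<in> lset Cs ==> s \<in> A.hs ==> lact m s \<in> A.hs" for m s by (intro A.tact_hs c)
 show "m \<in> lset Cs ==> s \<in> A.hs ==> t \<in> A.hs ==> A.hk (lact m s) t = A.hk s (lact (lstar Cs m) t)" for m s t
  by (simp add: g_star A.H.adj c)
 show "m \<in> lset Cs ==> n \<in> lset Cs ==> r \<in> A.hs ==> s \<in> A.hs ==>
  A.hk r (lact (lmul Cs m n) s) = A.hk r (lact m (lact n s))" for m n r s
  by (simp add: g_mult A.H.act_mul c)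
qed (auto intro: C.lmul_closed C.lstar_closed A.pd_hk)

text \<open>Acting by the images of basis lists, extended linearly, agrees against the form with
  acting by the image of the whole combination. This links the semigroup representation to norms in
  the completion.\<close>

lemma form_lact:
 assumes u: "u on lset Cs" and z: "z on A.hs" and w: "w on A.hs"
 shows "form A.hk z (av lact u w) = form A.hk z (av A.tact (single (g u) 1) w)"
 using u
proof (induction u rule: finsupp_induct)
 case zero
 interpret TA: cstar_algebra "tensor As" by (rule A.cstar_tensor)
 have "g 0 = scale_of (tensor As) 0 (g 0)" using g_psc[of 0 0] by simp
 then have "form A.hk z (av A.tact (single (g 0) 1) w) = 0"
  using A.H.form_act_scale[OF z w g_closed, of 0 0] by simp
 then show ?case by simp
next
 case (add k c u)
 have k: "(single k 1) on lset Cs" using add by simp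
 note gk = g_closed[OF k]
 have "av lact (single k 1) w = av A.tact (single (g (single k 1)) 1) w" by (simp add: av_single_left)
 then have "form A.hk z (av lact (psc c (single k 1) + u) w) =
   c * form A.hk z (av A.tact (single (g (single k 1)) 1) w) + form A.hk z (av A.tact (single (g u) 1) w)"
  unfolding av_add_left form_add_right av_psc_left form_psc_right add.IH by simp
 also have "... = form A.hk z (av A.tact (single (g (psc c (single k 1) + u)) 1) w)"
  using A.H.form_act_add[OF z w A.H.scale_closed[OF gk] g_closed[OF add(2)]] A.H.form_act_scale[OF z w gk]
  by (simp only: g_add[OF keys_psc_subset[OF k] add(2)] g_psc[OF k])
 finally show ?case by simp
qed

lemma hn_lact:
 assumes u: "u on lset Cs" and w: "w on A.hs"
 shows "hn A.hk (av lact u w) = hn A.hk (av A.tact (single (g u) 1) w)"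
proof (rule A.H.hn_eqI)
 interpret L: star_rep "lset Cs" "lmul Cs" "lstar Cs" A.hs lact A.hk by (rule star_rep_lact)
 show "(av lact u w) on A.hs" by (rule L.keys_act[OF u w])
 show "(av A.tact (single (g u) 1) w) on A.hs" by (rule A.H.keys_act[OF _ w]) (simp add: g_closed u)
qed (rule form_lact[OF u _ w])

lemma opbd_lact: "u on lset Cs ==> opbd A.hs lact A.hk u (norm_of (tensor As) (g u))"
 using A.H.opbd_single[OF g_closed] by (simp add: opbd_def hn_lact)

lemma opbd_lact_vector:
 assumes u: "u on lset Cs" and bd: "opbd A.hs lact A.hk u N" and v: "v on lset As"
 shows "sqrt (Re (A.hk (A.tact (g u) (%_. v)) (A.tact (g u) (%_. v)))) <= N * hn A.K v"
proof -
 have k: "(single (%_. v) 1) on A.hs" by (simp add: A.const_hs v)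
 have "hn A.hk (av A.tact (single (g u) 1) (single (%_. v) 1)) <= N * hn A.hk (single (%_. v) 1)"
  using bd k hn_lact[OF u k] unfolding opbd_def by metis
 then show ?thesis by (simp add: av_single hn_def A.hk_const v)
qed

end

locale formal_extension = C: cstar_list Cs + A: cstar_list As
 for Cs :: "'c star_alg list" and As :: "'a star_alg list" +
 fixes r :: "'c list => nat => 'a formal"
 assumes r: "m \<in> lset Cs ==> r m \<in> A.T.cn"
begin

text \<open>The linear extension is made on representing sequences rather than on classes, so that
  limits of inner products can later be computed term by term.\<close>

definition gnet :: "'c formal => nat => 'a formal" where
 "gnet u = (%n. ext (%m. r m n) u)"

definition gext :: "'c formal => 'a tensor" where
 "gext u = A.T.cls (gnet u)"

lemma gnet_cn: "u on lset Cs ==> gnet u \<in> A.T.cn"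
proof (induction u rule: finsupp_induct)
 case zero
 then show ?case using A.const_cn[of 0] by (simp add: gnet_def)
next
 case (add k c u)
 have "gnet (single k c + u) = A.T.padd (A.T.pscale c (r k)) (gnet u)"
  by (simp add: gnet_def A.T.padd_def A.T.pscale_def ext_add)
 then show ?case using add r by (simp add: A.T.cn_ops)
qed

lemma gext_single: "m \<in> lset Cs ==> gext (single m 1) = A.T.cls (r m)"
 by (simp add: gext_def gnet_def)

lemma gext_linear: "linear_map (formal_alg Cs) (tensor As) gext"
 unfolding linear_map_def A.tensor_T
 by (auto simp: gext_def A.T.cls_in gnet_cn A.T.add_cls A.T.scale_cls)
  (simp_all add: gnet_def A.T.padd_def A.T.pscale_def ext_add ext_psc)

text \<open>Products and adjoints are controlled on basis lists and spread by induction on supports,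
  one argument at a time.\<close>

lemma gext_star_hom:
 assumes m: "!!m n. m \<in> lset Cs ==> n \<in> lset Cs ==>
   A.T.cls (r (lmul Cs m n)) = mult_of (tensor As) (A.T.cls (r m)) (A.T.cls (r n))"
  and s: "!!m. m \<in> lset Cs ==> A.T.cls (r (lstar Cs m)) = star_of (tensor As) (A.T.cls (r m))"
 shows "star_hom (formal_alg Cs) (tensor As) gext"
proof -
 interpret TA: cstar_algebra "tensor As" by (rule A.cstar_tensor)
 interpret N: pre_cstar "formal_alg Cs" by (rule C.pre_cstar_formal_alg)
 note lin = gext_linear
 have addg: "gext (u + v) = add_of (tensor As) (gext u) (gext v)" if "u on lset Cs" "v on lset Cs" for u v
  using lin_map_add[OF lin, of u v] that by simp
 have scaleg: "gext (psc c u) = scale_of (tensor As) c (gext u)" if "u on lset Cs" for u c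
  using lin_scale[OF lin, of u c] that by simp
 have zerog: "gext 0 = zero_of (tensor As)"
  using linear_map_zero[OF lin N.pre_cstar_axioms TA.pre_cstar_axioms] by simp
 have clg: "gext u el tensor As" if "u on lset Cs" for u
  using lin_closed[OF lin, of u] that by simp
 have mult1: "gext (av (lmul Cs) (single k 1) v) = mult_of (tensor As) (gext (single k 1)) (gext v)"
  if k: "k \<in> lset Cs" and v: "v on lset Cs" for k v
  using v
 proof (induction v rule: finsupp_induct)
  case zero
  then show ?case using clg[of "single k 1"] k by (simp add: zerog TA.mult_zero)
 next
  case (add j d v)
  have k1: "(single k 1) on lset Cs" "(single j 1) on lset Cs" using k add by auto
  have "gext (av (lmul Cs) (single k 1) (psc d (single j 1) + v)) =
    add_of (tensor As) (scale_of (tensor As) d (gext (single (lmul Cs k j) 1))) (gext (av (lmul Cs) (single k 1) v))"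
   using k1 add(2) k add(1)
   by (simp add: av_add_right av_single)
    (subst addg,
     auto simp: C.lmul_closed C.keys_lmul scaleg[of "single (lmul Cs k j) 1" d, simplified])
  also have "... = mult_of (tensor As) (gext (single k 1)) (gext (psc d (single j 1) + v))"
   using k1 add k by (simp only: add.IH gext_single[OF C.lmul_closed] m gext_single[symmetric]
    addg
    keys_psc_subset scaleg TA.mult_add[OF clg TA.scale_closed clg] clg TA.mult_scale[OF clg clg])
  finally show ?case by simp
 qed
 have mult: "gext (av (lmul Cs) u v) = mult_of (tensor As) (gext u) (gext v)"
  if u: "u on lset Cs" and v: "v on lset Cs" for u v
  using u
 proof (induction u rule: finsupp_induct)
  case zero
  then show ?case using clg[OF v] by (simp add: zerog TA.zero_mult)
 next
  case (add k c u)
  have k1: "(single k 1) on lset Cs" using add by auto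
  have "gext (av (lmul Cs) (psc c (single k 1) + u) v) =
    add_of (tensor As) (scale_of (tensor As) c (gext (av (lmul Cs) (single k 1) v))) (gext (av (lmul Cs) u v))"
   by (simp only: av_add_left av_psc_left addg[OF keys_psc_subset[OF C.keys_lmul[OF k1 v]] C.keys_lmul[OF add(2) v]]
    scaleg[OF C.keys_lmul[OF k1 v]])
  also have "... = mult_of (tensor As) (gext (psc c (single k 1) + u)) (gext v)"
   unfolding addg[OF keys_psc_subset[OF k1] add(2)] scaleg[OF k1] add.IH mult1[OF add(1) v]
   by (simp add: TA.add_mult TA.scale_mult clg k1 add(1,2) v TA.scale_closed)
  finally show ?case by simp
 qed
 have star: "gext (pst (lstar Cs) u) = star_of (tensor As) (gext u)" if u: "u on lset Cs" for u
  using u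
 proof (induction u rule: finsupp_induct)
  case zero
  have "pst (lstar Cs) 0 = 0" by (simp add: pst_def)
  then show ?case by (simp add: zerog TA.star_zero)
 next
  case (add k c u)
  have k1: "(single k 1) on lset Cs" using add by auto
  have k2: "(single (lstar Cs k) 1) on lset Cs" using add C.lstar_closed by auto
  have "gext (pst (lstar Cs) (psc c (single k 1) + u)) = gext (psc (cnj c) (single (lstar Cs k) 1) + pst (lstar Cs) u)"
   by (simp only: pst_add C.pst_psc C.pst_single)
  also have "... = add_of (tensor As) (scale_of (tensor As) (cnj c) (gext (single (lstar Cs k) 1))) (star_of (tensor As) (gext u))"
   by (simp only: addg[OF keys_psc_subset[OF k2] C.keys_lstar[OF add(2)]] scaleg[OF k2] add.IH)
  also have "gext (single (lstar Cs k) 1) = star_of (tensor As) (gext (single k 1))"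
   using add(1) by (simp add: gext_single C.lstar_closed s)
  also have "add_of (tensor As) (scale_of (tensor As) (cnj c) (star_of (tensor As) (gext (single k 1)))) (star_of (tensor As) (gext u))
    = star_of (tensor As) (gext (psc c (single k 1) + u))"
   unfolding addg[OF keys_psc_subset[OF k1] add(2)] scaleg[OF k1]
   by (simp add: TA.star_add TA.star_scale clg k1 add(1,2) TA.scale_closed)
  finally show ?case by simp
 qed
 show ?thesis using lin mult star by (simp add: star_hom_def)
qed

end

lemma (in cstar_list) tensor_extension_chom:
 assumes B: "cstar_algebra B" and g: "star_hom (formal_alg As) B g"
  and bd: "!!u. u on lset As ==> norm_of B (g u) <= min_norm As u"
 shows "\<exists>H. chom (tensor As) B H \<and> (\<forall>u. u on lset As \<longrightarrow> H (iota As u) = g u)"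
proof (rule tensor_extension[OF B hom_linear[OF g] zero_le_one])
 show "u on lset As ==> norm_of B (g u) <= 1 * min_norm As u" for u using bd by simp
 fix H assume "!!x. x el tensor As ==> norm_of B (H x) <= 1 * norm_of (tensor As) x"
  "!!u. u on lset As ==> H (iota As u) = g u"
  "star_hom (formal_alg As) B g ==> star_hom (tensor As) B H"
 then show ?thesis using g by (intro exI[of _ H]) (simp add: chom_def)
qed

lemma opbd_mono:
 assumes "pd S K" "opbd S act K u N" "N <= N'"
 shows "opbd S act K u N'"
 unfolding opbd_def
proof (intro allI impI)
 fix w assume w: "w on S"
 have "hn K (av act u w) <= N * hn K w" using assms(2) w by (simp add: opbd_def)
 also have "... <= N' * hn K w" by (intro mult_right_mono assms(3) hn_nonneg[OF assms(1) w])
 finally show "hn K (av act u w) <= N' * hn K w" .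
qed

text \<open>Removes the strict positivity that \<open>opbd_from_gns\<close> demands of its
  bound.\<close>

lemma opbd_epsilon:
 assumes pd: "pd S K" and bd: "!!e. 0 < e ==> opbd S act K u (N + e)"
 shows "opbd S act K u N"
 unfolding opbd_def
proof (intro allI impI)
 fix w assume w: "w on S"
 have "(%n. (N + inverse (real (Suc n))) * hn K w) \<longlonglongrightarrow> (N + 0) * hn K w"
  by (intro tendsto_intros LIMSEQ_inverse_real_of_nat)
 then show "hn K (av act u w) <= N * hn K w"
  by (intro LIMSEQ_le_const[of _ "N * hn K w"]) (use bd w in \<open>auto simp: opbd_def intro!: exI[of _ 0]\<close>)
qed

lemma star_rep_pullback:
 assumes "star_rep M2 mul2 st2 S act K"
  and "!!m n. m \<in> M ==> n \<in> M ==> mul m n \<in> M" "!!m. m \<in> M ==> st m \<in> M"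
  and "!!m. m \<in> M ==> q m \<in> M2" "!!m n. m \<in> M ==> n \<in> M ==> q (mul m n) = mul2 (q m) (q n)"
   "!!m. m \<in> M ==> q (st m) = st2 (q m)"
 shows "star_rep M mul st S (%m. act (q m)) K"
proof -
 interpret star_rep M2 mul2 st2 S act K by fact
 show ?thesis by unfold_locales (use assms in \<open>auto intro: act_closed pd simp: adj act_mul\<close>)
qed

text \<open>\<open>\<kappa>\<close> is the norm of the functional. A nonzero positive functional
  divided by it meets the normalization in \<open>state\<close>, which is phrased by the same
  supremum.\<close>

lemma positive_functional_bound:
 assumes A: "cstar_algebra A" and lin: "linear_map A complex_alg \<omega>"
  and bd: "!!x. x el A ==> cmod (\<omega> x) <= C * norm_of A x"
 defines "\<kappa> \<equiv> Sup ((%x. cmod (\<omega> x)) ` {x \<in> carrier A. norm_of A x <= 1})"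
 shows "bdd_above ((%x. cmod (\<omega> x)) ` {x \<in> carrier A. norm_of A x <= 1})" and "0 <= \<kappa>"
  and "!!x. x el A ==> cmod (\<omega> x) <= \<kappa> * norm_of A x"
proof -
 interpret cstar_algebra A by fact
 let ?S = "(%x. cmod (\<omega> x)) ` {x \<in> carrier A. norm_of A x <= 1}"
 show bdd: "bdd_above ?S"
 proof (rule bdd_aboveI[of _ "\<bar>C\<bar>"])
  fix y assume "y \<in> ?S"
  then obtain x where x: "x el A" "norm_of A x <= 1" "y = cmod (\<omega> x)" by auto
  have "C * norm_of A x <= \<bar>C\<bar> * norm_of A x" by (intro mult_right_mono norm_nonneg x) auto
  also have "... <= \<bar>C\<bar> * 1" by (intro mult_left_mono x) auto
  finally show "y <= \<bar>C\<bar>" using bd[OF x(1)] x(3) by simp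
 qed
 show k0: "0 <= \<kappa>"
  unfolding \<kappa>_def
  by (rule order_trans[OF norm_ge_zero cSup_upper[OF _ bdd]]) (use zero_closed norm_zero in force)
 fix x assume x: "x el A"
 show "cmod (\<omega> x) <= \<kappa> * norm_of A x"
 proof (cases "norm_of A x = 0")
  case True
  then show ?thesis using bd[OF x] by simp
 next
  case False
  then have n: "0 < norm_of A x" using norm_nonneg[OF x] by simp
  let ?y = "scale_of A (of_real (1 / norm_of A x)) x"
  have "cmod (\<omega> ?y) <= \<kappa>"
   unfolding \<kappa>_def by (intro cSup_upper bdd image_eqI[of _ _ ?y])
    (use x n in \<open>auto simp: scale_closed norm_scale norm_divide\<close>)
  moreover have "\<omega> ?y = of_real (1 / norm_of A x) * \<omega> x" using lin_scale[OF lin x] by simp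
  ultimately have "cmod (\<omega> x) / norm_of A x <= \<kappa>" using n by (simp add: norm_mult norm_divide)
  then show ?thesis using n by (simp add: field_simps)
 qed
qed

lemma state_norm_le:
 assumes A: "cstar_algebra A" and phi: "state A \<phi>" and x: "x el A"
 shows "cmod (\<phi> x) <= norm_of A x"
proof -
 interpret cstar_algebra A by fact
 let ?S = "(%x. cmod (\<phi> x)) ` {x \<in> carrier A. norm_of A x <= 1}"
 have lin: "linear_map A complex_alg \<phi>" and S: "bdd_above ?S" "Sup ?S = 1"
  using phi by (auto simp: state_def Let_def)
 have le1: "cmod (\<phi> y) <= 1" if "y el A" "norm_of A y <= 1" for y
  using cSup_upper[OF _ S(1), of "cmod (\<phi> y)"] S(2) that by auto
 have sc: "\<phi> (scale_of A c x) = c * \<phi> x" for c using lin_scale[OF lin x] by simp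
 show ?thesis
 proof (cases "norm_of A x = 0")
  case True
  then have "x = zero_of A" using norm_eq_zero[OF x] by simp
  then have "\<phi> x = 0" using sc[of 0] scale_zero[OF x] by simp
  then show ?thesis using True by simp
 next
  case False
  then have n: "0 < norm_of A x" using norm_nonneg[OF x] by simp
  have "cmod (\<phi> (scale_of A (of_real (1 / norm_of A x)) x)) <= 1"
   by (rule le1) (use x n in \<open>auto simp: scale_closed norm_scale norm_divide\<close>)
  then show ?thesis unfolding sc using n by (simp add: norm_mult norm_divide field_simps)
 qed
qed

text \<open>The norm of the one-fold tensor product is the supremum over all states, which dominates
 every *-homomorphism; isometry of \<open>single_tensor\<close> is not needed.\<close>

lemma tensor_hat:
 assumes A: "cstar_algebra A" and Bs: "cstar_list Bs" and f: "star_hom A (tensor Bs) f"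
 shows "\<exists>F. chom (tensor [A]) (tensor Bs) F \<and> (\<forall>a\<in>carrier A. F (single_tensor A a) = f a)"
proof -
 interpret A: cstar_algebra A by fact
 interpret B: cstar_list Bs by fact
 interpret LA: cstar_list "[A]" using A by (simp add: cstar_list_def)
 have fc: "f a el tensor Bs" if "a el A" for a
  by (rule lin_closed[OF hom_linear[OF f] that])
 have LAE: "\<exists>a\<in>carrier A. m = [a]" if "m \<in> lset [A]" for m using that by (auto elim!: lset_ConsE)
 interpret E: formal_extension "[A]" Bs "%m. rep (f (hd m))"
  by unfold_locales (use LAE B.rep_tensor fc in fastforce)
 have clsr: "B.T.cls (rep (f a)) = f a" if "a el A" for a using B.rep_tensor fc that by simp
 have sh: "star_hom (formal_alg [A]) (tensor Bs) E.gext"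
 proof (rule E.gext_star_hom)
  fix m assume "m \<in> lset [A]"
  then obtain a where a: "m = [a]" "a el A" using LAE by blast
  show "B.T.cls (rep (f (hd (lstar [A] m)))) = star_of (tensor Bs) (B.T.cls (rep (f (hd m))))"
   using a by (simp add: clsr A.closed) (simp add: star_hom_star[OF f])
  fix n assume "n \<in> lset [A]"
  then obtain b where b: "n = [b]" "b el A" using LAE by blast
  show "B.T.cls (rep (f (hd (lmul [A] m n)))) = mult_of (tensor Bs) (B.T.cls (rep (f (hd m)))) (B.T.cls (rep (f (hd n))))"
   using a b by (simp add: clsr A.closed) (simp add: star_hom_mult[OF f])
 qed
 have gs: "E.gext (single [a] 1) = f a" if "a el A" for a using that by (simp add: E.gext_single clsr)
 have norm: "norm_of (tensor Bs) (E.gext u) <= min_norm [A] u" if u: "u on lset [A]" for u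
 proof -
  let ?N = "min_norm [A] u"
  have N: "0 <= ?N" by (rule LA.min_norm_ge0[OF u])
  have "norm_of (tensor Bs) (E.gext u) <= ?N"
  proof (rule B.tensor_norm_le[OF _ N])
   show "E.gext u el tensor Bs" using lin_closed[OF hom_linear[OF sh], of u] u by simp
   fix \<psi>s v assume psi: "B.states \<psi>s" and v: "v on lset Bs"
   interpret S: state_list Bs \<psi>s by unfold_locales (rule psi)
   interpret H: formal_hom "[A]" Bs \<psi>s E.gext by unfold_locales (rule sh)
   interpret L: star_rep "lset [A]" "lmul [A]" "lstar [A]" S.hs H.lact S.hk by (rule H.star_rep_lact)
   interpret CR: cstar_rep A S.hs "%a. S.tact (f a)" S.hk by (rule S.cstar_rep_star_hom[OF A f])
   \<comment> \<open>The action through \<open>f\<close> lives on a completed space that is not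
     given by a state of \<open>A\<close>. Its vector functionals are multiples of states, and
     \<open>opbd_from_gns\<close> passes from their cyclic representations to the operator.\<close>
   have "opbd S.hs H.lact S.hk u ?N"
   proof (rule opbd_epsilon[OF S.pd_hk])
    fix e :: real assume e: "0 < e"
    show "opbd S.hs H.lact S.hk u (?N + e)"
    proof (rule L.opbd_from_gns[OF u])
    show "0 < ?N + e" using N e by simp
    fix w assume w: "w on S.hs"
    interpret G: star_rep "lset [A]" "lmul [A]" "lstar [A]" "lset [A]" "lmul [A]" "L.gns_kernel w"
     by (rule L.star_rep_gns[OF w])
    \<comment> \<open>The kernel of the cyclic representation of \<open>w\<close> is the functional
      kernel of \<open>om\<close>, as \<open>gk\<close> records.\<close>
    define om where "om = CR.vector_functional w"
    have omlin: "linear_map A complex_alg om"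
     by (simp add: linear_map_def om_def CR.vector_functional_add[OF w] CR.vector_functional_scale[OF w])
    have ompos: "om (mult_of A (star_of A x) x) \<in> \<real>\<^sub>\<ge>\<^sub>0" if "x el A" for x
     unfolding om_def CR.vector_functional_star_mult[OF w that that]
     by (intro pd_form[OF S.pd_hk] CR.keys_act w) (use that in simp)
    have ombd: "cmod (om x) <= (hn S.hk w)\<^sup>2 * norm_of A x" if x: "x el A" for x
    proof -
     have "cmod (om x) <= hn S.hk w * hn S.hk (av (%a. S.tact (f a)) (single x 1) w)"
      unfolding om_def CR.vector_functional_def
      by (intro pd_cs[OF S.pd_hk] CR.keys_act w) (use x in simp)
     also have "... <= hn S.hk w * (norm_of A x * hn S.hk w)"
      by (intro mult_left_mono CR.hn_act_le x w hn_nonneg[OF S.pd_hk])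
     finally show ?thesis by (simp add: power2_eq_square algebra_simps)
    qed
    define \<kappa> where "\<kappa> = Sup ((%x. cmod (om x)) ` {x \<in> carrier A. norm_of A x <= 1})"
    have kb1: "bdd_above ((%x. cmod (om x)) ` {x \<in> carrier A. norm_of A x <= 1})"
     by (rule positive_functional_bound(1)[OF A omlin]) (rule ombd)
    have kb2: "0 <= \<kappa>"
     unfolding \<kappa>_def by (rule positive_functional_bound(2)[OF A omlin]) (rule ombd)
    have kb3: "cmod (om x) <= \<kappa> * norm_of A x" if "x el A" for x
     unfolding \<kappa>_def by (rule positive_functional_bound(3)[OF A omlin _ that]) (rule ombd)
    have gk: "L.gns_kernel w [a] [b] = om (mult_of A (star_of A a) b)" if "a el A" "b el A" for a b
     using CR.vector_functional_star_mult[OF w that] that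
     by (simp add: L.gns_kernel_def om_def av_single_left gs)
    have "opbd (lset [A]) (lmul [A]) (L.gns_kernel w) u ?N"
    proof (cases "\<kappa> = 0")
     \<comment> \<open>A zero functional cannot be normalized, but then the cyclic space consists of
       null vectors.\<close>
     case True
     have om0: "om x = 0" if "x el A" for x using kb3[OF that] True by simp
     have "hn (L.gns_kernel w) z = 0" if z: "z on lset [A]" for z
     proof -
      have "form (L.gns_kernel w) z z = form (%_ _. 0) z z"
      proof (rule form_cong)
       fix s t assume "s \<in> keys z" "t \<in> keys z"
       then obtain a b where "s = [a]" "t = [b]" "a el A" "b el A"
        using LAE[of s] LAE[of t] z by blast
       then show "L.gns_kernel w s t = 0" by (simp add: gk om0 A.closed)
      qed
      then show ?thesis by (simp add: hn_def)
     qed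
     then show ?thesis unfolding opbd_def using G.keys_act[OF u] by simp
    next
     case False
     then have k: "0 < \<kappa>" using kb2 by simp
     define \<phi> where "\<phi> x = om x / of_real \<kappa>" for x
     have phi: "state A \<phi>"
      unfolding state_def Let_def
     proof (intro conjI ballI)
      show "linear_map A complex_alg \<phi>"
       using omlin by (simp add: linear_map_def \<phi>_def add_divide_distrib)
      fix x assume "x el A"
      from ompos[OF this] k show "\<phi> (mult_of A (star_of A x) x) \<in> \<real>\<^sub>\<ge>\<^sub>0"
       by (auto simp: \<phi>_def complex_nonneg_Reals_iff)
     next
      let ?S = "(%x. cmod (om x)) ` {x \<in> carrier A. norm_of A x <= 1}"
      have im: "(%x. cmod (\<phi> x)) ` {x \<in> carrier A. norm_of A x <= 1} = (%y. y * (1 / \<kappa>)) ` ?S"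
       using k by (auto simp: \<phi>_def norm_divide image_image)
      have ne: "?S \<noteq> {}" using A.zero_closed A.norm_zero by force
      show "bdd_above ((%x. cmod (\<phi> x)) ` {x \<in> carrier A. norm_of A x <= 1})"
       unfolding im using kb1 k by (intro bdd_above_image_mono) (auto intro!: monoI divide_right_mono)
      have "Sup ((%y. y * (1 / \<kappa>)) ` ?S) = Sup ?S * (1 / \<kappa>)"
       by (rule continuous_at_Sup_mono[symmetric, OF _ _ ne kb1])
        (use k in \<open>auto intro!: monoI divide_right_mono continuous_intros\<close>)
      then show "Sup ((%x. cmod (\<phi> x)) ` {x \<in> carrier A. norm_of A x <= 1}) = 1"
       unfolding im using k by (simp add: \<kappa>_def[symmetric])
     qed
     have kern: "form (L.gns_kernel w) z z = of_real \<kappa> * form (skernel [A] [\<phi>]) z z" if z: "z on lset [A]" for z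
      unfolding form_fun_mult[symmetric]
     proof (rule form_cong)
      fix s t assume "s \<in> keys z" "t \<in> keys z"
      then obtain a b where "s = [a]" "t = [b]" "a el A" "b el A"
        using LAE[of s] LAE[of t] z by blast
      then show "L.gns_kernel w s t = of_real \<kappa> * skernel [A] [\<phi>] s t"
       using k by (simp add: gk skernel_def \<phi>_def)
     qed
     have hk: "hn (L.gns_kernel w) z = sqrt \<kappa> * hn (skernel [A] [\<phi>]) z" if "z on lset [A]" for z
      by (simp add: hn_def kern[OF that] real_sqrt_mult)
     have "opbd (lset [A]) (lmul [A]) (skernel [A] [\<phi>]) u ?N"
      by (rule LA.opbd_min_norm[OF u]) (simp add: phi)
     then show ?thesis using k hk G.keys_act[OF u] unfolding opbd_def
      by (simp add: mult.left_commute)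
    qed
    then show "opbd (lset [A]) (lmul [A]) (L.gns_kernel w) u (?N + e)"
     by (rule opbd_mono[OF G.pd]) (use e in simp)
    qed
   qed
   then show "sqrt (Re (S.hk (S.tact (E.gext u) (%_. v)) (S.tact (E.gext u) (%_. v)))) <= ?N * hn S.K v"
    by (rule H.opbd_lact_vector[OF u _ v])
  qed
  then show ?thesis by simp
 qed
 obtain F where F: "chom (tensor [A]) (tensor Bs) F" "!!u. u on lset [A] ==> F (iota [A] u) = E.gext u"
  using LA.tensor_extension_chom[OF B.cstar_tensor sh norm] by blast
 have "F (single_tensor A a) = f a" if "a el A" for a
  using F(2)[of "single [a] 1"] that by (simp add: single_tensor_def LA.pure_iota gs)
 then show ?thesis using F(1) by blast
qed

lemma append_chom_eqI:
 assumes L: "cstar_list As1" "cstar_list As2" "cstar_list Bs1" "cstar_list Bs2"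
  and H: "chom (tensor (As1 @ As2)) (tensor (Bs1 @ Bs2)) H"
  and F: "chom (tensor As1) (tensor Bs1) F" and G: "chom (tensor As2) (tensor Bs2) G"
  and eq: "!!as bs. as \<in> lset As1 ==> bs \<in> lset As2 ==>
   H (pure (As1 @ As2) (as @ bs)) = tensor_append Bs1 Bs2 (F (pure As1 as)) (G (pure As2 bs))"
  and x: "x el tensor As1" and y: "y el tensor As2"
 shows "H (tensor_append As1 As2 x y) = tensor_append Bs1 Bs2 (F x) (G y)"
proof -
 interpret A: cstar_lists2 As1 As2 using L by (simp add: cstar_lists2_def)
 interpret B: cstar_lists2 Bs1 Bs2 using L by (simp add: cstar_lists2_def)
 have p: "pre_cstar (tensor (As1 @ As2))" "pre_cstar (tensor Bs1)" "pre_cstar (tensor Bs2)"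
  by (intro cstar_pre A.AB.cstar_tensor B.A.cstar_tensor B.B.cstar_tensor)+
 show ?thesis
  by (rule A.bilinear_eqI[OF B.AB.cstar_tensor, where h="%x y. H (tensor_append As1 As2 x y)"
     and k="%x y. tensor_append Bs1 Bs2 (F x) (G y)", OF _ _ _ _ _ x y])
   (auto simp: A.append_pure eq intro: bounded_comp[OF A.bounded_append_left chom_bounded[OF H] p(1)]
    bounded_comp[OF A.bounded_append_right chom_bounded[OF H] p(1)]
    bounded_comp[OF chom_bounded[OF F] B.bounded_append_left[OF chom_closed[OF G]] p(2)]
    bounded_comp[OF chom_bounded[OF G] B.bounded_append_right[OF chom_closed[OF F]] p(3)])
qed

text \<open>The candidate is defined on formal tensors by splitting lists, and its contractivity is
  the hard part. For a state list of the target, the norm of an image is controlled by an operator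
  bound in the product of the two Hilbert space actions induced by \<open>F\<close> and
  \<open>G\<close>. Two uses of \<open>opbd_product_replace\<close>, with a swap between them, lead
  there from the state lists of the domain.\<close>

lemma tensor_pair:
 fixes As1 As2 :: "'a star_alg list" and Bs1 Bs2 :: "'b star_alg list"
 assumes As1: "cstar_list As1" and As2: "cstar_list As2" and Bs1: "cstar_list Bs1" and Bs2: "cstar_list Bs2"
  and F: "chom (tensor As1) (tensor Bs1) F" and G: "chom (tensor As2) (tensor Bs2) G"
 shows "\<exists>H. chom (tensor (As1 @ As2)) (tensor (Bs1 @ Bs2)) H \<and>
  (\<forall>x\<in>carrier (tensor As1). \<forall>y\<in>carrier (tensor As2).
   H (tensor_append As1 As2 x y) = tensor_append Bs1 Bs2 (F x) (G y))"
proof -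
 interpret A1: cstar_list As1 by fact
 interpret A2: cstar_list As2 by fact
 interpret B1: cstar_list Bs1 by fact
 interpret B2: cstar_list Bs2 by fact
 interpret A: cstar_lists2 As1 As2 by unfold_locales
 interpret B: cstar_lists2 Bs1 Bs2 by unfold_locales
 define q1 :: "'a list => 'a list" where "q1 = take (length As1)"
 define q2 :: "'a list => 'a list" where "q2 = drop (length As1)"
 have q: "q1 m \<in> lset As1" "q2 m \<in> lset As2" "q1 m @ q2 m = m" if "m \<in> lset (As1 @ As2)" for m
  using lset_split[OF that] by (simp_all add: q1_def q2_def)
 have qm: "q1 (lmul (As1 @ As2) m n) = lmul As1 (q1 m) (q1 n)" "q2 (lmul (As1 @ As2) m n) = lmul As2 (q2 m) (q2 n)"
  if "m \<in> lset (As1 @ As2)" "n \<in> lset (As1 @ As2)" for m n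
 proof -
  have "lmul (As1 @ As2) m n = lmul As1 (q1 m) (q1 n) @ lmul As2 (q2 m) (q2 n)"
   using lmul_append[of "q1 m" As1 "q1 n" As2 "q2 m" "q2 n"] q[OF that(1)] q[OF that(2)] by (simp add: lset_length)
  moreover have "length (lmul As1 (q1 m) (q1 n)) = length As1"
   by (intro lset_length A1.lmul_closed q that)
  ultimately show "q1 (lmul (As1 @ As2) m n) = lmul As1 (q1 m) (q1 n)" "q2 (lmul (As1 @ As2) m n) = lmul As2 (q2 m) (q2 n)"
   by (simp_all add: q1_def q2_def)
 qed
 have qs: "q1 (lstar (As1 @ As2) m) = lstar As1 (q1 m)" "q2 (lstar (As1 @ As2) m) = lstar As2 (q2 m)"
  if "m \<in> lset (As1 @ As2)" for m
 proof -
  have "lstar (As1 @ As2) m = lstar As1 (q1 m) @ lstar As2 (q2 m)"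
   using lstar_append[of "q1 m" As1 As2 "q2 m"] q[OF that] by (simp add: lset_length)
  moreover have "length (lstar As1 (q1 m)) = length As1" by (intro lset_length A1.lstar_closed q that)
  ultimately show "q1 (lstar (As1 @ As2) m) = lstar As1 (q1 m)" "q2 (lstar (As1 @ As2) m) = lstar As2 (q2 m)"
   by (simp_all add: q1_def q2_def)
 qed
 note Fc = chom_closed[OF F] and Gc = chom_closed[OF G]
 define f1 where "f1 m = rep (F (pure As1 (q1 m)))" for m
 define f2 where "f2 m = rep (G (pure As2 (q2 m)))" for m
 have f1: "f1 m \<in> B1.T.cn" "B1.T.cls (f1 m) = F (pure As1 (q1 m))" if "m \<in> lset (As1 @ As2)" for m
  unfolding f1_def by (intro B1.rep_tensor Fc A1.pure_in q that)+
 have f2: "f2 m \<in> B2.T.cn" "B2.T.cls (f2 m) = G (pure As2 (q2 m))" if "m \<in> lset (As1 @ As2)" for m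
  unfolding f2_def by (intro B2.rep_tensor Gc A2.pure_in q that)+
 interpret E: formal_extension "As1 @ As2" "Bs1 @ Bs2" "%m n. formal_append (f1 m n) (f2 m n)"
  by unfold_locales (intro B.append_cn f1 f2)
 have clsr: "B.AB.T.cls (%n. formal_append (f1 m n) (f2 m n)) =
   tensor_append Bs1 Bs2 (F (pure As1 (q1 m))) (G (pure As2 (q2 m)))" if "m \<in> lset (As1 @ As2)" for m
  using B.append_cls[OF f1(1)[OF that] f2(1)[OF that]] f1(2)[OF that] f2(2)[OF that] by simp
 have sh: "star_hom (formal_alg (As1 @ As2)) (tensor (Bs1 @ Bs2)) E.gext"
 proof (rule E.gext_star_hom)
  fix m assume m: "m \<in> lset (As1 @ As2)"
  show "B.AB.T.cls (%n. formal_append (f1 (lstar (As1 @ As2) m) n) (f2 (lstar (As1 @ As2) m) n)) =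
    star_of (tensor (Bs1 @ Bs2)) (B.AB.T.cls (%n. formal_append (f1 m n) (f2 m n)))"
   unfolding clsr[OF m] clsr[OF A.AB.lstar_closed[OF m]] qs[OF m]
   using m q by (simp add: B.append_star Fc Gc A1.pure_in A2.pure_in star_hom_star[OF chom_star_hom[OF F], symmetric]
    star_hom_star[OF chom_star_hom[OF G], symmetric] A1.pure_star A2.pure_star)
  fix n assume n: "n \<in> lset (As1 @ As2)"
  show "B.AB.T.cls (%na. formal_append (f1 (lmul (As1 @ As2) m n) na) (f2 (lmul (As1 @ As2) m n) na)) =
    mult_of (tensor (Bs1 @ Bs2)) (B.AB.T.cls (%n. formal_append (f1 m n) (f2 m n)))
     (B.AB.T.cls (%k. formal_append (f1 n k) (f2 n k)))"
   unfolding clsr[OF m] clsr[OF n] clsr[OF A.AB.lmul_closed[OF m n]] qm[OF m n]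
   using m n q by (simp add: B.append_mult Fc Gc A1.pure_in A2.pure_in star_hom_mult[OF chom_star_hom[OF F], symmetric]
    star_hom_mult[OF chom_star_hom[OF G], symmetric] A1.pure_mult A2.pure_mult)
 qed
 define g1 where "g1 u = F (iota As1 u)" for u
 define g2 where "g2 u = G (iota As2 u)" for u
 have g1: "star_hom (formal_alg As1) (tensor Bs1) g1" and g2: "star_hom (formal_alg As2) (tensor Bs2) g2"
  unfolding g1_def g2_def using star_hom_comp A1.iota_star_hom A2.iota_star_hom chom_star_hom F G by blast+
 have g1n: "norm_of (tensor Bs1) (g1 u) <= min_norm As1 u" if "u on lset As1" for u
  using chom_norm[OF F A1.iota_in[OF that]] A1.norm_iota[OF that] by (simp add: g1_def)
 have g2n: "norm_of (tensor Bs2) (g2 u) <= min_norm As2 u" if "u on lset As2" for u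
  using chom_norm[OF G A2.iota_in[OF that]] A2.norm_iota[OF that] by (simp add: g2_def)
 have norm: "norm_of (tensor (Bs1 @ Bs2)) (E.gext u) <= min_norm (As1 @ As2) u" if u: "u on lset (As1 @ As2)" for u
 proof -
  let ?N = "min_norm (As1 @ As2) u"
  have N: "0 <= ?N" by (rule A.AB.min_norm_ge0[OF u])
  have "norm_of (tensor (Bs1 @ Bs2)) (E.gext u) <= ?N"
  proof (rule B.AB.tensor_norm_le[OF _ N])
   show x: "E.gext u el tensor (Bs1 @ Bs2)" using lin_closed[OF hom_linear[OF sh], of u] u by simp
   fix \<omega> v assume om: "B.AB.states \<omega>" and v: "v on lset (Bs1 @ Bs2)"
   obtain \<psi>1 \<psi>2 where psi: "\<omega> = \<psi>1 @ \<psi>2" "B1.states \<psi>1" "B2.states \<psi>2" using om by (auto simp: list_all2_append1)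
   interpret S: state_list "Bs1 @ Bs2" \<omega> by unfold_locales (rule om)
   interpret H1: formal_hom As1 Bs1 \<psi>1 g1 by unfold_locales (rule psi, rule g1)
   interpret H2: formal_hom As2 Bs2 \<psi>2 g2 by unfold_locales (rule psi, rule g2)
   let ?M = "lset (As1 @ As2)" and ?mul = "lmul (As1 @ As2)" and ?st = "lstar (As1 @ As2)"
   let ?a1 = "%m. H1.lact (q1 m)" and ?a2 = "%m. H2.lact (q2 m)"
   \<comment> \<open>The starting point: for two state lists of the domain the bound
     \<open>?N\<close> is part of the meaning of the minimal norm.\<close>
   have split: "opbd (lset As1 \<times> lset As2) (pact (%m. lmul As1 (q1 m)) (%m. lmul As2 (q2 m)))
     (pkernel (skernel As1 \<phi>1) (skernel As2 \<phi>2)) u ?N"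
    if "A1.states \<phi>1" "A2.states \<phi>2" for \<phi>1 \<phi>2
    using A.AB.opbd_min_norm[OF u, of "\<phi>1 @ \<phi>2"] opbd_append_iff[OF As1 As2 _ u, of \<phi>1 \<phi>2 ?N] that
    by (simp add: q1_def q2_def list_all2_appendI list_all2_lengthD)
   \<comment> \<open>Bounds in all state lists of \<open>As2\<close> bound the minimal norm of
     \<open>c\<close>, hence the norm of \<open>g2 c\<close>, hence its action on the completed
     space.\<close>
   have step1: "opbd (lset As1 \<times> H2.A.hs) (pact (%m. lmul As1 (q1 m)) ?a2)
     (pkernel (skernel As1 \<phi>1) H2.A.hk) u ?N" if p1: "A1.states \<phi>1" for \<phi>1
   proof (rule opbd_product_replace[where M="?M" and mul="?mul" and st="?st" and q=q2 and ?M2.0="lset As2"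
      and ?mul2.0="lmul As2" and ?st2.0="lstar As2" and S'="lset As2" and act'="lmul As2" and K'="skernel As2"
      and \<Phi>="{\<phi>. A2.states \<phi>}", OF _ H2.star_rep_lact])
    show "star_rep ?M ?mul ?st (lset As1) (%m. lmul As1 (q1 m)) (skernel As1 \<phi>1)"
     by (rule star_rep_pullback[OF A1.star_rep_state[OF p1]])
      (auto intro: A.AB.lmul_closed A.AB.lstar_closed q simp: qm qs)
    fix c B assume c: "c on lset As2" and B: "0 <= B"
     and "!!\<phi>. \<phi> \<in> {\<phi>. A2.states \<phi>} ==> opbd (lset As2) (lmul As2) (skernel As2 \<phi>) c B"
    then have "min_norm As2 c <= B" by (intro A2.min_norm_le) auto
    then show "opbd H2.A.hs H2.lact H2.A.hk c B"
     using g2n[OF c] by (intro opbd_mono[OF H2.A.pd_hk H2.opbd_lact[OF c]]) simp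
   qed (use split p1 q qm qs A2.star_rep_state u N in auto)
   \<comment> \<open>The factors have been exchanged, so that the one to be replaced again stands
     second.\<close>
   have step2: "opbd (H2.A.hs \<times> H1.A.hs) (pact ?a2 ?a1) (pkernel H2.A.hk H1.A.hk) u ?N"
   proof (rule opbd_product_replace[where M="?M" and mul="?mul" and st="?st" and q=q1 and ?M2.0="lset As1"
      and ?mul2.0="lmul As1" and ?st2.0="lstar As1" and S'="lset As1" and act'="lmul As1" and K'="skernel As1"
      and \<Phi>="{\<phi>. A1.states \<phi>}", OF _ H1.star_rep_lact])
    show "star_rep ?M ?mul ?st H2.A.hs ?a2 H2.A.hk"
     by (rule star_rep_pullback[OF H2.star_rep_lact])
      (auto intro: A.AB.lmul_closed A.AB.lstar_closed q simp: qm qs)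
    fix c B assume c: "c on lset As1" and B: "0 <= B"
     and "!!\<phi>. \<phi> \<in> {\<phi>. A1.states \<phi>} ==> opbd (lset As1) (lmul As1) (skernel As1 \<phi>) c B"
    then have "min_norm As1 c <= B" by (intro A1.min_norm_le) auto
    then show "opbd H1.A.hs H1.lact H1.A.hk c B"
     using g1n[OF c] by (intro opbd_mono[OF H1.A.pd_hk H1.opbd_lact[OF c]]) simp
   qed (use opbd_swap[OF step1] q qm qs A1.star_rep_state u N in auto)
   have final: "opbd (H1.A.hs \<times> H2.A.hs) (pact ?a1 ?a2) (pkernel H1.A.hk H2.A.hk) u ?N"
    by (rule opbd_swap[OF step2])
   define t1 :: "'b list => 'b list" where "t1 = take (length Bs1)"
   define t2 :: "'b list => 'b list" where "t2 = drop (length Bs1)"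
   have t: "t1 s \<in> lset Bs1" "t2 s \<in> lset Bs2" "t1 s @ t2 s = s" if "s \<in> lset (Bs1 @ Bs2)" for s
    using lset_split[OF that] by (simp_all add: t1_def t2_def)
   define c1 where "c1 s = (%_ :: nat. single (t1 s) 1)" for s
   define c2 where "c2 s = (%_ :: nat. single (t2 s) 1)" for s
   have c1: "c1 s \<in> H1.A.hs" and c2: "c2 s \<in> H2.A.hs" if "s \<in> lset (Bs1 @ Bs2)" for s
    unfolding c1_def c2_def using t[OF that] by (auto intro!: H1.A.const_hs H2.A.const_hs)
   \<comment> \<open>The formal vector \<open>v\<close>, carried into the product of the two
     completed spaces by constant sequences; this preserves norms.\<close>
   define W where "W = ext (%s. single (c1 s, c2 s) 1) v"
   have W: "W on H1.A.hs \<times> H2.A.hs" unfolding W_def using v c1 c2 by (intro keys_ext_subset) auto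
   let ?K = "pkernel H1.A.hk H2.A.hk"
   have "form ?K W W = form (%s s'. H1.A.hk (c1 s) (c1 s') * H2.A.hk (c2 s) (c2 s')) v v"
    by (simp add: W_def form_ext)
   also have "... = form S.K v v"
   proof (rule form_cong)
    fix s s' assume "s \<in> keys v" "s' \<in> keys v"
    then have s: "s \<in> lset (Bs1 @ Bs2)" "s' \<in> lset (Bs1 @ Bs2)" using v by auto
    have "H1.A.hk (c1 s) (c1 s') = H1.A.K (t1 s) (t1 s')" "H2.A.hk (c2 s) (c2 s') = H2.A.K (t2 s) (t2 s')"
     unfolding c1_def c2_def using t s by (subst H1.A.hk_const H2.A.hk_const; simp)+
    then show "H1.A.hk (c1 s) (c1 s') * H2.A.hk (c2 s) (c2 s') = S.K s s'"
     using skernel_append[OF Bs1 t(1)[OF s(1)] t(1)[OF s(2)], of \<psi>1 Bs2 \<psi>2 "t2 s" "t2 s'"]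
      t(3)[OF s(1)] t(3)[OF s(2)] list_all2_lengthD[OF psi(2)] by (simp add: psi(1))
   qed
   finally have hW: "hn ?K W = hn S.K v" by (simp add: hn_def)
   let ?X = "E.gnet u"
   have lim1: "(%n. form S.K (av (lmul (Bs1 @ Bs2)) (?X n) v) (av (lmul (Bs1 @ Bs2)) (?X n) v)) \<longlonglongrightarrow>
     S.hk (S.tact (E.gext u) (%_. v)) (S.tact (E.gext u) (%_. v))"
    unfolding E.gext_def by (intro S.tact_lim2 E.gnet_cn u S.const_hs v)
   let ?p1 = "%n m s. av (lmul Bs1) (f1 m n) (c1 s n)" and ?p2 = "%n m s. av (lmul Bs2) (f2 m n) (c2 s n)"
   \<comment> \<open>For each \<open>n\<close> the inner product in the concatenated state list
     factorizes over its two parts. In the limit this identifies the norm of \<open>E.gext u\<close>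
     acting on \<open>v\<close> with that of \<open>u\<close> acting on \<open>W\<close>.\<close>
   have Xv: "form S.K (av (lmul (Bs1 @ Bs2)) (?X n) v) (av (lmul (Bs1 @ Bs2)) (?X n) v) =
     form (%m m'. form (%s s'. form H1.A.K (?p1 n m s) (?p1 n m' s') * form H2.A.K (?p2 n m s) (?p2 n m' s')) v v) u u" for n
   proof -
    have "av (lmul (Bs1 @ Bs2)) (?X n) v = ext (%m. ext (%s. av (lmul (Bs1 @ Bs2)) (formal_append (f1 m n) (f2 m n)) (single s 1)) v) u"
     unfolding E.gnet_def by (rule lin_extensionality) (simp add: lin_av lin_ext lin_swap[where v=v])
    also have "... = ext (%m. ext (%s. formal_append (?p1 n m s) (?p2 n m s)) v) u"
    proof (intro ext_cong)
     fix m s assume "m \<in> keys u" "s \<in> keys v"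
     then have ms: "m \<in> ?M" "s \<in> lset (Bs1 @ Bs2)" using u v by auto
     have "single s 1 = formal_append (single (t1 s) 1) (single (t2 s) 1)" using t(3)[OF ms(2)] by (simp add: formal_append_single)
     then show "av (lmul (Bs1 @ Bs2)) (formal_append (f1 m n) (f2 m n)) (single s 1) = formal_append (?p1 n m s) (?p2 n m s)"
      using B.formal_append_mult[OF B1.cn_formal[OF f1(1)[OF ms(1)]] _ B2.cn_formal[OF f2(1)[OF ms(1)]], of "single (t1 s) 1" "single (t2 s) 1" n n]
       t[OF ms(2)] by (simp add: c1_def c2_def)
    qed
    finally have e: "av (lmul (Bs1 @ Bs2)) (?X n) v = ext (%m. ext (%s. formal_append (?p1 n m s) (?p2 n m s)) v) u" .
    have k: "(?p1 n m s) on lset Bs1" if "m \<in> ?M" "s \<in> lset (Bs1 @ Bs2)" for m s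
     by (rule B1.keys_lmul[OF B1.cn_formal[OF f1(1)[OF that(1)]]]) (simp add: c1_def t that)
    have fa: "form S.K (formal_append x y) (formal_append x' y') = form H1.A.K x x' * form H2.A.K y y'"
     if "x on lset Bs1" "x' on lset Bs1" for x y x' y'
    proof -
     have "form S.K (formal_append x y) (formal_append x' y') =
       form (%a a'. form (%b b'. S.K (a @ b) (a' @ b')) y y') x x'"
      unfolding formal_append_ext form_ext by simp
     also have "... = form (%a a'. form H2.A.K y y' * H1.A.K a a') x x'"
     proof (rule form_cong)
      fix a a' assume "a \<in> keys x" "a' \<in> keys x'"
      then have "S.K (a @ b) (a' @ b') = H1.A.K a a' * H2.A.K b b'" for b b'
       unfolding psi(1) using that list_all2_lengthD[OF psi(2)] by (intro skernel_append[OF Bs1]) auto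
      then show "form (%b b'. S.K (a @ b) (a' @ b')) y y' = form H2.A.K y y' * H1.A.K a a'"
       by (simp add: form_fun_mult)
     qed
     finally show ?thesis by (simp add: form_fun_mult)
    qed
    show ?thesis unfolding e form_ext
     using u v by (intro form_cong fa k) auto
   qed
   have "(%n. form (%m m'. form (%s s'. form H1.A.K (?p1 n m s) (?p1 n m' s') * form H2.A.K (?p2 n m s) (?p2 n m' s')) v v) u u) \<longlonglongrightarrow>
     form (%m m'. form (%s s'. H1.A.hk (?a1 m (c1 s)) (?a1 m' (c1 s')) * H2.A.hk (?a2 m (c2 s)) (?a2 m' (c2 s'))) v v) u u"
   proof (intro form_tendsto tendsto_mult)
    fix m m' s s' assume "m \<in> keys u" "m' \<in> keys u" "s \<in> keys v" "s' \<in> keys v"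
    then have h: "m \<in> ?M" "m' \<in> ?M" "s \<in> lset (Bs1 @ Bs2)" "s' \<in> lset (Bs1 @ Bs2)" using u v by auto
    have "g1 (single (q1 m) 1) = B1.T.cls (f1 m)" "g2 (single (q2 m) 1) = B2.T.cls (f2 m)" if "m \<in> ?M" for m
     using f1(2)[OF that] f2(2)[OF that] by (simp_all add: g1_def g2_def A1.pure_iota A2.pure_iota)
    then show "(%n. form H1.A.K (?p1 n m s) (?p1 n m' s')) \<longlonglongrightarrow> H1.A.hk (?a1 m (c1 s)) (?a1 m' (c1 s'))"
     "(%n. form H2.A.K (?p2 n m s) (?p2 n m' s')) \<longlonglongrightarrow> H2.A.hk (?a2 m (c2 s)) (?a2 m' (c2 s'))"
     using h f1(1) f2(1) c1 c2 by (simp_all add: H1.A.tact_lim2 H2.A.tact_lim2)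
   qed
   then have "S.hk (S.tact (E.gext u) (%_. v)) (S.tact (E.gext u) (%_. v)) =
     form (%m m'. form (%s s'. H1.A.hk (?a1 m (c1 s)) (?a1 m' (c1 s')) * H2.A.hk (?a2 m (c2 s)) (?a2 m' (c2 s'))) v v) u u"
    using LIMSEQ_unique[OF lim1] unfolding Xv by blast
   also have "... = form ?K (av (pact ?a1 ?a2) u W) (av (pact ?a1 ?a2) u W)"
    unfolding form_av_av W_def form_ext by (simp add: pact_def)
   finally have "sqrt (Re (S.hk (S.tact (E.gext u) (%_. v)) (S.tact (E.gext u) (%_. v)))) = hn ?K (av (pact ?a1 ?a2) u W)"
    by (simp add: hn_def)
   then show "sqrt (Re (S.hk (S.tact (E.gext u) (%_. v)) (S.tact (E.gext u) (%_. v)))) <= ?N * hn S.K v"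
    using final[unfolded opbd_def, rule_format, OF W] hW by simp
  qed
  then show ?thesis by simp
 qed
 obtain H where chom: "chom (tensor (As1 @ As2)) (tensor (Bs1 @ Bs2)) H"
  and H: "!!u. u on lset (As1 @ As2) ==> H (iota (As1 @ As2) u) = E.gext u"
  using A.AB.tensor_extension_chom[OF B.AB.cstar_tensor sh norm] by blast
 have "H (tensor_append As1 As2 x y) = tensor_append Bs1 Bs2 (F x) (G y)"
  if "x el tensor As1" "y el tensor As2" for x y
 proof (rule append_chom_eqI[OF As1 As2 Bs1 Bs2 chom F G _ that])
  fix as bs assume ab: "as \<in> lset As1" "bs \<in> lset As2"
  have "H (pure (As1 @ As2) (as @ bs)) = E.gext (single (as @ bs) 1)"
   using H[of "single (as @ bs) 1"] lset_append[OF ab] by (simp add: A.AB.pure_iota)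
  also have "... = tensor_append Bs1 Bs2 (F (pure As1 as)) (G (pure As2 bs))"
   using lset_append[OF ab] by (simp add: E.gext_single clsr) (simp add: q1_def q2_def lset_length[OF ab(1)])
  finally show "H (pure (As1 @ As2) (as @ bs)) = tensor_append Bs1 Bs2 (F (pure As1 as)) (G (pure As2 bs))" .
 qed
 then show ?thesis using chom by blast
qed

section \<open>Tensor maps of several factors\<close>

lemma cstar_lists2I: "cstar_list As ==> cstar_list Bs ==> cstar_lists2 As Bs"
 by (simp add: cstar_lists2_def)

lemma cstar_list_Nil [simp]: "cstar_list []"
 by (simp add: cstar_list_def)

lemma cstar_tensor_list: "cstar_list As ==> cstar_algebra (tensor As)"
 by (rule cstar_list.cstar_tensor)

lemma pre_cstar_tensor: "cstar_list As ==> pre_cstar (tensor As)"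
 by (intro cstar_pre cstar_tensor_list)

lemma tensor_append_in: "cstar_list As ==> cstar_list Bs ==> x el tensor As ==> y el tensor Bs ==>
  tensor_append As Bs x y el tensor (As @ Bs)"
 by (rule cstar_lists2.append_in[OF cstar_lists2I])

lemma tensor_append_pure: "cstar_list As ==> cstar_list Bs ==> as \<in> lset As ==> bs \<in> lset Bs ==>
  tensor_append As Bs (pure As as) (pure Bs bs) = pure (As @ Bs) (as @ bs)"
 by (rule cstar_lists2.append_pure[OF cstar_lists2I])

lemma tensor_append_assoc:
 assumes "cstar_list As" "cstar_list Bs" "cstar_list Cs"
  and "x el tensor As" "y el tensor Bs" "z el tensor Cs"
 shows "tensor_append (As @ Bs) Cs (tensor_append As Bs x y) z = tensor_append As (Bs @ Cs) x (tensor_append Bs Cs y z)"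
proof -
 interpret AB: cstar_lists2 As Bs by (intro cstar_lists2I assms)
 interpret BC: cstar_lists2 Bs Cs by (intro cstar_lists2I assms)
 interpret AB_C: cstar_lists2 "As @ Bs" Cs by (intro cstar_lists2I assms AB.AB.cstar_list_axioms)
 interpret A_BC: cstar_lists2 As "Bs @ Cs" by (intro cstar_lists2I assms BC.AB.cstar_list_axioms)
 obtain f where f: "f \<in> AB.A.T.cn" "x = AB.A.T.cls f" using AB.A.tensor_cases[OF assms(4)] .
 obtain g where g: "g \<in> AB.B.T.cn" "y = AB.B.T.cls g" using AB.B.tensor_cases[OF assms(5)] .
 obtain h where h: "h \<in> BC.B.T.cn" "z = BC.B.T.cls h" using BC.B.tensor_cases[OF assms(6)] .
 show ?thesis
  unfolding f g h AB.append_cls[OF f(1) g(1)] BC.append_cls[OF g(1) h(1)]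
   AB_C.append_cls[OF AB.append_cn[OF f(1) g(1)] h(1)] A_BC.append_cls[OF f(1) BC.append_cn[OF g(1) h(1)]]
  by (simp add: formal_append_assoc)
qed

lemma pure_Nil_in: "pure [] [] el tensor []"
 using cstar_list.pure_in[OF cstar_list_Nil, of "[]"] by simp

lemma tensor_append_Nil:
 assumes "cstar_list As" "x el tensor As"
 shows "tensor_append As [] x (pure [] []) = x" "tensor_append [] As (pure [] []) x = x"
proof -
 interpret A: cstar_lists2 As "[]" by (intro cstar_lists2I assms) simp
 interpret B: cstar_lists2 "[]" As by (intro cstar_lists2I assms) simp
 obtain f where f: "f \<in> A.A.T.cn" "x = A.A.T.cls f" using A.A.tensor_cases[OF assms(2)] .
 have c: "(%_. single [] 1) \<in> A.B.T.cn" by (rule A.B.const_cn) simp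
 have p: "pure [] [] = A.B.T.cls (%_. single [] 1)" by (simp add: pure_def A.B.tensor_class_T)
 show "tensor_append As [] x (pure [] []) = x"
  unfolding f p A.append_cls[OF f(1) c] by (simp add: formal_append_Nil)
 show "tensor_append [] As (pure [] []) x = x"
  unfolding f p B.append_cls[OF c f(1)] by (simp add: formal_append_Nil)
qed

lemma single_tensor_in: "cstar_algebra A ==> a el A ==> single_tensor A a el tensor [A]"
 unfolding single_tensor_def by (rule cstar_list.pure_in) (simp_all add: cstar_list_Cons)

text \<open>If all matrix coefficients of \<open>w\<close> between basis vectors vanish, so does its
  operator in every state list. In this way the multilinear relations between lists are recovered
  from the seminorm.\<close>

lemma (in cstar_list) min_norm_zeroI:
 assumes w: "w on lset As"
  and z: "!!\<phi>s y s. states \<phi>s ==> y \<in> lset As ==> s \<in> lset As ==>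
   lin (%m. skernel As \<phi>s y (lmul As m s)) w = 0"
 shows "min_norm As w = 0"
proof (rule antisym[OF min_norm_le min_norm_ge0[OF w]])
 fix \<phi>s assume s: "states \<phi>s"
 interpret R: star_rep "lset As" "lmul As" "lstar As" "lset As" "lmul As" "skernel As \<phi>s"
  by (rule star_rep_state[OF s])
 show "opbd (lset As) (lmul As) (skernel As \<phi>s) w 0"
  unfolding opbd_def
 proof (intro allI impI)
  fix v assume v: "v on lset As"
  let ?x = "av (lmul As) w v"
  have x: "?x on lset As" by (rule R.keys_act[OF w v])
  have y: "lin (skernel As \<phi>s y) ?x = 0" if "y \<in> lset As" for y
  proof -
   have "lin (skernel As \<phi>s y) ?x = lin (%s. lin (%m. skernel As \<phi>s y (lmul As m s)) w) v"
    unfolding lin_av by (rule lin_swap)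
   also have "... = lin (%s. 0) v" using v by (intro lin_cong z s that) auto
   finally show ?thesis by simp
  qed
  have "lin (%s. cnj (lin (skernel As \<phi>s s) ?x)) ?x = lin (%s. 0) ?x"
   using x y by (intro lin_cong) auto
  then have "form (skernel As \<phi>s) ?x ?x = 0" by (simp add: form_conv)
  then show "hn (skernel As \<phi>s) ?x <= 0 * hn (skernel As \<phi>s) v" by (simp add: hn_def)
 qed
qed simp

lemma lin_diff: "lin f (u - v) = lin f u - lin f v"
 by (metis add_diff_cancel_right' diff_add_cancel lin_add)

text \<open>Formal tensors impose no linear relations, so linearity of \<open>single_tensor\<close>
  has to come from the seminorm: the formal difference of the two sides has vanishing coefficients
  in all states, hence norm zero.\<close>

lemma single_tensor_hom: assumes A: "cstar_algebra A" shows "star_hom A (tensor [A]) (single_tensor A)"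
proof -
 interpret A: cstar_algebra A by fact
 interpret L: cstar_list "[A]" using A by (simp add: cstar_list_Cons)
 interpret T: cstar_algebra "tensor [A]" by (rule L.cstar_tensor)
 have eqI: "iota [A] u = iota [A] v"
  if k: "u on lset [A]" "v on lset [A]"
   and z: "!!\<phi> y s. linear_map A complex_alg \<phi> ==> y el A ==> s el A ==>
    lin (%m. \<phi> (mult_of A (star_of A y) (mult_of A (hd m) s))) u = lin (%m. \<phi> (mult_of A (star_of A y) (mult_of A (hd m) s))) v"
  for u v
 proof (rule T.dst_eq_0)
  have "min_norm [A] (u - v) = 0"
  proof (rule L.min_norm_zeroI)
   fix \<phi>s y s assume "L.states \<phi>s" "y \<in> lset [A]" "s \<in> lset [A]"
   then obtain \<phi> y' s' where e: "\<phi>s = [\<phi>]" "y = [y']" "s = [s']" "state A \<phi>" "y' el A" "s' el A"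
    by (auto simp: list_all2_Cons1 elim!: lset_ConsE)
   have lp: "linear_map A complex_alg \<phi>" using e(4) by (simp add: state_def)
   have "lin (%m. skernel [A] \<phi>s y (lmul [A] m s)) w = lin (%m. \<phi> (mult_of A (star_of A y') (mult_of A (hd m) s'))) w"
    if "w on lset [A]" for w
    using that by (intro lin_cong) (auto elim!: lset_ConsE simp: skernel_def e)
   then show "lin (%m. skernel [A] \<phi>s y (lmul [A] m s)) (u - v) = 0"
    using z[OF lp e(5,6)] k by (simp add: lin_diff)
  qed (use k in \<open>simp add: keys_diff_subset\<close>)
  moreover have "minus_of (tensor [A]) (iota [A] u) (iota [A] v) = iota [A] (u - v)"
   using linear_map_minus[OF hom_linear[OF L.iota_star_hom] L.pre_cstar_formal_alg, of u v] k by simp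
  ultimately show "T.dst (iota [A] u) (iota [A] v) = 0" using k by (simp add: L.norm_iota keys_diff_subset)
 qed (use k in \<open>simp_all add: L.iota_in\<close>)
 have add: "single_tensor A (add_of A a b) = add_of (tensor [A]) (single_tensor A a) (single_tensor A b)"
  if "a el A" "b el A" for a b
 proof -
  have "iota [A] (single [add_of A a b] 1) = iota [A] (single [a] 1 + single [b] 1)"
   using that by (intro eqI keys_add_subset) (auto simp: lin_add A.closed A.add_mult A.mult_add lin_map_add)
  also have "... = add_of (tensor [A]) (iota [A] (single [a] 1)) (iota [A] (single [b] 1))"
   using lin_map_add[OF hom_linear[OF L.iota_star_hom], of "single [a] 1" "single [b] 1"] that by simp
  finally show ?thesis by (simp add: single_tensor_def L.pure_iota)
 qed
 have scale: "single_tensor A (scale_of A c a) = scale_of (tensor [A]) c (single_tensor A a)"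
  if "a el A" for a c
 proof -
  have "iota [A] (single [scale_of A c a] 1) = iota [A] (psc c (single [a] 1))"
   using that by (intro eqI keys_psc_subset) (auto simp: A.closed A.scale_mult A.mult_scale lin_scale)
  also have "... = scale_of (tensor [A]) c (iota [A] (single [a] 1))"
   using lin_scale[OF hom_linear[OF L.iota_star_hom], of "single [a] 1" c] that by simp
  finally show ?thesis by (simp add: single_tensor_def L.pure_iota)
 qed
 show ?thesis
  unfolding star_hom_def linear_map_def
  using add scale by (auto simp: single_tensor_in[OF A]) (auto simp: single_tensor_def L.pure_mult L.pure_star)
qed

lemma chom_single_tensor: assumes A: "cstar_algebra A" shows "chom A (tensor [A]) (single_tensor A)"
 unfolding chom_def
 using single_tensor_hom[OF A] cstar_list.star_hom_contractive[OF _ A single_tensor_hom[OF A]] A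
 by (simp add: cstar_list_Cons)

text \<open>Bundles the hypotheses on a list of homomorphisms into a recursive predicate, whose
  shape drives the inductions on the number of factors.\<close>

fun homs :: "'a star_alg list => 'a star_alg list list => ('a => 'a tensor) list => bool" where
 "homs [] [] [] = True"
| "homs (A # As) (Bs # Bss) (f # fs) \<longleftrightarrow>
  cstar_algebra A \<and> cstar_list Bs \<and> star_hom A (tensor Bs) f \<and> homs As Bss fs"
| "homs _ _ _ = False"

lemma homs_cstar: "homs As Bss fs ==> cstar_list As \<and> cstar_list (concat Bss) \<and> length fs = length As \<and> length Bss = length As"
 by (induction As Bss fs rule: homs.induct) (auto simp: cstar_list_Cons cstar_list_append)

lemma homs_append: "homs As Bss fs ==> homs As' Bss' fs' ==> homs (As @ As') (Bss @ Bss') (fs @ fs')"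
 by (induction As Bss fs rule: homs.induct) auto

lemma tensor_concat_in:
 "homs As Bss fs ==> as \<in> lset As ==> tensor_concat Bss (map2 (%f a. f a) fs as) el tensor (concat Bss)"
proof (induction As Bss fs arbitrary: as rule: homs.induct)
 case (2 A As Bs Bss f fs)
 obtain a cs where as: "as = a # cs" "a el A" "cs \<in> lset As" using 2(3) by (rule lset_ConsE)
 have h: "homs As Bss fs" "cstar_list Bs" "star_hom A (tensor Bs) f" using 2(2) by simp_all
 have "f a el tensor Bs" by (rule lin_closed[OF hom_linear[OF h(3)] as(2)])
 then show ?case using tensor_append_in[OF h(2) _ _ 2(1)[OF h(1) as(3)]] homs_cstar[OF h(1)] by (simp add: as)
qed (auto simp: pure_Nil_in)

lemma tensor_concat_append:
 "homs As Bss fs ==> homs As' Bss' fs' ==> as \<in> lset As ==> as' \<in> lset As' ==>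
  tensor_concat (Bss @ Bss') (map2 (%f a. f a) (fs @ fs') (as @ as')) =
  tensor_append (concat Bss) (concat Bss') (tensor_concat Bss (map2 (%f a. f a) fs as))
   (tensor_concat Bss' (map2 (%f a. f a) fs' as'))"
proof (induction As Bss fs arbitrary: as rule: homs.induct)
 case 1
 then show ?case using tensor_concat_in[of As' Bss' fs' as'] homs_cstar[of As' Bss' fs']
  by (simp add: tensor_append_Nil)
next
 case (2 A As Bs Bss f fs)
 obtain a cs where as: "as = a # cs" "a el A" "cs \<in> lset As" using 2(4) by (rule lset_ConsE)
 have h: "homs As Bss fs" "cstar_list Bs" "star_hom A (tensor Bs) f" using 2(2) by simp_all
 have "f a el tensor Bs" by (rule lin_closed[OF hom_linear[OF h(3)] as(2)])
 then show ?case
  using 2(1)[OF h(1) 2(3) as(3) 2(5)] homs_cstar[OF h(1)] homs_cstar[OF 2(3)] h(2)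
   tensor_concat_in[OF h(1) as(3)] tensor_concat_in[OF 2(3) 2(5)]
  by (simp add: as tensor_append_assoc)
qed auto

text \<open>Induction on the factors: \<open>tensor_hat\<close> for the head,
  \<open>tensor_pair\<close> to join it with the tail.\<close>

lemma tensor_map_exists:
 "homs As Bss fs ==> \<exists>H. chom (tensor As) (tensor (concat Bss)) H \<and>
  (\<forall>as\<in>lset As. H (pure As as) = tensor_concat Bss (map2 (%f a. f a) fs as))"
proof (induction As Bss fs rule: homs.induct)
 case 1
 have "chom (tensor []) (tensor []) (%x. x)" by (simp add: chom_def star_hom_def linear_map_def)
 then show ?case by (intro exI[of _ "%x. x"]) auto
next
 case (2 A As Bs Bss f fs)
 have h: "homs As Bss fs" "cstar_algebra A" "cstar_list Bs" "star_hom A (tensor Bs) f" using 2(2) by simp_all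
 note hc = homs_cstar[OF h(1)]
 have LA: "cstar_list [A]" using h by (simp add: cstar_list_Cons)
 obtain F where F: "chom (tensor [A]) (tensor Bs) F" "!!a. a el A ==> F (single_tensor A a) = f a"
  using tensor_hat[OF h(2,3,4)] by blast
 obtain G where G: "chom (tensor As) (tensor (concat Bss)) G"
  "!!as. as \<in> lset As ==> G (pure As as) = tensor_concat Bss (map2 (%f a. f a) fs as)"
  using 2(1)[OF h(1)] by blast
 obtain H where H: "chom (tensor ([A] @ As)) (tensor (Bs @ concat Bss)) H"
  "!!x y. x el tensor [A] ==> y el tensor As ==>
   H (tensor_append [A] As x y) = tensor_append Bs (concat Bss) (F x) (G y)"
  using tensor_pair[OF LA _ h(3) _ F(1) G(1)] hc by blast
 have "H (pure (A # As) as) = tensor_concat (Bs # Bss) (map2 (%f a. f a) (f # fs) as)" if z: "as \<in> lset (A # As)" for as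
 proof -
  obtain a cs where as: "as = a # cs" "a el A" "cs \<in> lset As" using z by (rule lset_ConsE)
  have "pure (A # As) as = tensor_append [A] As (single_tensor A a) (pure As cs)"
   using tensor_append_pure[OF LA, of As "[a]" cs] hc as by (simp add: single_tensor_def)
  then show ?thesis
   using H(2)[OF single_tensor_in[OF h(2) as(2)] cstar_list.pure_in[OF _ as(3)]] hc F(2)[OF as(2)] G(2)[OF as(3)]
   by (simp add: as)
 qed
 then show ?case using H(1) by (intro exI[of _ H]) simp
qed auto

lemma tensor_map_spec:
 assumes "homs As Bss fs"
 shows chom_tensor_map: "chom (tensor As) (tensor (concat Bss)) (tensor_map As Bss fs)"
  and tensor_map_pure: "as \<in> lset As ==> tensor_map As Bss fs (pure As as) = tensor_concat Bss (map2 (%f a. f a) fs as)"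
proof -
 note hc = homs_cstar[OF assms]
 obtain H where H: "chom (tensor As) (tensor (concat Bss)) H"
  "!!as. as \<in> lset As ==> H (pure As as) = tensor_concat Bss (map2 (%f a. f a) fs as)"
  using tensor_map_exists[OF assms] by blast
 have e: "tensor_map As Bss fs x = H x" if "x el tensor As" for x
  unfolding tensor_map_def
  by (rule cstar_list.tensor_lift_eq[OF _ cstar_tensor_list chom_bounded[OF H(1)] H(2) that]) (use hc in auto)
 show "chom (tensor As) (tensor (concat Bss)) (tensor_map As Bss fs)"
  by (rule chom_cong[OF H(1) pre_cstar_tensor]) (use hc e in auto)
 show "as \<in> lset As ==> tensor_map As Bss fs (pure As as) = tensor_concat Bss (map2 (%f a. f a) fs as)"
  using e H(2) cstar_list.pure_in hc by metis
qed

lemma tensor_map_append: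
 assumes h: "homs As Bss fs" "homs As' Bss' fs'" and x: "x el tensor As" and y: "y el tensor As'"
 shows "tensor_map (As @ As') (Bss @ Bss') (fs @ fs') (tensor_append As As' x y) =
  tensor_append (concat Bss) (concat Bss') (tensor_map As Bss fs x) (tensor_map As' Bss' fs' y)"
proof -
 note hc = homs_cstar[OF h(1)] homs_cstar[OF h(2)]
 show ?thesis
  by (rule append_chom_eqI[OF _ _ _ _ chom_tensor_map[OF homs_append[OF h], simplified concat_append] chom_tensor_map[OF h(1)] chom_tensor_map[OF h(2)] _ x y])
   (use hc in \<open>simp_all add: lset_append tensor_map_pure[OF homs_append[OF h]] tensor_map_pure[OF h(1)] tensor_map_pure[OF h(2)] tensor_concat_append[OF h]\<close>)
qed

lemma tensor_map_single:
 assumes "cstar_algebra A" "cstar_list Bs" "star_hom A (tensor Bs) f" "a el A"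
 shows "tensor_map [A] [Bs] [f] (single_tensor A a) = f a"
 using assms tensor_map_pure[of "[A]" "[Bs]" "[f]" "[a]"]
 by (simp add: single_tensor_def tensor_append_Nil lin_closed[OF hom_linear])

lemma tensor_map_two:
 assumes "cstar_algebra A" "cstar_list Bs" "star_hom A (tensor Bs) f" "a el A"
  "cstar_algebra A'" "cstar_list Bs'" "star_hom A' (tensor Bs') f'" "a' el A'"
 shows "tensor_map [A, A'] [Bs, Bs'] [f, f'] (pure [A, A'] [a, a']) = tensor_append Bs Bs' (f a) (f' a')"
 using assms tensor_map_pure[of "[A, A']" "[Bs, Bs']" "[f, f']" "[a, a']"]
 by (simp add: tensor_append_Nil lin_closed[OF hom_linear])

lemma tensor_map_single_id:
 assumes "cstar_algebra A" "cstar_algebra A'" "x el tensor [A, A']"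
 shows "tensor_map [A, A'] [[A], [A']] [single_tensor A, single_tensor A'] x = x"
proof -
 have h: "homs [A, A'] [[A], [A']] [single_tensor A, single_tensor A']"
  using assms by (simp add: single_tensor_hom cstar_list_Cons)
 have L: "cstar_list [A, A']" using assms by (simp add: cstar_list_Cons)
 show ?thesis
 proof (rule cstar_list.tensor_map_eqI[OF L cstar_tensor_list[OF L] _ _ _ assms(3)])
  show "bounded_linear_map (tensor [A, A']) (tensor [A, A']) (tensor_map [A, A'] [[A], [A']] [single_tensor A, single_tensor A'])"
   using chom_bounded[OF chom_tensor_map[OF h]] by simp
  show "bounded_linear_map (tensor [A, A']) (tensor [A, A']) (%x. x)"
   by (auto simp: bounded_linear_map_def linear_map_def intro: exI[of _ 1])
  fix as assume "as \<in> lset [A, A']"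
  then obtain a b where as: "as = [a, b]" "a el A" "b el A'" by (auto elim!: lset_ConsE)
  show "tensor_map [A, A'] [[A], [A']] [single_tensor A, single_tensor A'] (pure [A, A'] as) = pure [A, A'] as"
   using tensor_map_two[of A "[A]" "single_tensor A" a A' "[A']" "single_tensor A'" b] assms as
    tensor_append_pure[of "[A]" "[A']" "[a]" "[b]"]
   by (simp add: single_tensor_hom cstar_list_Cons) (simp add: single_tensor_def)
 qed
qed

section \<open>Partitions and refinement maps\<close>

lemma sorted_list_of_set_split:
 fixes J :: "real set"
 assumes "finite J" "r \<in> J"
 shows "sorted_list_of_set J = sorted_list_of_set (J \<inter> {..<r}) @ r # sorted_list_of_set (J \<inter> {r<..})"
 using assms
 by (intro sorted_distinct_set_unique) (auto simp: sorted_append)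

text \<open>A cut at a point of \<open>J\<close> puts that point into both parts, so no interval is
  lost or doubled. Together with its consequence for \<open>factors\<close> it underlies the
  inductions on partitions.\<close>

lemma intervals_split:
 assumes "finite J" "r \<in> J"
 shows "intervals J = intervals (J <| r) @ intervals (J |> r)"
proof -
 have z: "zip (xs @ r # ys) (tl (xs @ r # ys)) = zip (xs @ [r]) (tl (xs @ [r])) @ zip (r # ys) ys" for xs ys :: "real list"
 proof (induction xs)
  case (Cons a xs) then show ?case by (cases xs) auto
 qed simp
 have e: "J <| r \<inter> {..<r} = J \<inter> {..<r}" "J <| r \<inter> {r<..} = {}" "J |> r \<inter> {..<r} = {}"
  "J |> r \<inter> {r<..} = J \<inter> {r<..}" by auto
 have f: "finite (J <| r)" "r \<in> J <| r" "finite (J |> r)" "r \<in> J |> r" using assms by auto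
 show ?thesis
  unfolding intervals_def Let_def sorted_list_of_set_split[OF assms] sorted_list_of_set_split[OF f(1,2)]
   sorted_list_of_set_split[OF f(3,4)] e
  using z[of "sorted_list_of_set (J \<inter> {..<r})" "sorted_list_of_set (J \<inter> {r<..})"] by simp
qed

lemma intervals_single [simp]: "intervals {s} = []"
 by (simp add: intervals_def)

lemma intervals_pair [simp]: "s < t ==> intervals {s, t} = [(s, t)]"
 by (simp add: intervals_def)

lemma intervals_less: "(s, t) \<in> set (intervals J) ==> s < t \<and> s \<in> J \<and> t \<in> J"
proof (cases "finite J")
 case True
 have "sorted_wrt (<) xs ==> (s, t) \<in> set (zip xs (tl xs)) ==> s < t \<and> s \<in> set xs \<and> t \<in> set xs" for xs :: "real list"
 proof (induction xs)
  case (Cons a xs)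
  then show ?case by (cases xs) (force simp del: sorted_wrt.simps simp add: sorted_wrt.simps(2) strict_sorted_iff)+
 qed simp
 from this[of "sorted_list_of_set J"] True show "(s, t) \<in> set (intervals J) ==> ?thesis" by (simp add: intervals_def Let_def)
qed (simp add: intervals_def)

lemma factors_split: "finite J ==> r \<in> J ==> factors A J = factors A (J <| r) @ factors A (J |> r)"
 by (simp add: factors_def intervals_split[of J r])

lemma factors_single [simp]: "factors A {s} = []"
 by (simp add: factors_def)

lemma factors_pair [simp]: "s < t ==> factors A {s, t} = [A s t]"
 by (simp add: factors_def)

lemma partition_nonempty_induct [consumes 2, case_names single insert]:
 fixes I :: "real set"
 assumes "finite I" "I \<noteq> {}" and "!!s. P {s}"
  and "!!t I. finite I ==> I \<noteq> {} ==> (!!x. x \<in> I ==> x < t) ==> P I ==> P (insert t I)"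
 shows "P I"
proof -
 have "I \<noteq> {} \<longrightarrow> P I"
  using assms(1)
 proof (induction rule: finite_linorder_max_induct)
  case (insert b B) then show ?case using assms(3,4) by (cases "B = {}") auto
 qed simp
 then show ?thesis using assms(2) by blast
qed

text \<open>The end point moves: removing \<open>t\<close> leaves a partition that ends at the
  second largest point \<open>m\<close>, which matches the recursion of
  \<open>split_rev\<close>.\<close>

lemma partition_induct [consumes 2, case_names two insert]:
 assumes "J \<in> partitions s t" "s < t" and two: "!!t. s < t ==> P t {s, t}"
  and step: "!!m t J. s < m ==> m < t ==> J \<in> partitions s m ==> P m J ==> P t (insert t J)"
 shows "P t J"
proof -
 have "finite J" "J \<noteq> {}" using assms(1) by (auto simp: partitions_def)
 then have "\<forall>t. J \<in> partitions s t \<longrightarrow> s < t \<longrightarrow> P t J"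
 proof (induction J rule: partition_nonempty_induct)
  case (insert t J)
  show ?case
  proof (intro allI impI)
   fix u assume u: "insert t J \<in> partitions s u" "s < u"
   then have [simp]: "u = t" using insert by (force simp: partitions_def)
   have s: "s \<in> J" using u by (auto simp: partitions_def)
   define m where "m = Max J"
   have m: "m \<in> J" "m < t" "!!x. x \<in> J ==> x <= m" using insert by (auto simp: m_def)
   show "P u (insert t J)"
   proof (cases "m = s")
    case True
    then have "J = {s}" using m u s by (force simp: partitions_def)
    then show ?thesis using two[of t] u by (simp add: insert_commute[of t s])
   next
    case False
    then have "s < m" using m(3)[OF s] by simp
    moreover have "J \<in> partitions s m" using m u s by (auto simp: partitions_def)
    ultimately show ?thesis using insert step[of m t J] m(2) by simp
   qed
  qed
 qed (auto simp: partitions_def)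
 then show ?thesis using assms by blast
qed

lemma partition_insert:
 assumes "J \<in> partitions s m" "m < t" "r \<in> J"
 shows "insert t J <| r = J <| r" "insert t J |> r = insert t (J |> r)"
 using assms by (auto simp: partitions_def)

lemma partition_lower:
 assumes "J \<in> partitions s t" shows "J <| t = J" "J |> t = {t}" "J |> s = J" "J <| s = {s}"
 using assms by (auto simp: partitions_def)

lemma partition_sub:
 assumes "J \<in> partitions s t" "r \<in> J"
 shows "J <| r \<in> partitions s r" "J |> r \<in> partitions r t"
 using assms by (auto simp: partitions_def)

lemma factors_insert:
 assumes "J \<in> partitions s m" "m < t" shows "factors A (insert t J) = factors A J @ [A m t]"
proof -
 have "m \<in> J" "finite J" "J |> m = {m}" "J <| m = J" using assms by (auto simp: partitions_def)
 then show ?thesis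
  using factors_split[of "insert t J" m A] partition_insert[OF assms, of m] assms(2) by (simp add: insert_commute)
qed

text \<open>Functoriality of tensor maps for two factors whose inner maps take values in tensor
  products themselves. Both sides of coassociativity, followed by further splittings, have this
  shape.\<close>

lemma tensor_map_compose_two:
 assumes X: "cstar_algebra X1" "cstar_algebra X2"
  and f: "cstar_list Bs1" "star_hom X1 (tensor Bs1) f1" "cstar_list Bs2" "star_hom X2 (tensor Bs2) f2"
  and g: "homs Bs1 Css1 gs1" "homs Bs2 Css2 gs2"
  and h: "!!b. b el X1 ==> tensor_map Bs1 Css1 gs1 (f1 b) = h1 b"
   "!!b. b el X2 ==> tensor_map Bs2 Css2 gs2 (f2 b) = h2 b"
  and x: "x el tensor [X1, X2]"
 shows "tensor_map (Bs1 @ Bs2) (Css1 @ Css2) (gs1 @ gs2) (tensor_map [X1, X2] [Bs1, Bs2] [f1, f2] x) =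
  tensor_map [X1, X2] [concat Css1, concat Css2] [h1, h2] x"
proof -
 note hc = homs_cstar[OF g(1)] homs_cstar[OF g(2)]
 have L: "cstar_list [X1, X2]" using X by (simp add: cstar_list_Cons)
 have hh: "star_hom X1 (tensor (concat Css1)) h1" "star_hom X2 (tensor (concat Css2)) h2"
  using star_hom_cong[OF star_hom_comp[OF f(2) chom_star_hom[OF chom_tensor_map[OF g(1)]]] cstar_pre[OF X(1)] h(1)]
   star_hom_cong[OF star_hom_comp[OF f(4) chom_star_hom[OF chom_tensor_map[OF g(2)]]] cstar_pre[OF X(2)] h(2)] by auto
 have fs: "homs [X1, X2] [Bs1, Bs2] [f1, f2]" and hs: "homs [X1, X2] [concat Css1, concat Css2] [h1, h2]"
  using X f hh hc by simp_all
 have c: "cstar_list (concat Css1 @ concat Css2)" using hc by (simp add: cstar_list_append)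
 have F: "chom (tensor [X1, X2]) (tensor (Bs1 @ Bs2)) (tensor_map [X1, X2] [Bs1, Bs2] [f1, f2])"
  using chom_tensor_map[OF fs] by simp
 have G: "chom (tensor (Bs1 @ Bs2)) (tensor (concat Css1 @ concat Css2)) (tensor_map (Bs1 @ Bs2) (Css1 @ Css2) (gs1 @ gs2))"
  using chom_tensor_map[OF homs_append[OF g]] by simp
 have H: "chom (tensor [X1, X2]) (tensor (concat Css1 @ concat Css2)) (tensor_map [X1, X2] [concat Css1, concat Css2] [h1, h2])"
  using chom_tensor_map[OF hs] by simp
 show ?thesis
 proof (rule cstar_list.tensor_map_eqI[OF L cstar_tensor_list[OF c] chom_bounded[OF chom_comp[OF F G]] chom_bounded[OF H] _ x])
  fix as assume "as \<in> lset [X1, X2]"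
  then obtain a b where as: "as = [a, b]" "a el X1" "b el X2" by (auto elim!: lset_ConsE)
  show "tensor_map (Bs1 @ Bs2) (Css1 @ Css2) (gs1 @ gs2) (tensor_map [X1, X2] [Bs1, Bs2] [f1, f2] (pure [X1, X2] as)) =
   tensor_map [X1, X2] [concat Css1, concat Css2] [h1, h2] (pure [X1, X2] as)"
   unfolding as(1) tensor_map_two[OF X(1) f(1,2) as(2) X(2) f(3,4) as(3)]
    tensor_map_append[OF g lin_closed[OF hom_linear[OF f(2)] as(2)] lin_closed[OF hom_linear[OF f(4)] as(3)]]
    h(1)[OF as(2)] h(2)[OF as(3)]
   using tensor_map_two[OF X(1) _ hh(1) as(2) X(2) _ hh(2) as(3)] hc by simp
 qed
qed

section \<open>Iterated co-multiplications and refinement\<close>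

locale subproduct =
 fixes A :: "real => real => 'a star_alg" and D
 assumes sys: "subproduct_system A D"
begin

abbreviation "fac \<equiv> factors A"

lemma cst: "0 < s ==> s < t ==> cstar_algebra (A s t)"
 using sys by (simp add: subproduct_system_def)

lemma D_hom: "0 < r ==> r < s ==> s < t ==> star_hom (A r t) (tensor [A r s, A s t]) (D r s t)"
 using sys by (simp add: subproduct_system_def star_mono_def)

lemma D_in: "0 < r ==> r < s ==> s < t ==> a el A r t ==> D r s t a el tensor [A r s, A s t]"
 by (rule lin_closed[OF hom_linear[OF D_hom]])

lemma coassoc: "0 < r ==> r < s ==> s < t ==> t < u ==> a el A r u ==>
  tensor_map [A r s, A s u] [[A r s], [A s t, A t u]] [single_tensor (A r s), D s t u] (D r s u a) =
  tensor_map [A r t, A t u] [[A r s, A s t], [A t u]] [D r s t, single_tensor (A t u)] (D r t u a)"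
 using sys by (simp add: subproduct_system_def)

lemma fac_cstar: assumes "J \<subseteq> {0<..}" shows "cstar_list (fac J)"
proof -
 have "cstar_algebra (A s t)" if "(s, t) \<in> set (intervals J)" for s t
  using cst[of s t] intervals_less[OF that] assms by auto
 then show ?thesis by (auto simp: cstar_list_def factors_def)
qed

lemma partition_pos: "0 < s ==> J \<in> partitions s t ==> J \<subseteq> {0<..}"
 by (auto simp: partitions_def)

lemma fac_part: "J \<in> partitions s t ==> 0 < s ==> cstar_list (fac J)"
 by (intro fac_cstar partition_pos)

lemma split_pair: "s < t ==> split A D {s, t} = single_tensor (A s t)"
 by (simp add: split_def)

text \<open>The recursion of \<open>split_rev\<close> in terms of partitions. Its separate equation
  for three points is the case \<open>J = {s, m}\<close>, where both inner maps are canonical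
  embeddings and their tensor map is the identity.\<close>

lemma split_insert:
 assumes J: "J \<in> partitions s m" "0 < s" "s < m" "m < t" and a: "a el A s t"
 shows "split A D (insert t J) a =
  tensor_map [A s m, A m t] [fac J, [A m t]] [split A D J, single_tensor (A m t)] (D s m t a)"
proof -
 have fin: "finite J" "m \<in> J" "s \<in> J" "!!x. x \<in> J ==> x <= m \<and> s <= x" using J by (auto simp: partitions_def)
 have e: "insert t J \<inter> {..<t} = J" "insert t J \<inter> {t<..} = {}" "J \<inter> {m<..} = {}" "J \<inter> {..<s} = {}" "s \<in> J \<inter> {..<m}"
  "J \<inter> {..<m} \<inter> {..<s} = {}"
  using fin J by force+
 define L where "L = rev (sorted_list_of_set (J \<inter> {..<m}))"
 have 1: "rev (sorted_list_of_set (insert t J)) = t # rev (sorted_list_of_set J)"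
  using sorted_list_of_set_split[of "insert t J" t] fin e by simp
 have 2: "rev (sorted_list_of_set J) = m # L"
  using sorted_list_of_set_split[of J m] fin e by (simp add: L_def)
 have L: "L \<noteq> []" "last L = s"
  using sorted_list_of_set_split[of "J \<inter> {..<m}" s] fin e by (simp_all add: L_def)
 have set: "J = set (m # L)" by (metis 2 fin(1) set_rev set_sorted_list_of_set)
 consider "L = [s]" | r q qs where "L = r # q # qs" using L by (metis last_ConsL list.exhaust)
 then show ?thesis
 proof cases
  case 1
  then have "J = {s, m}" using set by auto
  then show ?thesis
   using \<open>rev (sorted_list_of_set (insert t J)) = _\<close> 2 1 J D_in[OF J(2-4) a] cst
   by (simp add: split_def tensor_map_single_id)
 next
  case 2
  have "split A D (insert t J) = split_rev A D (t # m # r # q # qs)"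
   unfolding split_def \<open>rev (sorted_list_of_set (insert t J)) = _\<close> \<open>rev (sorted_list_of_set J) = _\<close> 2 ..
  moreover have "split A D J = split_rev A D (m # r # q # qs)"
   unfolding split_def \<open>rev (sorted_list_of_set J) = _\<close> 2 ..
  moreover have "last (q # qs) = s" "set (m # r # q # qs) = J" using L set 2 by auto
  ultimately show ?thesis by (simp only: split_rev.simps Let_def)
 qed
qed

lemma split_hom:
 assumes "J \<in> partitions s t" "s < t" "0 < s"
 shows "star_hom (A s t) (tensor (fac J)) (split A D J)"
 using assms(1,2)
proof (induction rule: partition_induct)
 case (two t) then show ?case using assms by (simp add: split_pair single_tensor_hom cst)
next
 case (insert m t J)
 have h: "homs [A s m, A m t] [fac J, [A m t]] [split A D J, single_tensor (A m t)]"
  using insert.IH insert.hyps(1,2) assms(3) cst[of s m] cst[of m t] fac_part[OF insert.hyps(3) assms(3)]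
  by (simp add: single_tensor_hom cstar_list_Cons)
 have "star_hom (A s t) (tensor (fac J @ [A m t])) (%a. tensor_map [A s m, A m t] [fac J, [A m t]]
   [split A D J, single_tensor (A m t)] (D s m t a))"
  using star_hom_comp[OF D_hom[OF assms(3) insert.hyps(1,2)] chom_star_hom[OF chom_tensor_map[OF h]]] by simp
 moreover have "pre_cstar (A s t)" using cst[of s t] insert.hyps assms(3) by (simp add: cstar_pre)
 ultimately have "star_hom (A s t) (tensor (fac J @ [A m t])) (split A D (insert t J))"
  by (rule star_hom_cong) (simp add: split_insert[OF insert.hyps(3) assms(3) insert.hyps(1,2)])
 then show ?case by (simp add: factors_insert[OF insert.hyps(3,2)])
qed

lemma split_in: "J \<in> partitions s t ==> s < t ==> 0 < s ==> a el A s t ==> split A D J a el tensor (fac J)"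
 by (rule lin_closed[OF hom_linear[OF split_hom]])

text \<open>The definition always splits off the last interval; coassociativity moves the cut to any
  interior point \<open>r\<close>. If \<open>r\<close> is the last interior point this is the
  definition, otherwise the induction hypothesis cuts the part before \<open>m\<close>.\<close>

lemma split_at:
 assumes "J \<in> partitions s t" "s < t" "0 < s" "r \<in> J" "s < r" "r < t" "a el A s t"
 shows "split A D J a = tensor_map [A s r, A r t] [fac (J <| r), fac (J |> r)]
  [split A D (J <| r), split A D (J |> r)] (D s r t a)"
 using assms(1,2,4-7)
proof (induction arbitrary: a rule: partition_induct)
 case (two t) then show ?case by simp
next
 case (insert m t J)
 note s = assms(3)
 show ?case
 proof (cases "r = m")
  case True
  have "m \<in> J" using insert by (auto simp: partitions_def)
  then show ?thesis
   using True split_insert[of J s m t a] insert s partition_insert[of J s m t m] partition_lower[of J s m]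
   by (simp add: insert_commute split_pair)
 next
  case False
  let ?lo = "J <| r" and ?hi = "J |> r"
  have rJ: "r \<in> J" "r < m" using insert False by (auto simp: partitions_def)
  have lo: "?lo \<in> partitions s r" and hi: "?hi \<in> partitions r m" using partition_sub[OF insert.hyps(3) rJ(1)] .
  have r: "0 < r" using insert s by simp
  have C: "cstar_algebra (A s m)" "cstar_algebra (A m t)" "cstar_algebra (A s r)" "cstar_algebra (A r m)" "cstar_algebra (A r t)"
   using cst s r insert rJ by auto
  have H: "homs [A s r, A r m] [fac ?lo, fac ?hi] [split A D ?lo, split A D ?hi]"
   using C split_hom[OF lo] split_hom[OF hi] fac_part[OF lo] fac_part[OF hi] insert.prems rJ s r by simp
  have M: "homs [A m t] [[A m t]] [single_tensor (A m t)]" using C by (simp add: single_tensor_hom cstar_list_Cons)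
  have fJ: "fac J = fac ?lo @ fac ?hi" by (rule factors_split) (use rJ insert in \<open>auto simp: partitions_def\<close>)
  have "split A D (insert t J) a = tensor_map [A s m, A m t] [fac J, [A m t]] [split A D J, single_tensor (A m t)] (D s m t a)"
   using insert s by (intro split_insert) auto
  also have "tensor_map [A s m, A m t] [fac J, [A m t]] [split A D J, single_tensor (A m t)] (D s m t a) =
    tensor_map [A s m, A m t] [concat [fac ?lo, fac ?hi], concat [[A m t]]] [split A D J, single_tensor (A m t)] (D s m t a)"
   by (simp add: fJ)
  also have "... = tensor_map ([A s r, A r m] @ [A m t]) ([fac ?lo, fac ?hi] @ [[A m t]])
    ([split A D ?lo, split A D ?hi] @ [single_tensor (A m t)])
    (tensor_map [A s m, A m t] [[A s r, A r m], [A m t]] [D s r m, single_tensor (A m t)] (D s m t a))"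
  proof (rule tensor_map_compose_two[symmetric, OF C(1,2) _ _ _ _ H M])
   show "D s m t a el tensor [A s m, A m t]" by (rule D_in) (use insert.hyps insert.prems s in simp_all)
   show "tensor_map [A s r, A r m] [fac ?lo, fac ?hi] [split A D ?lo, split A D ?hi] (D s r m b) = split A D J b"
    if "b el A s m" for b using insert.IH[OF rJ(1) insert.prems(2) rJ(2) that] by simp
   show "tensor_map [A m t] [[A m t]] [single_tensor (A m t)] (single_tensor (A m t) b) = single_tensor (A m t) b"
    if "b el A m t" for b using that C by (simp add: tensor_map_single single_tensor_hom cstar_list_Cons)
  qed (use C D_hom[of s r m] insert.hyps insert.prems rJ s in \<open>simp_all add: single_tensor_hom cstar_list_Cons\<close>)
  \<comment> \<open>Coassociativity at \<open>s < r < m < t\<close> trades the outer cut at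
    \<open>m\<close> for an outer cut at \<open>r\<close>.\<close>
  also have "tensor_map [A s m, A m t] [[A s r, A r m], [A m t]] [D s r m, single_tensor (A m t)] (D s m t a) =
    tensor_map [A s r, A r t] [[A s r], [A r m, A m t]] [single_tensor (A s r), D r m t] (D s r t a)"
   by (rule coassoc[symmetric]) (use insert.hyps insert.prems rJ s in simp_all)
  also have "tensor_map ([A s r, A r m] @ [A m t]) ([fac ?lo, fac ?hi] @ [[A m t]])
    ([split A D ?lo, split A D ?hi] @ [single_tensor (A m t)]) ... =
   tensor_map ([A s r] @ [A r m, A m t]) ([fac ?lo] @ [fac ?hi, [A m t]])
    ([split A D ?lo] @ [split A D ?hi, single_tensor (A m t)])
    (tensor_map [A s r, A r t] [[A s r], [A r m, A m t]] [single_tensor (A s r), D r m t] (D s r t a))" by simp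
  also have "... = tensor_map [A s r, A r t] [concat [fac ?lo], concat [fac ?hi, [A m t]]]
    [split A D ?lo, split A D (insert t ?hi)] (D s r t a)"
  proof (rule tensor_map_compose_two)
   show "D s r t a el tensor [A s r, A r t]" by (rule D_in) (use insert.hyps insert.prems rJ s in simp_all)
   show "tensor_map [A s r] [fac ?lo] [split A D ?lo] (single_tensor (A s r) b) = split A D ?lo b"
    if "b el A s r" for b
    by (rule tensor_map_single[OF C(3) fac_part[OF lo s] split_hom[OF lo insert.prems(2) s] that])
   show "tensor_map [A r m, A m t] [fac ?hi, [A m t]] [split A D ?hi, single_tensor (A m t)] (D r m t b) =
     split A D (insert t ?hi) b" if "b el A r t" for b
    by (rule split_insert[OF hi r rJ(2) insert.hyps(2) that, symmetric])
  qed (use C D_hom[of r m t] H M insert.hyps rJ r in \<open>simp_all add: single_tensor_hom cstar_list_Cons\<close>)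
  finally show ?thesis
   using partition_insert[OF insert.hyps(3,2) rJ(1)] factors_insert[OF hi insert.hyps(2), of A] by simp
 qed
qed

end

lemma homs_map:
 assumes "!!s t. (s, t) \<in> set xs ==> cstar_algebra (A s t) \<and> cstar_list (F s t) \<and> star_hom (A s t) (tensor (F s t)) (G s t)"
 shows "homs (map (%(s, t). A s t) xs) (map (%(s, t). F s t) xs) (map (%(s, t). G s t) xs)"
 using assms by (induction xs) auto

definition refines :: "real set => real set => bool" where
 "refines I J \<longleftrightarrow> finite J \<and> I \<noteq> {} \<and> I \<subseteq> J \<and> J \<subseteq> {0<..} \<and>
   (\<forall>j\<in>J. (\<exists>a\<in>I. a <= j) \<and> (\<exists>b\<in>I. j <= b))"

lemma refines_finite: "refines I J ==> finite I"
 by (auto simp: refines_def intro: finite_subset)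

lemma refinesD:
 "refines I J ==> finite J" "refines I J ==> I \<subseteq> J" "refines I J ==> J \<subseteq> {0<..}"
 "refines I J ==> j \<in> J ==> \<exists>a\<in>I. a <= j" "refines I J ==> j \<in> J ==> \<exists>b\<in>I. j <= b"
 by (simp_all add: refines_def)

lemma refines_sub:
 assumes "refines I J" "r \<in> I"
 shows "refines (I <| r) (J <| r)" "refines (I |> r) (J |> r)"
proof -
 have "(\<exists>a\<in>I <| r. a <= j) \<and> (\<exists>b\<in>I <| r. j <= b)" if "j \<in> J <| r" for j
  using that assms unfolding refines_def by (metis IntD1 IntD2 IntI atMost_iff order_refl order_trans)
 moreover have "(\<exists>a\<in>I |> r. a <= j) \<and> (\<exists>b\<in>I |> r. j <= b)" if "j \<in> J |> r" for j
  using that assms unfolding refines_def by (metis IntD1 IntD2 IntI atLeast_iff order_refl order_trans)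
 ultimately show "refines (I <| r) (J <| r)" "refines (I |> r) (J |> r)"
  using assms unfolding refines_def by auto
qed

lemma refines_trans: "refines I J ==> refines J K ==> refines I K"
 unfolding refines_def by (meson order_trans subset_trans)

lemma refines_interval: "refines I J ==> (s, t) \<in> set (intervals I) ==> 0 < s \<and> s < t \<and> J \<inter> {s..t} \<in> partitions s t"
 using intervals_less[of s t I] by (auto simp: refines_def partitions_def)

text \<open>Removes the last interval \<open>[m, t]\<close> of the coarse partition together with
  the points of \<open>J\<close> inside it.\<close>

lemma refines_induct [consumes 1, case_names single insert]:
 assumes "refines I J" "!!s. 0 < s ==> P {s} {s}"
  and "!!m t I J. refines (insert t I) J ==> m < t ==> 0 < m ==> m \<in> insert t I ==> insert t I <| m = I ==>
   insert t I |> m = {m, t} ==> J |> m \<in> partitions m t ==> P I (J <| m) ==> P (insert t I) J"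
 shows "P I J"
proof -
 have "finite I" "I \<noteq> {}" using assms(1) refines_finite by (auto simp: refines_def)
 then have "\<forall>J. refines I J \<longrightarrow> P I J"
 proof (induction I rule: partition_nonempty_induct)
  case (single s)
  have "J = {s}" "0 < s" if "refines {s} J" for J using that by (force simp: refines_def)+
  then show ?case using assms(2) by metis
 next
  case (insert t I)
  define m where "m = Max I"
  have m: "m \<in> I" "m < t" "!!x. x \<in> I ==> x <= m" using insert by (auto simp: m_def)
  have e: "insert t I <| m = I" "insert t I |> m = {m, t}" using m by force+
  show ?case
  proof (intro allI impI)
   fix J assume J: "refines (insert t I) J"
   have "refines I (J <| m)" using refines_sub(1)[OF J, of m] m(1) unfolding e by blast
   then have "P I (J <| m)" using insert.IH by blast
   moreover have "j <= t" if j: "j \<in> J" for j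
   proof -
    obtain b where b: "b \<in> insert t I" "j <= b" using refinesD(5)[OF J j] by (rule bexE)
    then have "b <= t" using m(2) m(3)[of b] by auto
    then show ?thesis using b(2) by simp
   qed
   then have "0 < m" "J |> m \<in> partitions m t"
    using refinesD(1-3)[OF J] m(1,2) unfolding partitions_def by auto
   ultimately show "P (insert t I) J" using assms(3)[OF J m(2)] m(1) e by blast
  qed
 qed
 then show ?thesis using assms(1) by blast
qed

lemma pieces_split:
 assumes "refines I J" "r \<in> I"
 shows "map (%(s, t). f (J \<inter> {s..t})) (intervals I) =
  map (%(s, t). f (J <| r \<inter> {s..t})) (intervals (I <| r)) @
  map (%(s, t). f (J |> r \<inter> {s..t})) (intervals (I |> r))"
proof -
 have "J \<inter> {s..t} = J <| r \<inter> {s..t}" if "(s, t) \<in> set (intervals (I <| r))" for s t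
  using intervals_less[OF that] by auto
 moreover have "J \<inter> {s..t} = J |> r \<inter> {s..t}" if "(s, t) \<in> set (intervals (I |> r))" for s t
  using intervals_less[OF that] by auto
 ultimately show ?thesis
  unfolding intervals_split[OF refines_finite[OF assms(1)] assms(2)] map_append
  by (intro arg_cong2[where f="(@)"] map_cong) auto
qed

lemma partition_interval: "J \<in> partitions s t ==> J \<inter> {s..t} = J"
 by (auto simp: partitions_def)

lemma pieces_concat:
 "refines I J ==> concat (map (%(s, t). factors A (J \<inter> {s..t})) (intervals I)) = factors A J"
proof (induction rule: refines_induct)
 case (insert m t I J)
 have "finite J" "m \<in> J" using insert by (auto simp: refines_def)
 then show ?case
  unfolding pieces_split[OF insert.hyps(1,4)] insert.hyps(5,6) concat_append insert.IH
  using insert.hyps(2) partition_interval[OF insert.hyps(7)] by (simp add: factors_split[of J m])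
qed simp

context subproduct
begin

lemma homs_refine:
 assumes "refines I J"
 shows "homs (fac I) (map (%(s, t). fac (J \<inter> {s..t})) (intervals I)) (map (%(s, t). split A D (J \<inter> {s..t})) (intervals I))"
 unfolding factors_def[of A I]
proof (rule homs_map)
 fix s t assume "(s, t) \<in> set (intervals I)"
 then have h: "0 < s" "s < t" "J \<inter> {s..t} \<in> partitions s t" using refines_interval[OF assms] by auto
 show "cstar_algebra (A s t) \<and> cstar_list (fac (J \<inter> {s..t})) \<and> star_hom (A s t) (tensor (fac (J \<inter> {s..t}))) (split A D (J \<inter> {s..t}))"
  using cst[OF h(1,2)] fac_part[OF h(3,1)] split_hom[OF h(3,2,1)] by simp
qed

lemma chom_refine: "refines I J ==> chom (tensor (fac I)) (tensor (fac J)) (refine A D I J)"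
 using chom_tensor_map[OF homs_refine[of I J]] by (simp add: pieces_concat refine_def)

lemma refine_in: "refines I J ==> x el tensor (fac I) ==> refine A D I J x el tensor (fac J)"
 by (rule chom_closed[OF chom_refine])

lemma refines_cstar: "refines I J ==> cstar_list (fac I)" "refines I J ==> cstar_list (fac J)"
 by (auto simp: refines_def intro!: fac_cstar)

text \<open>Refinement acts interval by interval, so it respects every cut at a point of the coarse
  partition; identities can then be checked on single intervals.\<close>

lemma refine_append:
 assumes IJ: "refines I J" and r: "r \<in> I" and x: "x el tensor (fac (I <| r))" and y: "y el tensor (fac (I |> r))"
 shows "refine A D I J (tensor_append (fac (I <| r)) (fac (I |> r)) x y) =
  tensor_append (fac (J <| r)) (fac (J |> r)) (refine A D (I <| r) (J <| r) x) (refine A D (I |> r) (J |> r) y)"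
 using tensor_map_append[OF homs_refine[OF refines_sub(1)[OF IJ r]] homs_refine[OF refines_sub(2)[OF IJ r]] x y]
  pieces_concat[OF refines_sub(1)[OF IJ r], of A] pieces_concat[OF refines_sub(2)[OF IJ r], of A]
 by (simp add: refine_def pieces_split[OF IJ r] factors_split[OF refines_finite[OF IJ] r])

lemma refine_pair:
 assumes "J \<in> partitions s t" "0 < s" "s < t" "a el A s t"
 shows "refine A D {s, t} J (single_tensor (A s t) a) = split A D J a"
 using tensor_map_single[OF cst[OF assms(2,3)] fac_part[OF assms(1,2)] split_hom[OF assms(1,3,2)] assms(4)]
  partition_interval[OF assms(1)] assms(3) by (simp add: refine_def)

text \<open>The last interval of \<open>J\<close> is split off on both sides: on the left by the
  recursion, on the right by \<open>split_at\<close>, because \<open>m\<close> need not be the last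
  interior point of \<open>K\<close>.\<close>

lemma refine_split:
 assumes "J \<in> partitions s t" "s < t" "0 < s" "K \<in> partitions s t" "J \<subseteq> K" "a el A s t"
 shows "refine A D J K (split A D J a) = split A D K a"
 using assms(1,2,4-6)
proof (induction arbitrary: K a rule: partition_induct)
 case (two t) then show ?case using assms(3) by (simp add: split_pair refine_pair)
next
 case (insert m t J)
 note s = assms(3)
 note h = insert.hyps
 have m: "m \<in> insert t J" "m \<in> K" "0 < m" using h insert.prems s by (auto simp: partitions_def)
 have JK: "refines (insert t J) K" using h insert.prems s by (auto simp: refines_def partitions_def)
 have e: "insert t J <| m = J" "insert t J |> m = {m, t}"
  using h by (auto simp: partitions_def)
 note K = partition_sub[OF insert.prems(1) m(2)]
 have JK1: "refines J (K <| m)" and JK2: "refines {m, t} (K |> m)"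
  using refines_sub[OF JK m(1)] unfolding e .
 have fin: "finite (insert t J)" using refines_finite[OF JK] .
 have C: "cstar_algebra (A s m)" "cstar_algebra (A m t)" using cst s h m by auto
 have sub: "J \<subseteq> K <| m" using e(1) insert.prems(2) by blast
 have "refine A D (insert t J) K (split A D (insert t J) a) =
   refine A D (insert t J) K (tensor_map [A s m, A m t] [fac J, [A m t]] [split A D J, single_tensor (A m t)] (D s m t a))"
  using split_insert[OF h(3) s h(1,2) insert.prems(3)] by simp
 also have "... = tensor_map [A s m, A m t] [fac (K <| m), fac (K |> m)]
   [split A D (K <| m), split A D (K |> m)] (D s m t a)"
 proof -
  have 1: "tensor_map (fac J) (map (%(s, t). fac (K <| m \<inter> {s..t})) (intervals J))
    (map (%(s, t). split A D (K <| m \<inter> {s..t})) (intervals J)) (split A D J b) = split A D (K <| m) b"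
   if "b el A s m" for b using insert.IH[OF K(1) sub that] by (simp add: refine_def)
  have 2: "tensor_map [A m t] (map (%(s, t). fac (K |> m \<inter> {s..t})) (intervals {m, t}))
    (map (%(s, t). split A D (K |> m \<inter> {s..t})) (intervals {m, t})) (single_tensor (A m t) b) = split A D (K |> m) b"
   if "b el A m t" for b using refine_pair[OF K(2) m(3) h(2) that] h(2) by (simp add: refine_def)
  have 3: "homs [A m t] (map (%(s, t). fac (K |> m \<inter> {s..t})) (intervals {m, t}))
    (map (%(s, t). split A D (K |> m \<inter> {s..t})) (intervals {m, t}))"
   using homs_refine[OF JK2] h(2) by simp
  have 4: "cstar_list [A m t]" using C by (simp add: cstar_list_Cons)
  show ?thesis
   using tensor_map_compose_two[OF C fac_part[OF h(3) s] split_hom[OF h(3,1) s] 4 single_tensor_hom[OF C(2)]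
     homs_refine[OF JK1] 3 1 2 D_in[OF s h(1,2) insert.prems(3)]]
   unfolding refine_def pieces_split[OF JK m(1)] e factors_insert[OF h(3,2)] pieces_concat[OF JK1] pieces_concat[OF JK2]
   by simp
 qed
 also have "... = split A D K a"
  using split_at[OF insert.prems(1) _ s m(2) h(1,2) insert.prems(3)] h(1,2) by simp
 finally show ?case .
qed

text \<open>Cutting before the last interval reduces the claim to one interval, where it is
  \<open>refine_split\<close>.\<close>

lemma refine_comp:
 "refines I J ==> refines J K ==> x el tensor (fac I) ==> refine A D J K (refine A D I J x) = refine A D I K x"
proof (induction arbitrary: K x rule: refines_induct)
 case (single s)
 then have e: "K = {s}" by (force simp: refines_def)
 have c: "chom (tensor []) (tensor []) (refine A D {s} {s})" using chom_refine[of "{s}" "{s}"] single e by simp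
 show ?case
  unfolding e
 proof (rule cstar_list.tensor_map_eqI[OF cstar_list_Nil cstar_tensor_list[OF cstar_list_Nil]
   chom_bounded[OF chom_comp[OF c c]] chom_bounded[OF c]])
  show "refine A D {s} {s} (refine A D {s} {s} (pure [] as)) = refine A D {s} {s} (pure [] as)" if "as \<in> lset []" for as
   using that tensor_map_pure[where 'a='a, of "[]" "[]" "[]" "[]"] by (simp add: refine_def)
 qed (use single in simp)
next
 case (insert m t I J)
 note h = insert.hyps
 note JK = insert.prems(1)
 note IK = refines_trans[OF h(1) JK]
 have mJ: "m \<in> J" using h(1,4) by (auto simp: refines_def)
 note I1 = refines_sub(1)[OF h(1,4), unfolded h(5)] and I2 = refines_sub(2)[OF h(1,4), unfolded h(6)]
 note J1 = refines_sub(1)[OF JK mJ] and J2 = refines_sub(2)[OF JK mJ]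
 note fI = factors_split[OF refines_finite[OF h(1)] h(4), of A, unfolded h(5,6)]
 note fJ = factors_split[OF refines_finite[OF JK] mJ, of A]
 have K2: "K |> m \<in> partitions m t"
  using refines_trans[OF I2 J2] h(2) by (force simp: refines_def partitions_def)
 have C: "cstar_algebra (A m t)" using cst h by simp
 have pair: "refine A D (J |> m) (K |> m) (refine A D {m, t} (J |> m) y) = refine A D {m, t} (K |> m) y"
  if y: "y el tensor (fac {m, t})" for y
 proof (rule cstar_list.tensor_map_eqI[OF refines_cstar(1)[OF I2] cstar_tensor_list[OF refines_cstar(2)[OF J2]]
   chom_bounded[OF chom_comp[OF chom_refine[OF I2] chom_refine[OF J2]]] chom_bounded[OF chom_refine[OF refines_trans[OF I2 J2]]] _ y])
  fix as assume "as \<in> lset (fac {m, t})"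
  then obtain a where a: "as = [a]" "a el A m t" using h(2) by (auto elim!: lset_ConsE)
  have sub: "J |> m \<subseteq> K |> m" using JK by (auto simp: refines_def)
  have e: "pure (fac {m, t}) as = single_tensor (A m t) a" using h(2) by (simp add: a single_tensor_def)
  show "refine A D (J |> m) (K |> m) (refine A D {m, t} (J |> m) (pure (fac {m, t}) as)) = refine A D {m, t} (K |> m) (pure (fac {m, t}) as)"
   unfolding e refine_pair[OF h(7,3,2) a(2)] refine_pair[OF K2 h(3,2) a(2)] by (rule refine_split[OF h(7,2,3) K2 sub a(2)])
 qed
 show ?case
 proof (rule cstar_lists2.append_eqI[OF cstar_lists2I[OF refines_cstar(1)[OF I1] refines_cstar(1)[OF I2]]
    cstar_tensor_list[OF refines_cstar(2)[OF JK]]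
    chom_bounded[OF chom_comp[OF chom_refine[OF h(1)] chom_refine[OF JK]], unfolded fI]
    chom_bounded[OF chom_refine[OF IK], unfolded fI] _ insert.prems(2)[unfolded fI]])
  fix x y assume x: "x el tensor (fac I)" and y: "y el tensor (fac {m, t})"
  note a1 = refine_append[OF h(1,4), unfolded h(5,6), OF x y] and a2 = refine_append[OF IK h(4), unfolded h(5,6), OF x y]
   and a3 = refine_append[OF JK mJ refine_in[OF I1 x] refine_in[OF I2 y]]
  show "refine A D J K (refine A D (insert t I) J (tensor_append (fac I) (fac {m, t}) x y)) =
    refine A D (insert t I) K (tensor_append (fac I) (fac {m, t}) x y)"
   unfolding a1 a2 a3 insert.IH[OF J1 x] pair[OF y] ..
 qed
qed

end

section \<open>Units and the connecting maps of the partition system\<close>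

locale subproduct_unital = subproduct A D for A :: "real => real => 'a star_alg" and D +
 fixes p assumes unit: "subproduct_unit A D p"
begin

abbreviation "un \<equiv> unit_tensor A p"

lemma p_proj: "0 < s ==> s < t ==> projection (A s t) (p s t)" and p_nz: "0 < s ==> s < t ==> p s t \<noteq> zero_of (A s t)"
 using unit by (auto simp: subproduct_unit_def)

lemma p_in: "0 < s ==> s < t ==> p s t el A s t"
 using p_proj by (simp add: projection_def)

lemma D_p: "0 < r ==> r < s ==> s < t ==> D r s t (p r t) = pure [A r s, A s t] [p r s, p s t]"
 using unit by (simp add: subproduct_unit_def)

lemma unit_list_in: "J \<subseteq> {0<..} ==> map (%(s, t). p s t) (intervals J) \<in> lset (fac J)"
proof -
 assume J: "J \<subseteq> {0<..}"
 have "map (%(s, t). p s t) xs \<in> lset (map (%(s, t). A s t) xs)" if "set xs \<subseteq> {(s, t). 0 < s \<and> s < t}" for xs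
  using that by (induction xs) (auto simp: p_in)
 then show ?thesis using J intervals_less[of _ _ J] by (force simp: factors_def)
qed

lemma unit_in: "J \<subseteq> {0<..} ==> un J el tensor (fac J)"
 unfolding unit_tensor_def by (rule cstar_list.pure_in[OF fac_cstar unit_list_in])

lemma unit_split:
 assumes "finite J" "J \<subseteq> {0<..}" "r \<in> J"
 shows "un J = tensor_append (fac (J <| r)) (fac (J |> r)) (un (J <| r)) (un (J |> r))"
proof -
 have s: "J <| r \<subseteq> {0<..}" "J |> r \<subseteq> {0<..}" using assms(2) by auto
 show ?thesis
  unfolding unit_tensor_def tensor_append_pure[OF fac_cstar[OF s(1)] fac_cstar[OF s(2)] unit_list_in[OF s(1)] unit_list_in[OF s(2)]]
  by (simp add: factors_split[OF assms(1,3)] intervals_split[OF assms(1,3)])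
qed

lemma unit_single [simp]: "un {s} = pure [] []"
 by (simp add: unit_tensor_def)

lemma unit_pair: "s < t ==> un {s, t} = single_tensor (A s t) (p s t)"
 by (simp add: unit_tensor_def single_tensor_def)

lemma split_unit:
 assumes "J \<in> partitions s t" "s < t" "0 < s"
 shows "split A D J (p s t) = un J"
 using assms(1,2)
proof (induction rule: partition_induct)
 case (two t) then show ?case by (simp add: split_pair unit_pair)
next
 case (insert m t J)
 note h = insert.hyps
 have m: "0 < m" "m \<in> insert t J" "finite (insert t J)" "insert t J \<subseteq> {0<..}" using h assms(3) by (auto simp: partitions_def)
 have e: "insert t J <| m = J" "insert t J |> m = {m, t}" using h by (auto simp: partitions_def)
 have C: "cstar_algebra (A s m)" "cstar_algebra (A m t)" using cst assms(3) h m by auto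
 have L: "cstar_list [A m t]" using C by (simp add: cstar_list_Cons)
 show ?case
  unfolding split_insert[OF h(3) assms(3) h(1,2) p_in[OF assms(3) less_trans[OF h(1,2)]]] D_p[OF assms(3) h(1,2)]
   tensor_map_two[OF C(1) fac_part[OF h(3) assms(3)] split_hom[OF h(3,1) assms(3)] p_in[OF assms(3) h(1)]
    C(2) L single_tensor_hom[OF C(2)] p_in[OF m(1) h(2)]] insert.IH
  using unit_split[OF m(3,4,2)] h(2) unfolding e by (simp add: unit_pair)
qed

lemma refine_unit: "refines I J ==> refine A D I J (un I) = un J"
proof (induction rule: refines_induct)
 case (single s)
 then show ?case using tensor_map_pure[where 'a='a, of "[]" "[]" "[]" "[]"] by (simp add: refine_def)
next
 case (insert m t I J)
 note h = insert.hyps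
 have J: "finite J" "J \<subseteq> {0<..}" "m \<in> J" "insert t I \<subseteq> {0<..}" "I \<subseteq> {0<..}" "{m, t} \<subseteq> {0<..}" using h(1,2,3,4) by (auto simp: refines_def)
 note uI = unit_split[OF refines_finite[OF h(1)] J(4) h(4), unfolded h(5,6)]
 note a = refine_append[OF h(1,4), unfolded h(5,6), OF unit_in[OF J(5)] unit_in[OF J(6)]]
 show ?case
  unfolding uI a insert.IH
  unfolding unit_pair[OF h(2)] refine_pair[OF h(7,3,2) p_in[OF h(3,2)]] split_unit[OF h(7,2,3)]
  by (rule unit_split[OF J(1-3), symmetric])
qed

end

lemma (in cstar_algebra) projection_norm_le: "projection A q ==> norm_of A q <= 1"
 using cstar_identity[of q] norm_nonneg[of q] by (auto simp: projection_def power2_eq_square)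

text \<open>Multiplicativity and the involution use that the inserted element is idempotent and
  self-adjoint, contractivity that a projection has norm at most 1.\<close>

lemma chom_append_projection:
 assumes "cstar_list As" "cstar_list Bs" and u: "projection (tensor Bs) u"
 shows "chom (tensor As) (tensor (As @ Bs)) (%x. tensor_append As Bs x u)"
  "chom (tensor As) (tensor (Bs @ As)) (%x. tensor_append Bs As u x)"
proof -
 interpret AB: cstar_lists2 As Bs by (intro cstar_lists2I assms)
 interpret BA: cstar_lists2 Bs As by (intro cstar_lists2I assms)
 interpret A: cstar_algebra "tensor As" by (rule AB.A.cstar_tensor)
 interpret B: cstar_algebra "tensor Bs" by (rule AB.B.cstar_tensor)
 have uc: "u el tensor Bs" "star_of (tensor Bs) u = u" "mult_of (tensor Bs) u u = u"
  using u by (auto simp: projection_def)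
 have n: "norm_of (tensor As) x * norm_of (tensor Bs) u <= norm_of (tensor As) x" if "x el tensor As" for x
  using mult_left_mono[OF B.projection_norm_le[OF u] A.norm_nonneg[OF that]] by simp
 have "norm_of (tensor (As @ Bs)) (tensor_append As Bs x u) <= norm_of (tensor As) x" if "x el tensor As" for x
  using AB.append_norm[OF that uc(1)] n[OF that] by simp
 then show "chom (tensor As) (tensor (As @ Bs)) (%x. tensor_append As Bs x u)"
  unfolding chom_def star_hom_def using bounded_linear_map_linear[OF AB.bounded_append_left[OF uc(1)]]
  by (auto simp: AB.append_mult AB.append_star uc)
 have "norm_of (tensor (Bs @ As)) (tensor_append Bs As u x) <= norm_of (tensor As) x" if "x el tensor As" for x
  using BA.append_norm[OF uc(1) that] n[OF that] by (simp add: mult.commute)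
 then show "chom (tensor As) (tensor (Bs @ As)) (%x. tensor_append Bs As u x)"
  unfolding chom_def star_hom_def using bounded_linear_map_linear[OF BA.bounded_append_right[OF uc(1)]]
  by (auto simp: BA.append_mult BA.append_star uc)
qed

lemma partitions_Min_Max: "I \<in> partitions s t ==> Min I = s" "I \<in> partitions s t ==> Max I = t"
 by (auto simp: partitions_def intro!: Min_eqI Max_eqI)

text \<open>The order of the inductive system, enlarged by single points so that both halves of a
  cut stay in the relation even if the cut is at an end point.\<close>

definition extends :: "real set => real set => bool" where
 "extends I J \<longleftrightarrow> finite J \<and> I \<noteq> {} \<and> I \<subseteq> J \<and> J \<subseteq> {0<..}"

lemma extends_partition: assumes "extends I J" obtains s t where "I \<in> partitions s t" "s <= t"
proof -
 have "finite I" "I \<noteq> {}" using assms by (auto simp: extends_def intro: finite_subset)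
 then have "I \<in> partitions (Min I) (Max I)" "Min I <= Max I" by (auto simp: partitions_def)
 then show thesis using that by blast
qed

lemma extends_refines:
 assumes "extends I J" "I \<in> partitions s t"
 shows "refines I (J |> s <| t)"
proof -
 have "(\<exists>a\<in>I. a <= j) \<and> (\<exists>b\<in>I. j <= b)" if "j \<in> J |> s <| t" for j
  using that assms(2) by (auto simp: partitions_def)
 then show ?thesis using assms by (auto simp: refines_def extends_def partitions_def)
qed

context subproduct_unital
begin

abbreviation "app I J \<equiv> tensor_append (fac I) (fac J)"
abbreviation "T \<equiv> refine_ext A D p"

lemma un_projection: assumes "J \<subseteq> {0<..}" shows "projection (tensor (fac J)) (un J)"
proof -
 interpret F: cstar_list "fac J" by (rule fac_cstar[OF assms])
 have "lmul (map (%(s, t). A s t) xs) (map (%(s, t). p s t) xs) (map (%(s, t). p s t) xs) = map (%(s, t). p s t) xs \<and>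
   lstar (map (%(s, t). A s t) xs) (map (%(s, t). p s t) xs) = map (%(s, t). p s t) xs"
  if "!!s t. (s, t) \<in> set xs ==> projection (A s t) (p s t)" for xs
  using that by (induction xs) (auto simp: projection_def)
 then have "lmul (fac J) (map (%(s, t). p s t) (intervals J)) (map (%(s, t). p s t) (intervals J)) = map (%(s, t). p s t) (intervals J) \<and>
   lstar (fac J) (map (%(s, t). p s t) (intervals J)) = map (%(s, t). p s t) (intervals J)"
  using intervals_less[of _ _ J] p_proj assms unfolding factors_def by (meson greaterThan_iff subsetD)
 then show ?thesis
  using unit_list_in[OF assms] F.pure_in by (simp add: projection_def unit_tensor_def F.pure_mult F.pure_star)
qed

text \<open>Brings the connecting map into the form of successive cuts of \<open>J\<close> at
  \<open>s\<close> and then at \<open>t\<close>, bracketed to the right, so that the rules for cuts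
  apply.\<close>

lemma ext_eq:
 assumes IJ: "extends I J" and I: "I \<in> partitions s t" and x: "x el tensor (fac I)"
 shows "T I J x = app (J <| s) (J |> s) (un (J <| s))
  (app (J |> s <| t) (J |> s |> t) (refine A D I (J |> s <| t) x) (un (J |> s |> t)))"
proof -
 have st: "s <= t" "t \<in> J" "finite J" "J \<subseteq> {0<..}" using I IJ by (auto simp: partitions_def extends_def)
 have e: "{j \<in> J. j <= s} = J <| s" "J \<inter> {s..t} = J |> s <| t" "{j \<in> J. t <= j} = J |> s |> t" using st by auto
 have f: "fac (J |> s) = fac (J |> s <| t) @ fac (J |> s |> t)"
  by (rule factors_split) (use st in auto)
 have s: "J |> s |> t \<subseteq> {0<..}" using st by auto
 show ?thesis
  unfolding refine_ext_def Let_def partitions_Min_Max[OF I] e tensor_concat.simps concat.simps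
   tensor_append_Nil(1)[OF fac_cstar[OF s] unit_in[OF s]] append_Nil2 f ..
qed

lemma chom_ext: assumes IJ: "extends I J" shows "chom (tensor (fac I)) (tensor (fac J)) (T I J)"
proof -
 obtain s t where I: "I \<in> partitions s t" "s <= t" using extends_partition[OF IJ] .
 have J: "finite J" "J \<subseteq> {0<..}" "s \<in> J" "t \<in> J |> s" "finite (J |> s)" and I0: "I \<subseteq> {0<..}" using I IJ by (auto simp: partitions_def extends_def)
 have s: "J <| s \<subseteq> {0<..}" "J |> s \<subseteq> {0<..}" "J |> s <| t \<subseteq> {0<..}" "J |> s |> t \<subseteq> {0<..}" using J by auto
 have "chom (tensor (fac I)) (tensor (fac (J <| s) @ fac (J |> s <| t) @ fac (J |> s |> t)))
  (%x. app (J <| s) (J |> s) (un (J <| s))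
   (app (J |> s <| t) (J |> s |> t) (refine A D I (J |> s <| t) x) (un (J |> s |> t))))"
  unfolding factors_split[OF J(5,4), of A]
  by (rule chom_comp[OF chom_comp[OF chom_refine[OF extends_refines[OF IJ I(1)]]
    chom_append_projection(1)[OF fac_cstar[OF s(3)] fac_cstar[OF s(4)] un_projection[OF s(4)]]]
    chom_append_projection(2)[OF _ fac_cstar[OF s(1)] un_projection[OF s(1)]]])
   (simp add: cstar_list_append fac_cstar s)
 then have "chom (tensor (fac I)) (tensor (fac J)) (%x. app (J <| s) (J |> s) (un (J <| s))
   (app (J |> s <| t) (J |> s |> t) (refine A D I (J |> s <| t) x) (un (J |> s |> t))))"
  unfolding factors_split[OF J(1,3), of A] factors_split[OF J(5,4), of A] .
 then show ?thesis
  by (rule chom_cong[OF _ pre_cstar_tensor[OF fac_cstar[OF I0]]]) (simp only: ext_eq[OF IJ I(1)])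
qed

lemma ext_in: "extends I J ==> x el tensor (fac I) ==> T I J x el tensor (fac J)"
 by (rule chom_closed[OF chom_ext])

lemma ext_unit: assumes IJ: "extends I J" shows "T I J (un I) = un J"
proof -
 obtain s t where I: "I \<in> partitions s t" "s <= t" using extends_partition[OF IJ] .
 have J: "finite J" "J \<subseteq> {0<..}" "s \<in> J" "I \<subseteq> {0<..}" and J': "finite (J |> s)" "J |> s \<subseteq> {0<..}" "t \<in> J |> s"
  using I IJ by (auto simp: partitions_def extends_def)
 show ?thesis
  unfolding ext_eq[OF IJ I(1) unit_in[OF J(4)]] refine_unit[OF extends_refines[OF IJ I(1)]]
   unit_split[OF J(1-3)] unit_split[OF J', symmetric] ..
qed

text \<open>The left half adds units only below \<open>s\<close>, the right half only above
  \<open>t\<close>: at \<open>r\<close> the added part is the single point \<open>{r}\<close>, whose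
  tensor factor is trivial. What remains is a change of brackets.\<close>

lemma ext_append:
 assumes IJ: "extends I J" and r: "r \<in> I" and x: "x el tensor (fac (I <| r))" and y: "y el tensor (fac (I |> r))"
 shows "T I J (app (I <| r) (I |> r) x y) = app (J <| r) (J |> r) (T (I <| r) (J <| r) x) (T (I |> r) (J |> r) y)"
proof -
 obtain s t where I: "I \<in> partitions s t" "s <= t" using extends_partition[OF IJ] .
 note I1 = partition_sub(1)[OF I(1) r] and I2 = partition_sub(2)[OF I(1) r]
 have J: "finite J" "J \<subseteq> {0<..}" "r \<in> J" "s \<in> J" "t \<in> J" "s <= r" "r <= t" "finite I" "I \<subseteq> {0<..}"
  using I(1) IJ r by (auto simp: partitions_def extends_def)
 let ?M = "J |> s <| t" and ?L = "J <| s" and ?U = "J |> s |> t"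
 let ?M1 = "?M <| r" and ?M2 = "?M |> r"
 have xy: "app (I <| r) (I |> r) x y el tensor (fac I)"
  using tensor_append_in[OF fac_cstar fac_cstar x y] J by (auto simp: factors_split[of I r] r)
 have E1: "extends (I <| r) (J <| r)" and E2: "extends (I |> r) (J |> r)" using IJ r by (auto simp: extends_def)
 note R = extends_refines[OF IJ I(1)]
 have e1: "J <| r <| s = ?L" "J <| r |> s = ?M1" "?M1 <| r = ?M1" "?M1 |> r = {r}"
  and e2: "J |> r <| r = {r}" "J |> r |> r <| t = ?M2" "J |> r |> r |> t = ?U"
  using J by auto
 have rM: "r \<in> ?M" "finite ?M" using J by auto
 have c: "?L \<subseteq> {0<..}" "?M1 \<subseteq> {0<..}" "?M2 \<subseteq> {0<..}" "?U \<subseteq> {0<..}" "J |> s \<subseteq> {0<..}" "J |> r |> r \<subseteq> {0<..}" using J by auto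
 have f: "fac (J |> s) = fac ?M @ fac ?U" "fac ?M = fac ?M1 @ fac ?M2" "fac (J <| r) = fac ?L @ fac ?M1" "fac (J |> r) = fac ?M2 @ fac ?U"
  using factors_split[of "J |> s" t A] factors_split[OF rM(2,1), of A] factors_split[of "J <| r" s A]
   factors_split[of "J |> r" r A] factors_split[of "J |> r |> r" t A] J e1(1,2) e2 by (simp_all add: Int_assoc)
 define X where "X = refine A D (I <| r) ?M1 x"
 define Y where "Y = refine A D (I |> r) ?M2 y"
 have Xc: "X el tensor (fac ?M1)" and Yc: "Y el tensor (fac ?M2)"
  unfolding X_def Y_def using refine_in[OF refines_sub(1)[OF R r] x] refine_in[OF refines_sub(2)[OF R r] y] by auto
 note uL = unit_in[OF c(1)] and uU = unit_in[OF c(4)]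
 note cL = fac_cstar[OF c(1)] and c1 = fac_cstar[OF c(2)] and c2 = fac_cstar[OF c(3)] and cU = fac_cstar[OF c(4)]
 have c2U: "cstar_list (fac ?M2 @ fac ?U)" using c2 cU by (simp add: cstar_list_append)
 note YU = tensor_append_in[OF c2 cU Yc uU]
 have l: "T (I <| r) (J <| r) x = app ?L ?M1 (un ?L) X"
  unfolding ext_eq[OF E1 I1 x] e1 X_def[symmetric] by (simp add: tensor_append_Nil[OF c1 Xc])
 have u: "T (I |> r) (J |> r) y = app ?M2 ?U Y (un ?U)"
  unfolding ext_eq[OF E2 I2 y] e2 Y_def[symmetric]
  using tensor_append_Nil(2)[OF c2U YU] f(4) e2(3) by (simp add: Int_assoc)
 have "T I J (app (I <| r) (I |> r) x y) =
   tensor_append (fac ?L) (fac ?M1 @ fac ?M2 @ fac ?U) (un ?L) (tensor_append (fac ?M1 @ fac ?M2) (fac ?U) (app ?M1 ?M2 X Y) (un ?U))"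
  unfolding ext_eq[OF IJ I(1) xy] refine_append[OF R r x y] X_def[symmetric] Y_def[symmetric] f by simp
 also have "... = tensor_append (fac ?L @ fac ?M1) (fac ?M2 @ fac ?U) (app ?L ?M1 (un ?L) X) (app ?M2 ?U Y (un ?U))"
  unfolding tensor_append_assoc[OF c1 c2 cU Xc Yc uU] tensor_append_assoc[OF cL c1 c2U uL Xc YU] ..
 finally show ?thesis unfolding l u f .
qed

text \<open>\<open>J\<close> is cut at the end points of \<open>I\<close>: the outer parts carry
  units, which connecting maps preserve, and the middle part is refined twice, where
  \<open>refine_comp\<close> applies.\<close>

lemma ext_comp:
 assumes IJ: "extends I J" and JK: "extends J K" and x: "x el tensor (fac I)"
 shows "T J K (T I J x) = T I K x"
proof -
 obtain s t where I: "I \<in> partitions s t" "s <= t" using extends_partition[OF IJ] .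
 have IK: "extends I K" using IJ JK by (auto simp: extends_def)
 have J: "finite J" "s \<in> J" "t \<in> J |> s" "finite (J |> s)" "J \<subseteq> {0<..}" and K: "finite K" "K \<subseteq> {0<..}"
  using I IJ JK by (auto simp: partitions_def extends_def)
 let ?J1 = "J <| s" and ?J2 = "J |> s" and ?K1 = "K <| s" and ?K2 = "K |> s"
 let ?M = "?J2 <| t" and ?U = "?J2 |> t" and ?N = "?K2 <| t" and ?V = "?K2 |> t"
 have E: "extends ?J1 ?K1" "extends ?J2 ?K2" "extends ?M ?N" "extends ?U ?V" using JK J by (auto simp: extends_def)
 note R = extends_refines[OF IJ I(1)]
 have c: "?J1 \<subseteq> {0<..}" "?J2 \<subseteq> {0<..}" "?M \<subseteq> {0<..}" "?U \<subseteq> {0<..}" "?N \<subseteq> {0<..}" using J K by auto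
 define X where "X = refine A D I ?M x"
 have X: "X el tensor (fac ?M)" unfolding X_def by (rule refine_in[OF R x])
 have XU: "app ?M ?U X (un ?U) el tensor (fac ?J2)"
  using tensor_append_in[OF fac_cstar[OF c(3)] fac_cstar[OF c(4)] X unit_in[OF c(4)]] by (simp add: factors_split[OF J(4,3)])
 have M: "?M \<in> partitions s t" using I J by (auto simp: partitions_def)
 have n: "?N <| s = {s}" "?N |> s = ?N" "?N |> s |> t = {t}" "?N <| t = ?N" "?N |> t = {t}"
  using I JK J by (auto simp: extends_def)
 have MN: "refines ?M ?N" using extends_refines[OF E(3) M] unfolding n .
 have TX: "T ?M ?N X = refine A D I ?N x"
  unfolding ext_eq[OF E(3) M X] n
  using refine_in[OF MN X] refine_comp[OF R MN x] by (simp add: tensor_append_Nil fac_cstar[OF c(5)] X_def)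
 have "T J K (T I J x) = app ?K1 ?K2 (T ?J1 ?K1 (un ?J1)) (T ?J2 ?K2 (app ?M ?U X (un ?U)))"
  unfolding ext_eq[OF IJ I(1) x] X_def[symmetric] by (rule ext_append[OF JK J(2) unit_in[OF c(1)] XU])
 also have "T ?J2 ?K2 (app ?M ?U X (un ?U)) = app ?N ?V (T ?M ?N X) (T ?U ?V (un ?U))"
  by (rule ext_append[OF E(2) J(3) X unit_in[OF c(4)]])
 finally show ?thesis unfolding ext_unit[OF E(1)] ext_unit[OF E(4)] TX ext_eq[OF IK I(1) x] .
qed

end

section \<open>Product functionals\<close>

text \<open>With \<open>y = (1 - q) x\<close> one has \<open>\<parallel>q + c y\<parallel>\<^sup>2 <= 1 + \<bar>c\<bar>\<^sup>2 \<parallel>y\<parallel>\<^sup>2\<close>, so \<open>\<phi> y \<noteq> 0\<close> would contradict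
 \<open>\<bar>1 + c \<phi> y\<bar> <= \<parallel>q + c y\<parallel>\<close> for small \<open>c\<close>.\<close>

lemma (in cstar_algebra) contraction_projection:
 assumes lin: "linear_map A complex_alg \<phi>" and le: "!!x. x el A ==> cmod (\<phi> x) <= norm_of A x"
  and q: "projection A q" "\<phi> q = 1" and x: "x el A"
 shows "\<phi> (mult_of A q x) = \<phi> x"
proof (rule ccontr)
 assume ne: "\<phi> (mult_of A q x) \<noteq> \<phi> x"
 have q': "q el A" "star_of A q = q" "mult_of A q q = q" using q by (auto simp: projection_def)
 define y where "y = minus_of A x (mult_of A q x)"
 have y: "y el A" unfolding y_def by (intro minus_closed closed q' x)
 have qy: "mult_of A q y = zero_of A"
  unfolding y_def by (simp add: mult_minus closed q' x minus_self mult_assoc[symmetric])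
 have yq: "mult_of A (star_of A y) q = zero_of A"
  using star_mult[OF q'(1) y] by (simp add: qy q' star_zero)
 have phy: "\<phi> y = \<phi> x - \<phi> (mult_of A q x)"
  unfolding y_def minus_of_def using lin x q' by (simp add: lin_map_add lin_scale closed)
 define r where "r = (cmod (\<phi> y))\<^sup>2"
 have r: "0 < r" using ne by (simp add: r_def phy)
 define M where "M = (norm_of A y)\<^sup>2"
 have bd: "(1 + e * r)\<^sup>2 <= 1 + e\<^sup>2 * r * M" if e: "0 < e" for e :: real
 proof -
  \<comment> \<open>The phase of \<open>c\<close> is chosen such that \<open>\<phi>\<close> takes
    the value \<open>1 + e * r\<close> at \<open>?z\<close>.\<close>
  define c where "c = of_real e * cnj (\<phi> y)"
  let ?z = "add_of A q (scale_of A c y)"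
  have z: "?z el A" by (intro closed q' y)
  have "mult_of A (star_of A ?z) ?z = add_of A q (scale_of A (cnj c * c) (mult_of A (star_of A y) y))"
   using y q' by (simp add: star_add star_scale closed add_mult mult_add scale_mult mult_scale qy yq scale_scale
     scale_zero_right add_zero zero_add mult.commute[of c])
  then have "(norm_of A ?z)\<^sup>2 <= norm_of A q + norm_of A (scale_of A (cnj c * c) (mult_of A (star_of A y) y))"
   using cstar_identity[OF z] norm_add[of q "scale_of A (cnj c * c) (mult_of A (star_of A y) y)"] y q' by (simp add: closed)
  also have "... <= 1 + (cmod c)\<^sup>2 * M"
   using projection_norm_le[OF q(1)] y by (simp add: norm_scale closed cstar_identity Real_Vector_Spaces.norm_mult M_def power2_eq_square)
  also have "(cmod c)\<^sup>2 = e\<^sup>2 * r" by (simp add: c_def Real_Vector_Spaces.norm_mult r_def power_mult_distrib)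
  finally have n: "(norm_of A ?z)\<^sup>2 <= 1 + e\<^sup>2 * r * M" .
  have "\<phi> ?z = 1 + of_real (e * r)"
   using lin y q' q(2) by (simp add: lin_map_add lin_scale closed c_def r_def complex_norm_square[symmetric] mult.commute)
  then have "cmod (\<phi> ?z) = \<bar>1 + e * r\<bar>" by (metis norm_of_real of_real_1 of_real_add)
  then have "cmod (\<phi> ?z) = 1 + e * r" using e r by simp
  then have "1 + e * r <= norm_of A ?z" using le[OF z] by simp
  then have "(1 + e * r)\<^sup>2 <= (norm_of A ?z)\<^sup>2" using e r by (intro power_mono) auto
  then show ?thesis using n by linarith
 qed
 \<comment> \<open>With \<open>e * M <= 1\<close> the estimate becomes
   \<open>(1 + e * r)^2 <= 1 + e * r\<close>, which is impossible for
   \<open>e * r > 0\<close>.\<close>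
 define e where "e = 1 / (M + 1)"
 have M: "0 <= M" by (simp add: M_def)
 have e: "0 < e" "e * M <= 1" using M by (simp_all add: e_def field_simps)
 have "e\<^sup>2 * r * M = (e * r) * (e * M)" by (simp add: power2_eq_square)
 also have "... <= e * r" using e r by (simp add: mult_left_le)
 finally have "(1 + e * r)\<^sup>2 <= 1 + e * r" using bd[OF e(1)] by linarith
 moreover have "(1 + e * r)\<^sup>2 = 1 + 2 * (e * r) + (e * r)\<^sup>2" by (simp add: power2_sum)
 moreover have "0 < e * r" using e r by simp
 moreover have "0 <= (e * r)\<^sup>2" by simp
 ultimately show False by linarith
qed

text \<open>The left version, applied to the functional that sends \<open>x\<close> to the conjugate
  of \<open>\<phi>\<close> at the adjoint of \<open>x\<close>.\<close>

lemma (in cstar_algebra) contraction_projection_right: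
 assumes lin: "linear_map A complex_alg \<phi>" and le: "!!x. x el A ==> cmod (\<phi> x) <= norm_of A x"
  and q: "projection A q" "\<phi> q = 1" and x: "x el A"
 shows "\<phi> (mult_of A x q) = \<phi> x"
proof -
 have q': "q el A" "star_of A q = q" using q by (auto simp: projection_def)
 have "linear_map A complex_alg (%x. cnj (\<phi> (star_of A x)))"
  using lin unfolding linear_map_def by (simp add: star_add star_scale closed)
 moreover have "cmod (cnj (\<phi> (star_of A x))) <= norm_of A x" if "x el A" for x
  using le[OF star_closed[OF that]] norm_star[OF that] by simp
 ultimately have "cnj (\<phi> (star_of A (mult_of A q (star_of A x)))) = cnj (\<phi> (star_of A (star_of A x)))"
  by (rule contraction_projection[OF _ _ q(1) _ star_closed[OF x]]) (simp_all add: q q')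
 then show ?thesis using x q' by (simp add: closed star_mult star_star)
qed

text \<open>Positivity passes from the embedded algebras to the limit, because \<open>P* P\<close>
  depends continuously on \<open>P\<close> and the nonnegative reals are closed.\<close>

lemma (in ind_system) limit_positive:
 assumes H: "bounded_linear_map L complex_alg H"
  and pos: "!!i x. i \<in> I ==> x el N i ==> H (emb i (mult_of (N i) (star_of (N i) x) x)) \<in> \<real>\<^sub>\<ge>\<^sub>0"
  and P: "P el L"
 shows "H (mult_of L (star_of L P) P) \<in> \<real>\<^sub>\<ge>\<^sub>0"
proof -
 interpret L: pre_cstar L by (rule pre_cstar_ind_limit)
 obtain f where f: "f \<in> cn" "P = cls f" using P by (auto simp: carrier_L)
 obtain C where C: "!!x. x el L ==> cmod (H x) <= C * norm_of L x" and lin: "linear_map L complex_alg H"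
  using H by (auto simp: bounded_linear_map_def)
 define E where "E i = emb i (f i)" for i
 have E: "E i el L" if "i \<in> I" for i using that by (simp add: E_def emb_in cn_mem[OF f(1)])
 have d0: "((%i. L.dst P (E i)) \<longlongrightarrow> 0) F"
 proof (rule tendstoI)
  fix e :: real assume "0 < e"
  from emb_dense[OF f(1) this] show "\<forall>\<^sub>F i in F. dist (L.dst P (E i)) 0 < e"
   by eventually_elim (use L.dst_nonneg[OF P E] in \<open>auto simp: E_def f(2)\<close>)
 qed
 have "((%i. H (mult_of L (star_of L (E i)) (E i))) \<longlongrightarrow> H (mult_of L (star_of L P) P)) F"
 proof (rule LIM_zero_cancel, rule Lim_null_comparison)
  let ?b = "%i. \<bar>C\<bar> * (norm_of L P * L.dst P (E i) + L.dst P (E i) * (norm_of L P + L.dst P (E i)))"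
  show "(?b \<longlongrightarrow> 0) F" by (rule tendsto_eq_intros d0 | simp)+
  show "\<forall>\<^sub>F i in F. norm (H (mult_of L (star_of L (E i)) (E i)) - H (mult_of L (star_of L P) P)) <= ?b i"
   using eventually_in
  proof eventually_elim
   case (elim i)
   note Ei = E[OF elim]
   let ?X = "mult_of L (star_of L P) P" and ?Y = "mult_of L (star_of L (E i)) (E i)"
   have c: "?X el L" "?Y el L" using P Ei by (simp_all add: L.closed)
   have "norm (H ?Y - H ?X) = cmod (H (minus_of L ?X ?Y))"
    using linear_map_minus[OF lin L.pre_cstar_axioms c] by (simp add: minus_of_def norm_minus_commute)
   also have "... <= C * L.dst ?X ?Y" by (rule C[OF L.minus_closed[OF c]])
   also have "... <= \<bar>C\<bar> * L.dst ?X ?Y" using L.dst_nonneg[OF c] by (intro mult_right_mono) auto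
   also have "L.dst ?X ?Y <= norm_of L P * L.dst P (E i) + L.dst P (E i) * norm_of L (E i)"
    using L.dst_mult[of "star_of L P" "star_of L (E i)" P "E i"] P Ei by (simp add: L.closed L.norm_star L.dst_star)
   also have "norm_of L (E i) <= norm_of L P + L.dst P (E i)"
    using L.norm_le_dst[OF Ei P] L.dst_commute[OF P Ei] by simp
   finally show ?case using L.dst_nonneg[OF P Ei] by (simp add: mult_left_mono add_mono)
  qed
 qed
 moreover have "\<forall>\<^sub>F i in F. H (mult_of L (star_of L (E i)) (E i)) \<in> \<real>\<^sub>\<ge>\<^sub>0"
  using eventually_in
 proof eventually_elim
  case (elim i)
  have x: "f i el N i" by (rule cn_mem[OF f(1) elim])
  have "mult_of L (star_of L (E i)) (E i) = emb i (mult_of (N i) (star_of (N i) (f i)) (f i))"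
   unfolding E_def star_hom_star[OF emb_star_hom[OF elim] x, symmetric]
   by (rule star_hom_mult[OF emb_star_hom[OF elim] _ x, symmetric]) (rule pre_cstar.star_closed[OF N[OF elim] x])
  then show ?case using pos[OF elim x] by simp
 qed
 ultimately show ?thesis
  by (rule Lim_in_closed_set[OF closed_nonneg_Reals_complex _ net_nonbot, rotated])
qed

context cstar_list
begin

text \<open>State lists with projections on which the states take the value 1. This covers a co-unit
  with a unit on a partition as well as a state of the limit with the limit projection.\<close>

definition unital_states :: "('a => complex) list => 'a list => bool" where
 "unital_states \<phi>s qs \<longleftrightarrow> states \<phi>s \<and> qs \<in> lset As \<and> list_all2 (%(A, \<phi>) q. projection A q \<and> \<phi> q = 1) (zip As \<phi>s) qs"

text \<open>In each factor \<open>\<phi> (q a q) = \<phi> a\<close>, by the projection lemmas from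
  the left and from the right.\<close>

lemma lprod_unital:
 "unital_states \<phi>s qs ==> m \<in> lset As ==>
  skernel As \<phi>s qs (lmul As m qs) = lprod \<phi>s m \<and> skernel As \<phi>s qs qs = 1"
 unfolding unital_states_def skernel_def using cstar
proof (induction As arbitrary: \<phi>s qs m)
 case (Cons A As)
 obtain \<phi> \<psi>s where f: "\<phi>s = \<phi> # \<psi>s" "state A \<phi>" "list_all2 state As \<psi>s" using Cons.prems(1) by (auto simp: list_all2_Cons1)
 obtain q rs where q: "qs = q # rs" "q el A" "rs \<in> lset As" using Cons.prems(1) by (auto elim!: lset_ConsE)
 obtain a bs where m: "m = a # bs" "a el A" "bs \<in> lset As" using Cons.prems(2) by (auto elim!: lset_ConsE)
 have p: "projection A q" "\<phi> q = 1" "list_all2 (%(A, \<phi>) q. projection A q \<and> \<phi> q = 1) (zip As \<psi>s) rs"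
  using Cons.prems(1) by (simp_all add: f q)
 have q': "star_of A q = q" "mult_of A q q = q" using p(1) by (simp_all add: projection_def)
 have A: "cstar_algebra A" using Cons.prems(3) by simp
 interpret A: cstar_algebra A by fact
 have lin: "linear_map A complex_alg \<phi>" using f(2) by (simp add: state_def)
 note le = state_norm_le[OF A f(2)]
 have "\<phi> (mult_of A q (mult_of A a q)) = \<phi> a"
  using A.contraction_projection[OF lin le p(1,2) A.mult_closed[OF m(2) q(2)]]
   A.contraction_projection_right[OF lin le p(1,2) m(2)] by simp
 then show ?case using Cons.IH[OF _ m(3), of \<psi>s rs] Cons.prems(3) f(3) q(3) p by (simp add: f(1) q(1) m(1) q')
qed simp

text \<open>Cauchy-Schwarz against the unit vector \<open>single qs 1\<close>.\<close>

lemma formal_functional_le: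
 assumes s: "unital_states \<phi>s qs" and u: "u on lset As"
 shows "cmod (lin (lprod \<phi>s) u) <= min_norm As u"
proof -
 have st: "states \<phi>s" and q: "qs \<in> lset As" using s by (auto simp: unital_states_def)
 interpret R: star_rep "lset As" "lmul As" "lstar As" "lset As" "lmul As" "skernel As \<phi>s" by (rule star_rep_state[OF st])
 have v: "(single qs 1) on lset As" using q by simp
 have K: "skernel As \<phi>s qs qs = 1" using lprod_unital[OF s q] by simp
 then have h: "hn (skernel As \<phi>s) (single qs 1) = 1" by (simp add: hn_def)
 have "lin (lprod \<phi>s) u = lin (%m. skernel As \<phi>s qs (lmul As m qs)) u"
  using u lprod_unital[OF s] by (intro lin_cong) auto
 also have "... = form (skernel As \<phi>s) (single qs 1) (av (lmul As) u (single qs 1))"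
  by (subst form_av_right) (simp add: av_single)
 finally have "cmod (lin (lprod \<phi>s) u) <= hn (skernel As \<phi>s) (single qs 1) * hn (skernel As \<phi>s) (av (lmul As) u (single qs 1))"
  using pd_cs[OF R.pd v R.keys_act[OF u v]] by simp
 also have "... <= min_norm As u" using opbd_min_norm[OF u st, unfolded opbd_def, rule_format, OF v] by (simp add: h)
 finally show ?thesis .
qed

lemma tensor_functional_spec:
 assumes s: "unital_states \<phi>s qs"
 shows tensor_functional_bounded: "bounded_linear_map (tensor As) complex_alg (tensor_functional As \<phi>s)"
  and tensor_functional_le: "x el tensor As ==> cmod (tensor_functional As \<phi>s x) <= norm_of (tensor As) x"
  and tensor_functional_pure: "as \<in> lset As ==> tensor_functional As \<phi>s (pure As as) = lprod \<phi>s as"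
  and tensor_functional_positive: "x el tensor As ==>
   tensor_functional As \<phi>s (mult_of (tensor As) (star_of (tensor As) x) x) \<in> \<real>\<^sub>\<ge>\<^sub>0"
proof -
 have lin: "linear_map (formal_alg As) complex_alg (lin (lprod \<phi>s))" by (simp add: linear_map_def lin_add lin_psc)
 obtain H where H: "bounded_linear_map (tensor As) complex_alg H"
  "!!x. x el tensor As ==> cmod (H x) <= norm_of (tensor As) x"
  "!!u. u on lset As ==> H (iota As u) = lin (lprod \<phi>s) u"
  by (rule tensor_extension[OF cstar_complex_alg lin zero_le_one]) (use formal_functional_le[OF s] in auto)
 have Hp: "H (pure As as) = lprod \<phi>s as" if "as \<in> lset As" for as
  using H(3)[of "single as 1"] that by (simp add: pure_iota)
 have e: "tensor_functional As \<phi>s x = H x" if "x el tensor As" for x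
  unfolding tensor_functional_def by (rule tensor_lift_eq[OF cstar_complex_alg H(1) _ that]) (simp add: Hp lprod_def)
 interpret P: pre_cstar "tensor As" by (rule cstar_pre[OF cstar_tensor])
 show "bounded_linear_map (tensor As) complex_alg (tensor_functional As \<phi>s)"
  using H(1) e by (simp add: bounded_linear_map_def linear_map_def P.closed)
 show "x el tensor As ==> cmod (tensor_functional As \<phi>s x) <= norm_of (tensor As) x" using H(2) e by simp
 show "as \<in> lset As ==> tensor_functional As \<phi>s (pure As as) = lprod \<phi>s as" using e[OF pure_in] Hp by simp
 have "H (T.emb i (av (lmul As) (pst (lstar As) u) u)) \<in> \<real>\<^sub>\<ge>\<^sub>0" if u: "u on lset As" for i u
 proof -
  have k: "(av (lmul As) (pst (lstar As) u) u) on lset As" using u by (intro keys_lmul keys_lstar)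
  have "H (T.emb i (av (lmul As) (pst (lstar As) u) u)) = form (skernel As \<phi>s) u u"
   unfolding emb_iota[OF k] H(3)[OF k] using formal_functional_form[of \<phi>s As u u]
   by (simp add: formal_functional_lin formal_mult_av formal_star_pst)
  also have "... \<in> \<real>\<^sub>\<ge>\<^sub>0" using pd_state_kernel[of \<phi>s] s u by (auto simp: pd_def unital_states_def)
  finally show ?thesis .
 qed
 then show "x el tensor As ==> tensor_functional As \<phi>s (mult_of (tensor As) (star_of (tensor As) x) x) \<in> \<real>\<^sub>\<ge>\<^sub>0"
  using T.limit_positive[of H x] H(1) e by (simp add: tensor_T[symmetric] P.closed)
qed

end

lemma bounded_scale:
 "bounded_linear_map A complex_alg f ==> bounded_linear_map A complex_alg (%x. f x * c)"
 "bounded_linear_map A complex_alg f ==> bounded_linear_map A complex_alg (%x. c * f x)"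
proof -
 assume "bounded_linear_map A complex_alg f"
 then obtain C where "linear_map A complex_alg f" "!!x. x el A ==> cmod (f x) <= C * norm_of A x"
  by (auto simp: bounded_linear_map_def)
 note f = this
 have "cmod (f x) * cmod c <= (C * cmod c) * norm_of A x" if "x el A" for x
  using mult_right_mono[OF f(2)[OF that], of "cmod c"] by (simp add: ac_simps)
 then show "bounded_linear_map A complex_alg (%x. f x * c)" "bounded_linear_map A complex_alg (%x. c * f x)"
  using f(1) unfolding bounded_linear_map_def linear_map_def
  by (auto simp: norm_mult algebra_simps intro!: exI[of _ "C * cmod c"])
qed

lemma tensor_functional_append:
 assumes A: "cstar_list As" "cstar_list Bs" and s: "cstar_list.unital_states As \<phi>s qs" "cstar_list.unital_states Bs \<psi>s rs"
  and x: "x el tensor As" and y: "y el tensor Bs"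
 shows "tensor_functional (As @ Bs) (\<phi>s @ \<psi>s) (tensor_append As Bs x y) = tensor_functional As \<phi>s x * tensor_functional Bs \<psi>s y"
proof -
 interpret L: cstar_lists2 As Bs by (intro cstar_lists2I A)
 have len: "length \<phi>s = length As" using s(1) by (auto simp: L.A.unital_states_def dest: list_all2_lengthD)
 have "L.AB.unital_states (\<phi>s @ \<psi>s) (qs @ rs)"
  using s len unfolding L.A.unital_states_def L.B.unital_states_def L.AB.unital_states_def
  by (auto intro: list_all2_appendI lset_append)
 note S = L.AB.tensor_functional_spec[OF this] and S1 = L.A.tensor_functional_spec[OF s(1)] and S2 = L.B.tensor_functional_spec[OF s(2)]
 show ?thesis
  by (rule L.bilinear_eqI[OF cstar_complex_alg _ _ _ _ _ x y, where h="%x y. tensor_functional (As @ Bs) (\<phi>s @ \<psi>s) (tensor_append As Bs x y)"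
     and k="%x y. tensor_functional As \<phi>s x * tensor_functional Bs \<psi>s y"])
   (auto simp: L.append_pure S(3) S1(3) S2(3) lset_append lprod_append len lset_length
    intro: bounded_comp[OF L.bounded_append_left S(1)] bounded_comp[OF L.bounded_append_right S(1)]
     cstar_pre[OF L.AB.cstar_tensor] bounded_scale S1(1) S2(1))
qed

section \<open>The functionals of the co-unit on partitions\<close>

locale subproduct_counital = subproduct_unital A D p for A :: "real => real => 'a star_alg" and D p +
 fixes \<phi> assumes counit: "subproduct_counit A D \<phi>" and \<phi>_p: "!!s t. 0 < s ==> s < t ==> \<phi> s t (p s t) = 1"
begin

definition cf :: "real set => 'a tensor => complex" where
 "cf I = tensor_functional (fac I) (map (%(s, t). \<phi> s t) (intervals I))"

lemma unital_fac: assumes I: "I \<subseteq> {0<..}"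
 shows "cstar_list.unital_states (fac I) (map (%(s, t). \<phi> s t) (intervals I)) (map (%(s, t). p s t) (intervals I))"
proof -
 have "list_all2 state (map (%(s, t). A s t) xs) (map (%(s, t). \<phi> s t) xs) \<and>
   list_all2 (%(A, \<phi>) q. projection A q \<and> \<phi> q = 1) (zip (map (%(s, t). A s t) xs) (map (%(s, t). \<phi> s t) xs)) (map (%(s, t). p s t) xs)"
  if "set xs \<subseteq> {(s, t). 0 < s \<and> s < t}" for xs
  using that counit by (induction xs) (auto simp: subproduct_counit_def p_proj \<phi>_p)
 moreover have "set (intervals I) \<subseteq> {(s, t). 0 < s \<and> s < t}" using intervals_less[of _ _ I] I by auto
 ultimately show ?thesis
  unfolding cstar_list.unital_states_def[OF fac_cstar[OF I]] using unit_list_in[OF I] unfolding factors_def by blast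
qed

lemma cf_spec:
 assumes I: "I \<subseteq> {0<..}"
 shows cf_bounded: "bounded_linear_map (tensor (fac I)) complex_alg (cf I)"
  and cf_le: "x el tensor (fac I) ==> cmod (cf I x) <= norm_of (tensor (fac I)) x"
  and cf_pure: "as \<in> lset (fac I) ==> cf I (pure (fac I) as) = lprod (map (%(s, t). \<phi> s t) (intervals I)) as"
  and cf_positive: "x el tensor (fac I) ==> cf I (mult_of (tensor (fac I)) (star_of (tensor (fac I)) x) x) \<in> \<real>\<^sub>\<ge>\<^sub>0"
 unfolding cf_def using cstar_list.tensor_functional_spec[OF fac_cstar[OF I] unital_fac[OF I]] by blast+

lemma cf_append:
 assumes I: "finite I" "I \<subseteq> {0<..}" "r \<in> I"
  and x: "x el tensor (fac (I <| r))" and y: "y el tensor (fac (I |> r))"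
 shows "cf I (app (I <| r) (I |> r) x y) = cf (I <| r) x * cf (I |> r) y"
proof -
 have s: "I <| r \<subseteq> {0<..}" "I |> r \<subseteq> {0<..}" using I by auto
 show ?thesis
  unfolding cf_def factors_split[OF I(1,3)] intervals_split[OF I(1,3)] map_append
  by (rule tensor_functional_append[OF fac_cstar[OF s(1)] fac_cstar[OF s(2)] unital_fac[OF s(1)] unital_fac[OF s(2)] x y])
qed

lemma cf_unit: assumes J: "J \<subseteq> {0<..}" shows "cf J (un J) = 1"
proof -
 have "lprod (map (%(s, t). \<phi> s t) xs) (map (%(s, t). p s t) xs) = 1"
  if "set xs \<subseteq> {(s, t). 0 < s \<and> s < t}" for xs
  using that by (induction xs) (auto simp: \<phi>_p)
 moreover have "set (intervals J) \<subseteq> {(s, t). 0 < s \<and> s < t}" using intervals_less[of _ _ J] J by auto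
 ultimately show ?thesis unfolding unit_tensor_def cf_pure[OF J unit_list_in[OF J]] by blast
qed

lemma cf_single: "0 < s ==> s < t ==> a el A s t ==> cf {s, t} (single_tensor (A s t) a) = \<phi> s t a"
 using cf_pure[of "{s, t}" "[a]"] by (simp add: single_tensor_def)

text \<open>By the induction hypothesis, refining the first of the two intervals
  \<open>[s, m]\<close> and \<open>[m, t]\<close> preserves the functional; the co-unit identity
  then joins the two intervals.\<close>

lemma cf_split:
 assumes "J \<in> partitions s t" "s < t" "0 < s" "a el A s t"
 shows "cf J (split A D J a) = \<phi> s t a"
 using assms(1,2,4)
proof (induction arbitrary: a rule: partition_induct)
 case (two t) then show ?case using assms(3) by (simp add: split_pair cf_single)
next
 case (insert m t J)
 note h = insert.hyps
 have m: "0 < m" "m \<in> insert t J" "finite (insert t J)" "insert t J \<subseteq> {0<..}" using h assms(3) by (auto simp: partitions_def)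
 have e: "insert t J <| m = J" "insert t J |> m = {m, t}" using h by (auto simp: partitions_def)
 have C: "cstar_algebra (A s m)" "cstar_algebra (A m t)" using cst assms(3) h m by auto
 have L: "cstar_list [A s m, A m t]" "cstar_list [A m t]" using C by (simp_all add: cstar_list_Cons)
 have f2: "fac {s, m, t} = [A s m, A m t]" "intervals {s, m, t} = [(s, m), (m, t)]"
 proof -
  have i: "{s, m, t} <| m = {s, m}" "{s, m, t} |> m = {m, t}" using h by auto
  show "fac {s, m, t} = [A s m, A m t]" "intervals {s, m, t} = [(s, m), (m, t)]"
   using factors_split[of "{s, m, t}" m A] intervals_split[of "{s, m, t}" m] h(1,2) unfolding i by simp_all
 qed
 have pos: "{s, m, t} \<subseteq> {0<..}" using assms(3) h by auto
 have hm: "homs [A s m, A m t] [fac J, [A m t]] [split A D J, single_tensor (A m t)]"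
  using C L fac_part[OF h(3) assms(3)] split_hom[OF h(3,1) assms(3)] by (simp add: single_tensor_hom)
 have ch: "chom (tensor [A s m, A m t]) (tensor (fac (insert t J))) (tensor_map [A s m, A m t] [fac J, [A m t]] [split A D J, single_tensor (A m t)])"
  using chom_tensor_map[OF hm] by (simp add: factors_insert[OF h(3,2)])
 have "cf (insert t J) (tensor_map [A s m, A m t] [fac J, [A m t]] [split A D J, single_tensor (A m t)] z) = cf {s, m, t} z"
  if z: "z el tensor [A s m, A m t]" for z
 proof (rule cstar_list.tensor_map_eqI[OF L(1) cstar_complex_alg _ _ _ z])
  show "bounded_linear_map (tensor [A s m, A m t]) complex_alg
    (%z. cf (insert t J) (tensor_map [A s m, A m t] [fac J, [A m t]] [split A D J, single_tensor (A m t)] z))"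
   by (rule bounded_comp[OF chom_bounded[OF ch] cf_bounded[OF m(4)] pre_cstar_tensor[OF fac_cstar[OF m(4)]]])
  show "bounded_linear_map (tensor [A s m, A m t]) complex_alg (cf {s, m, t})" using cf_bounded[OF pos] by (simp add: f2)
  fix as assume "as \<in> lset [A s m, A m t]"
  then obtain a b where as: "as = [a, b]" "a el A s m" "b el A m t" by (auto elim!: lset_ConsE)
  have "single_tensor (A m t) b el tensor (fac {m, t})" using single_tensor_in[OF C(2) as(3)] h(2) by simp
  note ap = cf_append[OF m(3,4,2), unfolded e, OF split_in[OF h(3,1) assms(3) as(2)] this]
  have "cf (insert t J) (tensor_append (fac J) [A m t] (split A D J a) (single_tensor (A m t) b)) = \<phi> s m a * \<phi> m t b"
   using ap insert.IH[OF as(2)] cf_single[OF m(1) h(2) as(3)] h(2) by simp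
  then show "cf (insert t J) (tensor_map [A s m, A m t] [fac J, [A m t]] [split A D J, single_tensor (A m t)] (pure [A s m, A m t] as)) =
    cf {s, m, t} (pure [A s m, A m t] as)"
   unfolding as(1) tensor_map_two[OF C(1) fac_part[OF h(3) assms(3)] split_hom[OF h(3,1) assms(3)] as(2) C(2) L(2) single_tensor_hom[OF C(2)] as(3)]
   using cf_pure[OF pos, of "[a, b]"] as by (simp add: f2)
 qed
 moreover have "cf {s, m, t} = tensor_functional [A s m, A m t] [\<phi> s m, \<phi> m t]" by (simp add: cf_def f2)
 ultimately show ?case
  unfolding split_insert[OF h(3) assms(3) h(1,2) insert.prems(1)]
  using D_in[OF assms(3) h(1,2) insert.prems(1)] counit insert.prems h(1,2) assms(3) by (simp add: subproduct_counit_def)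
qed

text \<open>Both sides factorize at the cut before the last interval, and on one interval
  \<open>cf_split\<close> applies.\<close>

lemma cf_refine: "refines I J ==> x el tensor (fac I) ==> cf J (refine A D I J x) = cf I x"
proof (induction arbitrary: x rule: refines_induct)
 case (single s)
 have c: "chom (tensor []) (tensor []) (refine A D {s} {s})" using chom_refine[of "{s}" "{s}"] single by (simp add: refines_def)
 have b: "bounded_linear_map (tensor []) complex_alg (cf {s})" using cf_bounded[of "{s}"] single by simp
 show ?case
 proof (rule cstar_list.tensor_map_eqI[OF cstar_list_Nil cstar_complex_alg bounded_comp[OF chom_bounded[OF c] b] b])
  show "cf {s} (refine A D {s} {s} (pure [] as)) = cf {s} (pure [] as)" if "as \<in> lset []" for as
   using that tensor_map_pure[where 'a='a, of "[]" "[]" "[]" "[]"] by (simp add: refine_def)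
 qed (use single in \<open>simp_all add: pre_cstar_tensor\<close>)
next
 case (insert m t I J)
 note h = insert.hyps
 have mJ: "m \<in> J" and J: "finite J" "J \<subseteq> {0<..}" "insert t I \<subseteq> {0<..}" using h(1,4) by (auto simp: refines_def)
 have pos: "I \<subseteq> {0<..}" "{m, t} \<subseteq> {0<..}" using J(3) h(3) by auto
 note I1 = refines_sub(1)[OF h(1,4), unfolded h(5)] and I2 = refines_sub(2)[OF h(1,4), unfolded h(6)]
 note fI = factors_split[OF refines_finite[OF h(1)] h(4), of A, unfolded h(5,6)]
 have pair: "cf (J |> m) (refine A D {m, t} (J |> m) y) = cf {m, t} y" if y: "y el tensor (fac {m, t})" for y
 proof (rule cstar_list.tensor_map_eqI[OF fac_cstar[OF pos(2)] cstar_complex_alg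
   bounded_comp[OF chom_bounded[OF chom_refine[OF I2]] cf_bounded[OF refinesD(3)[OF I2]] pre_cstar_tensor[OF refines_cstar(2)[OF I2]]]
   cf_bounded[OF pos(2)] _ y])
  fix as assume "as \<in> lset (fac {m, t})"
  then obtain a where a: "as = [a]" "a el A m t" using h(2) by (auto elim!: lset_ConsE)
  have e: "pure (fac {m, t}) as = single_tensor (A m t) a" using h(2) by (simp add: a single_tensor_def)
  show "cf (J |> m) (refine A D {m, t} (J |> m) (pure (fac {m, t}) as)) = cf {m, t} (pure (fac {m, t}) as)"
   unfolding e refine_pair[OF h(7,3,2) a(2)] cf_split[OF h(7,2,3) a(2)] cf_single[OF h(3,2) a(2)] ..
 qed
 show ?case
 proof (rule cstar_lists2.append_eqI[OF cstar_lists2I[OF refines_cstar(1)[OF I1] refines_cstar(1)[OF I2]] cstar_complex_alg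
    bounded_comp[OF chom_bounded[OF chom_refine[OF h(1)]] cf_bounded[OF J(2)] pre_cstar_tensor[OF refines_cstar(2)[OF h(1)]], unfolded fI]
    cf_bounded[OF J(3), unfolded fI] _ insert.prems[unfolded fI]])
  fix x y assume x: "x el tensor (fac I)" and y: "y el tensor (fac {m, t})"
  show "cf J (refine A D (insert t I) J (tensor_append (fac I) (fac {m, t}) x y)) = cf (insert t I) (tensor_append (fac I) (fac {m, t}) x y)"
   unfolding refine_append[OF h(1,4), unfolded h(5,6), OF x y] cf_append[OF J(1,2) mJ refine_in[OF I1 x] refine_in[OF I2 y]]
    insert.IH[OF x] pair[OF y] cf_append[OF refines_finite[OF h(1)] J(3) h(4), unfolded h(5,6), OF x y] ..
 qed
qed

lemma cf_ext: assumes IJ: "extends I J" and x: "x el tensor (fac I)" shows "cf J (T I J x) = cf I x"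
proof -
 obtain s t where I: "I \<in> partitions s t" "s <= t" using extends_partition[OF IJ] .
 have J: "finite J" "J \<subseteq> {0<..}" "s \<in> J" and J': "finite (J |> s)" "J |> s \<subseteq> {0<..}" "t \<in> J |> s"
  using I IJ by (auto simp: partitions_def extends_def)
 let ?M = "J |> s <| t" and ?U = "J |> s |> t"
 have c: "J <| s \<subseteq> {0<..}" "?M \<subseteq> {0<..}" "?U \<subseteq> {0<..}" using J by auto
 note R = extends_refines[OF IJ I(1)]
 have y: "app ?M ?U (refine A D I ?M x) (un ?U) el tensor (fac (J |> s))"
  using tensor_append_in[OF fac_cstar[OF c(2)] fac_cstar[OF c(3)] refine_in[OF R x] unit_in[OF c(3)]]
  by (simp add: factors_split[OF J'(1,3)])
 show ?thesis
  unfolding ext_eq[OF IJ I(1) x] cf_append[OF J unit_in[OF c(1)] y] cf_append[OF J' refine_in[OF R x] unit_in[OF c(3)]]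
  by (simp add: cf_unit c cf_refine[OF R x])
qed

end

section \<open>The limit algebra and its idempotent states\<close>

text \<open>Two distinct points force minimum and maximum, which are the end points, to be
  distinct.\<close>

lemma all_part_iff: "I \<in> all_partitions \<longleftrightarrow> finite I \<and> I \<subseteq> {0<..} \<and> (\<exists>s\<in>I. \<exists>t\<in>I. s < t)"
proof
 assume "I \<in> all_partitions"
 then show "finite I \<and> I \<subseteq> {0<..} \<and> (\<exists>s\<in>I. \<exists>t\<in>I. s < t)" by (auto simp: all_partitions_def partitions_def)
next
 assume I: "finite I \<and> I \<subseteq> {0<..} \<and> (\<exists>s\<in>I. \<exists>t\<in>I. s < t)"
 then obtain s t where st: "s \<in> I" "t \<in> I" "s < t" by blast
 have "I \<noteq> {}" using st by blast
 then have "Min I <= s" "t <= Max I" "Min I \<in> I" "I \<in> partitions (Min I) (Max I)"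
  using I st by (auto simp: partitions_def)
 moreover from this I have "0 < Min I" by blast
 ultimately show "I \<in> all_partitions" using st(3) unfolding all_partitions_def by (intro CollectI exI[of _ "Min I"] exI[of _ "Max I"]) auto
qed

lemma directed_index_all_partitions: "directed_index all_partitions"
proof
 have "{1, 2} \<in> all_partitions" unfolding all_part_iff by (intro conjI bexI[of _ 1] bexI[of _ 2]) auto
 then show "all_partitions \<noteq> {}" by blast
 fix I assume I: "I \<in> all_partitions"
 show "\<exists>K\<in>all_partitions. I \<subseteq> K \<and> J \<subseteq> K" if "J \<in> all_partitions" for J
  using I that by (intro bexI[of _ "I \<union> J"]) (auto simp: all_part_iff)
 have "finite (Pow I)" using I by (simp add: all_part_iff)
 then show "finite {J \<in> all_partitions. J \<subseteq> I}" by (rule rev_finite_subset) auto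
 have f: "finite I" "I \<noteq> {}" "I \<subseteq> {0<..}" using I by (auto simp: all_part_iff)
 \<comment> \<open>A point can always be added beyond the maximum, so no partition is
   largest.\<close>
 have M: "Max I \<in> I" "Max I + 1 \<notin> I" using f Max_ge[of I "Max I + 1"] by auto
 then have "0 < Max I" using f(3) by auto
 then show "\<exists>J\<in>all_partitions. I \<subset> J"
  using I M by (intro bexI[of _ "insert (Max I + 1) I"]) (auto simp: all_part_iff)
qed

lemma all_part_extends: "I \<in> all_partitions ==> J \<in> all_partitions ==> I \<subseteq> J ==> extends I J"
 by (auto simp: all_part_iff extends_def)

lemma all_part_pos: "I \<in> all_partitions ==> I \<subseteq> {0<..}"
 by (simp add: all_part_iff)

lemma pair_all_partitions: "0 < s ==> s < t ==> {s, t} \<in> all_partitions"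
 by (auto simp: all_part_iff)

text \<open>\<open>s\<close> is an interior point of \<open>K\<close>, so both halves are partitions
  and embed into the limit.\<close>

definition cut :: "real => real set => bool" where
 "cut s K \<longleftrightarrow> s \<in> K \<and> K <| s \<in> all_partitions \<and> K |> s \<in> all_partitions"

lemma cut_all_partitions: assumes "cut s K" shows "K \<in> all_partitions"
proof -
 have "K = K <| s \<union> K |> s" by auto
 moreover have "finite (K <| s \<union> K |> s)" "K <| s \<union> K |> s \<subseteq> {0<..}" "\<exists>a\<in>K. \<exists>b\<in>K. a < b"
  using assms by (auto simp: cut_def all_part_iff)
 ultimately show ?thesis by (simp add: all_part_iff)
qed

text \<open>The points \<open>s / 2\<close> and \<open>s + 1\<close> guarantee intervals on both
  sides of \<open>s\<close>, even if \<open>I\<close> lies on one side of it. Hence the partitions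
  with interior point \<open>s\<close> are cofinal.\<close>

lemma cut_enlarge: assumes "0 < s" "I \<in> all_partitions" shows "cut s (I \<union> {s / 2, s, s + 1})"
proof -
 have "(I \<union> {s / 2, s, s + 1}) <| s \<in> all_partitions"
  using assms unfolding all_part_iff by (intro conjI bexI[of _ "s / 2"] bexI[of _ s]) auto
 moreover have "(I \<union> {s / 2, s, s + 1}) |> s \<in> all_partitions"
  using assms unfolding all_part_iff by (intro conjI bexI[of _ s] bexI[of _ "s + 1"]) auto
 ultimately show ?thesis by (simp add: cut_def)
qed

lemma cut_union:
 assumes "0 < r" "r < s" "s < t" "I \<in> partitions r s" "J \<in> partitions s t"
 shows "cut s (I \<union> J)" "(I \<union> J) <| s = I" "(I \<union> J) |> s = J"
proof -
 show "(I \<union> J) <| s = I" "(I \<union> J) |> s = J" using assms by (auto simp: partitions_def)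
 moreover have "I \<in> all_partitions" "J \<in> all_partitions"
  using assms less_trans[OF assms(1,2)] unfolding all_partitions_def by blast+
 moreover have "s \<in> I" using assms(4) by (simp add: partitions_def)
 ultimately show "cut s (I \<union> J)" by (simp add: cut_def)
qed

sublocale subproduct_unital \<subseteq> Lim: ind_system all_partitions "%I. tensor (factors A I)" "refine_ext A D p"
proof (intro ind_system.intro directed_index_all_partitions ind_system_axioms.intro)
 fix I J K x assume I: "I \<in> all_partitions"
 show "pre_cstar (tensor (fac I))" by (rule pre_cstar_tensor[OF fac_cstar[OF all_part_pos[OF I]]])
 assume J: "J \<in> all_partitions" and IJ: "I \<subseteq> J"
 note e = all_part_extends[OF I J IJ]
 show "star_hom (tensor (fac I)) (tensor (fac J)) (T I J)" by (rule chom_star_hom[OF chom_ext[OF e]])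
 assume "x el tensor (fac I)"
 then show "norm_of (tensor (fac J)) (T I J x) <= norm_of (tensor (fac I)) x" by (rule chom_norm[OF chom_ext[OF e]])
next
 fix I J K x assume I: "I \<in> all_partitions" and J: "J \<in> all_partitions" and K: "K \<in> all_partitions"
  and "I \<subseteq> J" "J \<subseteq> K" "x el tensor (fac I)"
 then show "T J K (T I J x) = T I K x" by (intro ext_comp all_part_extends)
qed

context subproduct_unital
begin

abbreviation "L \<equiv> limit_alg A D p"
abbreviation "em \<equiv> partition_emb A D p"
abbreviation "ten I \<equiv> carrier (tensor (fac I))"

lemma L_limit: "Lim.L = L"
 by (simp add: limit_alg_def)

lemma em_limit: "Lim.emb = em"
 by (simp add: partition_emb_def)

lemma cstar_L: "cstar_algebra L"
 using Lim.cstar_ind_limit by (simp add: L_limit)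

lemmas em_in = Lim.emb_in[unfolded L_limit em_limit]
 and em_hom = Lim.emb_star_hom[unfolded L_limit em_limit]
 and em_norm = Lim.norm_emb_le[unfolded L_limit em_limit]
 and limit_eqI = Lim.ind_limit_map_eqI[unfolded L_limit em_limit]

lemma em_ext: "I \<in> all_partitions ==> J \<in> all_partitions ==> I \<subseteq> J ==> x \<in> ten I ==> em J (T I J x) = em I x"
 using Lim.emb_comp[of I J x] by (simp add: em_limit)

lemma em_chom: "I \<in> all_partitions ==> chom (tensor (fac I)) L (em I)"
 using em_hom em_norm by (simp add: chom_def)

text \<open>Both units are compared in \<open>I \<union> J\<close>, since connecting maps send units
  to units.\<close>

lemma em_unit: assumes I: "I \<in> all_partitions" and J: "J \<in> all_partitions" shows "em I (un I) = em J (un J)"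
proof -
 have IJ: "I \<union> J \<in> all_partitions" using I J by (auto simp: all_part_iff)
 have "em I (un I) = em (I \<union> J) (un (I \<union> J))" if "I \<in> all_partitions" "I \<union> J \<in> all_partitions" for I J
  using em_ext[OF that _ unit_in] that ext_unit[OF all_part_extends[OF that]] all_part_pos by simp
 from this[OF I IJ] this[of J I] show ?thesis using J IJ by (simp add: Un_commute)
qed

lemma interval_emb_p: "0 < s ==> s < t ==> interval_emb A D p s t (p s t) = em {s, t} (un {s, t})"
 by (simp add: interval_emb_def unit_pair)

lemma limit_projection_eq: "I \<in> all_partitions ==> limit_projection A D p = em I (un I)"
 unfolding limit_projection_def
proof (rule the_equality)
 assume I: "I \<in> all_partitions"
 show "\<forall>s t. 0 < s \<and> s < t \<longrightarrow> interval_emb A D p s t (p s t) = em I (un I)"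
  using interval_emb_p em_unit[OF pair_all_partitions I] by simp
 show "q = em I (un I)" if "\<forall>s t. 0 < s \<and> s < t \<longrightarrow> interval_emb A D p s t (p s t) = q" for q
  using that[rule_format, of 1 2] interval_emb_p[of 1 2] em_unit[OF pair_all_partitions[of 1 2] I] by simp
qed

lemma limit_projection_proj: "projection L (limit_projection A D p)"
proof -
 have I: "{1, 2} \<in> all_partitions" by (rule pair_all_partitions) auto
 have "projection (tensor (fac {1, 2})) (un {1, 2})" by (rule un_projection[OF all_part_pos[OF I]])
 then show ?thesis
  unfolding limit_projection_eq[OF I] projection_def
  using em_in[OF I] star_hom_mult[OF em_hom[OF I]] star_hom_star[OF em_hom[OF I]] by metis
qed

lemma cstar_LL: "cstar_list [L, L]" "cstar_list [L]"
 using cstar_L by (simp_all add: cstar_list_Cons)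

lemma split_comult_exists:
 assumes "cut s K"
 shows "\<exists>G. chom (tensor (fac K)) (tensor [L, L]) G \<and> (\<forall>x\<in>ten (K <| s). \<forall>y\<in>ten (K |> s).
  G (app (K <| s) (K |> s) x y) = pure [L, L] [em (K <| s) x, em (K |> s) y])"
proof -
 have K: "K <| s \<in> all_partitions" "K |> s \<in> all_partitions" "s \<in> K" "finite K"
  using assms cut_all_partitions[OF assms] by (auto simp: cut_def all_part_iff)
 note c = fac_cstar[OF all_part_pos[OF K(1)]] fac_cstar[OF all_part_pos[OF K(2)]]
 note F = chom_comp[OF em_chom[OF K(1)] chom_single_tensor[OF cstar_L]] and F' = chom_comp[OF em_chom[OF K(2)] chom_single_tensor[OF cstar_L]]
 obtain G where G: "chom (tensor (fac (K <| s) @ fac (K |> s))) (tensor ([L] @ [L])) G"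
  "!!x y. x \<in> ten (K <| s) ==> y \<in> ten (K |> s) ==> G (app (K <| s) (K |> s) x y) =
   tensor_append [L] [L] (single_tensor L (em (K <| s) x)) (single_tensor L (em (K |> s) y))"
  using tensor_pair[OF c cstar_LL(2) cstar_LL(2) F F'] by blast
 have "G (app (K <| s) (K |> s) x y) = pure [L, L] [em (K <| s) x, em (K |> s) y]"
  if "x \<in> ten (K <| s)" "y \<in> ten (K |> s)" for x y
  using G(2)[OF that] tensor_append_pure[OF cstar_LL(2) cstar_LL(2), of "[em (K <| s) x]" "[em (K |> s) y]"]
   em_in[OF K(1) that(1)] em_in[OF K(2) that(2)] by (simp add: single_tensor_def)
 then show ?thesis using G(1) by (intro exI[of _ G]) (simp add: factors_split[OF K(4,3)])
qed

text \<open>The tensor product of the embeddings of the two halves. The choice is harmless, since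
  \<open>cut_eqI\<close> determines the map from its values on concatenations.\<close>

definition split_comult :: "real => real set => 'a tensor => 'a limit tensor" where
 "split_comult s K = (SOME G. chom (tensor (fac K)) (tensor [L, L]) G \<and> (\<forall>x\<in>ten (K <| s). \<forall>y\<in>ten (K |> s).
  G (app (K <| s) (K |> s) x y) = pure [L, L] [em (K <| s) x, em (K |> s) y]))"

lemma split_comult_chom: "cut s K ==> chom (tensor (fac K)) (tensor [L, L]) (split_comult s K)"
 and split_comult_append: "cut s K ==> x \<in> ten (K <| s) ==> y \<in> ten (K |> s) ==>
  split_comult s K (app (K <| s) (K |> s) x y) = pure [L, L] [em (K <| s) x, em (K |> s) y]"
 unfolding split_comult_def using someI_ex[OF split_comult_exists, of s K] by blast+

lemma cut_eqI:
 assumes K: "cut s K" and Z: "cstar_algebra Z" and h: "bounded_linear_map (tensor (fac K)) Z h" "bounded_linear_map (tensor (fac K)) Z h'"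
  and eq: "!!x y. x \<in> ten (K <| s) ==> y \<in> ten (K |> s) ==>
   h (app (K <| s) (K |> s) x y) = h' (app (K <| s) (K |> s) x y)"
  and z: "z \<in> ten K"
 shows "h z = h' z"
proof -
 have K': "K <| s \<subseteq> {0<..}" "K |> s \<subseteq> {0<..}" "s \<in> K" "finite K"
  using K cut_all_partitions[OF K] by (auto simp: cut_def all_part_iff)
 note f = factors_split[OF K'(4,3), of A]
 show ?thesis
  by (rule cstar_lists2.append_eqI[OF cstar_lists2I[OF fac_cstar[OF K'(1)] fac_cstar[OF K'(2)]] Z h[unfolded f] eq z[unfolded f]])
qed

text \<open>Connecting maps respect the cut at \<open>s\<close> by \<open>ext_append\<close>, and
  the embeddings absorb them on each half.\<close>

lemma split_comult_ext:
 assumes K: "cut s K" and K': "cut s K'" and sub: "K \<subseteq> K'" and z: "z \<in> ten K"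
 shows "split_comult s K' (T K K' z) = split_comult s K z"
proof -
 note a = cut_all_partitions[OF K] cut_all_partitions[OF K']
 note e = all_part_extends[OF a sub]
 have s: "s \<in> K" and c: "K <| s \<in> all_partitions" "K |> s \<in> all_partitions" "K' <| s \<in> all_partitions" "K' |> s \<in> all_partitions"
  and sub': "K <| s \<subseteq> K' <| s" "K |> s \<subseteq> K' |> s"
  using K K' sub by (auto simp: cut_def)
 note e1 = all_part_extends[OF c(1,3) sub'(1)] and e2 = all_part_extends[OF c(2,4) sub'(2)]
 show ?thesis
 proof (rule cut_eqI[OF K cstar_tensor_list[OF cstar_LL(1)] chom_bounded[OF chom_comp[OF chom_ext[OF e] split_comult_chom[OF K']]]
    chom_bounded[OF split_comult_chom[OF K]] _ z])
  fix x y assume x: "x \<in> ten (K <| s)" and y: "y \<in> ten (K |> s)"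
  show "split_comult s K' (T K K' (app (K <| s) (K |> s) x y)) = split_comult s K (app (K <| s) (K |> s) x y)"
   unfolding ext_append[OF e s x y] split_comult_append[OF K' ext_in[OF e1 x] ext_in[OF e2 y]] split_comult_append[OF K x y]
    em_ext[OF c(1,3) sub'(1) x] em_ext[OF c(2,4) sub'(2) y] ..
 qed
qed

text \<open>Every partition is enlarged to one with \<open>s\<close> in its interior, where \<open>\<Delta>\<^sub>s\<close> is prescribed.\<close>

lemma comult_spec:
 assumes s: "0 < s"
 shows "comult A D p s \<in> extensional (carrier L) \<and> star_hom L (tensor [L, L]) (comult A D p s) \<and>
  (\<forall>K z. cut s K \<longrightarrow> z \<in> ten K \<longrightarrow> comult A D p s (em K z) = split_comult s K z)"
proof -
 define e where "e I = I \<union> {s / 2, s, s + 1}" for I :: "real set"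
 have e: "cut s (e I)" "e I \<in> all_partitions" "I \<subseteq> e I" "extends I (e I)" if "I \<in> all_partitions" for I
  using cut_enlarge[OF s that] cut_all_partitions all_part_extends[OF that, of "e I"] by (auto simp: e_def)
 define h where "h I x = split_comult s (e I) (T I (e I) x)" for I x
 have hc: "chom (tensor (fac I)) (tensor [L, L]) (h I)" if "I \<in> all_partitions" for I
  unfolding h_def by (rule chom_comp[OF chom_ext[OF e(4)[OF that]] split_comult_chom[OF e(1)[OF that]]])
 have hT: "h J (T I J x) = h I x" if I: "I \<in> all_partitions" and J: "J \<in> all_partitions" and IJ: "I \<subseteq> J" and x: "x \<in> ten I" for I J x
 proof -
  have ee: "e I \<subseteq> e J" using IJ by (auto simp: e_def)
  have "T J (e J) (T I J x) = T (e I) (e J) (T I (e I) x)"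
   unfolding ext_comp[OF all_part_extends[OF I J IJ] e(4)[OF J] x]
   by (rule ext_comp[OF e(4)[OF I] all_part_extends[OF e(2)[OF I] e(2)[OF J] ee] x, symmetric])
  then show ?thesis
   unfolding h_def using split_comult_ext[OF e(1)[OF I] e(1)[OF J] ee ext_in[OF e(4)[OF I] x]] by simp
 qed
 obtain H where H: "H \<in> extensional (carrier L)" "!!I x. I \<in> all_partitions ==> x \<in> ten I ==> H (em I x) = h I x"
  "star_hom L (tensor [L, L]) H"
 proof (rule Lim.ind_limit_extension[OF cstar_tensor_list[OF cstar_LL(1)], of h 1, unfolded L_limit em_limit])
  fix H assume 1: "H \<in> extensional (carrier L)" "!!I x. I \<in> all_partitions ==> x \<in> ten I ==> H (em I x) = h I x"
   "(!!I. I \<in> all_partitions ==> star_hom (tensor (fac I)) (tensor [L, L]) (h I)) ==> star_hom L (tensor [L, L]) H"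
   and w: "!!H. H \<in> extensional (carrier L) ==> (!!I x. I \<in> all_partitions ==> x \<in> ten I ==> H (em I x) = h I x) ==>
    star_hom L (tensor [L, L]) H ==> thesis"
  show thesis by (rule w[OF 1(1,2) 1(3)[OF chom_star_hom[OF hc]]])
 qed (use hc hT chom_norm[OF hc] in \<open>auto intro: chom_linear\<close>)
 have Hcut: "H (em K z) = split_comult s K z" if K: "cut s K" and z: "z \<in> ten K" for K z
  using H(2)[OF cut_all_partitions[OF K] z] split_comult_ext[OF K e(1,3)[OF cut_all_partitions[OF K]] z] by (simp add: h_def)
 have Happ: "H (em (I \<union> J) (app I J x y)) = pure [L, L] [em I x, em J y]"
  if rt: "0 < r" "r < s" "s < t" and I: "I \<in> partitions r s" and J: "J \<in> partitions s t" and x: "x \<in> ten I" and y: "y \<in> ten J" for r t I J x y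
 proof -
  note u = cut_union[OF rt I J]
  have "app I J x y \<in> ten (I \<union> J)"
   using tensor_append_in[OF fac_part[OF I rt(1)] fac_part[OF J s] x y] u cut_all_partitions[OF u(1)] I
    factors_split[of "I \<union> J" s A] by (auto simp: all_part_iff partitions_def)
  then show ?thesis using Hcut[OF u(1)] split_comult_append[OF u(1), unfolded u, OF x y] by simp
 qed
 have "comult A D p s = H"
  unfolding comult_def Let_def
 proof (rule the_equality)
  show "H \<in> extensional (carrier L) \<and> star_hom L (tensor [L, L]) H \<and>
    (\<forall>r t. 0 < r \<and> r < s \<and> s < t \<longrightarrow> (\<forall>I\<in>partitions r s. \<forall>J\<in>partitions s t. \<forall>x\<in>ten I. \<forall>y\<in>ten J.
      H (em (I \<union> J) (app I J x y)) = pure [L, L] [em I x, em J y]))"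
   using H(1,3) Happ by blast
  fix d assume d: "d \<in> extensional (carrier L) \<and> star_hom L (tensor [L, L]) d \<and>
    (\<forall>r t. 0 < r \<and> r < s \<and> s < t \<longrightarrow> (\<forall>I\<in>partitions r s. \<forall>J\<in>partitions s t. \<forall>x\<in>ten I. \<forall>y\<in>ten J.
      d (em (I \<union> J) (app I J x y)) = pure [L, L] [em I x, em J y]))"
  \<comment> \<open>Competing maps are only known to be *-homomorphisms; automatic contractivity
    makes them continuous, so agreement on a dense set suffices.\<close>
  have b: "bounded_linear_map L (tensor [L, L]) f" if "star_hom L (tensor [L, L]) f" for f
   using cstar_list.star_hom_contractive[OF cstar_LL(1) cstar_L that] that by (intro chom_bounded) (simp add: chom_def)
  show "d = H"
  proof (rule extensionalityI[of _ "carrier L"])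
   fix P assume P: "P el L"
   show "d P = H P"
   proof (rule limit_eqI[OF cstar_tensor_list[OF cstar_LL(1)] b b _ P])
    fix I assume I: "I \<in> all_partitions"
    note K = e(1)[OF I]
    let ?K1 = "e I <| s" and ?K2 = "e I |> s"
    obtain r r' t t' where rt: "0 < r" "r < r'" "?K1 \<in> partitions r r'" "0 < t'" "t' < t" "?K2 \<in> partitions t' t"
     using K unfolding cut_def all_partitions_def by blast
    have "s \<in> ?K1" "s \<in> ?K2" using K by (auto simp: cut_def)
    then have [simp]: "r' = s" "t' = s" using rt by (auto simp: partitions_def)
    have u: "?K1 \<union> ?K2 = e I" by auto
    have "d (em (e I) z) = H (em (e I) z)" if z: "z \<in> ten (e I)" for z
    proof (rule cut_eqI[OF K cstar_tensor_list[OF cstar_LL(1)] _ _ _ z])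
     note c = chom_bounded[OF em_chom[OF e(2)[OF I]]] and pc = cstar_pre[OF cstar_L]
     show "bounded_linear_map (tensor (fac (e I))) (tensor [L, L]) (%z. d (em (e I) z))"
      "bounded_linear_map (tensor (fac (e I))) (tensor [L, L]) (%z. H (em (e I) z))"
      using bounded_comp[OF c b pc] d H(3) by blast+
     fix x y assume xy: "x \<in> ten ?K1" "y \<in> ten ?K2"
     have "d (em (?K1 \<union> ?K2) (app ?K1 ?K2 x y)) = pure [L, L] [em ?K1 x, em ?K2 y]"
      using d rt xy by auto
     moreover have "H (em (?K1 \<union> ?K2) (app ?K1 ?K2 x y)) = pure [L, L] [em ?K1 x, em ?K2 y]"
      by (rule Happ[OF rt(1) _ _ _ _ xy]) (use rt in auto)
     ultimately show "d (em (e I) (app ?K1 ?K2 x y)) = H (em (e I) (app ?K1 ?K2 x y))" unfolding u by simp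
    qed
    then show "\<exists>j\<in>all_partitions. I \<subseteq> j \<and> (\<forall>x\<in>ten j. d (em j x) = H (em j x))"
     using e[OF I] by (intro bexI[of _ "e I"]) auto
   qed (use d H(3) in auto)
  qed (use d H(1) in auto)
 qed
 then show ?thesis using H(1,3) Hcut by blast
qed

lemma unital_limit_states:
 assumes "state L \<psi>" "\<psi> (limit_projection A D p) = 1"
 shows "cstar_list.unital_states [L, L] [\<psi>, \<psi>] [limit_projection A D p, limit_projection A D p]"
 unfolding cstar_list.unital_states_def[OF cstar_LL(1)]
 using assms limit_projection_proj by (simp add: projection_def)

text \<open>On a concatenation at \<open>s\<close> the co-multiplication is an elementary tensor, on
  which the product functional factorizes.\<close>

lemma comult_functional:
 assumes \<psi>: "state L \<psi>" "\<psi> (limit_projection A D p) = 1" and s: "0 < s" and K: "cut s K"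
  and x: "x \<in> ten (K <| s)" and y: "y \<in> ten (K |> s)"
 shows "tensor_functional [L, L] [\<psi>, \<psi>] (comult A D p s (em K (app (K <| s) (K |> s) x y))) =
  \<psi> (em (K <| s) x) * \<psi> (em (K |> s) y)"
proof -
 have K': "K <| s \<in> all_partitions" "K |> s \<in> all_partitions" "s \<in> K" "finite K"
  using K cut_all_partitions[OF K] by (auto simp: cut_def all_part_iff)
 have z: "app (K <| s) (K |> s) x y \<in> ten K"
  using tensor_append_in[OF fac_cstar[OF all_part_pos[OF K'(1)]] fac_cstar[OF all_part_pos[OF K'(2)]] x y]
  by (simp add: factors_split[OF K'(4,3)])
 have c: "comult A D p s (em K (app (K <| s) (K |> s) x y)) = pure [L, L] [em (K <| s) x, em (K |> s) y]"
  using comult_spec[OF s] K z split_comult_append[OF K x y] by simp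
 show ?thesis
  unfolding c using cstar_list.tensor_functional_pure[OF cstar_LL(1) unital_limit_states[OF \<psi>], of "[em (K <| s) x, em (K |> s) y]"]
   em_in[OF K'(1) x] em_in[OF K'(2) y] by simp
qed

end

context subproduct_counital
begin

lemma limit_state_exists:
 obtains \<psi> where "\<psi> \<in> extensional (carrier L)" "state L \<psi>" "\<psi> (limit_projection A D p) = 1"
  "!!I x. I \<in> all_partitions ==> x \<in> ten I ==> \<psi> (em I x) = cf I x"
proof (rule Lim.ind_limit_extension[OF cstar_complex_alg, of cf 1, unfolded L_limit em_limit])
 fix \<psi> assume \<psi>: "\<psi> \<in> extensional (carrier L)" "bounded_linear_map L complex_alg \<psi>"
  "!!x. x el L ==> norm_of complex_alg (\<psi> x) <= 1 * norm_of L x"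
  "!!I x. I \<in> all_partitions ==> x \<in> ten I ==> \<psi> (em I x) = cf I x"
  and w: "!!\<psi>. \<psi> \<in> extensional (carrier L) ==> state L \<psi> ==> \<psi> (limit_projection A D p) = 1 ==>
   (!!I x. I \<in> all_partitions ==> x \<in> ten I ==> \<psi> (em I x) = cf I x) ==> thesis"
 have I: "{1, 2} \<in> all_partitions" by (rule pair_all_partitions) auto
 have q: "\<psi> (limit_projection A D p) = 1"
  unfolding limit_projection_eq[OF I] \<psi>(4)[OF I unit_in[OF all_part_pos[OF I]]] by (rule cf_unit[OF all_part_pos[OF I]])
 have pos: "\<psi> (mult_of L (star_of L x) x) \<in> \<real>\<^sub>\<ge>\<^sub>0" if x: "x el L" for x
 proof (rule Lim.limit_positive[of \<psi>, unfolded L_limit em_limit, OF \<psi>(2) _ x])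
  fix I x assume I: "I \<in> all_partitions" and x: "x \<in> ten I"
  interpret P: pre_cstar "tensor (fac I)" by (rule Lim.N[OF I])
  show "\<psi> (em I (mult_of (tensor (fac I)) (star_of (tensor (fac I)) x) x)) \<in> \<real>\<^sub>\<ge>\<^sub>0"
   using \<psi>(4)[OF I] cf_positive[OF all_part_pos[OF I] x] x by (simp add: P.closed)
 qed
 interpret L: cstar_algebra L by (rule cstar_L)
 let ?q = "limit_projection A D p"
 let ?S = "(%x. cmod (\<psi> x)) ` {x \<in> carrier L. norm_of L x <= 1}"
 have le: "y <= 1" if "y \<in> ?S" for y using \<psi>(3) that by force
 \<comment> \<open>The norm 1 is attained at the limit projection, which has norm at most 1 and on
   which the functional is 1.\<close>
 have qS: "1 \<in> ?S"
  using q limit_projection_proj L.projection_norm_le[OF limit_projection_proj]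
  by (intro image_eqI[of _ _ ?q]) (auto simp: projection_def)
 have "bdd_above ?S" using le by (rule bdd_aboveI)
 moreover have "Sup ?S = 1" by (rule cSup_eq_maximum[OF qS le])
 ultimately have "state L \<psi>"
  using pos \<psi>(2) by (simp add: state_def bounded_linear_map_def)
 then show thesis by (rule w[OF \<psi>(1) _ q \<psi>(4)])
qed (use cf_bounded cf_le cf_ext all_part_extends all_part_pos in \<open>auto simp: bounded_linear_map_def\<close>)

lemma state_bounded: "state L \<psi> ==> bounded_linear_map L complex_alg \<psi>"
 using state_norm_le[OF cstar_L, of \<psi>] unfolding bounded_linear_map_def
 by (intro conjI exI[of _ 1]) (auto simp: state_def)

text \<open>Checked on the cofinal partitions with interior point \<open>s\<close>, where both sides
  are products over the two halves, by \<open>comult_functional\<close> and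
  \<open>cf_append\<close>.\<close>

lemma limit_state_idempotent:
 assumes \<psi>: "state L \<psi>" "\<psi> (limit_projection A D p) = 1"
  and cf: "!!I x. I \<in> all_partitions ==> x \<in> ten I ==> \<psi> (em I x) = cf I x"
 shows "idempotent_state A D p \<psi>"
proof -
 have "tensor_functional [L, L] [\<psi>, \<psi>] (comult A D p s P) = \<psi> P" if s: "0 < s" and P: "P el L" for s P
 proof -
  have ch: "star_hom L (tensor [L, L]) (comult A D p s)" using comult_spec[OF s] by blast
  have d: "bounded_linear_map L (tensor [L, L]) (comult A D p s)"
   using cstar_list.star_hom_contractive[OF cstar_LL(1) cstar_L ch] ch by (intro chom_bounded) (simp add: chom_def)
  note b = bounded_comp[OF d cstar_list.tensor_functional_bounded[OF cstar_LL(1) unital_limit_states[OF \<psi>]]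
    pre_cstar_tensor[OF cstar_LL(1)]]
  show ?thesis
  proof (rule limit_eqI[OF cstar_complex_alg b state_bounded[OF \<psi>(1)] _ P])
   fix I assume I: "I \<in> all_partitions"
   define K where "K = I \<union> {s / 2, s, s + 1}"
   have K: "cut s K" "I \<subseteq> K" using cut_enlarge[OF s I] by (auto simp: K_def)
   note Kp = cut_all_partitions[OF K(1)]
   have K': "K <| s \<in> all_partitions" "K |> s \<in> all_partitions" "s \<in> K" "finite K"
    using K Kp by (auto simp: cut_def all_part_iff)
   note e = chom_bounded[OF em_chom[OF Kp]]
   have "tensor_functional [L, L] [\<psi>, \<psi>] (comult A D p s (em K z)) = \<psi> (em K z)" if z: "z \<in> ten K" for z
   proof (rule cut_eqI[OF K(1) cstar_complex_alg bounded_comp[OF e b cstar_pre[OF cstar_L]]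
      bounded_comp[OF e state_bounded[OF \<psi>(1)] cstar_pre[OF cstar_L]] _ z])
    fix x y assume x: "x \<in> ten (K <| s)" and y: "y \<in> ten (K |> s)"
    have z: "app (K <| s) (K |> s) x y \<in> ten K"
     using tensor_append_in[OF fac_cstar[OF all_part_pos[OF K'(1)]] fac_cstar[OF all_part_pos[OF K'(2)]] x y]
     by (simp add: factors_split[OF K'(4,3)])
    show "tensor_functional [L, L] [\<psi>, \<psi>] (comult A D p s (em K (app (K <| s) (K |> s) x y))) =
      \<psi> (em K (app (K <| s) (K |> s) x y))"
     unfolding comult_functional[OF \<psi> s K(1) x y] cf[OF K'(1) x] cf[OF K'(2) y] cf[OF Kp z]
     by (rule cf_append[OF K'(4) all_part_pos[OF Kp] K'(3) x y, symmetric])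
   qed
   then show "\<exists>j\<in>all_partitions. I \<subseteq> j \<and> (\<forall>x\<in>ten j. tensor_functional [L, L] [\<psi>, \<psi>] (comult A D p s (em j x)) = \<psi> (em j x))"
    using Kp K(2) by blast
  qed
 qed
 moreover have "limit_projection A D p \<notin> left_kernel L \<psi>"
  using limit_projection_proj \<psi>(2) by (simp add: left_kernel_def projection_def)
 ultimately show ?thesis using \<psi>(1) by (simp add: idempotent_state_def Let_def)
qed

text \<open>Idempotence at the second largest point of a partition splits off its last interval.\<close>

lemma idempotent_state_cf:
 assumes id: "idempotent_state A D p \<psi>"
  and marg: "!!s t a. 0 < s ==> s < t ==> a el A s t ==> \<phi> s t a = \<psi> (interval_emb A D p s t a)"
  and I: "I \<in> all_partitions" and x: "x \<in> ten I"
 shows "\<psi> (em I x) = cf I x"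
proof -
 have st: "state L \<psi>" and fix_: "!!s x. 0 < s ==> x el L ==> tensor_functional [L, L] [\<psi>, \<psi>] (comult A D p s x) = \<psi> x"
  using id by (simp_all add: idempotent_state_def Let_def)
 \<comment> \<open>The limit projection is the image of the unit of any interval, so the marginal
   condition on one interval, here \<open>[1, 2]\<close>, gives its value.\<close>
 have q: "\<psi> (limit_projection A D p) = 1"
  using marg[of 1 2 "p 1 2"] p_in[of 1 2] \<phi>_p[of 1 2] interval_emb_p[of 1 2] limit_projection_eq[OF pair_all_partitions[of 1 2]] by simp
 note bd = bounded_comp[OF chom_bounded[OF em_chom] state_bounded[OF st] cstar_pre[OF cstar_L]]
 have two: "\<psi> (em {s, t} x) = cf {s, t} x" if s: "0 < s" "s < t" and x: "x \<in> ten {s, t}" for s t x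
 proof (rule cstar_list.tensor_map_eqI[OF fac_cstar cstar_complex_alg bd[OF pair_all_partitions[OF s]] cf_bounded _ x])
  fix as assume "as \<in> lset (fac {s, t})"
  then obtain a where a: "as = [a]" "a el A s t" using s(2) by (auto elim!: lset_ConsE)
  have e: "pure (fac {s, t}) as = single_tensor (A s t) a" using s(2) by (simp add: a single_tensor_def)
  show "\<psi> (em {s, t} (pure (fac {s, t}) as)) = cf {s, t} (pure (fac {s, t}) as)"
   unfolding e cf_single[OF s a(2)] using marg[OF s a(2)] by (simp add: interval_emb_def)
 qed (use s in auto)
 have "finite I" "I \<noteq> {}" using I by (auto simp: all_part_iff)
 then have "I \<in> all_partitions \<longrightarrow> (\<forall>x\<in>ten I. \<psi> (em I x) = cf I x)"
 proof (induction I rule: partition_nonempty_induct)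
  case (insert t I)
  define m where "m = Max I"
  have m: "m \<in> I" "m < t" "!!x. x \<in> I ==> x <= m" using insert by (auto simp: m_def)
  have e: "insert t I <| m = I" "insert t I |> m = {m, t}" using m by force+
  show ?case
  proof (intro impI ballI)
   fix z assume tI: "insert t I \<in> all_partitions" and z: "z \<in> ten (insert t I)"
   have pos: "insert t I \<subseteq> {0<..}" "finite (insert t I)" "m \<in> insert t I" "0 < m" using tI m by (auto simp: all_part_iff)
   show "\<psi> (em (insert t I) z) = cf (insert t I) z"
   proof (cases "I \<in> all_partitions")
    case False
    \<comment> \<open>\<open>I\<close> is nonempty but not a partition, so it is the single point
      \<open>m\<close>, and \<open>insert t I\<close> is one interval.\<close>
    then have "\<not> a < m" if "a \<in> I" for a using insert.hyps(1) pos(1) m(1) that by (auto simp: all_part_iff)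
    then have "I = {m}" using m by force
    then show ?thesis using two[OF pos(4) m(2)] z by (simp add: insert_commute)
   next
    case True
    have mt: "{m, t} \<in> all_partitions" by (rule pair_all_partitions[OF pos(4) m(2)])
    have cut: "cut m (insert t I)" unfolding cut_def e using True mt pos(3) by blast
    show ?thesis
    proof (rule cut_eqI[OF cut cstar_complex_alg bd[OF tI] cf_bounded[OF pos(1)] _ z], unfold e)
     fix x y assume x: "x \<in> ten I" and y: "y \<in> ten {m, t}"
     have c: "app I {m, t} x y \<in> ten (insert t I)"
      using tensor_append_in[OF fac_cstar[OF all_part_pos[OF True]] fac_cstar[OF all_part_pos[OF mt]] x y]
       factors_split[OF pos(2,3), of A, unfolded e] by simp
     have "\<psi> (em (insert t I) (app I {m, t} x y)) = \<psi> (em I x) * \<psi> (em {m, t} y)"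
      using comult_functional[OF st q pos(4) cut, unfolded e, OF x y] fix_[OF pos(4) em_in[OF tI c]] by simp
     also have "... = cf I x * cf {m, t} y" using insert.IH True x two[OF pos(4) m(2) y] by simp
     also have "... = cf (insert t I) (app I {m, t} x y)"
      using cf_append[OF pos(2,1,3), unfolded e, OF x y] by simp
     finally show "\<psi> (em (insert t I) (app I {m, t} x y)) = cf (insert t I) (app I {m, t} x y)" .
    qed
   qed
  qed
 qed (simp add: all_part_iff)
 then show ?thesis using I x by blast
qed

end

theorem theorem6p3:
  fixes A :: "real \<Rightarrow> real \<Rightarrow> 'a star_alg"
    and \<Delta> :: "real \<Rightarrow> real \<Rightarrow> real \<Rightarrow> 'a \<Rightarrow> 'a tensor"
    and p :: "real \<Rightarrow> real \<Rightarrow> 'a"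
    and \<phi> :: "real \<Rightarrow> real \<Rightarrow> 'a \<Rightarrow> complex"
  assumes "subproduct_system A \<Delta>"
    and "subproduct_unit A \<Delta> p"
    and "subproduct_counit A \<Delta> \<phi>"
    and "\<And>s t. 0 < s \<Longrightarrow> s < t \<Longrightarrow> \<phi> s t (p s t) = 1"
  shows "\<exists>!\<psi>. \<psi> \<in> extensional (carrier (limit_alg A \<Delta> p)) \<and>
    idempotent_state A \<Delta> p \<psi> \<and>
    (\<forall>s t. 0 < s \<and> s < t \<longrightarrow>
       (\<forall>a\<in>carrier (A s t). \<phi> s t a = \<psi> (interval_emb A \<Delta> p s t a)))"
proof -
 interpret subproduct_counital A \<Delta> p \<phi> using assms by unfold_locales auto
 obtain \<psi> where \<psi>: "\<psi> \<in> extensional (carrier L)" "state L \<psi>" "\<psi> (limit_projection A \<Delta> p) = 1"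
  "!!I x. I \<in> all_partitions ==> x \<in> ten I ==> \<psi> (em I x) = cf I x"
  using limit_state_exists by blast
 show ?thesis
 proof (intro ex1I conjI allI impI ballI)
  show "\<psi> \<in> extensional (carrier L)" by fact
  show "idempotent_state A \<Delta> p \<psi>" by (rule limit_state_idempotent[OF \<psi>(2-4)])
  fix s t a assume st: "0 < s \<and> s < t" and a: "a el A s t"
  then have "single_tensor (A s t) a \<in> ten {s, t}" using single_tensor_in[OF cst a] by simp
  then show "\<phi> s t a = \<psi> (interval_emb A \<Delta> p s t a)"
   using \<psi>(4)[OF pair_all_partitions] cf_single a st by (simp add: interval_emb_def)
 next
  fix \<omega> assume \<omega>: "\<omega> \<in> extensional (carrier L) \<and> idempotent_state A \<Delta> p \<omega> \<and>
   (\<forall>s t. 0 < s \<and> s < t \<longrightarrow> (\<forall>a\<in>carrier (A s t). \<phi> s t a = \<omega> (interval_emb A \<Delta> p s t a)))"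
  then have st: "state L \<omega>" by (simp add: idempotent_state_def Let_def)
  have cf: "\<omega> (em I x) = cf I x" if "I \<in> all_partitions" "x \<in> ten I" for I x
   using \<omega> idempotent_state_cf[of \<omega>, OF _ _ that] by blast
  \<comment> \<open>Both functions are extensional, so they are compared on the carrier only, where
    continuity and density reduce the claim to the embedded algebras.\<close>
  show "\<omega> = \<psi>"
  proof (rule extensionalityI[of _ "carrier L"])
   fix P assume P: "P el L"
   show "\<omega> P = \<psi> P"
   proof (rule limit_eqI[OF cstar_complex_alg state_bounded[OF st] state_bounded[OF \<psi>(2)] _ P])
    fix I assume "I \<in> all_partitions"
    then show "\<exists>j\<in>all_partitions. I \<subseteq> j \<and> (\<forall>x\<in>ten j. \<omega> (em j x) = \<psi> (em j x))"
     using cf \<psi>(4) by (intro bexI[of _ I]) auto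
   qed
  qed (use \<omega> \<psi>(1) in auto)
 qed
qed

end
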